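(* Let $A$ be a quantum nilpotent algebra in $N$ generators which is uniparameter at a root of unity: $\lambda_{i,j}=q^{m_{i,j}}$ for all $i,j$, where $q\in\mathbb{K}^*$ is a primitive $\ell$-th root of unity and $M=(m_{i,j})\in M_N(\mathbb{Z})$ is skew-symmetric. Let $w\in\mathcal{W}'$ and let $P_w=\psi^{-1}(J_w)$ be the corresponding Cauchon ideal of $A$. Then $$\mathrm{PI\text{-}deg}(A/P_w)=\prod_{i=1}^{\frac{N-|w|-\dim(\ker(M(w)))}{2}}\frac{\ell}{\gcd(h_i,\ell)},$$ where $M(w)$ is the matrix obtained from $M$ by removing the rows and columns indexed by $w$, and $h_1,h_2,\dots$ are the invariant factors of $M(w)$ (listed once per pair).
   Context: Notation: $\mathbb{K}$ is a field; $[\![a,b]\!]$ is the set of integers from $a$ to $b$. $\mathbb{K}_\Lambda[T_1,\dots,T_N]$ is the algebra generated by $T_1,\dots,T_N$ with defining relations $T_iT_j=\lambda_{i,j}T_jT_i$. For a PI domain $R$, $\mathrm{PI\text{-}deg}(R)$ is the square root of the dimension of $\mathrm{Frac}(R)$ over its centre. Invariant factors: every skew-symmetric integral matrix is congruent over $\mathbb{Z}$ (via $S\mapsto ESE^T$, $E$ invertible over $\mathbb{Z}$) to a block diagonal matrix with blocks $\begin{pmatrix}0&h_i\\-h_i&0\end{pmatrix}$, $i=1,\dots,s$, followed by a square zero block of size the dimension of the kernel, where the $h_i$ are nonzero integers with $h_i\mid h_{i+1}$; $h_1,\dots,h_s$ are its invariant factors (listed once per pair). Ore extensions: in $R[x;\sigma,\delta]$,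 $\sigma$ is a $\mathbb{K}$-algebra automorphism of $R$, $\delta$ is a $\mathbb{K}$-linear $\sigma$-derivation, $\delta(ab)=\sigma(a)\delta(b)+\delta(a)b$, and $xr=\sigma(r)x+\delta(r)$. Higher skew derivations: for $1\ne p\in\mathbb{K}^*$, $\delta$ extends to a higher $p$-skew $\sigma$-derivation $\{d_n\}_{n\ge0}$ on $R$ if the $d_n$ are $\mathbb{K}$-linear operators on $R$ with $d_0=\mathrm{id}$, $d_1=\delta$, $d_n(rs)=\sum_{i=0}^n\sigma^{n-i}d_i(r)\,d_{n-i}(s)$ and $d_n\circ\sigma=p^n\sigma\circ d_n$ for all $n$. It is locally nilpotent if for each $r\in R$ there is $n_r\ge0$ with $d_n(r)=0$ for all $n\ge n_r$, and iterative if $d_nd_m=\binom{n+m}{m}_p d_{n+m}$ for all $n,m$. Quantum nilpotent algebra: $A=\mathbb{K}[X_1][X_2;\sigma_2,\delta_2]\cdots[X_N;\sigma_N,\delta_N]$ with $A_{i}=\mathbb{K}\langle X_1,\dots,X_i\rangle$ such that: (1) $\sigma_i(X_l)=\lambda_{i,l}X_l$ for $l<i$, $\lambda_{i,l}\in\mathbb{K}^*$; (2) $\Lambda=(\lambda_{i,j})\in M_N(\mathbb{K}^* )$ is multiplicatively antisymmetric ($\lambda_{i,l}=\lambda_{l,i}^{-1}$, $\lambda_{i,i}=1$); (3) for $2\le i\le N$ there is $1\ne q_i\in\mathbb{K}^*$ with $\delta_i\circ\sigma_i=q_i\sigma_i\circ\delta_i$; (4) for $2\le i\le N$, $\delta_i$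 extends to a (fixed) locally nilpotent, iterative higher $q_i$-skew $\sigma_i$-derivation $\{d_{i,n}\}_{n\ge0}$ on $A_{i-1}$, and $\sigma_l\circ d_{i,n}=\lambda_{l,i}^n d_{i,n}\circ\sigma_l$ on $A_{i-1}$ for all $n\ge0$, $i+1\le l\le N$. Such an $A$ is a Noetherian domain. Deleting derivations algorithm: put $X_i^{(N+1)}=X_i$, and let $A^{(j)}$ be the subalgebra of $\mathrm{Frac}(A)$ generated by $X_1^{(j)},\dots,X_N^{(j)}$. For $j=N,N-1,\dots,2$ write $x_i=X_i^{(j+1)}$, $y_i=X_i^{(j)}$. There is a $\mathbb{K}$-algebra isomorphism $A^{(j+1)}\to\mathbb{K}[X_1]\cdots[X_j;\sigma_j,\delta_j][X_{j+1};\sigma_{j+1}^{(j+1)}]\cdots[X_N;\sigma_N^{(j+1)}]$, $x_i\mapsto X_i$, with $\sigma_i^{(j+1)}(X_l)=\lambda_{i,l}X_l$ for $l<i$; via it $\sigma_j$ and $d_{j,n}$ are regarded as maps on $\mathbb{K}\langle x_1,\dots,x_{j-1}\rangle\cong A_{j-1}$. Then $y_l=x_l$ for $l\ge j$ and $y_l=\sum_{n\ge0}q_j^{n(n+1)/2}(q_j-1)^{-n}d_{j,n}\circ\sigma_j^{-n}(x_l)\,x_j^{-n}$ (a finite sum) for $l<j$. The set $S_j=\{x_j^n\}_{n\ge0}=\{y_j^n\}_{n\ge0}$ is a two-sided Ore set of regular elements in $A^{(j)}$ and $A^{(j+1)}$, and $A^{(j)}S_j^{-1}=A^{(j+1)}S_j^{-1}$.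 Put $A'=A^{(2)}$, $T_i=X_i^{(2)}$; then $A'=\mathbb{K}_\Lambda[T_1,\dots,T_N]$. Canonical embedding: $\mathrm{C.Spec}(R)$ is the set of completely prime ideals of $R$ (ideals $P$ with $R/P$ a domain). There is a surjective homomorphism $g_j:A^{(j)}\to A^{(j+1)}/\langle x_j\rangle$, $y_i\mapsto x_i+\langle x_j\rangle$. The injective map $\psi_j:\mathrm{C.Spec}(A^{(j+1)})\to\mathrm{C.Spec}(A^{(j)})$ is $\psi_j(P)=PS_j^{-1}\cap A^{(j)}$ if $x_j\notin P$ and $\psi_j(P)=g_j^{-1}(P/\langle x_j\rangle)$ if $x_j\in P$; and $\psi=\psi_2\circ\cdots\circ\psi_N:\mathrm{C.Spec}(A)\to\mathrm{C.Spec}(A')$. Cauchon diagrams and ideals: for $w\subseteq[\![1,N]\!]$, $\mathrm{C.Spec}_w(A')=\{Q\in\mathrm{C.Spec}(A')\mid Q\cap\{T_1,\dots,T_N\}=\{T_i\mid i\in w\}\}$, $\mathrm{C.Spec}_w(A)=\psi^{-1}(\mathrm{C.Spec}_w(A'))$, and $\mathcal{W}'$ is the set of $w$ (Cauchon diagrams) with $\mathrm{C.Spec}_w(A)\ne\emptyset$. Put $J_w=\langle T_i\mid i\in w\rangle\in\mathrm{C.Spec}_w(A')$. A Cauchon ideal $P_w$ is an element of $\mathrm{C.Spec}_w(A)$ with $\psi(P_w)=J_w$ (unique if it exists). *)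

theory Defs
  imports
    "HOL-Algebra.Embedded_Algebras"
    "HOL-Algebra.Generated_Rings"
    "Jordan_Normal_Form.Matrix_Kernel"
    "Jordan_Normal_Form.DL_Submatrix"
begin

section \<open>Noncommutative domains, division rings and PI degree\<close>

text \<open>The locales \<^locale>\<open>domain\<close> and \<^locale>\<open>field\<close> of HOL-Algebra are commutative.\<close>

locale nc_domain = ring +
  assumes one_not_zero: "\<one> \<noteq> \<zero>"
    and integral: "\<lbrakk>a \<in> carrier R; b \<in> carrier R; a \<otimes> b = \<zero>\<rbrakk> \<Longrightarrow> a = \<zero> \<or> b = \<zero>"

locale skew_field = ring +
  assumes one_not_zero: "\<one> \<noteq> \<zero>"
    and nonzero_Units: "Units R = carrier R - {\<zero>}"

definition ring_center :: "('a, 'b) ring_scheme \<Rightarrow> 'a set" where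
  "ring_center R = {z \<in> carrier R. \<forall>x \<in> carrier R. z \<otimes>\<^bsub>R\<^esub> x = x \<otimes>\<^bsub>R\<^esub> z}"

text \<open>\<open>D\<close> is the (two-sided Ore) division ring of fractions \<open>Frac(R)\<close>, with embedding \<open>\<iota>\<close>.\<close>

definition is_Frac ::
  "('r, 'c) ring_scheme \<Rightarrow> ('d, 'e) ring_scheme \<Rightarrow> ('r \<Rightarrow> 'd) \<Rightarrow> bool" where
  "is_Frac R D \<iota> \<longleftrightarrow>
     ring R \<and> skew_field D \<and> \<iota> \<in> Ring.ring_hom R D \<and> inj_on \<iota> (carrier R) \<and>
     (\<forall>x \<in> carrier D.
        (\<exists>a \<in> carrier R. \<exists>s \<in> carrier R - {\<zero>\<^bsub>R\<^esub>}. x = \<iota> a \<otimes>\<^bsub>D\<^esub> inv\<^bsub>D\<^esub> (\<iota> s)) \<and>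
        (\<exists>a \<in> carrier R. \<exists>s \<in> carrier R - {\<zero>\<^bsub>R\<^esub>}. x = inv\<^bsub>D\<^esub> (\<iota> s) \<otimes>\<^bsub>D\<^esub> \<iota> a))"

text \<open>
  \<open>R\<close> has a division ring of fractions whose dimension over its centre is \<open>n\<^sup>2\<close>.
  \<open>Frac(R)\<close> is unique up to isomorphism and is a quotient of a subset of \<open>R \<times> R\<close>, so that
  the type chosen for \<open>D\<close> is no restriction.  A ring with this property is a domain
  satisfying a polynomial identity.
\<close>

definition has_PI_deg :: "('r, 'c) ring_scheme \<Rightarrow> nat \<Rightarrow> bool" where
  "has_PI_deg R n \<longleftrightarrow>
     (\<exists>(D :: ('r \<times> 'r) set ring) \<iota>.
        is_Frac R D \<iota> \<and> ring.dimension D (n\<^sup>2) (ring_center D) (carrier D))"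

definition completely_prime :: "'a set \<Rightarrow> ('a, 'b) ring_scheme \<Rightarrow> bool" where
  "completely_prime P R \<longleftrightarrow> ideal P R \<and> nc_domain (R Quot P)"

definition CSpec :: "('a, 'b) ring_scheme \<Rightarrow> 'a set set" where
  "CSpec R = {P. completely_prime P R}"


section \<open>Skew derivations and Ore extensions\<close>

text \<open>
  All algebras below are subrings of one ring, containing a common central subfield \<open>K\<close>.
\<close>

context ring
begin

text \<open>\<open>K\<langle>X\<^sub>1,\<dots>,X\<^sub>i\<rangle>\<close>\<close>

definition subalg :: "'a set \<Rightarrow> (nat \<Rightarrow> 'a) \<Rightarrow> nat \<Rightarrow> 'a set" where
  "subalg K X i = generate_ring R (K \<union> X ` {1..i})"

definition K_linear_on :: "'a set \<Rightarrow> 'a set \<Rightarrow> ('a \<Rightarrow> 'a) \<Rightarrow> bool" where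
  "K_linear_on K B f \<longleftrightarrow>
     f \<in> B \<rightarrow> B \<and> (\<forall>r\<in>B. \<forall>s\<in>B. f (r \<oplus> s) = f r \<oplus> f s) \<and>
     (\<forall>k\<in>K. \<forall>r\<in>B. f (k \<otimes> r) = k \<otimes> f r)"

definition K_automorphism :: "'a set \<Rightarrow> 'a set \<Rightarrow> ('a \<Rightarrow> 'a) \<Rightarrow> bool" where
  "K_automorphism K B \<sigma> \<longleftrightarrow>
     \<sigma> \<in> ring_iso (R\<lparr>carrier := B\<rparr>) (R\<lparr>carrier := B\<rparr>) \<and> (\<forall>k\<in>K. \<sigma> k = k)"

definition skew_derivation :: "'a set \<Rightarrow> 'a set \<Rightarrow> ('a \<Rightarrow> 'a) \<Rightarrow> ('a \<Rightarrow> 'a) \<Rightarrow> bool" where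
  "skew_derivation K B \<sigma> \<delta> \<longleftrightarrow>
     K_linear_on K B \<delta> \<and> (\<forall>a\<in>B. \<forall>b\<in>B. \<delta> (a \<otimes> b) = \<sigma> a \<otimes> \<delta> b \<oplus> \<delta> a \<otimes> b)"

text \<open>
  \<open>C = B[x; \<sigma>, \<delta>]\<close>: the powers of \<open>x\<close> form a basis of \<open>C\<close> as a left \<open>B\<close>-module, and
  \<open>x r = \<sigma>(r) x + \<delta>(r)\<close>.
\<close>

definition ore_extension ::
  "'a set \<Rightarrow> 'a set \<Rightarrow> 'a set \<Rightarrow> 'a \<Rightarrow> ('a \<Rightarrow> 'a) \<Rightarrow> ('a \<Rightarrow> 'a) \<Rightarrow> bool" where
  "ore_extension K B C x \<sigma> \<delta> \<longleftrightarrow>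
     subring B R \<and> subring C R \<and> K \<subseteq> B \<and> B \<subseteq> C \<and> x \<in> C \<and>
     K_automorphism K B \<sigma> \<and> skew_derivation K B \<sigma> \<delta> \<and>
     (\<forall>r\<in>B. x \<otimes> r = \<sigma> r \<otimes> x \<oplus> \<delta> r) \<and>
     (\<forall>s\<in>C. \<exists>!c :: nat \<Rightarrow> 'a. (\<forall>n. c n \<in> B) \<and> finite {n. c n \<noteq> \<zero>} \<and>
        s = (\<Oplus>n\<in>{n. c n \<noteq> \<zero>}. c n \<otimes> x [^] n))"

text \<open>
  Gaussian binomial coefficients, evaluated at \<open>p\<close>.  The \<open>q\<close>-Pascal recursion is valid at roots
  of unity too, where the quotient formula is not.
\<close>

fun qbinomial :: "'a \<Rightarrow> nat \<Rightarrow> nat \<Rightarrow> 'a" where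
  "qbinomial p n 0 = \<one>"
| "qbinomial p 0 (Suc k) = \<zero>"
| "qbinomial p (Suc n) (Suc k) = qbinomial p n k \<oplus> p [^] Suc k \<otimes> qbinomial p n (Suc k)"

definition higher_skew_derivation ::
  "'a set \<Rightarrow> 'a set \<Rightarrow> ('a \<Rightarrow> 'a) \<Rightarrow> 'a \<Rightarrow> (nat \<Rightarrow> 'a \<Rightarrow> 'a) \<Rightarrow> bool" where
  "higher_skew_derivation K B \<sigma> p d \<longleftrightarrow>
     (\<forall>n. K_linear_on K B (d n)) \<and> (\<forall>r\<in>B. d 0 r = r) \<and>
     (\<forall>n. \<forall>r\<in>B. \<forall>s\<in>B. d n (r \<otimes> s) = (\<Oplus>i\<in>{0..n}. (\<sigma> ^^ (n - i)) (d i r) \<otimes> d (n - i) s)) \<and>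
     (\<forall>n. \<forall>r\<in>B. d n (\<sigma> r) = p [^] n \<otimes> \<sigma> (d n r))"

definition locally_nilpotent :: "'a set \<Rightarrow> (nat \<Rightarrow> 'a \<Rightarrow> 'a) \<Rightarrow> bool" where
  "locally_nilpotent B d \<longleftrightarrow> (\<forall>r\<in>B. \<exists>m. \<forall>n\<ge>m. d n r = \<zero>)"

definition iterative :: "'a set \<Rightarrow> 'a \<Rightarrow> (nat \<Rightarrow> 'a \<Rightarrow> 'a) \<Rightarrow> bool" where
  "iterative B p d \<longleftrightarrow>
     (\<forall>n m. \<forall>r\<in>B. d n (d m r) = qbinomial p (n + m) m \<otimes> d (n + m) r)"

end


section \<open>Quantum nilpotent algebras\<close>

text \<open>
  The ring \<open>F\<close> plays the role of \<open>Frac(A)\<close>, where \<open>A = K\<langle>X\<^sub>1,\<dots>,X\<^sub>N\<rangle>\<close> is regarded as a subring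
  of \<open>F\<close>.  Generators are numbered from \<open>1\<close>; \<open>\<sigma> i\<close>, \<open>\<delta> i\<close>, \<open>d i\<close>, \<open>q i\<close> are relevant for
  \<open>2 \<le> i \<le> N\<close> only.
\<close>

locale quantum_nilpotent_algebra = skew_field F for F (structure) +
  fixes K :: "'a set" and N :: nat and X :: "nat \<Rightarrow> 'a"
    and lam :: "nat \<Rightarrow> nat \<Rightarrow> 'a"
    and \<sigma> \<delta> :: "nat \<Rightarrow> 'a \<Rightarrow> 'a" and d :: "nat \<Rightarrow> nat \<Rightarrow> 'a \<Rightarrow> 'a"
    and q :: "nat \<Rightarrow> 'a"
  assumes K_subfield: "subfield K F"
    and K_central: "K \<subseteq> ring_center F"
    and N_pos: "1 \<le> N"
    and X_carrier: "\<And>i. i \<in> {1..N} \<Longrightarrow> X i \<in> carrier F"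
    and F_is_Frac:
      "is_Frac (F\<lparr>carrier := subalg K X N\<rparr>) F (\<lambda>x. x)"
    and ore_first:
      "ore_extension K K (subalg K X 1) (X 1) (\<lambda>r. r) (\<lambda>r. \<zero>)"
    and ore_step: "\<And>i. i \<in> {2..N} \<Longrightarrow>
      ore_extension K (subalg K X (i-1))
        (subalg K X i) (X i) (\<sigma> i) (\<delta> i)"
    and lam_scalar: "\<And>i l. \<lbrakk>i \<in> {1..N}; l \<in> {1..N}\<rbrakk> \<Longrightarrow> lam i l \<in> K - {\<zero>}"
    and lam_antisym: "\<And>i l. \<lbrakk>i \<in> {1..N}; l \<in> {1..N}\<rbrakk> \<Longrightarrow> lam i l = inv (lam l i)"
    and lam_diag: "\<And>i. i \<in> {1..N} \<Longrightarrow> lam i i = \<one>"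
    and sigma_gen: "\<And>i l. \<lbrakk>i \<in> {2..N}; l \<in> {1..<i}\<rbrakk> \<Longrightarrow> \<sigma> i (X l) = lam i l \<otimes> X l"
    and q_scalar: "\<And>i. i \<in> {2..N} \<Longrightarrow> q i \<in> K - {\<zero>, \<one>}"
    and delta_sigma: "\<And>i r. \<lbrakk>i \<in> {2..N}; r \<in> subalg K X (i-1)\<rbrakk> \<Longrightarrow>
      \<delta> i (\<sigma> i r) = q i \<otimes> \<sigma> i (\<delta> i r)"
    and d_higher: "\<And>i. i \<in> {2..N} \<Longrightarrow>
      higher_skew_derivation K (subalg K X (i-1)) (\<sigma> i) (q i) (d i)"
    and d_one: "\<And>i r. \<lbrakk>i \<in> {2..N}; r \<in> subalg K X (i-1)\<rbrakk> \<Longrightarrow>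
      d i 1 r = \<delta> i r"
    and d_nilpotent: "\<And>i. i \<in> {2..N} \<Longrightarrow>
      locally_nilpotent (subalg K X (i-1)) (d i)"
    and d_iterative: "\<And>i. i \<in> {2..N} \<Longrightarrow>
      iterative (subalg K X (i-1)) (q i) (d i)"
    and sigma_d: "\<And>i l n r. \<lbrakk>i \<in> {2..N}; l \<in> {i+1..N}; r \<in> subalg K X (i-1)\<rbrakk>
      \<Longrightarrow> \<sigma> l (d i n r) = lam l i [^] n \<otimes> d i n (\<sigma> l r)"
begin


subsection \<open>The deleting derivations algorithm\<close>

text \<open>
  Only the restriction \<open>K\<langle>x\<^sub>1,\<dots>,x\<^bsub>j-1\<^esub>\<rangle> \<cong> A\<^bsub>j-1\<^esub>\<close>, \<open>x\<^sub>i \<mapsto> X\<^sub>i\<close>, of the isomorphism from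
  \<open>A\<^bsup>(j+1)\<^esup>\<close> to an iterated Ore extension enters the algorithm.  It is determined by its values
  on generators.
\<close>

definition dd_iso :: "nat \<Rightarrow> (nat \<Rightarrow> 'a) \<Rightarrow> 'a \<Rightarrow> 'a" where
  "dd_iso j x = (SOME \<theta>.
     \<theta> \<in> ring_iso (F\<lparr>carrier := subalg K x (j-1)\<rparr>)
                  (F\<lparr>carrier := subalg K X (j-1)\<rparr>) \<and>
     (\<forall>k\<in>K. \<theta> k = k) \<and> (\<forall>i\<in>{1..j-1}. \<theta> (x i) = X i))"

text \<open>The operator \<open>d\<^bsub>j,n\<^esub> \<circ> \<sigma>\<^sub>j\<^bsup>-n\<^esup>\<close>, transported to \<open>K\<langle>x\<^sub>1,\<dots>,x\<^bsub>j-1\<^esub>\<rangle>\<close>.\<close>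

definition dd_op :: "nat \<Rightarrow> (nat \<Rightarrow> 'a) \<Rightarrow> nat \<Rightarrow> 'a \<Rightarrow> 'a" where
  "dd_op j x n r =
     inv_into (subalg K x (j-1)) (dd_iso j x)
       (d j n ((inv_into (subalg K X (j-1)) (\<sigma> j) ^^ n) (dd_iso j x r)))"

definition dd_summand :: "nat \<Rightarrow> (nat \<Rightarrow> 'a) \<Rightarrow> nat \<Rightarrow> nat \<Rightarrow> 'a" where
  "dd_summand j x l n =
     q j [^] (n * (n + 1) div 2) \<otimes> inv ((q j \<ominus> \<one>) [^] n) \<otimes> dd_op j x n (x l) \<otimes> inv (x j [^] n)"

definition dd_step :: "nat \<Rightarrow> (nat \<Rightarrow> 'a) \<Rightarrow> nat \<Rightarrow> 'a" where
  "dd_step j x l =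
     (if l < j then (\<Oplus>n\<in>{n. dd_summand j x l n \<noteq> \<zero>}. dd_summand j x l n) else x l)"

primrec dd_iter :: "nat \<Rightarrow> nat \<Rightarrow> 'a" where
  "dd_iter 0 = X"
| "dd_iter (Suc k) = dd_step (N - k) (dd_iter k)"

text \<open>\<open>dd_gen j i = X\<^sub>i\<^bsup>(j)\<^esup>\<close> for \<open>2 \<le> j \<le> N + 1\<close>, so that the step with index \<open>j\<close> leads from
  \<open>dd_gen (j + 1)\<close> to \<open>dd_gen j\<close>.\<close>

definition dd_gen :: "nat \<Rightarrow> nat \<Rightarrow> 'a" where
  "dd_gen j = dd_iter (N + 1 - j)"

definition dd_alg where
  "dd_alg j = F\<lparr>carrier := subalg K (dd_gen j) N\<rparr>"

abbreviation A where "A \<equiv> dd_alg (N + 1)"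

abbreviation A' where "A' \<equiv> dd_alg 2"

abbreviation T :: "nat \<Rightarrow> 'a" where "T \<equiv> dd_gen 2"


subsection \<open>The canonical embedding\<close>

definition dd_ideal :: "nat \<Rightarrow> 'a set" where
  "dd_ideal j = Idl\<^bsub>dd_alg (j+1)\<^esub> {dd_gen (j+1) j}"

text \<open>The homomorphism \<open>g\<^sub>j\<close>; it is determined by its values on generators.\<close>

definition dd_quot_map :: "nat \<Rightarrow> 'a \<Rightarrow> 'a set" where
  "dd_quot_map j = (SOME g.
     g \<in> Ring.ring_hom (dd_alg j) (dd_alg (j+1) Quot dd_ideal j) \<and>
     (\<forall>k\<in>K. g k = dd_ideal j +>\<^bsub>dd_alg (j+1)\<^esub> k) \<and>
     (\<forall>i\<in>{1..N}. g (dd_gen j i) = dd_ideal j +>\<^bsub>dd_alg (j+1)\<^esub> dd_gen (j+1) i))"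

definition psi_step :: "nat \<Rightarrow> 'a set \<Rightarrow> 'a set" where
  "psi_step j P =
     (if dd_gen (j+1) j \<notin> P
      then {p \<otimes> inv (dd_gen (j+1) j [^] n) | p (n :: nat). p \<in> P}
             \<inter> carrier (dd_alg j)
      else {a \<in> carrier (dd_alg j).
              dd_quot_map j a \<in> (\<lambda>p. dd_ideal j +>\<^bsub>dd_alg (j+1)\<^esub> p) ` P})"

definition psi :: "'a set \<Rightarrow> 'a set" where
  "psi = foldr psi_step [2..<N+1]"


subsection \<open>Cauchon diagrams and Cauchon ideals\<close>

definition CSpec_A'_at :: "nat set \<Rightarrow> 'a set set" where
  "CSpec_A'_at w = {Q \<in> CSpec A'. Q \<inter> T ` {1..N} = T ` w}"

definition CSpec_A_at :: "nat set \<Rightarrow> 'a set set" where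
  "CSpec_A_at w = {P \<in> CSpec A. psi P \<in> CSpec_A'_at w}"

definition Cauchon_diagrams :: "nat set set" where
  "Cauchon_diagrams = {w. w \<subseteq> {1..N} \<and> CSpec_A_at w \<noteq> {}}"

definition J_ideal :: "nat set \<Rightarrow> 'a set" where
  "J_ideal w = Idl\<^bsub>A'\<^esub> (T ` w)"

definition Cauchon_ideal :: "nat set \<Rightarrow> 'a set \<Rightarrow> bool" where
  "Cauchon_ideal w P \<longleftrightarrow> P \<in> CSpec_A_at w \<and> psi P = J_ideal w"

end


section \<open>Integral skew-symmetric matrices\<close>

text \<open>Matrix indices start at \<open>0\<close>, so that \<open>i \<in> w\<close> refers to the row and column \<open>i - 1\<close>.\<close>

definition remove_rows_cols :: "'a mat \<Rightarrow> nat set \<Rightarrow> 'a mat" where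
  "remove_rows_cols M w = submatrix M {i. Suc i \<notin> w} {i. Suc i \<notin> w}"

definition int_kernel_dim :: "int mat \<Rightarrow> nat" where
  "int_kernel_dim S = kernel_dim (map_mat rat_of_int S)"

definition skew_block :: "int \<Rightarrow> int mat" where
  "skew_block h = mat_of_rows_list 2 [[0, h], [-h, 0]]"

text \<open>\<open>hs\<close> lists invariant factors of \<open>S\<close>, one for each \<open>2 \<times> 2\<close> block; their signs are not
  determined by \<open>S\<close>.\<close>

definition invariant_factors :: "int mat \<Rightarrow> int list \<Rightarrow> bool" where
  "invariant_factors S hs \<longleftrightarrow>
     0 \<notin> set hs \<and> (\<forall>i. Suc i < length hs \<longrightarrow> hs ! i dvd hs ! Suc i) \<and>
     (\<exists>E \<in> carrier_mat (dim_row S) (dim_row S). invertible_mat E \<and>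
        E * S * E\<^sup>T =
          diag_block_mat (map skew_block hs @ [0\<^sub>m (int_kernel_dim S) (int_kernel_dim S)]))"


definition primitive_root_of_unity :: "('a, 'b) ring_scheme \<Rightarrow> nat \<Rightarrow> 'a \<Rightarrow> bool" where
  "primitive_root_of_unity R l x \<longleftrightarrow>
     0 < l \<and> x [^]\<^bsub>R\<^esub> l = \<one>\<^bsub>R\<^esub> \<and> (\<forall>k. 0 < k \<and> k < l \<longrightarrow> x [^]\<^bsub>R\<^esub> k \<noteq> \<one>\<^bsub>R\<^esub>)"

end

theory Submission
  imports Defs
begin

text \<open>
  For \<open>b \<in> A\<^bsub>j-1\<^esub>\<close> the series \<open>\<phi>(b) = \<Sum>\<^sub>n q\<^bsup>n(n+1)/2\<^esup>(q-1)\<^bsup>-n\<^esup>d\<^sub>n\<sigma>\<^bsup>-n\<^esup>(b)x\<^sub>j\<^bsup>-n\<^esup>\<close> satisfies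
  \<open>x\<^sub>j \<phi>(b) = \<phi>(\<sigma>(b)) x\<^sub>j\<close>, and multiplicativity of \<open>\<phi>\<close> follows from this relation.  Since the
  \<open>\<lambda>\<^bsub>i,m\<^esub>\<close> are \<open>l\<close>-th roots of unity, \<open>x\<^sub>j\<^bsup>l\<^esup>\<close> is central in \<open>A\<^bsup>(j)\<^esup>\<close> and in \<open>A\<^bsup>(j+1)\<^esup>\<close>, and the two
  algebras agree after inverting it; hence passing from \<open>P\<close> to its image under \<open>\<psi>\<^sub>j\<close> changes
  neither complete primeness nor the division ring of fractions of the quotient.  At the end of
  the algorithm \<open>A'/J\<^sub>w\<close> is a quantum affine space.  Its division ring of fractions is spanned over
  the centre by monomials, which are eigenvectors of the conjugations by the generators, so that
  its dimension is the number of distinct characters.  This is the number of vectors \<open>M(w)a\<close>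
  modulo \<open>l\<close>, which the normal form of \<open>M(w)\<close> evaluates to \<open>\<Prod>(l/gcd(h\<^sub>i,l))\<^sup>2\<close>.
\<close>

section \<open>Division rings\<close>


text \<open>A/P comes with no embedding into \<open>F\<close>. The retraction of A' killing the T_i
  with i in w places A'/J_w inside \<open>F\<close>, and its fractions form a subring D of
  \<open>F\<close>. What climbs through the algorithm is the property that this same D is Frac(C/P)
  (\<open>frac_datum\<close>): the image of x_j^l in D is central, and invertible when x_j is
  outside P. \<open>dd_iso\<close> and \<open>dd_quot_map\<close> are choices among maps with
  prescribed values on generators. Their existence rests on left independence of the powers of
  X_i^(j) over the earlier generators, carried down from the Ore extensions by comparing leading
  coefficients and clearing central denominators. The q_j may be roots of unity, so q-factorials
  must not be inverted. The constants c_n = q^(n(n+1)/2) (q-1)^-n satisfy c_n [n+1] = (1 - q^-(n+1))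
  c_(n+1), which makes the relation with x_j telescope, and c_(i+m) = c_i c_m q^(im), which turns
  the Leibniz rule of the d_n into a convolution; the only denominators are powers of q and of q -
  1.\<close>

context skew_field
begin

lemma Units_iff: "x \<in> Units R \<longleftrightarrow> x \<in> carrier R \<and> x \<noteq> \<zero>"
  using nonzero_Units by auto

lemma inv_mem [simp]: "x \<in> carrier R \<Longrightarrow> x \<noteq> \<zero> \<Longrightarrow> inv x \<in> carrier R"
  using Units_inv_closed Units_iff by blast

lemma r_inv' [simp]: "x \<in> carrier R \<Longrightarrow> x \<noteq> \<zero> \<Longrightarrow> x \<otimes> inv x = \<one>"
  using Units_r_inv Units_iff by blast

lemma l_inv' [simp]: "x \<in> carrier R \<Longrightarrow> x \<noteq> \<zero> \<Longrightarrow> inv x \<otimes> x = \<one>"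
  using Units_l_inv Units_iff by blast

lemma inv_nonzero [simp]: "x \<in> carrier R \<Longrightarrow> x \<noteq> \<zero> \<Longrightarrow> inv x \<noteq> \<zero>"
  using r_inv' one_not_zero r_null by metis

lemma mult_zero_iff [simp]:
  "x \<in> carrier R \<Longrightarrow> y \<in> carrier R \<Longrightarrow> x \<otimes> y = \<zero> \<longleftrightarrow> x = \<zero> \<or> y = \<zero>"
  by (metis Units_iff Units_l_cancel l_null r_null zero_closed)

lemma pow_nonzero [simp]: "x \<in> carrier R \<Longrightarrow> x \<noteq> \<zero> \<Longrightarrow> x [^] (n::nat) \<noteq> \<zero>"
  using one_not_zero by (induct n) auto

lemma l_inv_cancel [simp]:
  "x \<in> carrier R \<Longrightarrow> x \<noteq> \<zero> \<Longrightarrow> y \<in> carrier R \<Longrightarrow> inv x \<otimes> (x \<otimes> y) = y"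
  by (simp flip: m_assoc)

lemma r_inv_cancel [simp]:
  "x \<in> carrier R \<Longrightarrow> x \<noteq> \<zero> \<Longrightarrow> y \<in> carrier R \<Longrightarrow> x \<otimes> (inv x \<otimes> y) = y"
  by (simp flip: m_assoc)

lemma mult_cancel_left:
  "x \<in> carrier R \<Longrightarrow> x \<noteq> \<zero> \<Longrightarrow> y \<in> carrier R \<Longrightarrow> z \<in> carrier R \<Longrightarrow> x \<otimes> y = x \<otimes> z \<longleftrightarrow> y = z"
  by (metis l_inv_cancel)

lemma mult_cancel_right:
  assumes "x \<in> carrier R" "x \<noteq> \<zero>" "y \<in> carrier R" "z \<in> carrier R"
  shows "y \<otimes> x = z \<otimes> x \<longleftrightarrow> y = z"
proof
  assume "y \<otimes> x = z \<otimes> x"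
  then have "y \<otimes> x \<otimes> inv x = z \<otimes> x \<otimes> inv x" by simp
  then show "y = z" using assms by (simp add: m_assoc)
qed simp

lemma inv_mult:
  assumes "x \<in> carrier R" "x \<noteq> \<zero>" "y \<in> carrier R" "y \<noteq> \<zero>"
  shows "inv (x \<otimes> y) = inv y \<otimes> inv x"
  using assms by (intro inv_unique'[symmetric]) (auto simp: m_assoc)

lemma commute_inv:
  assumes "x \<in> carrier R" "x \<noteq> \<zero>" "y \<in> carrier R" "x \<otimes> y = y \<otimes> x"
  shows "inv x \<otimes> y = y \<otimes> inv x"
proof -
  have "inv x \<otimes> y = inv x \<otimes> (y \<otimes> x) \<otimes> inv x"
    using assms(1-3) by (simp add: m_assoc)
  also have "\<dots> = y \<otimes> inv x"
    using assms by (simp flip: assms(4))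
  finally show ?thesis .
qed

lemma inv_inv_eq: "x \<in> carrier R \<Longrightarrow> x \<noteq> \<zero> \<Longrightarrow> inv (inv x) = x"
  using Units_iff Units_inv_inv by blast

section \<open>Localisation at central elements inside a division ring\<close>

definition central_loc :: "'a set \<Rightarrow> 'a set \<Rightarrow> 'a set" where
  "central_loc C S = {a \<otimes> inv s | a s. a \<in> C \<and> s \<in> S}"

definition central_mult :: "'a set \<Rightarrow> 'a set \<Rightarrow> bool" where
  "central_mult C S \<longleftrightarrow> subring C R \<and> S \<subseteq> C - {\<zero>} \<and> \<one> \<in> S \<and> (\<forall>s\<in>S. \<forall>t\<in>S. s \<otimes> t \<in> S) \<and>
     (\<forall>s\<in>S. \<forall>a\<in>C. s \<otimes> a = a \<otimes> s)"

lemma central_multD: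
  assumes "central_mult C S"
  shows "subring C R" "C \<subseteq> carrier R" "\<one> \<in> S" "\<And>s. s \<in> S \<Longrightarrow> s \<in> C" "\<And>s. s \<in> S \<Longrightarrow> s \<noteq> \<zero>"
    "\<And>s t. s \<in> S \<Longrightarrow> t \<in> S \<Longrightarrow> s \<otimes> t \<in> S" "\<And>s a. s \<in> S \<Longrightarrow> a \<in> C \<Longrightarrow> s \<otimes> a = a \<otimes> s"
  using assms subringE(1) unfolding central_mult_def by blast+

lemma central_loc_mult:
  assumes "central_mult C S" "a \<in> C" "b \<in> C" "s \<in> S" "t \<in> S"
  shows "(a \<otimes> inv s) \<otimes> (b \<otimes> inv t) = (a \<otimes> b) \<otimes> inv (s \<otimes> t)"
proof -
  note D = central_multD[OF assms(1)]
  have c: "a \<in> carrier R" "b \<in> carrier R" "s \<in> carrier R" "t \<in> carrier R" "s \<noteq> \<zero>" "t \<noteq> \<zero>"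
    using D assms by blast+
  have "inv s \<otimes> (b \<otimes> inv t) = b \<otimes> (inv s \<otimes> inv t)"
    using c commute_inv[of s b] D(7)[OF assms(4,3)] by (simp flip: m_assoc)
  moreover have "inv s \<otimes> inv t = inv (s \<otimes> t)"
    using c D(7)[of s t] D(4) assms by (simp add: inv_mult)
  ultimately show ?thesis using c by (simp add: m_assoc)
qed

lemma central_loc_add:
  assumes "central_mult C S" "a \<in> C" "b \<in> C" "s \<in> S" "t \<in> S"
  shows "(a \<otimes> inv s) \<oplus> (b \<otimes> inv t) = (a \<otimes> t \<oplus> b \<otimes> s) \<otimes> inv (s \<otimes> t)"
proof -
  note D = central_multD[OF assms(1)]
  have c: "a \<in> carrier R" "b \<in> carrier R" "s \<in> carrier R" "t \<in> carrier R" "s \<noteq> \<zero>" "t \<noteq> \<zero>"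
    using D assms by blast+
  have "s \<otimes> t = t \<otimes> s" using D(7)[of s t] D(4) assms by blast
  then have e: "inv (s \<otimes> t) = inv t \<otimes> inv s" "inv (s \<otimes> t) = inv s \<otimes> inv t"
    using c inv_mult[of s t] inv_mult[of t s] by auto
  have "a \<otimes> t \<otimes> inv (s \<otimes> t) = a \<otimes> inv s" using c e(1) by (simp add: m_assoc)
  moreover have "b \<otimes> s \<otimes> inv (s \<otimes> t) = b \<otimes> inv t" using c e(2) by (simp add: m_assoc)
  ultimately show ?thesis using c by (simp add: l_distr)
qed

lemma central_loc_subring:
  assumes "central_mult C S" shows "subring (central_loc C S) R"
proof -
  note D = central_multD[OF assms(1)]
  note C = subringE[OF D(1)]
  show ?thesis
  proof (rule subringI)
    show "central_loc C S \<subseteq> carrier R"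
      using D(2,4,5) unfolding central_loc_def by (auto simp: subset_iff)
    show "\<one> \<in> central_loc C S"
      using D(3) C(3) unfolding central_loc_def by (force intro: exI[of _ \<one>])
    fix x y assume "x \<in> central_loc C S"
    then obtain a s where x: "x = a \<otimes> inv s" "a \<in> C" "s \<in> S" unfolding central_loc_def by blast
    have "\<ominus> x = (\<ominus> a) \<otimes> inv s" using x D(2,4,5) by (simp add: l_minus subset_iff)
    then show "\<ominus> x \<in> central_loc C S" using x C(5) unfolding central_loc_def by blast
    assume "y \<in> central_loc C S"
    then obtain b t where y: "y = b \<otimes> inv t" "b \<in> C" "t \<in> S" unfolding central_loc_def by blast
    show "x \<otimes> y \<in> central_loc C S"
      using x y central_loc_mult[OF assms, of a b s t] C(6) D(6) unfolding central_loc_def by blast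
    have "a \<otimes> t \<oplus> b \<otimes> s \<in> C" using x y C(6,7) D(4) by blast
    then show "x \<oplus> y \<in> central_loc C S"
      using x y central_loc_add[OF assms, of a b s t] D(6) unfolding central_loc_def by blast
  qed
qed

lemma central_loc_incl:
  assumes "central_mult C S" shows "C \<subseteq> central_loc C S"
proof
  note D = central_multD[OF assms(1)]
  fix a assume "a \<in> C"
  then have "a = a \<otimes> inv \<one>" using D(2) by auto
  then show "a \<in> central_loc C S" using \<open>a \<in> C\<close> D(3) unfolding central_loc_def by blast
qed

text \<open>Inverses of denominators inherit commutation. This carries centrality from a ring to its
  localisation, first for the torus and later from A^(j) to A^(j+1).\<close>

lemma central_loc_commute:
  assumes "central_mult C S" "x \<in> carrier R" "\<And>a. a \<in> C \<Longrightarrow> x \<otimes> a = a \<otimes> x" "y \<in> central_loc C S"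
  shows "x \<otimes> y = y \<otimes> x"
proof -
  note D = central_multD[OF assms(1)]
  obtain a s where y: "y = a \<otimes> inv s" "a \<in> C" "s \<in> S" using assms(4) unfolding central_loc_def by blast
  have c: "a \<in> carrier R" "s \<in> carrier R" "s \<noteq> \<zero>" using y D by blast+
  have "x \<otimes> inv s = inv s \<otimes> x" using commute_inv[of s x] assms(2,3) D(4)[OF y(3)] c by simp
  then show ?thesis unfolding y(1)
    by (metis assms(2,3) c inv_mem m_assoc y(2))
qed

end

section \<open>Quantum tori at a root of unity\<close>


locale central_subfield = skew_field R for R (structure) +
  fixes K :: "'a set"
  assumes K_subfield: "subfield K R" and K_central: "K \<subseteq> ring_center R"
begin

lemma K_carrier [simp]: "k \<in> K \<Longrightarrow> k \<in> carrier R"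
  using subfieldE(3)[OF K_subfield] by blast

lemma K_comm: "k \<in> K \<Longrightarrow> x \<in> carrier R \<Longrightarrow> x \<otimes> k = k \<otimes> x"
  using K_central unfolding ring_center_def by force

lemma K_lcomm: "k \<in> K \<Longrightarrow> x \<in> carrier R \<Longrightarrow> y \<in> carrier R \<Longrightarrow> x \<otimes> (k \<otimes> y) = k \<otimes> (x \<otimes> y)"
  by (metis K_carrier K_comm m_assoc)

lemma K_subring: "subring K R"
  using subfieldE(1)[OF K_subfield] .

lemmas K_closed [simp] = subringE(2,3,5,6,7)[OF K_subring]

lemma K_pow [simp]: "k \<in> K \<Longrightarrow> k [^] (n::nat) \<in> K"
  by (induct n) auto

lemma K_inv [simp]: "k \<in> K \<Longrightarrow> k \<noteq> \<zero> \<Longrightarrow> inv k \<in> K"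
  using subfield_m_inv(1)[OF K_subfield] by simp

end

text \<open>Only commutation relations inside a division ring are assumed. Linear independence of
  monomials over the centre comes from distinct eigenvalues, in
  \<open>eig_independent\<close>.\<close>

locale quantum_torus = central_subfield +
  fixes I :: "nat set" and t :: "nat \<Rightarrow> 'a" and lam :: "nat \<Rightarrow> nat \<Rightarrow> 'a" and l :: nat
  assumes t: "\<And>i. i \<in> I \<Longrightarrow> t i \<in> carrier R - {\<zero>}"
    and lam: "\<And>i j. i \<in> I \<Longrightarrow> j \<in> I \<Longrightarrow> lam i j \<in> K \<and> lam i j [^] l = \<one>"
    and rel: "\<And>i j. i \<in> I \<Longrightarrow> j \<in> I \<Longrightarrow> t i \<otimes> t j = lam i j \<otimes> (t j \<otimes> t i)"
    and l_pos: "0 < l"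
begin

inductive_set words :: "'a set" where
  one: "\<one> \<in> words"
| step: "u \<in> words \<Longrightarrow> i \<in> I \<Longrightarrow> t i \<otimes> u \<in> words"

text \<open>Eigenvalues are required to be \<open>l\<close>-th roots of unity in \<open>K\<close>,
  so that the \<open>l\<close>-th power of an eigenvector commutes with all generators.\<close>

definition eig :: "'a \<Rightarrow> (nat \<Rightarrow> 'a) \<Rightarrow> bool" where
  "eig u c \<longleftrightarrow> u \<in> carrier R \<and> u \<noteq> \<zero> \<and> (\<forall>i\<in>I. c i \<in> K \<and> c i [^] l = \<one> \<and> t i \<otimes> u = c i \<otimes> (u \<otimes> t i))"

text \<open>Recovers the eigenvalues from the vector itself. Restriction to \<open>I\<close> makes
  equality of functions the same as equality of characters.\<close>

definition chi :: "'a \<Rightarrow> nat \<Rightarrow> 'a" where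
  "chi u = (\<lambda>i\<in>I. t i \<otimes> u \<otimes> inv (u \<otimes> t i))"

lemma t_carrier [simp]: "i \<in> I \<Longrightarrow> t i \<in> carrier R" and t_nonzero [simp]: "i \<in> I \<Longrightarrow> t i \<noteq> \<zero>"
  using t by auto

lemma eig_carrier: "eig u c \<Longrightarrow> u \<in> carrier R" "eig u c \<Longrightarrow> u \<noteq> \<zero>"
  by (auto simp: eig_def)

lemma eig_chi:
  assumes "eig u c" shows "chi u = restrict c I"
proof
  fix i
  show "chi u i = restrict c I i"
  proof (cases "i \<in> I")
    case True
    then have "t i \<otimes> u \<otimes> inv (u \<otimes> t i) = c i \<otimes> (u \<otimes> t i \<otimes> inv (u \<otimes> t i))"
      using assms by (auto simp: eig_def m_assoc)
    also have "\<dots> = c i" using assms True by (auto simp: eig_def)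
    finally show ?thesis using True by (simp add: chi_def)
  qed (simp add: chi_def)
qed

lemma K_pow_mult: "a \<in> K \<Longrightarrow> b \<in> K \<Longrightarrow> (a \<otimes> b) [^] (n::nat) = a [^] n \<otimes> b [^] n"
  using K_comm[of a b] by (intro pow_mult_distrib) auto

lemma eig_mult:
  assumes "eig u c" "eig v c'" shows "eig (u \<otimes> v) (\<lambda>i. c i \<otimes> c' i)"
proof -
  have "t i \<otimes> (u \<otimes> v) = c i \<otimes> c' i \<otimes> (u \<otimes> v \<otimes> t i)" if "i \<in> I" for i
  proof -
    have c: "u \<in> carrier R" "v \<in> carrier R" "c i \<in> K" "c' i \<in> K"
      using assms that by (auto simp: eig_def)
    have "t i \<otimes> (u \<otimes> v) = t i \<otimes> u \<otimes> v" using c that by (simp add: m_assoc)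
    also have "\<dots> = c i \<otimes> (u \<otimes> (t i \<otimes> v))" using assms(1) c that by (simp add: eig_def m_assoc)
    also have "t i \<otimes> v = c' i \<otimes> (v \<otimes> t i)" using assms(2) that by (simp add: eig_def)
    also have "u \<otimes> (c' i \<otimes> (v \<otimes> t i)) = c' i \<otimes> (u \<otimes> (v \<otimes> t i))"
      using c that by (intro K_lcomm) auto
    finally show ?thesis using c that by (simp add: m_assoc)
  qed
  then show ?thesis using assms by (auto simp: eig_def K_pow_mult)
qed

lemma eig_one: "eig \<one> (\<lambda>_. \<one>)"
  using one_not_zero by (simp add: eig_def)

lemma eig_t: "j \<in> I \<Longrightarrow> eig (t j) (\<lambda>i. lam i j)"
  unfolding eig_def using lam t_carrier t_nonzero rel by blast

lemma eig_pow: "eig u c \<Longrightarrow> eig (u [^] (n::nat)) (\<lambda>i. c i [^] n)"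
proof (induct n)
  case 0 then show ?case using eig_one by simp
next
  case (Suc n) then show ?case using eig_mult[of "u [^] n" _ u c] by simp
qed

lemma words_eig: "u \<in> words \<Longrightarrow> \<exists>c. eig u c"
proof (induct rule: words.induct)
  case one then show ?case using eig_one by blast
next
  case (step u i) then show ?case using eig_mult eig_t by blast
qed

lemma words_carrier [simp]: "u \<in> words \<Longrightarrow> u \<in> carrier R" and words_nonzero [simp]: "u \<in> words \<Longrightarrow> u \<noteq> \<zero>"
  using words_eig eig_carrier by blast+

lemma words_mult: "u \<in> words \<Longrightarrow> v \<in> words \<Longrightarrow> u \<otimes> v \<in> words"
  by (induct rule: words.induct) (auto simp: m_assoc words.step)

lemma words_pow: "u \<in> words \<Longrightarrow> u [^] (n::nat) \<in> words"
  by (induct n) (auto intro: words_mult words.one)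

section \<open>The quantum affine space \<open>C\<close>, its centre and its fractions\<close>

definition C :: "'a set" where "C = generate_ring R (K \<union> t ` I)"

lemma C_subring: "subring C R"
  unfolding C_def by (rule generate_ring_is_subring) auto

lemma C_carrier [simp]: "a \<in> C \<Longrightarrow> a \<in> carrier R"
  using subringE(1)[OF C_subring] by blast

lemmas C_closed [simp] = subringE(2,3,5,6,7)[OF C_subring]

lemma K_in_C [simp]: "k \<in> K \<Longrightarrow> k \<in> C" and t_in_C [simp]: "i \<in> I \<Longrightarrow> t i \<in> C"
  unfolding C_def by (auto intro: generate_ring.incl)

lemma words_in_C [simp]: "u \<in> words \<Longrightarrow> u \<in> C"
  by (induct rule: words.induct) auto

lemma C_commute:
  assumes "x \<in> carrier R" "\<And>i. i \<in> I \<Longrightarrow> x \<otimes> t i = t i \<otimes> x" "a \<in> C"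
  shows "x \<otimes> a = a \<otimes> x"
  using assms(3)[unfolded C_def]
proof (induct rule: generate_ring.induct)
  case (incl h) then show ?case using assms(1,2) K_comm by auto
next
  case (a_inv h)
  then have "h \<in> carrier R" using C_carrier C_def by simp
  then show ?case using a_inv assms(1) by (simp add: l_minus r_minus)
next
  case (eng_add h1 h2)
  then have "h1 \<in> carrier R" "h2 \<in> carrier R" using C_carrier C_def by auto
  then show ?case using eng_add assms(1) by (simp add: l_distr r_distr)
next
  case (eng_mult h1 h2)
  then have "h1 \<in> carrier R" "h2 \<in> carrier R" using C_carrier C_def by auto
  then show ?case using eng_mult assms(1) by (metis m_assoc)
qed (use assms(1) in auto)

definition ZC :: "'a set" where "ZC = {z \<in> C. \<forall>i\<in>I. z \<otimes> t i = t i \<otimes> z}"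

lemma ZC_commute: "z \<in> ZC \<Longrightarrow> a \<in> C \<Longrightarrow> z \<otimes> a = a \<otimes> z"
  using C_commute unfolding ZC_def by auto

lemma ZC_subring: "subring ZC R"
proof (rule subringI)
  fix x y assume x: "x \<in> ZC" and y: "y \<in> ZC"
  then have c: "x \<in> C" "y \<in> C" by (auto simp: ZC_def)
  show "x \<otimes> y \<in> ZC"
  proof -
    have "x \<otimes> y \<otimes> t i = t i \<otimes> (x \<otimes> y)" if "i \<in> I" for i
      by (metis C_carrier ZC_commute c m_assoc t_in_C that x y)
    then show ?thesis using c by (auto simp: ZC_def)
  qed
  show "x \<oplus> y \<in> ZC" using x y by (auto simp: ZC_def l_distr r_distr)
next
  fix x assume "x \<in> ZC"
  then show "\<ominus> x \<in> ZC" by (auto simp: ZC_def l_minus r_minus)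
qed (auto simp: ZC_def)

lemma ZC_carrier [simp]: "z \<in> ZC \<Longrightarrow> z \<in> carrier R"
  unfolding ZC_def by auto

lemma ZC_C [simp]: "z \<in> ZC \<Longrightarrow> z \<in> C"
  unfolding ZC_def by auto

lemma K_ZC: "k \<in> K \<Longrightarrow> k \<in> ZC"
  unfolding ZC_def using K_comm[OF _ t_carrier, symmetric] K_in_C by blast

lemma eig_ZC:
  assumes "eig u c" "\<And>i. i \<in> I \<Longrightarrow> c i = \<one>" "u \<in> C" shows "u \<in> ZC"
proof -
  have "u \<otimes> t i = t i \<otimes> u" if i: "i \<in> I" for i
  proof -
    have "t i \<otimes> u = c i \<otimes> (u \<otimes> t i)" using assms(1) i unfolding eig_def by blast
    also have "\<dots> = u \<otimes> t i" using assms(2)[OF i] i eig_carrier(1)[OF assms(1)] by simp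
    finally show ?thesis by (rule sym)
  qed
  then show ?thesis using assms(3) unfolding ZC_def by blast
qed

lemma ZC_mult: "central_mult C (ZC - {\<zero>})" and ZC_mult': "central_mult ZC (ZC - {\<zero>})"
  using C_subring ZC_subring one_not_zero subringE(3,6)[OF ZC_subring] ZC_commute
  unfolding central_mult_def by auto

text \<open>Fractions with central denominators only. That \<open>D\<close> is a division ring is
  proved in \<open>D_inv\<close> from finite dimension over \<open>Z\<close>; that \<open>Z\<close>
  is its whole centre is \<open>D_center\<close>.\<close>

definition D :: "'a set" where "D = central_loc C (ZC - {\<zero>})"
definition Z :: "'a set" where "Z = central_loc ZC (ZC - {\<zero>})"

lemma D_subring: "subring D R" and Z_subring: "subring Z R"
  unfolding D_def Z_def using central_loc_subring ZC_mult ZC_mult' by auto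

lemma C_D: "C \<subseteq> D" and ZC_Z: "ZC \<subseteq> Z"
  unfolding D_def Z_def using central_loc_incl ZC_mult ZC_mult' by auto

lemma Z_D: "Z \<subseteq> D"
  unfolding D_def Z_def central_loc_def using ZC_C by blast

lemma D_carrier [simp]: "x \<in> D \<Longrightarrow> x \<in> carrier R" and Z_carrier [simp]: "x \<in> Z \<Longrightarrow> x \<in> carrier R"
  using subringE(1)[OF D_subring] subringE(1)[OF Z_subring] by auto

lemma ZC_D_commute: "z \<in> ZC \<Longrightarrow> x \<in> D \<Longrightarrow> z \<otimes> x = x \<otimes> z"
  unfolding D_def using central_loc_commute[OF ZC_mult] ZC_commute by auto

lemma Z_D_commute:
  assumes "z \<in> Z" "x \<in> D" shows "z \<otimes> x = x \<otimes> z"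
proof -
  have "x \<otimes> z = z \<otimes> x"
    by (rule central_loc_commute[OF ZC_mult' D_carrier[OF assms(2)] ZC_D_commute[OF _ assms(2), symmetric]
          assms(1)[unfolded Z_def]])
  then show ?thesis by simp
qed

lemma Z_t_commute: "z \<in> Z \<Longrightarrow> i \<in> I \<Longrightarrow> t i \<otimes> z = z \<otimes> t i"
  by (rule Z_D_commute[symmetric]) (use C_D t_in_C in auto)

lemma Z_inv: assumes "z \<in> Z" "z \<noteq> \<zero>" shows "inv z \<in> Z"
proof -
  obtain a s where z: "z = a \<otimes> inv s" "a \<in> ZC" "s \<in> ZC" "s \<noteq> \<zero>"
    using assms unfolding Z_def central_loc_def by blast
  then have "a \<noteq> \<zero>" using assms(2) by auto
  then have "inv z = s \<otimes> inv a" using z by (simp add: inv_mult inv_inv_eq)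
  then show ?thesis using z \<open>a \<noteq> \<zero>\<close> unfolding Z_def central_loc_def by blast
qed

lemma Z_subfield: "subfield Z R"
proof (rule subfieldI)
  show "subcring Z R"
    using Z_subring Z_D_commute Z_D by (intro subcringI) auto
  have "\<exists>y\<in>Z. y \<otimes> x = \<one> \<and> x \<otimes> y = \<one>" if "x \<in> Z" "x \<noteq> \<zero>" for x
    using that Z_inv[OF that] by (intro bexI[of _ "inv x"]) auto
  moreover have "x \<noteq> \<zero>" if "y \<in> Z" "y \<otimes> x = \<one>" for x y
    using that one_not_zero by auto
  ultimately show "Units (R\<lparr>carrier := Z\<rparr>) = Z - {\<zero>}"
    unfolding Units_def by auto
qed

text \<open>The power v^(l-1) serves as an inverse of v up to the central element v^l: u v^(l-1) has
  trivial character, so z = u v^(l-1) (v^l)^-1 is a central fraction with u = z v.\<close>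

lemma chi_eq_imp:
  assumes "u \<in> words" "v \<in> words" "chi u = chi v"
  shows "\<exists>z\<in>Z. u = z \<otimes> v"
proof -
  obtain c where c: "eig u c" using words_eig assms(1) by blast
  obtain c' where c': "eig v c'" using words_eig assms(2) by blast
  have cc: "c i = c' i" if "i \<in> I" for i
    using eig_chi[OF c] eig_chi[OF c'] assms(3) that by (metis restrict_apply')
  obtain k where k: "l = Suc k" using l_pos gr0_conv_Suc by blast
  have e: "eig (u \<otimes> v [^] k) (\<lambda>i. c i \<otimes> c' i [^] k)" using eig_mult[OF c eig_pow[OF c']] .
  have one: "c i \<otimes> c' i [^] k = \<one>" if "i \<in> I" for i
  proof -
    have "c' i \<in> K" using c' that by (auto simp: eig_def)
    then have "c' i \<otimes> c' i [^] k = c' i [^] l" unfolding k by (simp add: K_comm)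
    then show ?thesis using c' cc that by (auto simp: eig_def)
  qed
  have cu [simp]: "u \<in> carrier R" "v \<in> carrier R" "v \<noteq> \<zero>" using assms by auto
  have "u \<otimes> v [^] k \<in> ZC"
    by (rule eig_ZC[OF e one]) (simp_all add: assms(1,2) words_pow)
  moreover have "v [^] l \<in> ZC"
    using c' assms(2) words_pow by (intro eig_ZC[OF eig_pow[OF c', of l]]) (auto simp: eig_def)
  ultimately have z: "u \<otimes> v [^] k \<otimes> inv (v [^] l) \<in> Z"
    unfolding Z_def central_loc_def using pow_nonzero[of v l] cu by blast
  have "v [^] k \<otimes> v = v [^] l" unfolding k by simp
  moreover have "inv (v [^] l) \<otimes> v = v \<otimes> inv (v [^] l)"
    using nat_pow_Suc[of v l] nat_pow_Suc2[OF cu(2), of l] by (intro commute_inv) auto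
  ultimately have vv: "v [^] k \<otimes> v = v [^] l" "inv (v [^] l) \<otimes> v = v \<otimes> inv (v [^] l)" .
  have "u \<otimes> v [^] k \<otimes> inv (v [^] l) \<otimes> v = u \<otimes> (v [^] k \<otimes> (inv (v [^] l) \<otimes> v))"
    using cu by (simp add: m_assoc)
  also have "\<dots> = u \<otimes> (v [^] k \<otimes> v \<otimes> inv (v [^] l))"
    unfolding vv(2) using cu by (simp add: m_assoc)
  also have "\<dots> = u" unfolding vv(1) using cu by simp
  finally have "u = u \<otimes> v [^] k \<otimes> inv (v [^] l) \<otimes> v" by (rule sym)
  then show ?thesis using z by blast
qed

text \<open>The span contains all words and is stable under left multiplication by \<open>K\<close>
  and by each t_i, hence by \<open>C\<close>. Letting \<open>C\<close> act on \<one> gives the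
  inclusion.\<close>

lemma C_in_Span:
  assumes Us: "set Us \<subseteq> words" "chi ` words \<subseteq> chi ` set Us"
  shows "C \<subseteq> Span Z Us"
proof -
  have UR: "set Us \<subseteq> carrier R" using Us(1) by auto
  note S = Span_subgroup_props[OF Z_subfield UR]
  note smult = Span_smult_closed[OF Z_subfield UR]
  have words: "words \<subseteq> Span Z Us"
  proof
    fix u assume u: "u \<in> words"
    then obtain v where v: "v \<in> set Us" "chi u = chi v" using Us(2) by blast
    obtain z where "z \<in> Z" "u = z \<otimes> v" using chi_eq_imp[OF u _ v(2)] v(1) Us(1) by blast
    then show "u \<in> Span Z Us" using smult Span_base_incl[OF Z_subfield UR] v(1) by blast
  qed
  have ts: "t i \<otimes> s \<in> Span Z Us" if i: "i \<in> I" and s: "s \<in> Span Z Us" for i s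
  proof -
    obtain Ks where Ks: "set Ks \<subseteq> Z" "s = combine Ks Us"
      using s Span_eq_combine_set[OF Z_subfield UR] by blast
    have "t i \<otimes> combine Ks Vs \<in> Span Z Us" if "set Vs \<subseteq> set Us" "set Ks \<subseteq> Z" for Ks Vs
      using that
    proof (induct Ks Vs rule: combine.induct)
      case (1 k Ks v Vs)
      have c: "k \<in> Z" "v \<in> words" "set Ks \<subseteq> carrier R" "set Vs \<subseteq> carrier R" using 1 Us(1) by auto
      have "t i \<otimes> k = k \<otimes> t i" using c(1) i by (rule Z_t_commute)
      then have "t i \<otimes> combine (k # Ks) (v # Vs) = k \<otimes> (t i \<otimes> v) \<oplus> t i \<otimes> combine Ks Vs"
        using c i combine_in_carrier[OF c(3,4)] by (simp add: r_distr flip: m_assoc)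
      moreover have "t i \<otimes> v \<in> Span Z Us" using words words.step[OF c(2) i] by blast
      ultimately show ?case using 1 S(3) smult c(1) by simp
    qed (use S(2) i in auto)
    then show ?thesis using Ks by blast
  qed
  have "\<forall>s \<in> Span Z Us. a \<otimes> s \<in> Span Z Us" if "a \<in> C" for a
    using that[unfolded C_def]
  proof (induct rule: generate_ring.induct)
    case one then show ?case using S(1) by auto
  next
    case (incl h) then show ?case using ts smult subsetD[OF ZC_Z K_ZC] by blast
  next
    case (a_inv h)
    then have "h \<in> carrier R" using C_carrier C_def by simp
    then show ?case using a_inv S by (auto simp: l_minus subset_iff)
  next
    case (eng_add h1 h2)
    then have "h1 \<in> carrier R" "h2 \<in> carrier R" using C_carrier C_def by auto
    then show ?case using eng_add S by (auto simp: l_distr subset_iff)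
  next
    case (eng_mult h1 h2)
    then have "h1 \<in> carrier R" "h2 \<in> carrier R" using C_carrier C_def by auto
    then show ?case using eng_mult S by (auto simp: m_assoc subset_iff)
  qed
  then show ?thesis using words words.one C_carrier by (metis r_one subset_eq)
qed

text \<open>Denominators in \<open>ZC\<close> are invertible in \<open>Z\<close>, so passing from
  \<open>C\<close> to its fractions does not enlarge the span.\<close>

lemma Span_eq_D:
  assumes Us: "set Us \<subseteq> words" "chi ` words \<subseteq> chi ` set Us"
  shows "Span Z Us = D"
proof
  have UR: "set Us \<subseteq> carrier R" using Us(1) by auto
  note S = Span_subgroup_props[OF Z_subfield UR]
  have UD: "set Us \<subseteq> D" using Us(1) C_D words_in_C by blast
  have "combine Ks Vs \<in> D" if "set Ks \<subseteq> Z" "set Vs \<subseteq> D" for Ks Vs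
    using that
  proof (induct Ks Vs rule: combine.induct)
    case (1 k Ks v Vs)
    then show ?case using Z_D subringE(6,7)[OF D_subring] by (simp add: subset_iff)
  qed (use subringE(2)[OF D_subring] in auto)
  then show "Span Z Us \<subseteq> D"
    unfolding Span_eq_combine_set[OF Z_subfield UR] using UD by auto
  show "D \<subseteq> Span Z Us"
  proof
    fix x assume x: "x \<in> D"
    then obtain a s where a: "x = a \<otimes> inv s" "a \<in> C" "s \<in> ZC" "s \<noteq> \<zero>"
      unfolding D_def central_loc_def by blast
    have "inv s \<in> Z" using Z_inv a ZC_Z by blast
    moreover have "x = inv s \<otimes> a" 
      unfolding a(1) using Z_D_commute[OF \<open>inv s \<in> Z\<close>, of a] C_D a(2) by auto
    moreover have "a \<in> Span Z Us" using C_in_Span[OF Us] a by blast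
    ultimately show "x \<in> Span Z Us" using Span_smult_closed[OF Z_subfield UR] by blast
  qed
qed

text \<open>
  Dedekind's independence argument: the words are simultaneous eigenvectors of the conjugations
  by the \<open>t\<^sub>i\<close>, whose fixed ring in \<open>D\<close> is the centre of \<open>D\<close>.
\<close>

lemma eig_independent:
  assumes "set Us \<subseteq> words" "distinct (map chi Us)"
  shows "independent Z Us"
  using assms
proof (induct Us)
  case Nil then show ?case by simp
next
  case (Cons u Us)
  have UR: "set Us \<subseteq> carrier R" "u \<in> carrier R" "u \<noteq> \<zero>" using Cons by auto
  have ind: "independent Z Us" using Cons by simp
  have "u \<notin> Span Z Us"
  proof
    assume "u \<in> Span Z Us"
    then obtain Ks where Ks: "set Ks \<subseteq> Z" "length Ks = length Us" "u = combine Ks Us"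
      using Span_mem_iff_length_version[OF Z_subfield UR(1)] by blast
    obtain c where c: "eig u c" using words_eig Cons(2) by auto
    \<comment> \<open>The operator y |-> c_i y t_i - t_i y kills u and multiplies the v-component by
      c_i - \<open>chi v i\<close>, up to a common right factor t_i. It turns the relation for u
      into one among the vectors of the shorter list.\<close>
    have key: "combine (map2 (\<lambda>k v. (c i \<ominus> chi v i) \<otimes> k) Ks Vs) Vs \<otimes> t i
        = c i \<otimes> combine Ks Vs \<otimes> t i \<ominus> t i \<otimes> combine Ks Vs"
      if i: "i \<in> I" and "set Vs \<subseteq> words" "set Ks \<subseteq> Z" "length Ks = length Vs" for i Ks Vs
      using that(2-)
    proof (induct Ks Vs rule: combine.induct)
      case (1 k Ks v Vs)
      have ci [simp]: "c i \<in> K" using c i by (auto simp: eig_def)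
      have vw: "v \<in> words" using 1(2) by simp
      then obtain c' where c': "eig v c'" using words_eig by blast
      then have chi: "chi v i = c' i" "c' i \<in> K" "t i \<otimes> v = c' i \<otimes> (v \<otimes> t i)"
        using eig_chi[OF c'] i by (auto simp: eig_def)
      have mem: "v \<in> carrier R" "k \<in> carrier R" "k \<in> Z" "combine Ks Vs \<in> carrier R"
        using 1 by (auto intro!: combine_in_carrier)
      have m2: "combine (map2 (\<lambda>k v. (c i \<ominus> chi v i) \<otimes> k) Ks Vs) Vs \<in> carrier R" (is "?m \<in> _")
      proof -
        have "chi v i \<in> carrier R" if "v \<in> words" for v
          using that i words_eig eig_chi by (auto simp: chi_def)
        then have "(c i \<ominus> chi b i) \<otimes> a \<in> carrier R" if "(a, b) \<in> set (zip Ks Vs)" for a b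
          using set_zip_leftD[OF that] set_zip_rightD[OF that] 1(2-) by (simp add: subset_iff)
        then show ?thesis using 1(2-) by (intro combine_in_carrier) auto
      qed
      have tk: "t i \<otimes> k = k \<otimes> t i" using mem(3) i by (rule Z_t_commute)
      have "t i \<otimes> (k \<otimes> v) = k \<otimes> (t i \<otimes> v)" using tk mem i by (simp flip: m_assoc)
      also have "\<dots> = c' i \<otimes> k \<otimes> v \<otimes> t i" unfolding chi(3)
        using mem i chi(2) K_lcomm[OF chi(2) mem(2), of "v \<otimes> t i"] by (simp add: m_assoc)
      finally have e: "t i \<otimes> (k \<otimes> v) = c' i \<otimes> k \<otimes> v \<otimes> t i" .
      have "((c i \<ominus> c' i) \<otimes> k \<otimes> v \<oplus> ?m) \<otimes> t i = ((c i \<ominus> c' i) \<otimes> k \<otimes> v) \<otimes> t i \<oplus> ?m \<otimes> t i"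
        using mem m2 i chi(2) by (simp add: l_distr)
      also have "?m \<otimes> t i = c i \<otimes> combine Ks Vs \<otimes> t i \<ominus> t i \<otimes> combine Ks Vs"
        using 1 by simp
      also have "((c i \<ominus> c' i) \<otimes> k \<otimes> v) \<otimes> t i = c i \<otimes> (k \<otimes> v) \<otimes> t i \<ominus> t i \<otimes> (k \<otimes> v)"
        unfolding e using mem i chi(2) ci[THEN K_carrier] by (simp add: l_distr minus_eq m_assoc l_minus)
      also have "(c i \<otimes> (k \<otimes> v) \<otimes> t i \<ominus> t i \<otimes> (k \<otimes> v)) \<oplus> (c i \<otimes> combine Ks Vs \<otimes> t i \<ominus> t i \<otimes> combine Ks Vs)
          = c i \<otimes> (k \<otimes> v \<oplus> combine Ks Vs) \<otimes> t i \<ominus> t i \<otimes> (k \<otimes> v \<oplus> combine Ks Vs)"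
        using mem i ci[THEN K_carrier] by (simp add: l_distr r_distr minus_eq minus_add a_ac)
      finally show ?case using chi(1) by simp
    qed (use i c in \<open>auto simp: eig_def minus_eq\<close>)
    \<comment> \<open>As \<open>combine Ks Us\<close> equals u, the right side of \<open>key\<close>
      vanishes, and independence of \<open>Us\<close> kills every modified coefficient.\<close>
    have zero: "(c i \<ominus> chi v i) \<otimes> k = \<zero>" if i: "i \<in> I" and kv: "(k, v) \<in> set (zip Ks Us)" for i k v
    proof -
      have ci: "c i \<in> K" "t i \<otimes> u = c i \<otimes> u \<otimes> t i" using c i UR by (auto simp: eig_def m_assoc)
      have "combine (map2 (\<lambda>k v. (c i \<ominus> chi v i) \<otimes> k) Ks Us) Us \<otimes> t i = \<zero>"
        using key[OF i, of Us Ks] Cons(2) Ks UR i ci by (simp add: minus_eq r_neg)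
      moreover have sub: "set (map2 (\<lambda>k v. (c i \<ominus> chi v i) \<otimes> k) Ks Us) \<subseteq> Z"
      proof -
        have "chi v i \<in> K" if v: "v \<in> words" for v
        proof -
          obtain c' where c': "eig v c'" using words_eig v by auto
          then show ?thesis using eig_chi[OF c'] i by (auto simp: eig_def)
        qed
        then have "c i \<ominus> chi b i \<in> K" if "b \<in> set Us" for b
          using that Cons(2) ci(1) by (simp add: minus_eq subset_iff)
        then have "(c i \<ominus> chi b i) \<otimes> a \<in> Z" if "(a, b) \<in> set (zip Ks Us)" for a b
          using set_zip_leftD[OF that] set_zip_rightD[OF that] Ks(1) subsetD[OF ZC_Z K_ZC]
          by (intro subringE(6)[OF Z_subring]) auto
        then show ?thesis by auto
      qed
      then have "combine (map2 (\<lambda>k v. (c i \<ominus> chi v i) \<otimes> k) Ks Us) Us \<in> carrier R"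
        using UR by (intro combine_in_carrier) auto
      ultimately have "combine (map2 (\<lambda>k v. (c i \<ominus> chi v i) \<otimes> k) Ks Us) Us = \<zero>"
        using i by simp
      from independent_imp_trivial_combine[OF Z_subfield ind sub this]
      show ?thesis using kv Ks(2) by fastforce
    qed
    \<comment> \<open>The characters of u and v differ at some i, where c_i - \<open>chi v i\<close>
      is nonzero and can be cancelled.\<close>
    have "k = \<zero>" if "(k, v) \<in> set (zip Ks Us)" for k v
    proof -
      have v: "v \<in> set Us" and k: "k \<in> Z" using that Ks(1) by (auto dest: set_zip_leftD set_zip_rightD)
      then have ne: "chi u \<noteq> chi v" and vw: "v \<in> words" using Cons(2,3) by auto
      obtain c' where c': "eig v c'" using words_eig vw by auto
      then obtain i where i: "i \<in> I" "c i \<noteq> c' i"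
        using ne eig_chi[OF c] eig_chi[OF c'] by (metis restrict_ext)
      moreover have "chi v i = c' i" using eig_chi[OF c'] i by simp
      moreover have "c i \<in> carrier R" "c' i \<in> carrier R" using c c' i by (auto simp: eig_def)
      ultimately show ?thesis using zero[OF i(1) that] k by auto
    qed
    then have "set Ks \<subseteq> {\<zero>}" using Ks(2) by (metis in_set_impl_in_set_zip1 singletonI subsetI surj_pair)
    then have "Ks = replicate (length Us) \<zero>" using Ks(2) by (metis replicate_eqI singletonD subsetD)
    then have "u = \<zero>" using Ks(3) combine_replicate[OF UR(1)] by simp
    then show False using UR by simp
  qed
  then show ?case using ind UR by (intro li_Cons) auto
qed

text \<open>One word is taken for each character that occurs; these words form a basis of
  \<open>D\<close> over \<open>Z\<close>.\<close>

lemma D_dimension: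
  assumes "finite (chi ` words)"
  shows "dimension (card (chi ` words)) Z D"
proof -
  obtain U where U: "U \<subseteq> words" "finite U" "inj_on chi U" "chi ` words = chi ` U"
    using assms by (metis finite_subset_image inj_on_finite subset_image_inj subset_refl finite_imageD)
  obtain Us where Us: "set Us = U" "distinct Us" using finite_distinct_list[OF U(2)] by blast
  have "dimension (length Us) Z (Span Z Us)"
    using U Us by (intro dimension_independent[OF eig_independent]) (auto simp: distinct_map)
  moreover have "Span Z Us = D" using Span_eq_D U Us by auto
  moreover have "length Us = card (chi ` words)"
    using U Us by (metis card_image distinct_card)
  ultimately show ?thesis by simp
qed

text \<open>Left multiplication by a nonzero a is injective and \<open>Z\<close>-linear, so it maps
  a basis of the finite-dimensional space \<open>D\<close> to a basis. Expanding \<one> in the new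
  basis yields the inverse.\<close>

lemma D_inv:
  assumes fin: "finite (chi ` words)" and a: "a \<in> D" "a \<noteq> \<zero>" shows "inv a \<in> D"
proof -
  let ?n = "card (chi ` words)"
  obtain Us where Us: "set Us \<subseteq> carrier R" "independent Z Us" "length Us = ?n" "Span Z Us = D"
    using exists_base[OF Z_subfield D_dimension[OF fin]] by blast
  have UD: "set Us \<subseteq> D" using Span_base_incl[OF Z_subfield Us(1)] Us(4) by simp
  have ac [simp]: "a \<in> carrier R" using a by auto
  have comb: "combine Ks (map ((\<otimes>) a) Vs) = a \<otimes> combine Ks Vs" if "set Ks \<subseteq> Z" "set Vs \<subseteq> carrier R" for Ks Vs
    using that
  proof (induct Ks Vs rule: combine.induct)
    case (1 k Ks v Vs)
    have "k \<otimes> (a \<otimes> v) = a \<otimes> (k \<otimes> v)" using 1 a(1) Z_D_commute[of k a] by (simp flip: m_assoc)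
    moreover have "combine Ks Vs \<in> carrier R" using 1 by (intro combine_in_carrier) auto
    ultimately show ?case using 1 by (simp add: r_distr)
  qed auto
  have "independent Z (map ((\<otimes>) a) Us)"
  proof (rule trivial_combine_imp_independent[OF Z_subfield])
    show "set (map ((\<otimes>) a) Us) \<subseteq> carrier R" using Us(1) by auto
    fix Ks assume Ks: "set Ks \<subseteq> Z" "combine Ks (map ((\<otimes>) a) Us) = \<zero>"
    then have "a \<otimes> combine Ks Us = \<zero>" using comb Us(1) by simp
    moreover have "combine Ks Us \<in> carrier R" using Us(1) Ks(1) by (intro combine_in_carrier) auto
    ultimately have "combine Ks Us = \<zero>" using a by simp
    then show "set (take (length (map ((\<otimes>) a) Us)) Ks) \<subseteq> {\<zero>}"
      using independent_imp_trivial_combine[OF Z_subfield Us(2) Ks(1)] by simp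
  qed
  moreover have "set (map ((\<otimes>) a) Us) \<subseteq> D" using UD a(1) subringE(6)[OF D_subring] by auto
  ultimately have "Span Z (map ((\<otimes>) a) Us) = D"
    using independent_length_eq_dimension[OF Z_subfield D_dimension[OF fin]] Us(3) by (metis length_map)
  then have "\<one> \<in> Span Z (map ((\<otimes>) a) Us)" using subringE(3)[OF D_subring] by simp
  moreover have "set (map ((\<otimes>) a) Us) \<subseteq> carrier R" using Us(1) by auto
  ultimately obtain Ks where Ks: "set Ks \<subseteq> Z" "\<one> = combine Ks (map ((\<otimes>) a) Us)"
    using Span_eq_combine_set[OF Z_subfield] by blast
  then have "\<one> = a \<otimes> combine Ks Us" using comb Us(1) by simp
  moreover have cD: "combine Ks Us \<in> D" using Ks(1) Us Span_eq_combine_set[OF Z_subfield Us(1)] by blast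
  ultimately have "inv a = combine Ks Us"
    using a(2) by (metis D_carrier ac inv_mem l_inv_cancel r_one)
  then show ?thesis using cD by simp
qed

text \<open>If x = a s^-1 is central in \<open>D\<close>, then its numerator a = x s commutes with
  the generators, hence lies in \<open>ZC\<close>.\<close>

lemma D_center: "ring_center (R\<lparr>carrier := D\<rparr>) = Z"
proof
  show "Z \<subseteq> ring_center (R\<lparr>carrier := D\<rparr>)"
    using Z_D Z_D_commute unfolding ring_center_def by auto
  show "ring_center (R\<lparr>carrier := D\<rparr>) \<subseteq> Z"
  proof
    fix x assume x: "x \<in> ring_center (R\<lparr>carrier := D\<rparr>)"
    then have xD: "x \<in> D" and xc: "\<And>y. y \<in> D \<Longrightarrow> x \<otimes> y = y \<otimes> x" unfolding ring_center_def by auto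
    then obtain a s where a: "x = a \<otimes> inv s" "a \<in> C" "s \<in> ZC" "s \<noteq> \<zero>"
      unfolding D_def central_loc_def by blast
    have "a = x \<otimes> s" using a by (simp add: m_assoc)
    have "a \<otimes> t i = t i \<otimes> a" if i: "i \<in> I" for i
    proof -
      have "t i \<in> D" using C_D i by auto
      then have "x \<otimes> t i = t i \<otimes> x" "s \<otimes> t i = t i \<otimes> s" 
        using xc a(3) i unfolding ZC_def by blast+
      note c = this
      have m: "x \<in> carrier R" "s \<in> carrier R" "t i \<in> carrier R" using xD a(3) i by auto
      have "x \<otimes> s \<otimes> t i = x \<otimes> (s \<otimes> t i)" using m by (rule m_assoc)
      also have "\<dots> = x \<otimes> t i \<otimes> s" unfolding c(2) using m by (simp add: m_assoc)
      also have "\<dots> = t i \<otimes> (x \<otimes> s)" unfolding c(1) using m by (simp add: m_assoc)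
      finally show ?thesis unfolding \<open>a = x \<otimes> s\<close> .
    qed
    then have "a \<in> ZC" using a(2) unfolding ZC_def by blast
    then show "x \<in> Z" using a unfolding Z_def central_loc_def by blast
  qed
qed

end

section \<open>Extension of homomorphisms\<close>


text \<open>Several homomorphisms below are computed from non-unique representations, so they are
  built as relations. Taking differences reduces single-valuedness to the values over zero.\<close>

lemma graph_ring_hom:
  assumes "ring R" "ring Q" and sub: "G \<subseteq> carrier R \<times> carrier Q"
    and one: "(\<one>\<^bsub>R\<^esub>, \<one>\<^bsub>Q\<^esub>) \<in> G"
    and neg: "\<And>a w. (a, w) \<in> G \<Longrightarrow> (\<ominus>\<^bsub>R\<^esub> a, \<ominus>\<^bsub>Q\<^esub> w) \<in> G"
    and add: "\<And>a w b v. (a, w) \<in> G \<Longrightarrow> (b, v) \<in> G \<Longrightarrow> (a \<oplus>\<^bsub>R\<^esub> b, w \<oplus>\<^bsub>Q\<^esub> v) \<in> G"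
    and mult: "\<And>a w b v. (a, w) \<in> G \<Longrightarrow> (b, v) \<in> G \<Longrightarrow> (a \<otimes>\<^bsub>R\<^esub> b, w \<otimes>\<^bsub>Q\<^esub> v) \<in> G"
    and zero: "\<And>w. (\<zero>\<^bsub>R\<^esub>, w) \<in> G \<Longrightarrow> w = \<zero>\<^bsub>Q\<^esub>"
  shows "\<exists>h. h \<in> Ring.ring_hom (R\<lparr>carrier := fst ` G\<rparr>) Q \<and> (\<forall>a w. (a, w) \<in> G \<longrightarrow> h a = w)"
proof -
  interpret R: ring R by fact
  interpret Q: ring Q by fact
  have uniq: "w = v" if "(a, w) \<in> G" "(a, v) \<in> G" for a w v
  proof -
    have c: "a \<in> carrier R" "w \<in> carrier Q" "v \<in> carrier Q" using that sub by auto
    have "(a \<oplus>\<^bsub>R\<^esub> \<ominus>\<^bsub>R\<^esub> a, w \<oplus>\<^bsub>Q\<^esub> \<ominus>\<^bsub>Q\<^esub> v) \<in> G" using add[OF that(1) neg[OF that(2)]] .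
    then have "w \<ominus>\<^bsub>Q\<^esub> v = \<zero>\<^bsub>Q\<^esub>" using c zero by (simp add: R.r_neg Q.minus_eq)
    then show ?thesis using c by simp
  qed
  define h where "h a = (THE w. (a, w) \<in> G)" for a
  have h: "h a = w" if "(a, w) \<in> G" for a w
    unfolding h_def using that uniq by blast
  have "h \<in> Ring.ring_hom (R\<lparr>carrier := fst ` G\<rparr>) Q"
  proof (rule ring_hom_memI; simp)
    fix x assume "x \<in> fst ` G"
    then obtain v where x: "(x, v) \<in> G" by auto
    then show "h x \<in> carrier Q" using h[OF x] sub by auto
    fix y assume "y \<in> fst ` G"
    then obtain u where y: "(y, u) \<in> G" by auto
    show "h (x \<otimes>\<^bsub>R\<^esub> y) = h x \<otimes>\<^bsub>Q\<^esub> h y" "h (x \<oplus>\<^bsub>R\<^esub> y) = h x \<oplus>\<^bsub>Q\<^esub> h y"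
      using h[OF x] h[OF y] h[OF mult[OF x y]] h[OF add[OF x y]] by auto
  qed (rule h[OF one])
  then show ?thesis using h by auto
qed

lemma ring_hom_sub_zero:
  assumes "ring R" "ring Q" "subring B R" "h \<in> Ring.ring_hom (R\<lparr>carrier := B\<rparr>) Q"
  shows "h \<zero>\<^bsub>R\<^esub> = \<zero>\<^bsub>Q\<^esub>"
  using ring_hom_zero[OF assms(4) ring.subring_is_ring[OF assms(1,3)] assms(2)] by simp

lemma ring_hom_sub_neg:
  assumes "ring R" "ring Q" "subring B R" "h \<in> Ring.ring_hom (R\<lparr>carrier := B\<rparr>) Q" "a \<in> B"
  shows "h (\<ominus>\<^bsub>R\<^esub> a) = \<ominus>\<^bsub>Q\<^esub> h a"
proof -
  interpret R: ring R by fact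
  interpret Q: ring Q by fact
  have c: "a \<in> carrier R" "\<ominus>\<^bsub>R\<^esub> a \<in> B" 
    using subringE(1)[OF assms(3)] subringE(5)[OF assms(3,5)] assms(5) by auto
  have "h (\<ominus>\<^bsub>R\<^esub> a) \<oplus>\<^bsub>Q\<^esub> h a = h (\<ominus>\<^bsub>R\<^esub> a \<oplus>\<^bsub>R\<^esub> a)"
    using ring_hom_add[OF assms(4), of "\<ominus>\<^bsub>R\<^esub> a" a] assms(5) c by simp
  also have "\<dots> = \<zero>\<^bsub>Q\<^esub>" using c ring_hom_sub_zero[OF assms(1-4)] by (simp add: R.l_neg)
  finally show ?thesis
    using ring_hom_closed[OF assms(4), of "\<ominus>\<^bsub>R\<^esub> a"] ring_hom_closed[OF assms(4), of a] c assms(5)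
    by (intro Q.minus_equality[symmetric]) auto
qed

lemma ring_hom_subD:
  assumes "h \<in> Ring.ring_hom (R\<lparr>carrier := B\<rparr>) Q"
  shows "\<And>a. a \<in> B \<Longrightarrow> h a \<in> carrier Q"
    "\<And>a b. a \<in> B \<Longrightarrow> b \<in> B \<Longrightarrow> h (a \<otimes>\<^bsub>R\<^esub> b) = h a \<otimes>\<^bsub>Q\<^esub> h b"
    "\<And>a b. a \<in> B \<Longrightarrow> b \<in> B \<Longrightarrow> h (a \<oplus>\<^bsub>R\<^esub> b) = h a \<oplus>\<^bsub>Q\<^esub> h b"
    "h \<one>\<^bsub>R\<^esub> = \<one>\<^bsub>Q\<^esub>"
  using ring_hom_closed[OF assms] ring_hom_mult[OF assms] ring_hom_add[OF assms] ring_hom_one[OF assms] by auto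

lemma ring_hom_eq_on_generate:
  assumes "ring R" "ring Q" "H \<subseteq> carrier R"
    and "g \<in> Ring.ring_hom (R\<lparr>carrier := B\<rparr>) Q" "h \<in> Ring.ring_hom (R\<lparr>carrier := B\<rparr>) Q"
    and "subring B R" "H \<subseteq> B" "\<And>x. x \<in> H \<Longrightarrow> g x = h x" "x \<in> generate_ring R H"
  shows "g x = h x"
proof -
  interpret ring R by fact
  have B: "generate_ring R H \<subseteq> B" using generate_ring_min_subring1[OF assms(3,6,7)] .
  from assms(9) show ?thesis
  proof (induct rule: generate_ring.induct)
    case one then show ?case using ring_hom_subD(4) assms(4,5) by metis
  next
    case (a_inv x) then show ?case using ring_hom_sub_neg[OF assms(1,2,6)] assms(4,5) B by (metis subsetD)
  next
    case (eng_add x y) then show ?case using ring_hom_subD(3) assms(4,5) B by (metis subsetD)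
  next
    case (eng_mult x y) then show ?case using ring_hom_subD(2) assms(4,5) B by (metis subsetD)
  qed (use assms(8) in auto)
qed

section \<open>Left polynomials, and extension of homomorphisms to skew polynomials\<close>

context ring
begin

text \<open>Value at y of a polynomial with coefficients on the left, the constant one at the head
  of the list. Trailing zeros are allowed, so one polynomial has many lists.\<close>

fun horner :: "'a \<Rightarrow> 'a list \<Rightarrow> 'a" where
  "horner y [] = \<zero>"
| "horner y (c # cs) = c \<oplus> horner y cs \<otimes> y"

lemma horner_closed [simp]: "y \<in> carrier R \<Longrightarrow> set cs \<subseteq> carrier R \<Longrightarrow> horner y cs \<in> carrier R"
  by (induct cs) auto

text \<open>Left linear independence of 1, y, y^2, ... over \<open>B\<close>. This is the part of
  the Ore extension structure that is carried along when the generators change.\<close>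

definition left_free :: "'a set \<Rightarrow> 'a \<Rightarrow> bool" where
  "left_free B y \<longleftrightarrow> (\<forall>cs. set cs \<subseteq> B \<longrightarrow> horner y cs = \<zero> \<longrightarrow> set cs \<subseteq> {\<zero>})"

end

context skew_field
begin

text \<open>Universal property of a skew polynomial ring whose twist is conjugation by y, for
  subrings of a division ring. Freeness makes the image of a polynomial well defined.\<close>

lemma extend_ring_hom:
  assumes B: "subring B R" and y: "y \<in> carrier R" "y \<noteq> \<zero>"
    and conj: "\<And>b. b \<in> B \<Longrightarrow> y \<otimes> b \<otimes> inv y \<in> B" and free: "left_free B y"
    and Q: "ring Q" and h: "h \<in> Ring.ring_hom (R\<lparr>carrier := B\<rparr>) Q" and s: "s \<in> carrier Q"
    and sh: "\<And>b. b \<in> B \<Longrightarrow> s \<otimes>\<^bsub>Q\<^esub> h b = h (y \<otimes> b \<otimes> inv y) \<otimes>\<^bsub>Q\<^esub> s"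
  shows "\<exists>h' \<in> Ring.ring_hom (R\<lparr>carrier := generate_ring R (B \<union> {y})\<rparr>) Q. (\<forall>b\<in>B. h' b = h b) \<and> h' y = s"
proof -
  interpret Q: ring Q by fact
  note hD = ring_hom_subD[OF h]
  have BR: "B \<subseteq> carrier R" using subringE(1)[OF B] .
  note Bc = subringE(2,3,5,6,7)[OF B]
  have h0: "h \<zero> = \<zero>\<^bsub>Q\<^esub>" using ring_hom_sub_zero[OF ring_axioms Q B h] .
  \<comment> \<open>The graph of the intended map on left polynomials. It will be shown to be
    additive and stable under left multiplication by \<open>B\<close> and by y; products of two
    general polynomials are never expanded.\<close>
  define T where "T = {(horner y cs, Q.horner s (map h cs)) | cs. set cs \<subseteq> B}"
  have TI: "(horner y cs, Q.horner s (map h cs)) \<in> T" if "set cs \<subseteq> B" for cs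
    unfolding T_def using that by blast
  have TB: "(b, h b) \<in> T" if "b \<in> B" for b
    using TI[of "[b]"] that BR hD(1) y s by (auto simp: subset_iff)
  have Tsub: "T \<subseteq> carrier R \<times> carrier Q"
  proof -
    have "horner y cs \<in> carrier R \<and> Q.horner s (map h cs) \<in> carrier Q" if "set cs \<subseteq> B" for cs
      using that BR y s hD(1) by (intro conjI horner_closed Q.horner_closed) auto
    then show ?thesis unfolding T_def by blast
  qed
  have Tcons: "(b \<oplus> a \<otimes> y, h b \<oplus>\<^bsub>Q\<^esub> w \<otimes>\<^bsub>Q\<^esub> s) \<in> T" if "b \<in> B" "(a, w) \<in> T" for a b w
  proof -
    obtain cs where "a = horner y cs" "w = Q.horner s (map h cs)" "set cs \<subseteq> B"
      using \<open>(a, w) \<in> T\<close> unfolding T_def by blast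
    then show ?thesis using TI[of "b # cs"] that by simp
  qed
  have T0: "(\<zero>, \<zero>\<^bsub>Q\<^esub>) \<in> T" using TI[of "[]"] by simp
  have Tadd1: "(horner y cs \<oplus> b, Q.horner s (map h cs) \<oplus>\<^bsub>Q\<^esub> v) \<in> T"
    if "set cs \<subseteq> B" "(b, v) \<in> T" for cs b v
    using that
  proof (induct cs arbitrary: b v)
    case Nil then show ?case using Tsub by auto
  next
    case (Cons c cs)
    obtain ds where ds: "b = horner y ds" "v = Q.horner s (map h ds)" "set ds \<subseteq> B"
      using Cons(3) unfolding T_def by blast
    have c: "c \<in> B" "c \<in> carrier R" "h c \<in> carrier Q" "set cs \<subseteq> B" "horner y cs \<in> carrier R" "Q.horner s (map h cs) \<in> carrier Q"
      using Cons(2) BR hD(1) y s TI[of cs] Tsub by auto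
    show ?case
    proof (cases ds)
      case Nil
      then show ?thesis using TI[of "c # cs"] Cons(2) ds c y s by simp
    next
      case (Cons d es)
      have e: "(horner y es, Q.horner s (map h es)) \<in> T" using ds Cons by (intro TI) auto
      have d: "d \<in> B" "d \<in> carrier R" "h d \<in> carrier Q" "horner y es \<in> carrier R" "Q.horner s (map h es) \<in> carrier Q"
        using ds Cons BR hD(1) e Tsub by auto
      have "(c \<oplus> d \<oplus> (horner y cs \<oplus> horner y es) \<otimes> y,
          h (c \<oplus> d) \<oplus>\<^bsub>Q\<^esub> (Q.horner s (map h cs) \<oplus>\<^bsub>Q\<^esub> Q.horner s (map h es)) \<otimes>\<^bsub>Q\<^esub> s) \<in> T"
        using Cons.hyps[OF c(4) e] c d Bc(5) by (intro Tcons) auto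
      then show ?thesis unfolding ds Cons
        using c d y s hD(3)[OF c(1) d(1)] by (simp add: l_distr a_ac Q.l_distr Q.a_ac)
    qed
  qed
  have Tadd: "(a \<oplus> b, w \<oplus>\<^bsub>Q\<^esub> v) \<in> T" if "(a, w) \<in> T" "(b, v) \<in> T" for a b w v
    using that(1) Tadd1[OF _ that(2)] unfolding T_def by auto
  have TmB: "(b \<otimes> a, h b \<otimes>\<^bsub>Q\<^esub> w) \<in> T" if "b \<in> B" "(a, w) \<in> T" for a b w
  proof -
    have "(b \<otimes> horner y cs, h b \<otimes>\<^bsub>Q\<^esub> Q.horner s (map h cs)) \<in> T" if "set cs \<subseteq> B" for cs
      using that
    proof (induct cs)
      case Nil then show ?case using T0 \<open>b \<in> B\<close> BR hD(1) by auto
    next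
      case (Cons c cs)
      have c: "c \<in> B" "c \<in> carrier R" "h c \<in> carrier Q" "set cs \<subseteq> B" "horner y cs \<in> carrier R" "Q.horner s (map h cs) \<in> carrier Q"
        "b \<in> carrier R" "h b \<in> carrier Q"
        using Cons(2) BR hD(1) y s TI[of cs] Tsub \<open>b \<in> B\<close> by auto
      have "(b \<otimes> c \<oplus> (b \<otimes> horner y cs) \<otimes> y,
          h (b \<otimes> c) \<oplus>\<^bsub>Q\<^esub> (h b \<otimes>\<^bsub>Q\<^esub> Q.horner s (map h cs)) \<otimes>\<^bsub>Q\<^esub> s) \<in> T"
        using Cons c \<open>b \<in> B\<close> Bc(4) by (intro Tcons) auto
      then show ?case using c y s hD(2)[OF \<open>b \<in> B\<close> c(1)] by (simp add: r_distr m_assoc Q.r_distr Q.m_assoc)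
    qed
    then show ?thesis using that(2) unfolding T_def by blast
  qed
  have Tmy: "(y \<otimes> a, s \<otimes>\<^bsub>Q\<^esub> w) \<in> T" if "(a, w) \<in> T" for a w
  proof -
    have "(y \<otimes> horner y cs, s \<otimes>\<^bsub>Q\<^esub> Q.horner s (map h cs)) \<in> T" if "set cs \<subseteq> B" for cs
      using that
    proof (induct cs)
      case Nil then show ?case using T0 y s by auto
    next
      case (Cons c cs)
      have c: "c \<in> B" "c \<in> carrier R" "h c \<in> carrier Q" "set cs \<subseteq> B" "horner y cs \<in> carrier R" "Q.horner s (map h cs) \<in> carrier Q"
        using Cons(2) BR hD(1) y s TI[of cs] Tsub by auto
      define c' where "c' = y \<otimes> c \<otimes> inv y"
      have c': "c' \<in> B" "c' \<in> carrier R" "h c' \<in> carrier Q" "y \<otimes> c = c' \<otimes> y" "s \<otimes>\<^bsub>Q\<^esub> h c = h c' \<otimes>\<^bsub>Q\<^esub> s"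
        using conj[OF c(1)] BR hD(1) c y sh[OF c(1)] unfolding c'_def by (auto simp: m_assoc)
      \<comment> \<open>The product y (c + p y) = (c' + y p) y has constant coefficient
        zero.\<close>
      have "(\<zero> \<oplus> (c' \<oplus> y \<otimes> horner y cs) \<otimes> y,
          h \<zero> \<oplus>\<^bsub>Q\<^esub> (h c' \<oplus>\<^bsub>Q\<^esub> s \<otimes>\<^bsub>Q\<^esub> Q.horner s (map h cs)) \<otimes>\<^bsub>Q\<^esub> s) \<in> T"
        using Cons c c' Bc(1) Tadd TB by (intro Tcons) auto
      then show ?case using c c' y s h0 by (simp add: l_distr r_distr m_assoc Q.l_distr Q.r_distr Q.m_assoc)
    qed
    then show ?thesis using that unfolding T_def by blast
  qed
  have Tneg: "(\<ominus> a, \<ominus>\<^bsub>Q\<^esub> w) \<in> T" if "(a, w) \<in> T" for a w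
  proof -
    have "(\<ominus> \<one> \<otimes> a, h (\<ominus> \<one>) \<otimes>\<^bsub>Q\<^esub> w) \<in> T" using TmB[OF _ that] Bc by blast
    moreover have "h (\<ominus> \<one>) = \<ominus>\<^bsub>Q\<^esub> \<one>\<^bsub>Q\<^esub>" using ring_hom_sub_neg[OF ring_axioms Q B h Bc(2)] hD(4) by simp
    moreover have "a \<in> carrier R" "w \<in> carrier Q" using that Tsub by auto
    ultimately show ?thesis by (simp add: l_minus Q.l_minus)
  qed
  have mem: "a \<in> carrier R" "w \<in> carrier Q" if "(a, w) \<in> T" for a w using that Tsub by auto
  have dom: "\<exists>w. w \<in> carrier Q \<and> (\<forall>(b, v) \<in> T. (a \<otimes> b, w \<otimes>\<^bsub>Q\<^esub> v) \<in> T)" if "a \<in> generate_ring R (B \<union> {y})" for a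
    using that
  proof (induct rule: generate_ring.induct)
    case one then show ?case using mem by (intro exI[of _ "\<one>\<^bsub>Q\<^esub>"]) auto
  next
    case (incl a)
    then show ?case
    proof
      assume "a \<in> B" then show ?thesis using TmB hD(1) by (intro exI[of _ "h a"]) auto
    next
      assume "a \<in> {y}" then show ?thesis using Tmy s by (intro exI[of _ s]) auto
    qed
  next
    case (a_inv a)
    then obtain w where w: "w \<in> carrier Q" "\<forall>(b, v) \<in> T. (a \<otimes> b, w \<otimes>\<^bsub>Q\<^esub> v) \<in> T" by blast
    have a: "a \<in> carrier R" using a_inv(1) generate_ring_in_carrier[of "B \<union> {y}"] BR y by auto
    show ?case using w a Tneg mem by (intro exI[of _ "\<ominus>\<^bsub>Q\<^esub> w"]) (auto simp: l_minus Q.l_minus)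
  next
    case (eng_add a1 a2)
    then obtain w1 w2 where w: "w1 \<in> carrier Q" "\<forall>(b, v) \<in> T. (a1 \<otimes> b, w1 \<otimes>\<^bsub>Q\<^esub> v) \<in> T"
      "w2 \<in> carrier Q" "\<forall>(b, v) \<in> T. (a2 \<otimes> b, w2 \<otimes>\<^bsub>Q\<^esub> v) \<in> T" by blast
    have a: "a1 \<in> carrier R" "a2 \<in> carrier R"
      using eng_add(1,3) generate_ring_in_carrier[of "B \<union> {y}"] BR y by auto
    have "(a1 \<otimes> b \<oplus> a2 \<otimes> b, w1 \<otimes>\<^bsub>Q\<^esub> v \<oplus>\<^bsub>Q\<^esub> w2 \<otimes>\<^bsub>Q\<^esub> v) \<in> T" if "(b, v) \<in> T" for b v
      using Tadd w that by blast
    then show ?case using w a mem by (intro exI[of _ "w1 \<oplus>\<^bsub>Q\<^esub> w2"]) (auto simp: l_distr Q.l_distr)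
  next
    case (eng_mult a1 a2)
    then obtain w1 w2 where w: "w1 \<in> carrier Q" "\<forall>(b, v) \<in> T. (a1 \<otimes> b, w1 \<otimes>\<^bsub>Q\<^esub> v) \<in> T"
      "w2 \<in> carrier Q" "\<forall>(b, v) \<in> T. (a2 \<otimes> b, w2 \<otimes>\<^bsub>Q\<^esub> v) \<in> T" by blast
    have a: "a1 \<in> carrier R" "a2 \<in> carrier R"
      using eng_mult(1,3) generate_ring_in_carrier[of "B \<union> {y}"] BR y by auto
    have "(a1 \<otimes> (a2 \<otimes> b), w1 \<otimes>\<^bsub>Q\<^esub> (w2 \<otimes>\<^bsub>Q\<^esub> v)) \<in> T" if "(b, v) \<in> T" for b v
      using w that by blast
    then show ?case using w a mem by (intro exI[of _ "w1 \<otimes>\<^bsub>Q\<^esub> w2"]) (auto simp: m_assoc Q.m_assoc)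
  qed
  have T1: "(\<one>, \<one>\<^bsub>Q\<^esub>) \<in> T" using TB[OF Bc(2)] hD(4) by simp
  have uniq: "w = \<zero>\<^bsub>Q\<^esub>" if "(\<zero>, w) \<in> T" for w
  proof -
    have "\<exists>cs. (\<zero>, w) = (horner y cs, Q.horner s (map h cs)) \<and> set cs \<subseteq> B"
      using that unfolding T_def by (rule CollectD)
    then obtain cs where cs: "\<zero> = horner y cs" "w = Q.horner s (map h cs)" "set cs \<subseteq> B" by auto
    have "horner y cs = \<zero>" using cs(1) by (rule sym)
    then have "set cs \<subseteq> {\<zero>}" using free cs(3) unfolding left_free_def by blast
    then have "Q.horner s (map h cs) = \<zero>\<^bsub>Q\<^esub>" using h0 s by (induct cs) auto
    then show ?thesis using cs by simp
  qed
  \<comment> \<open>Pairs whose left multiplication preserves \<open>T\<close>. Closure under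
    products is immediate for them, and every element of the generated ring has a partner by
    \<open>dom\<close>.\<close>
  define G where "G = {(a, w) \<in> T. \<forall>(b, v) \<in> T. (a \<otimes> b, w \<otimes>\<^bsub>Q\<^esub> v) \<in> T}"
  have GI: "(a, w) \<in> G" if "w \<in> carrier Q" "a \<in> carrier R" "\<forall>(b, v) \<in> T. (a \<otimes> b, w \<otimes>\<^bsub>Q\<^esub> v) \<in> T" for a w
    using that T1 unfolding G_def by force
  have "\<exists>h'. h' \<in> Ring.ring_hom (R\<lparr>carrier := fst ` G\<rparr>) Q \<and> (\<forall>a w. (a, w) \<in> G \<longrightarrow> h' a = w)"
  proof (rule graph_ring_hom[OF ring_axioms Q])
    show "G \<subseteq> carrier R \<times> carrier Q" using Tsub unfolding G_def by blast
    show "(\<one>, \<one>\<^bsub>Q\<^esub>) \<in> G" using mem by (intro GI) auto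
    show "w = \<zero>\<^bsub>Q\<^esub>" if "(\<zero>, w) \<in> G" for w using that uniq unfolding G_def by blast
    fix a w assume aw: "(a, w) \<in> G"
    then have 1: "(a, w) \<in> T" "\<And>b v. (b, v) \<in> T \<Longrightarrow> (a \<otimes> b, w \<otimes>\<^bsub>Q\<^esub> v) \<in> T" unfolding G_def by auto
    show "(\<ominus> a, \<ominus>\<^bsub>Q\<^esub> w) \<in> G"
      using 1 mem[OF 1(1)] Tneg[OF 1(2)] mem by (intro GI) (auto simp: l_minus Q.l_minus)
    fix b v assume bv: "(b, v) \<in> G"
    then have 2: "(b, v) \<in> T" "\<And>a w. (a, w) \<in> T \<Longrightarrow> (b \<otimes> a, v \<otimes>\<^bsub>Q\<^esub> w) \<in> T" unfolding G_def by auto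
    show "(a \<oplus> b, w \<oplus>\<^bsub>Q\<^esub> v) \<in> G"
      using mem[OF 1(1)] mem[OF 2(1)] Tadd[OF 1(2) 2(2)] mem by (intro GI) (auto simp: l_distr Q.l_distr)
    show "(a \<otimes> b, w \<otimes>\<^bsub>Q\<^esub> v) \<in> G"
      using mem[OF 1(1)] mem[OF 2(1)] 1(2)[OF 2(2)] mem by (intro GI) (auto simp: m_assoc Q.m_assoc)
  qed
  then obtain h' where h': "h' \<in> Ring.ring_hom (R\<lparr>carrier := fst ` G\<rparr>) Q" "\<And>a w. (a, w) \<in> G \<Longrightarrow> h' a = w"
    by auto
  have gen: "generate_ring R (B \<union> {y}) \<subseteq> fst ` G"
  proof
    fix a assume a: "a \<in> generate_ring R (B \<union> {y})"
    then obtain w where "w \<in> carrier Q" "\<forall>(b, v) \<in> T. (a \<otimes> b, w \<otimes>\<^bsub>Q\<^esub> v) \<in> T" using dom by blast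
    moreover have "a \<in> carrier R" using a generate_ring_in_carrier[of "B \<union> {y}"] BR y by auto
    ultimately show "a \<in> fst ` G" using GI by force
  qed
  have "h' \<in> Ring.ring_hom (R\<lparr>carrier := generate_ring R (B \<union> {y})\<rparr>) Q"
    using ring_hom_subD[OF h'(1)] gen by (intro ring_hom_memI) (auto simp: subset_iff)
  moreover have "h' b = h b" if "b \<in> B" for b
    using that TmB hD(1) BR by (intro h'(2) GI) auto
  moreover have "h' y = s" using Tmy y s by (intro h'(2) GI) auto
  ultimately show ?thesis by blast
qed

end

section \<open>Subalgebras generated by an initial segment of the generators\<close>

context central_subfield
begin

lemma subalg_subring:
  assumes "\<And>i. i \<in> {1..n} \<Longrightarrow> y i \<in> carrier R"
  shows "subring (subalg K y n) R"
  unfolding subalg_def using assms by (intro generate_ring_is_subring) auto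

lemma subalg_carrier:
  assumes "\<And>i. i \<in> {1..n} \<Longrightarrow> y i \<in> carrier R" "x \<in> subalg K y n"
  shows "x \<in> carrier R"
  using subringE(1)[OF subalg_subring] assms by blast

lemma K_subalg: "k \<in> K \<Longrightarrow> k \<in> subalg K y n"
  unfolding subalg_def by (rule generate_ring.incl) simp

lemma gen_subalg: "1 \<le> i \<Longrightarrow> i \<le> n \<Longrightarrow> y i \<in> subalg K y n"
  unfolding subalg_def by (rule generate_ring.incl) simp

lemma subalg_min:
  assumes "subring B R" "K \<subseteq> B" "\<And>i. i \<in> {1..n} \<Longrightarrow> y i \<in> B"
  shows "subalg K y n \<subseteq> B"
  unfolding subalg_def using assms subringE(1)[OF assms(1)] by (intro generate_ring_min_subring1) auto

lemma subalg_mono: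
  assumes "\<And>i. i \<in> {1..m} \<Longrightarrow> y i \<in> carrier R" "n \<le> m"
  shows "subalg K y n \<subseteq> subalg K y m"
  using subalg_subring[OF assms(1)] assms(2) K_subalg gen_subalg by (intro subalg_min) auto

lemma subalg_0: "subalg K y 0 = K"
proof
  show "subalg K y 0 \<subseteq> K" by (rule subalg_min[OF K_subring]) auto
qed (auto intro: K_subalg)

lemma subalg_Suc:
  assumes y: "\<And>i. i \<in> {1..Suc n} \<Longrightarrow> y i \<in> carrier R"
  shows "subalg K y (Suc n) = generate_ring R (subalg K y n \<union> {y (Suc n)})"
proof
  have sub: "subalg K y n \<union> {y (Suc n)} \<subseteq> carrier R"
    using subalg_carrier[of n y] y by auto
  show "subalg K y (Suc n) \<subseteq> generate_ring R (subalg K y n \<union> {y (Suc n)})"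
  proof (rule subalg_min[OF generate_ring_is_subring[OF sub]])
    show "y i \<in> generate_ring R (subalg K y n \<union> {y (Suc n)})" if "i \<in> {1..Suc n}" for i
      using that gen_subalg[of i n y] by (cases "i = Suc n") (auto intro!: generate_ring.incl)
  qed (auto intro: generate_ring.incl K_subalg)
  show "generate_ring R (subalg K y n \<union> {y (Suc n)}) \<subseteq> subalg K y (Suc n)"
  proof (rule generate_ring_min_subring1[OF sub subalg_subring[OF y]])
    have "subalg K y n \<subseteq> subalg K y (Suc n)" using y by (intro subalg_mono) auto
    then show "subalg K y n \<union> {y (Suc n)} \<subseteq> subalg K y (Suc n)" using gen_subalg[of "Suc n" "Suc n" y] by auto
  qed
qed

lemma subalg_induct [consumes 2, case_names K gen neg add mult]:
  assumes "x \<in> subalg K y n" and y': "y ` {1..n} \<subseteq> carrier R"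
    and "\<And>k. k \<in> K \<Longrightarrow> P k" "\<And>i. 1 \<le> i \<Longrightarrow> i \<le> n \<Longrightarrow> P (y i)"
    and "\<And>a. a \<in> subalg K y n \<Longrightarrow> a \<in> carrier R \<Longrightarrow> P a \<Longrightarrow> P (\<ominus> a)"
    and "\<And>a b. a \<in> subalg K y n \<Longrightarrow> b \<in> subalg K y n \<Longrightarrow> a \<in> carrier R \<Longrightarrow> b \<in> carrier R \<Longrightarrow> P a \<Longrightarrow> P b \<Longrightarrow> P (a \<oplus> b)"
    and "\<And>a b. a \<in> subalg K y n \<Longrightarrow> b \<in> subalg K y n \<Longrightarrow> a \<in> carrier R \<Longrightarrow> b \<in> carrier R \<Longrightarrow> P a \<Longrightarrow> P b \<Longrightarrow> P (a \<otimes> b)"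
  shows "P x"
proof -
  have y: "\<And>i. i \<in> {1..n} \<Longrightarrow> y i \<in> carrier R" using y' by auto
  show ?thesis
    using assms(1)[unfolded subalg_def]
  proof (induct rule: generate_ring.induct)
    case one then show ?case using assms(3) by simp
  next
    case (incl h) then show ?case using assms(3,4) by auto
  next
    case (a_inv h) then show ?case using assms(5) subalg_carrier[OF y] by (simp add: subalg_def)
  next
    case (eng_add h1 h2) then show ?case using assms(6) subalg_carrier[OF y] by (simp add: subalg_def)
  next
    case (eng_mult h1 h2) then show ?case using assms(7) subalg_carrier[OF y] by (simp add: subalg_def)
  qed
qed

lemma conj_subalg:
  assumes y: "\<And>i. i \<in> {1..n} \<Longrightarrow> y i \<in> carrier R" and x: "x \<in> carrier R" "x \<noteq> \<zero>"
    and rel: "\<And>i. i \<in> {1..n} \<Longrightarrow> c i \<in> K \<and> x \<otimes> y i = c i \<otimes> (y i \<otimes> x)"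
    and b: "b \<in> subalg K y n"
  shows "x \<otimes> b \<otimes> inv x \<in> subalg K y n"
proof -
  have yR: "y ` {1..n} \<subseteq> carrier R" using y by auto
  have "subring (subalg K y n) R" by (rule subalg_subring) (rule y)
  note S = subringE(5,6,7)[OF this]
  show ?thesis using b yR
  proof (induct rule: subalg_induct)
    case (K k) then show ?case using x K_lcomm[of k x "inv x"] K_subalg by (simp add: m_assoc)
  next
    case (gen i)
    then have "x \<otimes> y i \<otimes> inv x = c i \<otimes> y i"
      using x y[of i] rel[of i] by (simp add: m_assoc)
    then show ?case using S(2) K_subalg gen_subalg rel[of i] gen by simp
  next
    case (neg a) then show ?case using x S(1) by (simp add: l_minus r_minus)
  next
    case (add a b) then show ?case using x S(3) by (simp add: l_distr r_distr)
  next
    case (mult a b)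
    have "x \<otimes> (a \<otimes> b) \<otimes> inv x = (x \<otimes> a \<otimes> inv x) \<otimes> (x \<otimes> b \<otimes> inv x)"
      using x mult by (simp add: m_assoc)
    then show ?case using mult S(2) by simp
  qed
qed

text \<open>Iterates \<open>extend_ring_hom\<close> over the generators with index above s, each of
  which q-commutes with all earlier ones. It is applied with s = j - 1 to construct g_j and with s =
  0 to construct the retraction of A'.\<close>

lemma extend_subalg_hom:
  assumes y: "\<And>i. i \<in> {1..N} \<Longrightarrow> y i \<in> carrier R" and y0: "\<And>i. i \<in> {s<..N} \<Longrightarrow> y i \<noteq> \<zero>"
    and rel: "\<And>i l. i \<in> {s<..N} \<Longrightarrow> l \<in> {1..<i} \<Longrightarrow> c i l \<in> K \<and> y i \<otimes> y l = c i l \<otimes> (y l \<otimes> y i)"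
    and free: "\<And>i. i \<in> {s<..N} \<Longrightarrow> left_free (subalg K y (i - 1)) (y i)"
    and Q: "ring Q" and h: "h \<in> Ring.ring_hom (R\<lparr>carrier := subalg K y s\<rparr>) Q"
    and hy: "\<And>l. l \<in> {1..s} \<Longrightarrow> h (y l) = \<tau> l"
    and tau: "\<And>i. i \<in> {s<..N} \<Longrightarrow> \<tau> i \<in> carrier Q"
    and tauK: "\<And>i k. i \<in> {s<..N} \<Longrightarrow> k \<in> K \<Longrightarrow> \<tau> i \<otimes>\<^bsub>Q\<^esub> h k = h k \<otimes>\<^bsub>Q\<^esub> \<tau> i"
    and tau_rel: "\<And>i l. i \<in> {s<..N} \<Longrightarrow> l \<in> {1..<i} \<Longrightarrow>
      \<tau> i \<otimes>\<^bsub>Q\<^esub> \<tau> l = h (c i l) \<otimes>\<^bsub>Q\<^esub> (\<tau> l \<otimes>\<^bsub>Q\<^esub> \<tau> i)"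
    and sn: "s \<le> n" "n \<le> N"
  shows "\<exists>h'. h' \<in> Ring.ring_hom (R\<lparr>carrier := subalg K y n\<rparr>) Q \<and>
    (\<forall>b\<in>subalg K y s. h' b = h b) \<and> (\<forall>l\<in>{1..n}. h' (y l) = \<tau> l)"
  using sn
proof (induct n rule: dec_induct)
  case base then show ?case using h hy by blast
next
  case (step n)
  interpret Q: ring Q by fact
  obtain g where g: "g \<in> Ring.ring_hom (R\<lparr>carrier := subalg K y n\<rparr>) Q"
    "\<forall>b\<in>subalg K y s. g b = h b" "\<forall>l\<in>{1..n}. g (y l) = \<tau> l"
    using step by auto
  note gD = ring_hom_subD[OF g(1)]
  have yn: "\<And>i. i \<in> {1..n} \<Longrightarrow> y i \<in> carrier R" and yS: "\<And>i. i \<in> {1..Suc n} \<Longrightarrow> y i \<in> carrier R"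
    using y step by auto
  have S: "subring (subalg K y n) R" by (rule subalg_subring) (rule yn)
  define x where "x = y (Suc n)"
  have mem: "Suc n \<in> {s<..N}" using step by auto
  have x: "x \<in> carrier R" "x \<noteq> \<zero>" using y y0[OF mem] step unfolding x_def by auto
  have gK: "g k = h k" if "k \<in> K" for k using g(2) that K_subalg by blast
  have t: "\<tau> (Suc n) \<in> carrier Q" using tau[OF mem] .
  have rel': "c (Suc n) i \<in> K \<and> x \<otimes> y i = c (Suc n) i \<otimes> (y i \<otimes> x)" if "i \<in> {1..n}" for i
    using rel[OF mem, of i] that unfolding x_def by auto
  have conj: "x \<otimes> b \<otimes> inv x \<in> subalg K y n" if "b \<in> subalg K y n" for b
    using conj_subalg[OF yn x rel' that] .
  have yR: "y ` {1..n} \<subseteq> carrier R" using yn by auto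
  \<comment> \<open>Twisted commutation is given on generators only; it spreads to the whole
    subalgebra because conjugation by x is a ring homomorphism.\<close>
  have "\<tau> (Suc n) \<otimes>\<^bsub>Q\<^esub> g b = g (x \<otimes> b \<otimes> inv x) \<otimes>\<^bsub>Q\<^esub> \<tau> (Suc n)" if "b \<in> subalg K y n" for b
    using that yR
  proof (induct rule: subalg_induct)
    case (K k)
    then have "x \<otimes> k \<otimes> inv x = k" using x K_lcomm[of k x "inv x"] by (simp add: m_assoc)
    then show ?case using tauK[OF mem K] gK[OF K] by simp
  next
    case (gen i)
    then have e: "x \<otimes> y i \<otimes> inv x = c (Suc n) i \<otimes> y i"
      using x yn[of i] rel'[of i] by (simp add: m_assoc)
    have ci: "c (Suc n) i \<in> K" using rel'[of i] gen by simp
    have "g (c (Suc n) i \<otimes> y i) = h (c (Suc n) i) \<otimes>\<^bsub>Q\<^esub> \<tau> i"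
      using gD(2) gen gen_subalg K_subalg ci gK g(3) by simp
    moreover have "\<tau> i \<in> carrier Q" using gD(1)[OF gen_subalg[OF gen]] g(3) gen by simp
    moreover have "h (c (Suc n) i) \<in> carrier Q" using gD(1)[OF K_subalg[OF ci]] gK[OF ci] by simp
    ultimately show ?case unfolding e using tau_rel[OF mem, of i] gen g(3) t by (simp add: Q.m_assoc)
  next
    case (neg a)
    have e: "x \<otimes> \<ominus> a \<otimes> inv x = \<ominus> (x \<otimes> a \<otimes> inv x)" using x neg by (simp add: l_minus r_minus)
    note gn = ring_hom_sub_neg[OF ring_axioms Q S g(1)]
    show ?case
      unfolding e gn[OF neg(1)] gn[OF conj[OF neg(1)]]
      using neg(3) t gD(1)[OF neg(1)] gD(1)[OF conj[OF neg(1)]] by (simp add: Q.l_minus Q.r_minus)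
  next
    case (add a b)
    have e: "x \<otimes> (a \<oplus> b) \<otimes> inv x = x \<otimes> a \<otimes> inv x \<oplus> x \<otimes> b \<otimes> inv x"
      using x add by (simp add: l_distr r_distr)
    show ?case unfolding e using add t gD(1,3) conj by (simp add: Q.l_distr Q.r_distr)
  next
    case (mult a b)
    have e: "x \<otimes> (a \<otimes> b) \<otimes> inv x = (x \<otimes> a \<otimes> inv x) \<otimes> (x \<otimes> b \<otimes> inv x)"
      using x mult by (simp add: m_assoc)
    have c: "g a \<in> carrier Q" "g b \<in> carrier Q" "g (x \<otimes> a \<otimes> inv x) \<in> carrier Q" "g (x \<otimes> b \<otimes> inv x) \<in> carrier Q"
      using mult gD(1) conj by auto
    have "\<tau> (Suc n) \<otimes>\<^bsub>Q\<^esub> g (a \<otimes> b) = \<tau> (Suc n) \<otimes>\<^bsub>Q\<^esub> g a \<otimes>\<^bsub>Q\<^esub> g b"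
      using gD(2)[OF mult(1,2)] c t by (simp add: Q.m_assoc)
    also have "\<dots> = g (x \<otimes> a \<otimes> inv x) \<otimes>\<^bsub>Q\<^esub> (\<tau> (Suc n) \<otimes>\<^bsub>Q\<^esub> g b)"
      unfolding mult(5) using c t by (simp add: Q.m_assoc)
    also have "\<dots> = g ((x \<otimes> a \<otimes> inv x) \<otimes> (x \<otimes> b \<otimes> inv x)) \<otimes>\<^bsub>Q\<^esub> \<tau> (Suc n)"
      unfolding mult(6) using c t gD(2)[OF conj[OF mult(1)] conj[OF mult(2)]] by (simp add: Q.m_assoc)
    finally show ?case unfolding e .
  qed
  moreover have "left_free (subalg K y n) x" using free[OF mem] unfolding x_def by simp
  ultimately have "\<exists>h'\<in>Ring.ring_hom (R\<lparr>carrier := generate_ring R (subalg K y n \<union> {x})\<rparr>) Q.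
      (\<forall>b\<in>subalg K y n. h' b = g b) \<and> h' x = \<tau> (Suc n)"
    using extend_ring_hom[OF S x conj _ Q g(1) t] by blast
  moreover have eS: "subalg K y (Suc n) = generate_ring R (subalg K y n \<union> {x})"
    unfolding x_def by (rule subalg_Suc) (rule yS)
  ultimately obtain h' where h': "h' \<in> Ring.ring_hom (R\<lparr>carrier := subalg K y (Suc n)\<rparr>) Q"
    "\<forall>b\<in>subalg K y n. h' b = g b" "h' x = \<tau> (Suc n)"
    unfolding eS by blast
  have "\<forall>b\<in>subalg K y s. h' b = h b" using h'(2) g(2) subalg_mono[of n y s] yn step(1) by (auto simp: subset_iff)
  moreover have "h' (y l) = \<tau> l" if "l \<in> {1..Suc n}" for l
    using that h'(2,3) g(3) gen_subalg[of l n y] unfolding x_def by (cases "l = Suc n") auto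
  ultimately show ?case using h'(1) by blast
qed

end

section \<open>The deleting derivations homomorphism\<close>


context ring
begin

lemma horner_append:
  assumes "y \<in> carrier R" "set cs \<subseteq> carrier R" "set ds \<subseteq> carrier R"
  shows "horner y (cs @ ds) = horner y cs \<oplus> horner y ds \<otimes> y [^] length cs"
  using assms(2)
proof (induct cs)
  case Nil then show ?case using assms by simp
next
  case (Cons c cs)
  have "horner y cs \<in> carrier R" "horner y ds \<in> carrier R" using Cons assms by auto
  then show ?case using Cons assms by (simp add: l_distr m_assoc a_assoc)
qed

lemma horner_zeros: "y \<in> carrier R \<Longrightarrow> horner y (replicate k \<zero>) = \<zero>"
  by (induct k) auto

lemma horner_map2:
  assumes "length cs = length ds" "y \<in> carrier R" "set cs \<subseteq> carrier R" "set ds \<subseteq> carrier R"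
  shows "horner y (map2 (\<oplus>) cs ds) = horner y cs \<oplus> horner y ds"
  using assms
proof (induct cs ds rule: list_induct2)
  case (Cons c cs d ds)
  have "horner y cs \<in> carrier R" "horner y ds \<in> carrier R" using Cons by auto
  then show ?case using Cons by (simp add: l_distr a_ac)
qed simp

text \<open>Left polynomials of degree below n. Fixing the length of the list, with zero padding,
  reduces sums to entrywise addition.\<close>

definition polys :: "'a set \<Rightarrow> 'a \<Rightarrow> nat \<Rightarrow> 'a set" where
  "polys E y n = {horner y cs | cs. set cs \<subseteq> E \<and> length cs = n}"

context
  fixes E y assumes E: "subring E R" and y: "y \<in> carrier R"
begin

lemma polys_add: "a \<in> polys E y n \<Longrightarrow> b \<in> polys E y n \<Longrightarrow> a \<oplus> b \<in> polys E y n"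
proof -
  assume "a \<in> polys E y n" "b \<in> polys E y n"
  then obtain cs ds where cs: "a = horner y cs" "set cs \<subseteq> E" "length cs = n"
    and ds: "b = horner y ds" "set ds \<subseteq> E" "length ds = n" unfolding polys_def by blast
  have "set (map2 (\<oplus>) cs ds) \<subseteq> E"
  proof -
    have "c \<oplus> d \<in> E" if "(c, d) \<in> set (zip cs ds)" for c d
      using set_zip_leftD[OF that] set_zip_rightD[OF that] cs(2) ds(2) by (intro subringE(7)[OF E]) auto
    then show ?thesis by auto
  qed
  moreover have "a \<oplus> b = horner y (map2 (\<oplus>) cs ds)"
    using cs ds y subringE(1)[OF E] horner_map2[of cs ds y] by auto
  ultimately show ?thesis using cs ds unfolding polys_def by force
qed

lemma polys_mono_Suc: "polys E y n \<subseteq> polys E y (Suc n)"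
proof
  fix a assume "a \<in> polys E y n"
  then obtain cs where cs: "a = horner y cs" "set cs \<subseteq> E" "length cs = n" unfolding polys_def by blast
  have "horner y (cs @ [\<zero>]) = a" using cs y subringE(1)[OF E] horner_append[of y cs "[\<zero>]"] by auto
  moreover have "set (cs @ [\<zero>]) \<subseteq> E" "length (cs @ [\<zero>]) = Suc n" using cs subringE(2)[OF E] by auto
  ultimately show "a \<in> polys E y (Suc n)" unfolding polys_def by blast
qed

lemma polys_mono: "n \<le> m \<Longrightarrow> polys E y n \<subseteq> polys E y m"
  by (rule lift_Suc_mono_le) (rule polys_mono_Suc)

lemma polys_zero: "\<zero> \<in> polys E y n"
proof -
  have "set (replicate n \<zero>) \<subseteq> E" using subringE(2)[OF E] by auto
  then show ?thesis unfolding polys_def mem_Collect_eq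
    by (intro exI[of _ "replicate n \<zero>"] conjI) (simp_all add: horner_zeros[OF y])
qed

lemma polys_monom: "c \<in> E \<Longrightarrow> c \<otimes> y [^] k \<in> polys E y (Suc k)"
proof -
  assume c: "c \<in> E"
  have "set (replicate k \<zero>) \<subseteq> carrier R" by auto
  then have "horner y (replicate k \<zero> @ [c]) = c \<otimes> y [^] k"
    using horner_append[of y "replicate k \<zero>" "[c]"] c subringE(1)[OF E] y horner_zeros[OF y] by auto
  moreover have "set (replicate k \<zero> @ [c]) \<subseteq> E" "length (replicate k \<zero> @ [c]) = Suc k"
    using c subringE(2)[OF E] by auto
  ultimately show ?thesis unfolding polys_def by (metis (mono_tags, lifting) mem_Collect_eq)
qed

text \<open>Comparison of leading coefficients; this is how \<open>phi_free\<close> uses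
  freeness.\<close>

lemma polys_monom_zero:
  assumes free: "left_free E y" and c: "c \<in> E" and v: "v \<in> polys E y n" "c \<otimes> y [^] n \<oplus> v = \<zero>"
  shows "c = \<zero>"
proof -
  obtain cs where cs: "v = horner y cs" "set cs \<subseteq> E" "length cs = n" using v(1) unfolding polys_def by blast
  have vc: "v \<in> carrier R" "c \<in> carrier R" using cs y c subringE(1)[OF E] by auto
  have "horner y (cs @ [c]) = v \<oplus> c \<otimes> y [^] n"
    using horner_append[of y cs "[c]"] cs c subringE(1)[OF E] y by auto
  also have "\<dots> = \<zero>" using v(2) vc y by (simp add: a_comm)
  finally have "horner y (cs @ [c]) = \<zero>" .
  moreover have "set (cs @ [c]) \<subseteq> E" using cs(2) c by simp
  ultimately have "set (cs @ [c]) \<subseteq> {\<zero>}" using free unfolding left_free_def by blast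
  then show ?thesis by simp
qed

end

end

text \<open>Cauchy product of truncated series: one triangle summed along antidiagonals and along
  rows.\<close>

lemma (in abelian_monoid) finsum_triangle:
  fixes f :: "nat \<Rightarrow> nat \<Rightarrow> 'a"
  assumes "\<And>i k. f i k \<in> carrier G"
  shows "(\<Oplus>n\<in>{..<M}. \<Oplus>i\<in>{..n}. f i (n - i)) = (\<Oplus>i\<in>{..<M}. \<Oplus>k\<in>{..<M - i}. f i k)"
proof (induct M)
  case 0 then show ?case by simp
next
  case (Suc M)
  have c: "(\<Oplus>i\<in>A. f i (n - i)) \<in> carrier G" "(\<Oplus>k\<in>A. f i k) \<in> carrier G" for n i A
    using assms by auto
  have "(\<Oplus>i\<in>{..<Suc M}. \<Oplus>k\<in>{..<Suc M - i}. f i k) = (\<Oplus>i\<in>{..<Suc M}. (\<Oplus>k\<in>{..<M - i}. f i k) \<oplus> f i (M - i))"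
  proof (rule finsum_cong')
    fix i assume "i \<in> {..<Suc M}"
    then have "{..<Suc M - i} = insert (M - i) {..<M - i}" by auto
    then show "(\<Oplus>k\<in>{..<Suc M - i}. f i k) = (\<Oplus>k\<in>{..<M - i}. f i k) \<oplus> f i (M - i)"
      using assms by (simp add: finsum_insert a_comm)
  qed (use assms in auto)
  also have "\<dots> = (\<Oplus>i\<in>{..<Suc M}. \<Oplus>k\<in>{..<M - i}. f i k) \<oplus> (\<Oplus>i\<in>{..<Suc M}. f i (M - i))"
    using assms by (subst finsum_addf) auto
  also have "(\<Oplus>i\<in>{..<Suc M}. \<Oplus>k\<in>{..<M - i}. f i k) = (\<Oplus>i\<in>{..<M}. \<Oplus>k\<in>{..<M - i}. f i k)"
    using c by (simp add: lessThan_Suc finsum_insert)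
  also have "{..<Suc M} = {..M}" by auto
  finally have "(\<Oplus>i\<in>{..<Suc M}. \<Oplus>k\<in>{..<Suc M - i}. f i k)
      = (\<Oplus>n\<in>{..<M}. \<Oplus>i\<in>{..n}. f i (n - i)) \<oplus> (\<Oplus>i\<in>{..M}. f i (M - i))"
    using Suc by (simp add: lessThan_Suc_atMost)
  also have "\<dots> = (\<Oplus>n\<in>{..<Suc M}. \<Oplus>i\<in>{..n}. f i (n - i))"
    using c by (simp add: lessThan_Suc finsum_insert a_comm)
  finally show ?case by simp
qed

text \<open>
  In the deleting derivations algorithm \<open>e n b\<close> is the transport of
  \<open>q\<^bsup>n(n+1)/2\<^esup>(q-1)\<^bsup>-n\<^esup>d\<^sub>n\<sigma>\<^bsup>-n\<^esup>(b)\<close>, so that \<open>phi b\<close> is the series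
  \<open>\<Sum>\<^sub>n e n b x\<^bsup>-n\<^esup>\<close>.
\<close>

locale dd_phi = central_subfield +
  fixes B :: "'a set" and x :: 'a and e :: "nat \<Rightarrow> 'a \<Rightarrow> 'a" and s s' :: "'a \<Rightarrow> 'a" and p :: 'a
  assumes B: "subring B R" and x: "x \<in> carrier R" "x \<noteq> \<zero>" and p: "p \<in> K" "p \<noteq> \<zero>"
    and s: "\<And>b. b \<in> B \<Longrightarrow> s b \<in> B" "\<And>b. b \<in> B \<Longrightarrow> s' b \<in> B" "\<And>b. b \<in> B \<Longrightarrow> s (s' b) = b"
    and e_closed: "\<And>n b. b \<in> B \<Longrightarrow> e n b \<in> carrier R"
    and e_add: "\<And>n a b. a \<in> B \<Longrightarrow> b \<in> B \<Longrightarrow> e n (a \<oplus> b) = e n a \<oplus> e n b"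
    and e_nil: "\<And>b. b \<in> B \<Longrightarrow> \<exists>m. \<forall>n\<ge>m. e n b = \<zero>"
    and e_x: "\<And>n b. b \<in> B \<Longrightarrow>
      x \<otimes> e n b = inv (p [^] n) \<otimes> (e n (s b) \<otimes> x) \<oplus> (\<one> \<ominus> inv (p [^] Suc n)) \<otimes> e (Suc n) (s b)"
    and e_mult: "\<And>n a b. a \<in> B \<Longrightarrow> b \<in> B \<Longrightarrow>
      e n (a \<otimes> b) = (\<Oplus>i\<in>{..n}. e i a \<otimes> e (n - i) ((s' ^^ i) b))"
    and s'_one: "s' \<one> = \<one>" and e_0_one: "e 0 \<one> = \<one>"
    and e_range: "\<And>n b. b \<in> B \<Longrightarrow> \<exists>u\<in>B. e 0 u = e n b \<and> (\<forall>k. e (n + k) b = \<zero> \<longrightarrow> e k u = \<zero>)"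
    and e_inj: "\<And>b. b \<in> B \<Longrightarrow> e 0 b = \<zero> \<Longrightarrow> b = \<zero>"
    and e_free: "left_free (e 0 ` B) x"
begin

definition xi :: "nat \<Rightarrow> 'a" where "xi n = inv (x [^] n)"
definition psum :: "nat \<Rightarrow> 'a \<Rightarrow> 'a" where "psum m b = (\<Oplus>n\<in>{..<m}. e n b \<otimes> xi n)"
text \<open>The index set is the support of the summands, as in \<open>dd_step\<close>, so that the
  two sums can be identified by unfolding.\<close>

definition phi :: "'a \<Rightarrow> 'a" where "phi b = (\<Oplus>n\<in>{n. e n b \<otimes> xi n \<noteq> \<zero>}. e n b \<otimes> xi n)"

lemma BR [simp]: "b \<in> B \<Longrightarrow> b \<in> carrier R" using subringE(1)[OF B] by blast

lemmas Bc [simp] = subringE(2,3,5,6,7)[OF B]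

declare s(1,2) [simp] e_closed [simp] x [simp]

lemma xi_closed [simp]: "xi n \<in> carrier R" and xi_nonzero [simp]: "xi n \<noteq> \<zero>"
  unfolding xi_def by auto

lemma xi_0: "xi 0 = \<one>"
  unfolding xi_def by (simp add: inv_one)

lemma xi_add: "xi n \<otimes> xi m = xi (n + m)"
  unfolding xi_def by (simp add: inv_mult[symmetric] nat_pow_mult add.commute)

lemma x_xi: "x \<otimes> xi n = xi n \<otimes> x"
proof -
  have "xi n \<otimes> x = x \<otimes> xi n"
    unfolding xi_def using nat_pow_Suc[of x n] nat_pow_Suc2[OF x(1), of n] by (intro commute_inv) auto
  then show ?thesis by (rule sym)
qed

lemma xi_Suc: "xi (Suc n) \<otimes> x = xi n"
proof -
  have "xi 1 \<otimes> x = \<one>" unfolding xi_def by simp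
  then show ?thesis using xi_add[of n 1, symmetric] by (simp add: m_assoc)
qed

lemma xi_pow: "n \<le> m \<Longrightarrow> xi n \<otimes> x [^] m = x [^] (m - n)"
proof -
  assume "n \<le> m"
  then have "x [^] m = x [^] n \<otimes> x [^] (m - n)" by (simp add: nat_pow_mult)
  then show ?thesis unfolding xi_def by simp
qed

lemma psum_0 [simp]: "psum 0 b = \<zero>" unfolding psum_def by simp

lemma psum_Suc: "b \<in> B \<Longrightarrow> psum (Suc m) b = psum m b \<oplus> e m b \<otimes> xi m"
  unfolding psum_def by (simp add: lessThan_Suc finsum_insert a_comm)

lemma psum_closed [simp]: "b \<in> B \<Longrightarrow> psum m b \<in> carrier R"
  unfolding psum_def by auto

lemma phi_psum:
  assumes b: "b \<in> B" and m: "\<And>n. n \<ge> m \<Longrightarrow> e n b = \<zero>"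
  shows "phi b = psum m b"
  unfolding phi_def psum_def
proof (rule add.finprod_mono_neutral_cong_left)
  show "{n. e n b \<otimes> xi n \<noteq> \<zero>} \<subseteq> {..<m}"
  proof
    fix n assume "n \<in> {n. e n b \<otimes> xi n \<noteq> \<zero>}"
    then have "e n b \<noteq> \<zero>" using b by auto
    then show "n \<in> {..<m}" using m by (metis lessThan_iff not_le)
  qed
qed (use b in auto)

lemma phi_psum_ex: "b \<in> B \<Longrightarrow> \<exists>m. \<forall>M\<ge>m. phi b = psum M b"
  using e_nil[of b] phi_psum[of b] by (meson order_trans)

lemma phi_closed [simp]: "b \<in> B \<Longrightarrow> phi b \<in> carrier R"
  using phi_psum_ex[of b] psum_closed[of b] by (metis order_refl)

text \<open>The coefficients are such that the two parts of \<open>x (e n b) x\<^bsup>-n\<^esup>\<close> telescope.\<close>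

lemma x_psum:
  assumes b: "b \<in> B"
  shows "x \<otimes> psum m b = psum m (s b) \<otimes> x \<oplus> (\<one> \<ominus> inv (p [^] m)) \<otimes> (e m (s b) \<otimes> (xi m \<otimes> x))"
proof (induct m)
  case 0
  then show ?case using b by (simp add: minus_eq r_neg)
next
  case (Suc m)
  let ?y = "e m (s b) \<otimes> (xi m \<otimes> x)" and ?z = "e (Suc m) (s b) \<otimes> (xi (Suc m) \<otimes> x)"
  let ?c = "inv (p [^] m)" and ?d = "\<one> \<ominus> inv (p [^] Suc m)"
  have c: "?c \<in> K" "?d \<in> K" "?c \<in> carrier R" "?d \<in> carrier R" using p by (auto simp: minus_eq simp del: nat_pow_Suc)
  have mem: "?y \<in> carrier R" "?z \<in> carrier R" "psum m (s b) \<in> carrier R" "psum m b \<in> carrier R" using b by auto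
  have "x \<otimes> (e m b \<otimes> xi m) = x \<otimes> e m b \<otimes> xi m" using b by (simp add: m_assoc)
  also have "\<dots> = ?c \<otimes> (e m (s b) \<otimes> (x \<otimes> xi m)) \<oplus> ?d \<otimes> (e (Suc m) (s b) \<otimes> xi m)"
    unfolding e_x[OF b] using b c by (simp add: l_distr m_assoc del: nat_pow_Suc)
  also have "\<dots> = ?c \<otimes> ?y \<oplus> ?d \<otimes> ?z" unfolding x_xi xi_Suc ..
  finally have 1: "x \<otimes> (e m b \<otimes> xi m) = ?c \<otimes> ?y \<oplus> ?d \<otimes> ?z" .
  have "x \<otimes> psum (Suc m) b = x \<otimes> psum m b \<oplus> x \<otimes> (e m b \<otimes> xi m)"
    using b psum_Suc[OF b] by (simp add: r_distr)
  also have "\<dots> = psum m (s b) \<otimes> x \<oplus> ((\<one> \<ominus> ?c) \<otimes> ?y \<oplus> ?c \<otimes> ?y) \<oplus> ?d \<otimes> ?z"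
    unfolding 1 Suc using mem c by (simp add: a_assoc)
  \<comment> \<open>The remainder of the previous partial sum has weight 1 - p^-m, and the new term
    contributes the missing p^-m.\<close>
  also have "(\<one> \<ominus> ?c) \<otimes> ?y \<oplus> ?c \<otimes> ?y = ?y"
    using mem c by (simp add: minus_eq l_minus l_distr a_assoc l_neg)
  also have "psum m (s b) \<otimes> x \<oplus> ?y = psum (Suc m) (s b) \<otimes> x"
    using b mem by (simp add: psum_Suc l_distr m_assoc)
  finally show ?case .
qed

text \<open>Beyond the nilpotency index of s b the remainder in \<open>x_psum\<close> is zero, and
  the derivation has disappeared from the commutation rule.\<close>

lemma x_phi: assumes b: "b \<in> B" shows "x \<otimes> phi b = phi (s b) \<otimes> x"
proof -
  obtain m where m: "\<forall>M\<ge>m. phi b = psum M b" using phi_psum_ex[OF b] by blast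
  obtain m1 where m1: "\<forall>M\<ge>m1. e M (s b) = \<zero>" using e_nil[of "s b"] b by auto
  let ?M = "max m m1"
  have "phi (s b) = psum ?M (s b)" using m1 b by (intro phi_psum) auto
  moreover have "x \<otimes> psum ?M b = psum ?M (s b) \<otimes> x"
    using x_psum[OF b, of ?M] m1 b p by (simp add: minus_eq)
  moreover have "phi b = psum ?M b" using m by simp
  ultimately show ?thesis by simp
qed

lemma s'_pow [simp]: "b \<in> B \<Longrightarrow> (s' ^^ n) b \<in> B"
  by (induct n) auto

lemma xi_phi: "b \<in> B \<Longrightarrow> xi n \<otimes> phi b = phi ((s' ^^ n) b) \<otimes> xi n"
proof (induct n)
  case 0 then show ?case by (simp add: xi_0)
next
  case (Suc n)
  let ?b = "(s' ^^ n) b"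
  have b: "?b \<in> B" "s' ?b \<in> B" using Suc by auto
  have x1: "xi 1 \<otimes> x = \<one>" "x \<otimes> xi 1 = \<one>" unfolding xi_def by auto
  have "xi 1 \<otimes> phi ?b \<otimes> (x \<otimes> xi 1) = xi 1 \<otimes> (x \<otimes> phi (s' ?b)) \<otimes> xi 1"
    using x_phi[OF b(2)] s(3)[OF b(1)] b by (simp add: m_assoc)
  also have "\<dots> = xi 1 \<otimes> x \<otimes> (phi (s' ?b) \<otimes> xi 1)" using b by (simp add: m_assoc)
  finally have "xi 1 \<otimes> phi ?b = phi (s' ?b) \<otimes> xi 1" unfolding x1 using b by simp
  then have "xi 1 \<otimes> (phi ?b \<otimes> xi n) = phi (s' ?b) \<otimes> (xi 1 \<otimes> xi n)" using b by (simp flip: m_assoc)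
  moreover have "xi (Suc n) \<otimes> phi b = xi 1 \<otimes> (xi n \<otimes> phi b)"
    using Suc(2) m_assoc[of "xi 1" "xi n" "phi b"] by (simp add: xi_add)
  ultimately show ?case using Suc xi_add[of 1 n] by simp
qed

lemma phi_add: assumes "a \<in> B" "b \<in> B" shows "phi (a \<oplus> b) = phi a \<oplus> phi b"
proof -
  obtain m1 where m1: "\<forall>M\<ge>m1. e M a = \<zero>" using e_nil assms by blast
  obtain m2 where m2: "\<forall>M\<ge>m2. e M b = \<zero>" using e_nil assms by blast
  let ?M = "max m1 m2"
  have "psum m (a \<oplus> b) = psum m a \<oplus> psum m b" for m
    using assms by (induct m) (simp_all add: psum_Suc e_add l_distr a_ac)
  moreover have "phi (a \<oplus> b) = psum ?M (a \<oplus> b)"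
    using m1 m2 assms by (intro phi_psum) (auto simp: e_add)
  moreover have "phi a = psum ?M a" "phi b = psum ?M b" using m1 m2 assms by (auto intro!: phi_psum)
  ultimately show ?thesis by simp
qed

text \<open>By \<open>xi_phi\<close>, moving x^-i from the series of a past phi b turns b into s'^i
  b. The resulting double sum is the Leibniz rule \<open>e_mult\<close> summed over n.\<close>

lemma phi_mult: assumes a: "a \<in> B" and b: "b \<in> B" shows "phi (a \<otimes> b) = phi a \<otimes> phi b"
proof -
  obtain m where m: "\<And>n. n \<ge> m \<Longrightarrow> e n a = \<zero>" using e_nil[OF a] by blast
  \<comment> \<open>A single truncation bound is wanted for the finitely many twists s'^i b with i <
    m.\<close>
  have "\<exists>m'. \<forall>i<m. \<forall>M\<ge>m'. phi ((s' ^^ i) b) = psum M ((s' ^^ i) b)"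
  proof (induct m)
    case (Suc m)
    then obtain m1 where "\<forall>i<m. \<forall>M\<ge>m1. phi ((s' ^^ i) b) = psum M ((s' ^^ i) b)" by blast
    moreover obtain m2 where "\<forall>M\<ge>m2. phi ((s' ^^ m) b) = psum M ((s' ^^ m) b)"
      using phi_psum_ex[of "(s' ^^ m) b"] b by auto
    ultimately show ?case by (intro exI[of _ "max m1 m2"]) (auto simp: less_Suc_eq)
  qed simp
  then obtain m' where m': "\<And>i M. i < m \<Longrightarrow> M \<ge> m' \<Longrightarrow> phi ((s' ^^ i) b) = psum M ((s' ^^ i) b)" by blast
  obtain m2 where m2: "\<forall>M\<ge>m2. phi (a \<otimes> b) = psum M (a \<otimes> b)" using phi_psum_ex[of "a \<otimes> b"] a b by auto
  \<comment> \<open>This choice leaves M - i \<ge> m' for every i < m, so the inner sums are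
    complete; for i \<ge> m the factor e_i a is zero.\<close>
  define M where "M = m + m' + m2"
  define f where "f i k = e i a \<otimes> e k ((s' ^^ i) b) \<otimes> xi (i + k)" for i k
  have f: "f i k \<in> carrier R" for i k using a b unfolding f_def by auto
  have "phi a \<otimes> phi b = psum M a \<otimes> phi b" using phi_psum[OF a, of M] m unfolding M_def by simp
  also have "\<dots> = (\<Oplus>i\<in>{..<M}. e i a \<otimes> xi i \<otimes> phi b)"
    unfolding psum_def using a b by (subst finsum_ldistr) auto
  also have "\<dots> = (\<Oplus>i\<in>{..<M}. \<Oplus>k\<in>{..<M - i}. f i k)"
  proof (rule finsum_cong')
    fix i assume "i \<in> {..<M}"
    let ?b = "(s' ^^ i) b"
    have sb: "?b \<in> B" using b by simp
    show "e i a \<otimes> xi i \<otimes> phi b = (\<Oplus>k\<in>{..<M - i}. f i k)"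
    proof (cases "i < m")
      case True
      have "(\<Oplus>k\<in>{..<M - i}. f i k) = (\<Oplus>k\<in>{..<M - i}. e i a \<otimes> (e k ?b \<otimes> xi k \<otimes> xi i))"
        unfolding f_def using a sb by (intro finsum_cong') (auto simp: m_assoc xi_add add.commute)
      also have "\<dots> = e i a \<otimes> (\<Oplus>k\<in>{..<M - i}. e k ?b \<otimes> xi k \<otimes> xi i)"
        using a sb by (subst finsum_rdistr) auto
      also have "(\<Oplus>k\<in>{..<M - i}. e k ?b \<otimes> xi k \<otimes> xi i) = psum (M - i) ?b \<otimes> xi i"
        unfolding psum_def using sb by (subst finsum_ldistr) auto
      also have "psum (M - i) ?b = phi ?b" using m'[OF True, of "M - i"] True unfolding M_def by auto
      also have "phi ?b \<otimes> xi i = xi i \<otimes> phi b" using xi_phi[OF b] by simp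
      finally show ?thesis using a b by (simp add: m_assoc)
    next
      case False
      then have "e i a = \<zero>" using m by simp
      then show ?thesis using b sb unfolding f_def by simp
    qed
  qed (use a b f in auto)
  also have "\<dots> = (\<Oplus>n\<in>{..<M}. \<Oplus>i\<in>{..n}. f i (n - i))"
    by (rule finsum_triangle[symmetric]) (rule f)
  also have "\<dots> = (\<Oplus>n\<in>{..<M}. e n (a \<otimes> b) \<otimes> xi n)"
  proof (rule finsum_cong')
    fix n
    show "(\<Oplus>i\<in>{..n}. f i (n - i)) = e n (a \<otimes> b) \<otimes> xi n"
      unfolding e_mult[OF a b] f_def using a b by (subst finsum_ldistr) (auto intro!: finsum_cong')
  qed (use a b in auto)
  also have "\<dots> = phi (a \<otimes> b)" using m2[rule_format, of M] unfolding psum_def[symmetric] M_def by simp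
  finally show ?thesis by simp
qed

text \<open>By induction only the two extreme terms of the Leibniz rule for \<one> \<otimes> \<one>
  survive, so e_n \<one> equals twice itself.\<close>

lemma e_one: "0 < n \<Longrightarrow> e n \<one> = \<zero>"
proof (induct n rule: less_induct)
  case (less n)
  have s1: "(s' ^^ i) \<one> = \<one>" for i by (induct i) (simp_all add: s'_one)
  obtain k where n: "n = Suc k" using less(2) gr0_conv_Suc by blast
  have "e n \<one> = (\<Oplus>i\<in>{..n}. e i \<one> \<otimes> e (n - i) \<one>)" using e_mult[of \<one> \<one> n] s1 by simp
  also have "\<dots> = (\<Oplus>i\<in>{0, n}. e i \<one> \<otimes> e (n - i) \<one>)"
    using less by (intro add.finprod_mono_neutral_cong_right) auto
  also have "\<dots> = e n \<one> \<oplus> e n \<one>" using less(2) by (simp add: finsum_insert e_0_one)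
  finally have "\<ominus> e n \<one> \<oplus> (e n \<one> \<oplus> e n \<one>) = \<ominus> e n \<one> \<oplus> e n \<one>" by simp
  then show ?case by (simp add: r_neg1 l_neg)
qed

lemma phi_one: "phi \<one> = \<one>"
proof -
  have "phi \<one> = psum (Suc 0) \<one>" using e_one by (intro phi_psum) auto
  then show ?thesis by (simp add: psum_Suc e_0_one xi_0)
qed

lemma phi_hom: "phi \<in> Ring.ring_hom (R\<lparr>carrier := B\<rparr>) R"
  by (rule ring_hom_memI) (auto simp: phi_add phi_mult phi_one)

lemma e0_hom: "e 0 \<in> Ring.ring_hom (R\<lparr>carrier := B\<rparr>) R"
  by (rule ring_hom_memI) (auto simp: e_add e_mult e_0_one)

lemma E_subring: "subring (e 0 ` B) R"
proof (rule subringI)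
  fix a assume "a \<in> e 0 ` B"
  then obtain b where b: "b \<in> B" "a = e 0 b" by blast
  have "\<ominus> a = e 0 (\<ominus> b)" using ring_hom_sub_neg[OF ring_axioms ring_axioms B e0_hom b(1)] b(2) by simp
  then show "\<ominus> a \<in> e 0 ` B" using b by auto
  fix a' assume "a' \<in> e 0 ` B"
  then obtain b' where b': "b' \<in> B" "a' = e 0 b'" by blast
  show "a \<otimes> a' \<in> e 0 ` B" "a \<oplus> a' \<in> e 0 ` B"
    using ring_hom_subD(2,3)[OF e0_hom b(1) b'(1)] b b' by (metis Bc(4) imageI, metis Bc(5) imageI)
qed (use e_0_one in \<open>auto intro!: image_eqI[of _ _ \<one>]\<close>)

lemma e_in_E: "b \<in> B \<Longrightarrow> e n b \<in> e 0 ` B"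
  using e_range[of b n] by (metis imageI)

text \<open>Multiplication by x^M clears the denominators and puts e_0 b in front of the highest
  power.\<close>

lemma psum_polys:
  assumes b: "b \<in> B" and m: "m \<le> M"
  shows "\<exists>v \<in> polys (e 0 ` B) x M. psum (Suc m) b \<otimes> x [^] M = e 0 b \<otimes> x [^] M \<oplus> v"
  using m
proof (induct m)
  case 0
  show ?case using b polys_zero[OF E_subring x(1)] by (intro bexI[of _ \<zero>]) (auto simp: psum_Suc xi_0)
next
  case (Suc m)
  then obtain v where v: "v \<in> polys (e 0 ` B) x M" "psum (Suc m) b \<otimes> x [^] M = e 0 b \<otimes> x [^] M \<oplus> v" by auto
  let ?w = "e (Suc m) b \<otimes> x [^] (M - Suc m)"
  have w: "e (Suc m) b \<otimes> xi (Suc m) \<otimes> x [^] M = ?w" using xi_pow[of "Suc m" M] Suc b by (simp add: m_assoc del: nat_pow_Suc)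
  have "?w \<in> polys (e 0 ` B) x (Suc (M - Suc m))" using polys_monom[OF E_subring x(1) e_in_E[OF b]] .
  then have wp: "?w \<in> polys (e 0 ` B) x M" 
  proof -
    have "Suc (M - Suc m) \<le> M" using Suc(2) by arith
    then show ?thesis using polys_mono[OF E_subring x(1)] \<open>?w \<in> polys (e 0 ` B) x (Suc (M - Suc m))\<close> by blast
  qed
  have vc: "v \<in> carrier R" using v(1) subringE(1)[OF E_subring] unfolding polys_def by auto
  have "psum (Suc (Suc m)) b \<otimes> x [^] M = e 0 b \<otimes> x [^] M \<oplus> (v \<oplus> ?w)"
    using psum_Suc[OF b, of "Suc m"] v(2) w b vc by (simp add: l_distr a_assoc)
  then show ?case using polys_add[OF E_subring x(1) v(1) wp] by blast
qed

lemma phi_polys: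
  assumes b: "b \<in> B"
  shows "\<exists>m. \<forall>M\<ge>m. \<exists>v \<in> polys (e 0 ` B) x M. phi b \<otimes> x [^] M = e 0 b \<otimes> x [^] M \<oplus> v"
proof -
  obtain m where m: "\<forall>M\<ge>m. phi b = psum M b" using phi_psum_ex[OF b] by blast
  have "\<exists>v \<in> polys (e 0 ` B) x M. phi b \<otimes> x [^] M = e 0 b \<otimes> x [^] M \<oplus> v" if "M \<ge> m" for M
  proof -
    have "m \<le> Suc M" using that by simp
    then have "phi b = psum (Suc M) b" using m by blast
    then show ?thesis using psum_polys[OF b, of M M] by simp
  qed
  then show ?thesis by blast
qed

lemma horner_phi_polys:
  "set cs \<subseteq> B \<Longrightarrow> \<exists>m. \<forall>M\<ge>m. horner x (map phi cs) \<otimes> x [^] M \<in> polys (e 0 ` B) x (M + length cs)"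
proof (induct cs rule: rev_induct)
  case Nil then show ?case using polys_zero[OF E_subring x(1)] by simp
next
  case (snoc b cs)
  have b: "b \<in> B" "set cs \<subseteq> B" using snoc by auto
  obtain m1 where m1: "\<And>M. M \<ge> m1 \<Longrightarrow> horner x (map phi cs) \<otimes> x [^] M \<in> polys (e 0 ` B) x (M + length cs)"
    using snoc b by blast
  obtain m2 where m2: "\<And>M. M \<ge> m2 \<Longrightarrow> \<exists>v \<in> polys (e 0 ` B) x M. phi b \<otimes> x [^] M = e 0 b \<otimes> x [^] M \<oplus> v"
    using phi_polys[OF b(1)] by blast
  have hc: "horner x (map phi cs) \<in> carrier R" using b by (intro horner_closed) auto
  have cc: "set (map phi cs) \<subseteq> carrier R" "set [phi b] \<subseteq> carrier R" using b by auto
  have "horner x (map phi (cs @ [b])) \<otimes> x [^] M \<in> polys (e 0 ` B) x (M + length (cs @ [b]))"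
    if M: "M \<ge> max m1 m2" for M
  proof -
    let ?n = "M + length cs"
    obtain v where v: "v \<in> polys (e 0 ` B) x ?n" "phi b \<otimes> x [^] ?n = e 0 b \<otimes> x [^] ?n \<oplus> v"
      using m2[of ?n] M by auto
    have "horner x (map phi (cs @ [b])) \<otimes> x [^] M = horner x (map phi cs) \<otimes> x [^] M \<oplus> phi b \<otimes> x [^] ?n"
      using horner_append[OF x(1) cc] b hc by (simp add: l_distr m_assoc nat_pow_mult add.commute)
    moreover have "e 0 b \<otimes> x [^] ?n \<in> polys (e 0 ` B) x (Suc ?n)"
      using polys_monom[OF E_subring x(1) e_in_E[OF b(1)]] .
    ultimately show ?thesis
      using v m1[of M] M polys_mono_Suc[OF E_subring x(1), of ?n] polys_add[OF E_subring x(1), of _ "Suc ?n"]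
      by (simp add: subset_iff)
  qed
  then show ?case by blast
qed

text \<open>Leading terms: after clearing denominators the top coefficient of the relation is e_0 of
  the last list entry, since e_n with n > 0 comes with a lower power of x. Freeness over the image
  of \<open>e 0\<close> and \<open>e_inj\<close> remove that entry.\<close>

lemma phi_free:
  "set cs \<subseteq> B \<Longrightarrow> horner x (map phi cs) = \<zero> \<Longrightarrow> set cs \<subseteq> {\<zero>}"
proof (induct cs rule: rev_induct)
  case (snoc b cs)
  have b: "b \<in> B" "set cs \<subseteq> B" using snoc by auto
  obtain m1 where m1: "\<And>M. M \<ge> m1 \<Longrightarrow> horner x (map phi cs) \<otimes> x [^] M \<in> polys (e 0 ` B) x (M + length cs)"
    using horner_phi_polys b by blast
  obtain m2 where m2: "\<And>M. M \<ge> m2 \<Longrightarrow> \<exists>v \<in> polys (e 0 ` B) x M. phi b \<otimes> x [^] M = e 0 b \<otimes> x [^] M \<oplus> v"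
    using phi_polys[OF b(1)] by blast
  have hc: "horner x (map phi cs) \<in> carrier R" using b by (intro horner_closed) auto
  have cc: "set (map phi cs) \<subseteq> carrier R" "set [phi b] \<subseteq> carrier R" using b by auto
  define M where "M = max m1 m2"
  let ?n = "M + length cs"
  obtain v where v: "v \<in> polys (e 0 ` B) x ?n" "phi b \<otimes> x [^] ?n = e 0 b \<otimes> x [^] ?n \<oplus> v"
    using m2[of ?n] unfolding M_def by (auto simp: max.coboundedI2 trans_le_add1)
  let ?h = "horner x (map phi cs) \<otimes> x [^] M"
  have vc: "v \<in> carrier R" using v(1) subringE(1)[OF E_subring] unfolding polys_def by auto
  have ap: "horner x (map phi (cs @ [b])) = horner x (map phi cs) \<oplus> phi b \<otimes> x [^] length cs"
    using horner_append[OF x(1) cc] b by simp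
  have "\<zero> = horner x (map phi (cs @ [b])) \<otimes> x [^] M" using snoc(3) by simp
  also have "\<dots> = ?h \<oplus> phi b \<otimes> x [^] ?n"
    unfolding ap using b hc by (simp add: l_distr m_assoc nat_pow_mult add.commute)
  also have "\<dots> = e 0 b \<otimes> x [^] ?n \<oplus> (v \<oplus> ?h)"
    unfolding v(2) using b hc vc by (simp add: a_ac)
  finally have "e 0 b \<otimes> x [^] ?n \<oplus> (v \<oplus> ?h) = \<zero>" by simp
  moreover have "v \<oplus> ?h \<in> polys (e 0 ` B) x ?n"
    using polys_add[OF E_subring x(1) v(1)] m1 unfolding M_def by simp
  ultimately have "e 0 b = \<zero>"
    using polys_monom_zero[OF E_subring x(1) e_free e_in_E[OF b(1)]] by blast
  then have b0: "b = \<zero>" using e_inj b by blast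
  have "phi \<zero> = \<zero>" using ring_hom_sub_zero[OF ring_axioms ring_axioms B phi_hom] .
  then have "horner x (map phi cs) = \<zero>" using ap snoc(3) hc b0 by simp
  then show ?case using snoc b b0 by simp
qed simp

lemma phi_inj: "b \<in> B \<Longrightarrow> phi b = \<zero> \<Longrightarrow> b = \<zero>"
  using phi_free[of "[b]"] by simp

lemma phi_left_free: "left_free (phi ` B) x"
  unfolding left_free_def
proof (intro allI impI)
  fix ds assume "set ds \<subseteq> phi ` B" "horner x ds = \<zero>"
  define cs where "cs = map (inv_into B phi) ds"
  have cs: "ds = map phi cs" "set cs \<subseteq> B"
    using \<open>set ds \<subseteq> phi ` B\<close> unfolding cs_def
    by (auto simp: map_idI f_inv_into_f subset_iff inv_into_into comp_def intro!: map_idI[symmetric])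
  have "phi \<zero> = \<zero>" using ring_hom_sub_zero[OF ring_axioms ring_axioms B phi_hom] .
  then show "set ds \<subseteq> {\<zero>}" using phi_free[of cs] cs \<open>horner x ds = \<zero>\<close> by auto
qed

text \<open>Inverts the series. Subtracting the terms with n > 0 from phi b leaves e_0 b, and by
  \<open>e_range\<close> each of their coefficients e_n b is e_0 of an element with smaller
  nilpotency index, so induction on that index applies.\<close>

lemma e0_in_loc:
  assumes L: "subring L R" "phi ` B \<subseteq> L" "inv x \<in> L" and b: "b \<in> B"
  shows "e 0 b \<in> L"
proof -
  have xiL: "xi n \<in> L" for n
  proof (induct n)
    case 0 then show ?case using subringE(3)[OF L(1)] by (simp add: xi_0)
  next
    case (Suc n)
    then show ?case using xi_add[of n 1] subringE(6)[OF L(1) Suc, of "inv x"] L(3) unfolding xi_def by simp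
  qed
  have "\<forall>b\<in>B. (\<forall>n\<ge>m. e n b = \<zero>) \<longrightarrow> e 0 b \<in> L" for m
  proof (induct m rule: less_induct)
    case (less m)
    show ?case
    proof (intro ballI impI)
      fix b assume b: "b \<in> B" and z: "\<forall>n\<ge>m. e n b = \<zero>"
      have en: "e n b \<in> L" if n: "0 < n" for n
      proof (cases "n < m")
        case True
        obtain u where u: "u \<in> B" "e 0 u = e n b" "\<forall>k. e (n + k) b = \<zero> \<longrightarrow> e k u = \<zero>"
          using e_range[OF b] by blast
        have "\<forall>k\<ge>m - n. e k u = \<zero>" using u(3) z by (metis le_diff_conv add.commute)
        then show ?thesis using less[of "m - n"] n True u by auto
      next
        case False then show ?thesis using z subringE(2)[OF L(1)] by simp
      qed
      have "\<exists>t\<in>L. psum (Suc k) b = e 0 b \<oplus> t" for k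
      proof (induct k)
        case 0 show ?case using b subringE(2)[OF L(1)] by (intro bexI[of _ \<zero>]) (auto simp: psum_Suc xi_0)
      next
        case (Suc k)
        then obtain t where t: "t \<in> L" "psum (Suc k) b = e 0 b \<oplus> t" by blast
        have "t \<in> carrier R" using t(1) subringE(1)[OF L(1)] by blast
        then have "psum (Suc (Suc k)) b = e 0 b \<oplus> (t \<oplus> e (Suc k) b \<otimes> xi (Suc k))"
          using psum_Suc[OF b, of "Suc k"] t b by (simp add: a_assoc)
        moreover have "t \<oplus> e (Suc k) b \<otimes> xi (Suc k) \<in> L"
          using t en[of "Suc k"] xiL subringE(6,7)[OF L(1)] by blast
        ultimately show ?case by blast
      qed
      then obtain t where t: "t \<in> L" "psum (Suc m) b = e 0 b \<oplus> t" by blast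
      have tc: "t \<in> carrier R" using t(1) subringE(1)[OF L(1)] by blast
      have "phi b = e 0 b \<oplus> t" using phi_psum[OF b, of "Suc m"] z t by simp
      then have "e 0 b = phi b \<oplus> \<ominus> t" using tc b by (simp add: a_assoc r_neg)
      then show "e 0 b \<in> L" using L b t subringE(5,7)[OF L(1)] by auto
    qed
  qed
  then show ?thesis using e_nil[OF b] b by blast
qed

lemma phi_in_loc:
  assumes L: "subring L R" "e 0 ` B \<subseteq> L" "inv x \<in> L" and b: "b \<in> B"
  shows "phi b \<in> L"
proof -
  have xiL: "xi n \<in> L" for n
  proof (induct n)
    case 0 then show ?case using subringE(3)[OF L(1)] by (simp add: xi_0)
  next
    case (Suc n)
    then show ?case using xi_add[of n 1] subringE(6)[OF L(1) Suc, of "inv x"] L(3) unfolding xi_def by simp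
  qed
  have "psum m b \<in> L" for m
    using b e_in_E[OF b] L xiL subringE(2,6,7)[OF L(1)] by (induct m) (auto simp: psum_Suc subset_iff)
  then show ?thesis using phi_psum_ex[OF b] by (metis order_refl)
qed

end

section \<open>Quantum nilpotent algebras at a root of unity\<close>


lemma (in ring) horner_finsum:
  assumes "y \<in> carrier R" "set cs \<subseteq> carrier R"
  shows "horner y cs = (\<Oplus>n\<in>{..<length cs}. cs ! n \<otimes> y [^] n)"
  using assms(2)
proof (induct cs)
  case Nil then show ?case by simp
next
  case (Cons c cs)
  have mem: "cs ! n \<otimes> y [^] n \<in> carrier R" if "n < length cs" for n
    using Cons that assms(1) by (auto simp: subset_iff)
  have "horner y cs \<otimes> y = (\<Oplus>n\<in>{..<length cs}. cs ! n \<otimes> y [^] n \<otimes> y)"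
    using Cons assms(1) mem by (simp, subst finsum_ldistr) auto
  also have "\<dots> = (\<Oplus>n\<in>{..<length cs}. (c # cs) ! Suc n \<otimes> y [^] Suc n)"
    using Cons assms(1) by (intro finsum_cong') (auto simp: m_assoc subset_iff)
  also have "\<dots> = (\<Oplus>n\<in>Suc ` {..<length cs}. (c # cs) ! n \<otimes> y [^] n)"
    using mem assms(1) Cons by (subst add.finprod_reindex) (auto simp: subset_iff)
  finally have e: "horner y cs \<otimes> y = (\<Oplus>n\<in>Suc ` {..<length cs}. (c # cs) ! n \<otimes> y [^] n)" .
  have "{..<length (c # cs)} = insert 0 (Suc ` {..<length cs})"
    by (auto simp: lessThan_Suc_eq_insert_0)
  then have "(\<Oplus>n\<in>{..<length (c # cs)}. (c # cs) ! n \<otimes> y [^] n)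
      = c \<oplus> (\<Oplus>n\<in>Suc ` {..<length cs}. (c # cs) ! n \<otimes> y [^] n)"
    using Cons assms(1) by (simp, subst finsum_insert) (auto simp: subset_iff)
  then show ?case unfolding e[symmetric] by simp
qed

text \<open>A vanishing polynomial and the zero polynomial give two coefficient families for zero,
  which the uniqueness clause of \<open>ore_extension\<close> identifies.\<close>

lemma (in ring) ore_extension_left_free:
  assumes "ore_extension K B C x \<sigma> \<delta>" shows "left_free B x"
  unfolding left_free_def
proof (intro allI impI)
  fix cs assume cs: "set cs \<subseteq> B" "horner x cs = \<zero>"
  define P where "P c \<longleftrightarrow> (\<forall>n. c n \<in> B) \<and> finite {n. c n \<noteq> \<zero>} \<and>
        \<zero> = (\<Oplus>n\<in>{n. c n \<noteq> \<zero>}. c n \<otimes> x [^] n)" for c :: "nat \<Rightarrow> 'a"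
  have B: "subring B R" and C: "subring C R" and xC: "x \<in> C" and uniq: "\<exists>!c. P c"
    using assms subringE(2)[of C R] unfolding ore_extension_def P_def by blast+
  have x: "x \<in> carrier R" and csR: "set cs \<subseteq> carrier R"
    using xC subringE(1)[OF C] cs subringE(1)[OF B] by auto
  define c where "c n = (if n < length cs then cs ! n else \<zero>)" for n
  have cB: "c n \<in> B" for n using cs subringE(2)[OF B] nth_mem unfolding c_def by fastforce
  have fin: "{n. c n \<noteq> \<zero>} \<subseteq> {..<length cs}" unfolding c_def by auto
  have "\<zero> = (\<Oplus>n\<in>{..<length cs}. cs ! n \<otimes> x [^] n)" using horner_finsum[OF x csR] cs(2) by simp
  also have "\<dots> = (\<Oplus>n\<in>{n. c n \<noteq> \<zero>}. c n \<otimes> x [^] n)"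
    using fin cB subringE(1)[OF B] x csR unfolding c_def
    by (intro add.finprod_mono_neutral_cong_right) (auto simp: subset_iff)
  finally have "\<zero> = (\<Oplus>n\<in>{n. c n \<noteq> \<zero>}. c n \<otimes> x [^] n)" .
  then have "P c" unfolding P_def using cB finite_subset[OF fin] by simp
  moreover have "P (\<lambda>_. \<zero>)" unfolding P_def using subringE(2)[OF B] by simp
  ultimately have "c = (\<lambda>_. \<zero>)" using uniq by blast
  then have "cs ! n = \<zero>" if "n < length cs" for n using that unfolding c_def by metis
  then show "set cs \<subseteq> {\<zero>}" by (metis in_set_conv_nth singletonI subsetI)
qed

text \<open>The passage through the algorithm works with \<lambda>_{i,j} that are
  \<open>l\<close>-th roots of unity; their form as powers of one primitive root enters with the
  count of characters.\<close>

locale qna_root = quantum_nilpotent_algebra +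
  fixes l :: nat
  assumes l_pos: "0 < l" and lam_root: "\<And>i j. i \<in> {1..N} \<Longrightarrow> j \<in> {1..N} \<Longrightarrow> lam i j [^] l = \<one>"
begin

sublocale central_subfield F K
  by (intro central_subfield.intro skew_field_axioms central_subfield_axioms.intro K_subfield K_central)

declare One_nat_def [simp del]

abbreviation Al :: "nat \<Rightarrow> 'a set" where "Al n \<equiv> subalg K X n"

lemma Al_subring: "n \<le> N \<Longrightarrow> subring (Al n) F"
  using X_carrier by (intro subalg_subring) auto

lemma Al_carrier: "n \<le> N \<Longrightarrow> a \<in> Al n \<Longrightarrow> a \<in> carrier F"
  using subringE(1)[OF Al_subring] by blast

lemma Al_mono: "m \<le> n \<Longrightarrow> n \<le> N \<Longrightarrow> Al m \<subseteq> Al n"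
  using X_carrier by (intro subalg_mono) auto

lemma lam_K: "i \<in> {1..N} \<Longrightarrow> j \<in> {1..N} \<Longrightarrow> lam i j \<in> K" "i \<in> {1..N} \<Longrightarrow> j \<in> {1..N} \<Longrightarrow> lam i j \<noteq> \<zero>"
  using lam_scalar by auto

lemma lam_swap: "i \<in> {1..N} \<Longrightarrow> j \<in> {1..N} \<Longrightarrow> lam i j \<otimes> lam j i = \<one>"
  using lam_antisym[of i j] lam_K[of j i] by simp

lemma q_K: "i \<in> {2..N} \<Longrightarrow> q i \<in> K" "i \<in> {2..N} \<Longrightarrow> q i \<noteq> \<zero>" "i \<in> {2..N} \<Longrightarrow> q i \<ominus> \<one> \<noteq> \<zero>"
  using q_scalar[of i] by (auto simp: minus_eq)
    (metis K_carrier a_comm minus_equality minus_minus one_closed a_inv_closed)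

lemma X_free: "i \<in> {2..N} \<Longrightarrow> left_free (Al (i - 1)) (X i)"
  using ore_extension_left_free[OF ore_step] .

lemma X_one_free: "left_free K (X 1)"
  using ore_extension_left_free[OF ore_first] .

lemma X_rel: "i \<in> {2..N} \<Longrightarrow> a \<in> Al (i - 1) \<Longrightarrow> X i \<otimes> a = \<sigma> i a \<otimes> X i \<oplus> \<delta> i a"
  using ore_step[of i] unfolding ore_extension_def by blast

lemma sigma_iso: "i \<in> {2..N} \<Longrightarrow> \<sigma> i \<in> ring_iso (F\<lparr>carrier := Al (i - 1)\<rparr>) (F\<lparr>carrier := Al (i - 1)\<rparr>)"
  and sigma_K: "i \<in> {2..N} \<Longrightarrow> k \<in> K \<Longrightarrow> \<sigma> i k = k"
  using ore_step[of i] unfolding ore_extension_def K_automorphism_def by blast+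

lemma sigma_hom: "i \<in> {2..N} \<Longrightarrow> \<sigma> i \<in> Ring.ring_hom (F\<lparr>carrier := Al (i - 1)\<rparr>) (F\<lparr>carrier := Al (i - 1)\<rparr>)"
  using sigma_iso unfolding ring_iso_def by blast

lemma sigma_bij: "i \<in> {2..N} \<Longrightarrow> bij_betw (\<sigma> i) (Al (i - 1)) (Al (i - 1))"
  using sigma_iso unfolding ring_iso_def by auto

lemma sigma_closed: "i \<in> {2..N} \<Longrightarrow> a \<in> Al (i - 1) \<Longrightarrow> \<sigma> i a \<in> Al (i - 1)"
  and sigma_mult: "i \<in> {2..N} \<Longrightarrow> a \<in> Al (i - 1) \<Longrightarrow> b \<in> Al (i - 1) \<Longrightarrow> \<sigma> i (a \<otimes> b) = \<sigma> i a \<otimes> \<sigma> i b"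
  and sigma_add: "i \<in> {2..N} \<Longrightarrow> a \<in> Al (i - 1) \<Longrightarrow> b \<in> Al (i - 1) \<Longrightarrow> \<sigma> i (a \<oplus> b) = \<sigma> i a \<oplus> \<sigma> i b"
  using ring_hom_subD[OF sigma_hom] by auto

lemma Al_ring: "n \<le> N \<Longrightarrow> ring (F\<lparr>carrier := Al n\<rparr>)"
  using subring_is_ring[OF Al_subring] .

lemma sigma_neg: "i \<in> {2..N} \<Longrightarrow> a \<in> Al (i - 1) \<Longrightarrow> \<sigma> i (\<ominus> a) = \<ominus> \<sigma> i a"
proof -
  assume i: "i \<in> {2..N}" and a: "a \<in> Al (i - 1)"
  have le: "i - 1 \<le> N" using i by auto
  have "\<sigma> i \<in> Ring.ring_hom (F\<lparr>carrier := Al (i - 1)\<rparr>) F"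
    using ring_hom_subD[OF sigma_hom[OF i]] Al_carrier[OF le] by (intro ring_hom_memI) auto
  then show ?thesis using ring_hom_sub_neg[OF ring_axioms ring_axioms Al_subring _ a] i by auto
qed

text \<open>Since \<open>\<sigma> i\<close> rescales the generators, it stabilises each initial
  subalgebra.\<close>

lemma sigma_sub:
  assumes i: "i \<in> {2..N}" and n: "n < i" and a: "a \<in> Al n" shows "\<sigma> i a \<in> Al n"
proof -
  have nN: "n \<le> N" "n \<le> i - 1" "i - 1 \<le> N" using i n by auto
  have XR: "X ` {1..n} \<subseteq> carrier F" using X_carrier nN by auto
  note S = subringE(5,6,7)[OF Al_subring[OF nN(1)]]
  have sub: "b \<in> Al (i - 1)" if "b \<in> Al n" for b using that Al_mono[OF nN(2,3)] by blast
  from a XR show ?thesis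
  proof (induct rule: subalg_induct)
    case (K k) then show ?case using sigma_K[OF i] K_subalg by simp
  next
    case (gen m)
    then have "\<sigma> i (X m) = lam i m \<otimes> X m" using sigma_gen[of i m] i n by auto
    moreover have "lam i m \<in> Al n" using lam_K(1)[of i m] gen i n by (intro K_subalg) auto
    ultimately show ?case using S(2) gen_subalg gen by simp
  next
    case (neg a) then show ?case using S sub sigma_neg[OF i] by simp
  next
    case (add a b) then show ?case using S sub sigma_add[OF i] by simp
  next
    case (mult a b) then show ?case using S sub sigma_mult[OF i] by simp
  qed
qed

text \<open>Both maps are diagonal on the generators.\<close>

lemma sigma_commute:
  assumes i: "i \<in> {2..N}" and j: "j \<in> {2..N}" "j < i" and a: "a \<in> Al (j - 1)"
  shows "\<sigma> i (\<sigma> j a) = \<sigma> j (\<sigma> i a)"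
proof -
  have nN: "j - 1 \<le> N" "j - 1 < i" "i - 1 \<le> N" "j - 1 \<le> i - 1" using i j by auto
  have XR: "X ` {1..j-1} \<subseteq> carrier F" using X_carrier nN by auto
  have sub: "b \<in> Al (i - 1)" if "b \<in> Al (j - 1)" for b using that Al_mono[OF nN(4,3)] by blast
  have sc: "\<sigma> i b \<in> Al (j - 1)" if "b \<in> Al (j - 1)" for b using sigma_sub[OF i nN(2) that] .
  note sj = sigma_closed[OF j(1)]
  from a XR show ?thesis
  proof (induct rule: subalg_induct)
    case (K k) then show ?case using sigma_K i j by simp
  next
    case (gen m)
    have m: "m \<in> {1..N}" "m \<in> {1..<i}" "m \<in> {1..<j}" "X m \<in> Al (j - 1)" using gen j i gen_subalg[OF gen] by auto
    have lk: "lam i m \<in> K" "lam j m \<in> K" "lam i m \<in> Al (j - 1)" "lam j m \<in> Al (j - 1)"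
      using lam_K m i j K_subalg by auto
    have "\<sigma> i (\<sigma> j (X m)) = lam j m \<otimes> (lam i m \<otimes> X m)"
      using sigma_gen[OF j(1) m(3)] sigma_gen[OF i m(2)] sigma_mult[OF i sub[OF lk(4)] sub[OF m(4)]] sigma_K[OF i lk(2)] by simp
    moreover have "\<sigma> j (\<sigma> i (X m)) = lam i m \<otimes> (lam j m \<otimes> X m)"
      using sigma_gen[OF j(1) m(3)] sigma_gen[OF i m(2)] sigma_mult[OF j(1) lk(3) m(4)] sigma_K[OF j(1) lk(1)] by simp
    ultimately show ?case using K_lcomm[OF lk(1), of "lam j m" "X m"] lk X_carrier[OF m(1)] by simp
  next
    case (neg a) then show ?case using sub sc sj sigma_neg[OF i] sigma_neg[OF j(1)] by simp
  next
    case (add a b) then show ?case using sub sc sj sigma_add[OF i] sigma_add[OF j(1)] by simp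
  next
    case (mult a b) then show ?case using sub sc sj sigma_mult[OF i] sigma_mult[OF j(1)] by simp
  qed
qed

text \<open>Written with the same \<open>inv_into\<close> as in \<open>dd_op\<close>, so that it can
  be folded there.\<close>

definition \<sigma>' :: "nat \<Rightarrow> 'a \<Rightarrow> 'a" where "\<sigma>' i = inv_into (Al (i - 1)) (\<sigma> i)"

lemma sigma'_closed: "i \<in> {2..N} \<Longrightarrow> a \<in> Al (i - 1) \<Longrightarrow> \<sigma>' i a \<in> Al (i - 1)"
  and sigma_sigma': "i \<in> {2..N} \<Longrightarrow> a \<in> Al (i - 1) \<Longrightarrow> \<sigma> i (\<sigma>' i a) = a"
  and sigma'_sigma: "i \<in> {2..N} \<Longrightarrow> a \<in> Al (i - 1) \<Longrightarrow> \<sigma>' i (\<sigma> i a) = a"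
  unfolding \<sigma>'_def using sigma_bij[of i]
  by (auto simp: bij_betw_def inv_into_into f_inv_into_f inv_into_f_f)

lemma sigma'_eqI: "i \<in> {2..N} \<Longrightarrow> b \<in> Al (i - 1) \<Longrightarrow> \<sigma> i b = a \<Longrightarrow> \<sigma>' i a = b"
  using sigma'_sigma by blast

lemma d_lin: "i \<in> {2..N} \<Longrightarrow> K_linear_on K (Al (i - 1)) (d i n)"
  and d_0: "i \<in> {2..N} \<Longrightarrow> r \<in> Al (i - 1) \<Longrightarrow> d i 0 r = r"
  and d_mult: "i \<in> {2..N} \<Longrightarrow> r \<in> Al (i - 1) \<Longrightarrow> s \<in> Al (i - 1) \<Longrightarrow>
     d i n (r \<otimes> s) = (\<Oplus>m\<in>{0..n}. (\<sigma> i ^^ (n - m)) (d i m r) \<otimes> d i (n - m) s)"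
  and d_sigma: "i \<in> {2..N} \<Longrightarrow> r \<in> Al (i - 1) \<Longrightarrow> d i n (\<sigma> i r) = q i [^] n \<otimes> \<sigma> i (d i n r)"
  using d_higher[of i] unfolding higher_skew_derivation_def by blast+

lemma d_closed: "i \<in> {2..N} \<Longrightarrow> r \<in> Al (i - 1) \<Longrightarrow> d i n r \<in> Al (i - 1)"
  and d_add: "i \<in> {2..N} \<Longrightarrow> r \<in> Al (i - 1) \<Longrightarrow> s \<in> Al (i - 1) \<Longrightarrow> d i n (r \<oplus> s) = d i n r \<oplus> d i n s"
  and d_smult: "i \<in> {2..N} \<Longrightarrow> k \<in> K \<Longrightarrow> r \<in> Al (i - 1) \<Longrightarrow> d i n (k \<otimes> r) = k \<otimes> d i n r"
  using d_lin[of i n] unfolding K_linear_on_def by auto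

lemma d_nil: "i \<in> {2..N} \<Longrightarrow> r \<in> Al (i - 1) \<Longrightarrow> \<exists>m. \<forall>n\<ge>m. d i n r = \<zero>"
  using d_nilpotent[of i] unfolding locally_nilpotent_def by blast

lemma d_iter: "i \<in> {2..N} \<Longrightarrow> r \<in> Al (i - 1) \<Longrightarrow> d i n (d i m r) = qbinomial (q i) (n + m) m \<otimes> d i (n + m) r"
  using d_iterative[of i] unfolding iterative_def by blast

context
  fixes j assumes j: "j \<in> {2..N}"
begin

lemma j_le: "j - 1 \<le> N" using j by auto

lemma sigma'_pow_closed: "a \<in> Al (j - 1) \<Longrightarrow> (\<sigma>' j ^^ n) a \<in> Al (j - 1)"
  by (induct n) (auto simp: sigma'_closed[OF j])

lemma sigma'_add: "a \<in> Al (j - 1) \<Longrightarrow> b \<in> Al (j - 1) \<Longrightarrow> \<sigma>' j (a \<oplus> b) = \<sigma>' j a \<oplus> \<sigma>' j b"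
  using subringE(7)[OF Al_subring[OF j_le]] by (intro sigma'_eqI[OF j]) (auto simp: sigma_add[OF j] sigma'_closed[OF j] sigma_sigma'[OF j])

lemma sigma'_mult: "a \<in> Al (j - 1) \<Longrightarrow> b \<in> Al (j - 1) \<Longrightarrow> \<sigma>' j (a \<otimes> b) = \<sigma>' j a \<otimes> \<sigma>' j b"
  using subringE(6)[OF Al_subring[OF j_le]] by (intro sigma'_eqI[OF j]) (auto simp: sigma_mult[OF j] sigma'_closed[OF j] sigma_sigma'[OF j])

lemma sigma'_K: "k \<in> K \<Longrightarrow> \<sigma>' j k = k"
  by (intro sigma'_eqI[OF j]) (auto simp: sigma_K[OF j] K_subalg)

lemma sigma'_pow_add: "a \<in> Al (j - 1) \<Longrightarrow> b \<in> Al (j - 1) \<Longrightarrow> (\<sigma>' j ^^ n) (a \<oplus> b) = (\<sigma>' j ^^ n) a \<oplus> (\<sigma>' j ^^ n) b"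
  by (induct n) (auto simp: sigma'_add sigma'_pow_closed)

lemma sigma'_pow_mult: "a \<in> Al (j - 1) \<Longrightarrow> b \<in> Al (j - 1) \<Longrightarrow> (\<sigma>' j ^^ n) (a \<otimes> b) = (\<sigma>' j ^^ n) a \<otimes> (\<sigma>' j ^^ n) b"
  by (induct n) (auto simp: sigma'_mult sigma'_pow_closed)

lemma sigma'_pow_K: "k \<in> K \<Longrightarrow> (\<sigma>' j ^^ n) k = k"
  by (induct n) (auto simp: sigma'_K)

lemma q_pow_K [simp]: "q j [^] (n::nat) \<in> K" "q j [^] (n::nat) \<noteq> \<zero>"
  using q_K[OF j] by auto

lemma sigma'_smult: "k \<in> K \<Longrightarrow> a \<in> Al (j - 1) \<Longrightarrow> (\<sigma>' j ^^ n) (k \<otimes> a) = k \<otimes> (\<sigma>' j ^^ n) a"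
  by (simp add: sigma'_pow_mult K_subalg sigma'_pow_K)

lemma sigma_smult: "k \<in> K \<Longrightarrow> a \<in> Al (j - 1) \<Longrightarrow> \<sigma> j (k \<otimes> a) = k \<otimes> \<sigma> j a"
  by (simp add: sigma_mult[OF j] K_subalg sigma_K[OF j])

lemma smult_Al: "k \<in> K \<Longrightarrow> a \<in> Al (j - 1) \<Longrightarrow> k \<otimes> a \<in> Al (j - 1)"
  using subringE(6)[OF Al_subring[OF j_le]] K_subalg by blast

lemma d_sigma':
  assumes a: "a \<in> Al (j - 1)" shows "\<sigma>' j (d j n a) = q j [^] n \<otimes> d j n (\<sigma>' j a)"
proof (rule sigma'_eqI[OF j])
  have c: "\<sigma>' j a \<in> Al (j - 1)" "d j n (\<sigma>' j a) \<in> Al (j - 1)" using a sigma'_closed[OF j] d_closed[OF j] by auto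
  then show "q j [^] n \<otimes> d j n (\<sigma>' j a) \<in> Al (j - 1)" using smult_Al by simp
  show "\<sigma> j (q j [^] n \<otimes> d j n (\<sigma>' j a)) = d j n a"
    using d_sigma[OF j c(1), of n] c a by (simp add: sigma_smult sigma_sigma'[OF j])
qed

lemma d_sigma'_pow:
  assumes a: "a \<in> Al (j - 1)"
  shows "(\<sigma>' j ^^ m) (d j n a) = q j [^] (n * m) \<otimes> d j n ((\<sigma>' j ^^ m) a)"
proof (induct m)
  case 0 then show ?case using d_closed[OF j a] Al_carrier[OF j_le] by simp
next
  case (Suc m)
  let ?a = "(\<sigma>' j ^^ m) a"
  have c: "?a \<in> Al (j - 1)" "d j n ?a \<in> Al (j - 1)" "\<sigma>' j ?a \<in> Al (j - 1)" "d j n (\<sigma>' j ?a) \<in> Al (j - 1)"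
    using a sigma'_pow_closed d_closed[OF j] sigma'_closed[OF j] by auto
  have "(\<sigma>' j ^^ Suc m) (d j n a) = \<sigma>' j (q j [^] (n * m) \<otimes> d j n ?a)" using Suc by simp
  also have "\<dots> = q j [^] (n * m) \<otimes> (q j [^] n \<otimes> d j n (\<sigma>' j ?a))"
    using sigma'_smult[of "q j [^] (n * m)" _ "Suc 0"] c d_sigma' by simp
  also have "\<dots> = q j [^] (n * m + n) \<otimes> d j n (\<sigma>' j ?a)"
    using q_K(1)[OF j] Al_carrier[OF j_le c(4)] by (simp add: nat_pow_mult[symmetric] m_assoc)
  finally show ?case by (simp add: add.commute)
qed

text \<open>Removes the powers of \<sigma>_j that the twisted Leibniz rule puts in front of a d_n:
  they cancel against inner inverse powers at the price of a power of q_j.\<close>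

lemma d_sigma_pow:
  assumes a: "a \<in> Al (j - 1)"
  shows "q j [^] (n * m) \<otimes> (\<sigma> j ^^ m) (d j n ((\<sigma>' j ^^ m) a)) = d j n a"
proof -
  have d: "d j n ((\<sigma>' j ^^ m) a) \<in> Al (j - 1)" using a sigma'_pow_closed d_closed[OF j] by auto
  have sp: "(\<sigma> j ^^ m) b \<in> Al (j - 1)" if "b \<in> Al (j - 1)" for b m
    using that by (induct m) (auto simp: sigma_closed[OF j])
  have "(\<sigma> j ^^ m) (k \<otimes> b) = k \<otimes> (\<sigma> j ^^ m) b" if "k \<in> K" "b \<in> Al (j - 1)" for k b
    using that sp by (induct m) (auto simp: sigma_smult)
  then have "q j [^] (n * m) \<otimes> (\<sigma> j ^^ m) (d j n ((\<sigma>' j ^^ m) a)) = (\<sigma> j ^^ m) ((\<sigma>' j ^^ m) (d j n a))"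
    using d d_sigma'_pow[OF a, of m n] by simp
  also have "\<dots> = d j n a"
  proof -
    have "(\<sigma> j ^^ m) ((\<sigma>' j ^^ m) b) = b" if "b \<in> Al (j - 1)" for b
      using that
    proof (induct m arbitrary: b)
      case (Suc m)
      have "(\<sigma> j ^^ Suc m) ((\<sigma>' j ^^ Suc m) b) = \<sigma> j ((\<sigma> j ^^ m) ((\<sigma>' j ^^ m) (\<sigma>' j b)))"
        by (simp add: funpow_swap1)
      then show ?case using Suc sigma'_closed[OF j] sigma_sigma'[OF j] by simp
    qed simp
    then show ?thesis using d_closed[OF j a] by simp
  qed
  finally show ?thesis .
qed

text \<open>Lets the nilpotency bound of b serve for d_n \<sigma>^-n(b), where the power of \<sigma>
  varies with n.\<close>

lemma d_sigma'_nil: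
  assumes "a \<in> Al (j - 1)" "d j n a = \<zero>" shows "d j n ((\<sigma>' j ^^ m) a) = \<zero>"
proof -
  have z: "\<zero> \<in> K" by simp
  have c: "d j n ((\<sigma>' j ^^ m) a) \<in> carrier F"
    using assms sigma'_pow_closed d_closed[OF j] Al_carrier[OF j_le] by auto
  have "q j [^] (n * m) \<otimes> d j n ((\<sigma>' j ^^ m) a) = \<zero>"
    using d_sigma'_pow[OF assms(1), of m n] assms(2) sigma'_pow_K[OF z] by simp
  then show ?thesis using c q_pow_K(1)[THEN K_carrier] q_K[OF j] by simp
qed

end

end


section \<open>q-binomial coefficients and commutation with inverse powers\<close>

lemma (in ring) qbinomial_closed [simp]: "p \<in> carrier R \<Longrightarrow> qbinomial p n k \<in> carrier R"
  by (induct p n k rule: qbinomial.induct) auto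

lemma (in ring) qbinomial_eq_0: "p \<in> carrier R \<Longrightarrow> n < k \<Longrightarrow> qbinomial p n k = \<zero>"
  by (induct p n k rule: qbinomial.induct) auto

lemma (in ring) qbinomial_diag: "p \<in> carrier R \<Longrightarrow> qbinomial p n n = \<one>"
  by (induct n) (auto simp: qbinomial_eq_0)

text \<open>\<open>qbinomial p (Suc n) n\<close> is the q-integer [n+1] = 1 + p + ... + p^n, and the
  identity is its geometric sum.\<close>

lemma (in ring) qbinomial_Suc:
  assumes "p \<in> carrier R"
  shows "(p \<ominus> \<one>) \<otimes> qbinomial p (Suc n) n = p [^] Suc n \<ominus> \<one>"
proof (induct n)
  case 0 then show ?case using assms by (simp add: qbinomial_eq_0)
next
  case (Suc n)
  have q: "qbinomial p (Suc (Suc n)) (Suc n) = qbinomial p (Suc n) n \<oplus> p [^] Suc n"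
    using assms qbinomial_diag[OF assms, of "Suc n"] by simp
  have "(p \<ominus> \<one>) \<otimes> qbinomial p (Suc (Suc n)) (Suc n) = (p [^] Suc n \<ominus> \<one>) \<oplus> (p \<ominus> \<one>) \<otimes> p [^] Suc n"
    unfolding q using assms Suc by (simp add: r_distr del: nat_pow_Suc qbinomial.simps)
  also have "\<dots> = p [^] Suc n \<oplus> (\<ominus> \<one> \<oplus> (p \<otimes> p [^] Suc n \<oplus> \<ominus> (p [^] Suc n)))"
    using assms by (simp add: minus_eq l_distr l_minus a_assoc del: nat_pow_Suc)
  also have "p \<otimes> p [^] Suc n = p [^] Suc (Suc n)" using assms by (rule nat_pow_Suc2[symmetric])
  also have "p [^] Suc n \<oplus> (\<ominus> \<one> \<oplus> (p [^] Suc (Suc n) \<oplus> \<ominus> (p [^] Suc n))) = p [^] Suc (Suc n) \<ominus> \<one>"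
    using assms a_lcomm[of "p [^] Suc n" "p [^] Suc (Suc n)" "\<ominus> (p [^] Suc n)"]
      a_lcomm[of "p [^] Suc n" "\<ominus> \<one>" "p [^] Suc (Suc n) \<oplus> \<ominus> (p [^] Suc n)"]
    by (simp add: minus_eq r_neg a_comm[of "\<ominus> \<one>"] del: nat_pow_Suc)
  finally show ?case .
qed

lemma (in skew_field) commute_inv_pow:
  fixes n :: nat
  assumes "a \<in> carrier R" "x \<in> carrier R" "x \<noteq> \<zero>" "c \<in> carrier R" "c \<noteq> \<zero>"
    and "a \<otimes> x = c \<otimes> (x \<otimes> a)" "\<And>y. y \<in> carrier R \<Longrightarrow> y \<otimes> c = c \<otimes> y"
  shows "c [^] n \<otimes> (a \<otimes> inv (x [^] n)) = inv (x [^] n) \<otimes> a"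
proof -
  have cn: "y \<otimes> c [^] n = c [^] n \<otimes> y" if "y \<in> carrier R" for y and n :: nat
  proof (induct n)
    case (Suc n)
    have "y \<otimes> c [^] Suc n = y \<otimes> c [^] n \<otimes> c" using that assms(4) by (simp add: m_assoc)
    also have "\<dots> = c [^] n \<otimes> (y \<otimes> c)" unfolding Suc using that assms(4) by (simp add: m_assoc)
    also have "\<dots> = c [^] Suc n \<otimes> y" using assms(7)[OF that] that assms(4) by (simp add: m_assoc)
    finally show ?case .
  qed (use that in simp)
  have "a \<otimes> x [^] n = c [^] n \<otimes> (x [^] n \<otimes> a)"
  proof (induct n)
    case (Suc n)
    have "a \<otimes> x [^] Suc n = (a \<otimes> x [^] n) \<otimes> x" using assms by (simp add: m_assoc)
    also have "\<dots> = c [^] n \<otimes> (x [^] n \<otimes> (a \<otimes> x))" unfolding Suc using assms(1-5) by (simp add: m_assoc)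
    also have "x [^] n \<otimes> (a \<otimes> x) = (x [^] n \<otimes> c) \<otimes> (x \<otimes> a)" unfolding assms(6) using assms(1-5) by (simp add: m_assoc)
    also have "x [^] n \<otimes> c = c \<otimes> x [^] n" using assms by simp
    finally show ?case using assms(1-5) by (simp add: m_assoc)
  qed (use assms in simp)
  then have "inv (x [^] n) \<otimes> (a \<otimes> x [^] n) \<otimes> inv (x [^] n) = inv (x [^] n) \<otimes> (c [^] n \<otimes> (x [^] n \<otimes> a)) \<otimes> inv (x [^] n)"
    by simp
  moreover have "inv (x [^] n) \<otimes> (c [^] n \<otimes> (x [^] n \<otimes> a)) = c [^] n \<otimes> a"
    using cn[of "inv (x [^] n)" n] assms(1-5) by (simp flip: m_assoc) (simp add: m_assoc)
  ultimately show ?thesis using assms(1-5) by (simp add: m_assoc)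
qed

section \<open>The coefficients of the deleting derivations series\<close>

context qna_root
begin

text \<open>The constants of \<open>dd_summand\<close>. They owe their shape to
  \<open>coef_add\<close> and \<open>coef_qb\<close>.\<close>

definition coef :: "nat \<Rightarrow> nat \<Rightarrow> 'a" where
  "coef j n = q j [^] (n * (n + 1) div 2) \<otimes> inv ((q j \<ominus> \<one>) [^] n)"

definition e_op :: "nat \<Rightarrow> ('a \<Rightarrow> 'a) \<Rightarrow> nat \<Rightarrow> 'a \<Rightarrow> 'a" where
  "e_op j \<theta> n b = coef j n \<otimes> \<theta> (d j n ((\<sigma>' j ^^ n) b))"

context
  fixes j assumes j: "j \<in> {2..N}"
begin

lemma qm1: "q j \<ominus> \<one> \<in> K" "q j \<ominus> \<one> \<noteq> \<zero>"
  using q_K[OF j] by (auto simp: minus_eq)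

lemma coef_K: "coef j n \<in> K" "coef j n \<noteq> \<zero>"
  unfolding coef_def using q_K[OF j] qm1 by auto

lemma coef_0: "coef j 0 = \<one>"
  unfolding coef_def by (simp add: inv_one)

text \<open>The triangular numbers of i, m and i + m differ by the cross term i m. The resulting
  factor q^(i m) is the one that \<open>d_sigma_pow\<close> consumes.\<close>

lemma coef_add: "coef j (i + m) = coef j i \<otimes> (coef j m \<otimes> q j [^] (i * m))"
proof -
  have t: "(i + m) * (i + m + 1) div 2 = i * (i + 1) div 2 + (m * (m + 1) div 2 + i * m)"
  proof -
    have "even (i * (i + 1))" "even (m * (m + 1))" by auto
    then obtain a b where a: "i * (i + 1) = 2 * a" "m * (m + 1) = 2 * b" by (meson evenE)
    have "(i + m) * (i + m + 1) = i * (i + 1) + m * (m + 1) + 2 * (i * m)" by (simp add: algebra_simps)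
    then have "(i + m) * (i + m + 1) = 2 * (a + b + i * m)" using a by simp
    then show ?thesis using a by simp
  qed
  have K: "q j [^] n \<in> K" "inv ((q j \<ominus> \<one>) [^] n) \<in> K" for n :: nat using q_K[OF j] qm1 by auto
  have "inv ((q j \<ominus> \<one>) [^] (i + m)) = inv ((q j \<ominus> \<one>) [^] i) \<otimes> inv ((q j \<ominus> \<one>) [^] m)"
    using qm1 by (subst add.commute) (simp add: nat_pow_mult[symmetric] inv_mult)
  moreover have "q j [^] ((i + m) * (i + m + 1) div 2) = q j [^] (i * (i + 1) div 2) \<otimes> (q j [^] (m * (m + 1) div 2) \<otimes> q j [^] (i * m))"
    unfolding t using q_K[OF j] by (simp add: nat_pow_mult)
  moreover have "(a \<otimes> (b \<otimes> c)) \<otimes> (u \<otimes> v) = a \<otimes> u \<otimes> ((b \<otimes> v) \<otimes> c)"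
    if k: "a \<in> K" "b \<in> K" "c \<in> K" "u \<in> K" "v \<in> K" for a b c u v
  proof -
    note kc = k[THEN K_carrier]
    have "a \<otimes> u \<otimes> ((b \<otimes> v) \<otimes> c) = a \<otimes> (u \<otimes> (b \<otimes> (v \<otimes> c)))" using kc by (simp add: m_assoc)
    also have "v \<otimes> c = c \<otimes> v" by (rule K_comm[OF k(3) kc(5)])
    also have "u \<otimes> (b \<otimes> (c \<otimes> v)) = b \<otimes> (u \<otimes> (c \<otimes> v))" by (rule K_lcomm[OF k(2) kc(4)]) (use kc in simp)
    also have "u \<otimes> (c \<otimes> v) = c \<otimes> (u \<otimes> v)" by (rule K_lcomm[OF k(3) kc(4,5)])
    finally show ?thesis using kc by (simp add: m_assoc)
  qed
  ultimately show ?thesis unfolding coef_def using K by simp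
qed

lemma coef_Suc: "coef j (Suc n) \<otimes> (q j \<ominus> \<one>) = coef j n \<otimes> q j [^] Suc n"
proof -
  have "coef j (Suc 0) = q j \<otimes> inv (q j \<ominus> \<one>)" unfolding coef_def using q_K[OF j] by simp
  then have "coef j (Suc n) = coef j n \<otimes> (q j \<otimes> inv (q j \<ominus> \<one>) \<otimes> q j [^] n)"
    using coef_add[of n "Suc 0"] by simp
  then have "coef j (Suc n) \<otimes> (q j \<ominus> \<one>) = coef j n \<otimes> (q j \<otimes> (inv (q j \<ominus> \<one>) \<otimes> (q j [^] n \<otimes> (q j \<ominus> \<one>))))"
    using coef_K q_K[OF j] qm1 by (simp add: m_assoc)
  also have "q j [^] n \<otimes> (q j \<ominus> \<one>) = (q j \<ominus> \<one>) \<otimes> q j [^] n" by (rule K_comm[OF qm1(1) K_carrier[OF q_pow_K(1)[OF j]]])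
  finally show ?thesis using qm1 q_K(1)[OF j] nat_pow_Suc2[of "q j" n] by simp
qed

lemma qb_K: "qbinomial (q j) n k \<in> K"
proof -
  have "q j \<in> K" using q_K j by blast
  then show ?thesis by (induct "q j" n k rule: qbinomial.induct) auto
qed

text \<open>Obtained by cancelling q_j - 1 alone, hence valid also when the q-integer [n+1] is zero;
  then q_j^(n+1) = 1 and both sides vanish.\<close>

lemma coef_qb: "coef j n \<otimes> qbinomial (q j) (Suc n) n = (\<one> \<ominus> inv (q j [^] Suc n)) \<otimes> coef j (Suc n)"
proof -
  let ?p = "q j" and ?b = "qbinomial (q j) (Suc n) n" and ?r = "q j [^] Suc n"
  have K: "?p \<in> K" "?b \<in> K" "?r \<in> K" "?r \<noteq> \<zero>" "inv ?r \<in> K" "coef j n \<in> K" "coef j (Suc n) \<in> K" "\<one> \<ominus> inv ?r \<in> K"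
    using q_K[OF j] qb_K coef_K by (auto simp: minus_eq simp del: nat_pow_Suc)
  note c = K(1,2,3,5,6,7,8)[THEN K_carrier]
  have "(coef j n \<otimes> ?b) \<otimes> (?p \<ominus> \<one>) = coef j n \<otimes> ((?p \<ominus> \<one>) \<otimes> ?b)"
    using c K_comm[OF qm1(1), of ?b] qm1 by (simp add: m_assoc)
  also have "\<dots> = coef j n \<otimes> (?r \<ominus> \<one>)" using qbinomial_Suc c by simp
  also have "?r \<ominus> \<one> = ?r \<otimes> (\<one> \<ominus> inv ?r)" using c K(4) by (simp add: minus_eq r_distr r_minus)
  also have "coef j n \<otimes> (?r \<otimes> (\<one> \<ominus> inv ?r)) = (\<one> \<ominus> inv ?r) \<otimes> (coef j n \<otimes> ?r)"
    using c K_comm[OF K(8), of "coef j n \<otimes> ?r"] by (simp add: m_assoc)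
  also have "\<dots> = (\<one> \<ominus> inv ?r) \<otimes> coef j (Suc n) \<otimes> (?p \<ominus> \<one>)"
    unfolding coef_Suc[symmetric] using c qm1 by (simp add: m_assoc)
  finally show ?thesis using mult_cancel_right[OF K_carrier[OF qm1(1)] qm1(2)] c by auto
qed

text \<open>The Ore relation together with d_1 d_n = [n+1] d_(n+1) gives \<open>e_x\<close>, the
  Leibniz rule gives \<open>e_mult\<close>, and iterativity gives \<open>e_range\<close>.\<close>

lemma e_op_dd_phi:
  assumes hom: "\<theta> \<in> Ring.ring_hom (F\<lparr>carrier := Al j\<rparr>) F" and inj: "\<And>a. a \<in> Al j \<Longrightarrow> \<theta> a = \<zero> \<Longrightarrow> a = \<zero>"
    and thK: "\<And>k. k \<in> K \<Longrightarrow> \<theta> k = k"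
  shows "dd_phi F K (Al (j - 1)) (\<theta> (X j)) (e_op j \<theta>) (\<sigma> j) (\<sigma>' j) (q j)"
proof -
  note tD = ring_hom_subD[OF hom]
  have jN: "j \<le> N" "1 \<le> j" using j by auto
  note Sj = Al_subring[OF jN(1)]
  have sub: "a \<in> Al j" if "a \<in> Al (j - 1)" for a using that Al_mono[of "j - 1" j] jN by auto
  have Xj: "X j \<in> Al j" using gen_subalg[of j j X] jN by simp
  have x: "\<theta> (X j) \<in> carrier F" using tD(1)[OF Xj] .
  have Xnz: "X j \<noteq> \<zero>"
  proof
    assume "X j = \<zero>"
    then have "horner (X j) [\<zero>, \<one>] = \<zero>" using X_carrier j by simp
    moreover have "set [\<zero>, \<one>] \<subseteq> Al (j - 1)" using K_subalg by simp
    ultimately have "set [\<zero>, \<one>] \<subseteq> {\<zero>}" using X_free[OF j] unfolding left_free_def by blast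
    then show False using one_not_zero by simp
  qed
  have x0: "\<theta> (X j) \<noteq> \<zero>" using inj[OF Xj] Xnz by blast
  have tsm: "\<theta> (k \<otimes> a) = k \<otimes> \<theta> a" if "k \<in> K" "a \<in> Al j" for k a
    using tD(2)[OF K_subalg that(2)] thK that by simp
  have t0: "\<theta> \<zero> = \<zero>" using thK[of \<zero>] by simp
  note S = subringE[OF Al_subring[OF j_le[OF j]]]
  have dc: "d j n ((\<sigma>' j ^^ m) b) \<in> Al (j - 1)" if "b \<in> Al (j - 1)" for n m b
    using d_closed[OF j sigma'_pow_closed[OF j that]] .
  have tc: "\<theta> a \<in> carrier F" if "a \<in> Al (j - 1)" for a using tD(1)[OF sub[OF that]] .
  have cc: "coef j n \<in> carrier F" for n using coef_K by auto
  have ez: "e_op j \<theta> n b = \<zero> \<longleftrightarrow> d j n ((\<sigma>' j ^^ n) b) = \<zero>" if "b \<in> Al (j - 1)" for n b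
    unfolding e_op_def using cc coef_K(2) tc[OF dc[OF that]] inj[OF sub[OF dc[OF that]]] t0 by auto
  have s's: "(\<sigma>' j ^^ Suc n) (\<sigma> j b) = (\<sigma>' j ^^ n) b" "\<sigma> j ((\<sigma>' j ^^ n) b) = (\<sigma>' j ^^ n) (\<sigma> j b)"
    if b: "b \<in> Al (j - 1)" for n b
  proof -
    have 1: "(\<sigma>' j ^^ Suc n) (\<sigma> j b) = (\<sigma>' j ^^ n) b" for n
      using sigma'_sigma[OF j b] by (simp add: funpow_Suc_right del: funpow.simps)
    then show "(\<sigma>' j ^^ Suc n) (\<sigma> j b) = (\<sigma>' j ^^ n) b" .
    have "\<sigma> j ((\<sigma>' j ^^ n) b) = \<sigma> j (\<sigma>' j ((\<sigma>' j ^^ n) (\<sigma> j b)))" using 1[of n] by simp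
    also have "\<dots> = (\<sigma>' j ^^ n) (\<sigma> j b)"
      using sigma_sigma'[OF j sigma'_pow_closed[OF j sigma_closed[OF j b]]] .
    finally show "\<sigma> j ((\<sigma>' j ^^ n) b) = (\<sigma>' j ^^ n) (\<sigma> j b)" .
  qed
  show ?thesis
  proof (intro dd_phi.intro central_subfield_axioms dd_phi_axioms.intro Al_subring j_le j x x0)
    show "q j \<in> K" "q j \<noteq> \<zero>" using q_K[OF j] by auto
    show "\<sigma>' j \<one> = \<one>" using sigma'_K[OF j] by simp
    show "e_op j \<theta> 0 \<one> = \<one>" using d_0[OF j S(3)] thK[of \<one>] by (simp add: e_op_def coef_0)
    \<comment> \<open>A relation over the image is the image under \<theta> of a relation over
      A_(j-1), so injectivity of \<theta> reduces the claim to freeness of X_j.\<close>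
    show "left_free (e_op j \<theta> 0 ` Al (j - 1)) (\<theta> (X j))"
      unfolding left_free_def
    proof (intro allI impI)
      have e0: "e_op j \<theta> 0 b = \<theta> b" if "b \<in> Al (j - 1)" for b
        unfolding e_op_def coef_0 using d_0[OF j that] tc[OF that] by simp
      fix ds assume ds: "set ds \<subseteq> e_op j \<theta> 0 ` Al (j - 1)" "horner (\<theta> (X j)) ds = \<zero>"
      then have "set ds \<subseteq> \<theta> ` Al (j - 1)" using e0 by auto
      then obtain cs where cs: "ds = map \<theta> cs" "set cs \<subseteq> Al (j - 1)"
        by (induct ds) (auto, metis insert_subset list.simps(15) list.simps(9))
      have "horner (X j) bs \<in> Al j \<and> \<theta> (horner (X j) bs) = horner (\<theta> (X j)) (map \<theta> bs)" if "set bs \<subseteq> Al (j - 1)" for bs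
        using that
      proof (induct bs)
        case Nil then show ?case using subringE(2)[OF Sj] t0 by simp
      next
        case (Cons b bs)
        then have b: "b \<in> Al j" "horner (X j) bs \<in> Al j" using sub by auto
        have m: "horner (X j) bs \<otimes> X j \<in> Al j" using subringE(6)[OF Sj b(2) Xj] .
        then show ?case using Cons b subringE(7)[OF Sj b(1) m] tD(3)[OF b(1) m] tD(2)[OF b(2) Xj] by simp
      qed
      then have "horner (X j) cs = \<zero>" using cs ds(2) inj by metis
      then have "set cs \<subseteq> {\<zero>}" using X_free[OF j] cs(2) unfolding left_free_def by blast
      then show "set ds \<subseteq> {\<zero>}" unfolding cs(1) using t0 by auto
    qed
    fix b assume b: "b \<in> Al (j - 1)"
    show "\<sigma> j b \<in> Al (j - 1)" "\<sigma>' j b \<in> Al (j - 1)" "\<sigma> j (\<sigma>' j b) = b"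
      using sigma_closed[OF j b] sigma'_closed[OF j b] sigma_sigma'[OF j b] by auto
    show "b = \<zero>" if "e_op j \<theta> 0 b = \<zero>" using that ez[OF b, of 0] d_0[OF j b] by simp
    obtain m where m: "\<forall>n\<ge>m. d j n b = \<zero>" using d_nil[OF j b] by blast
    then have "\<forall>n\<ge>m. e_op j \<theta> n b = \<zero>" using ez[OF b] d_sigma'_nil[OF j b] by simp
    then show "\<exists>m. \<forall>n\<ge>m. e_op j \<theta> n b = \<zero>" by blast
    fix n
    show "e_op j \<theta> n b \<in> carrier F" unfolding e_op_def using cc tc[OF dc[OF b]] by simp
    let ?u = "d j n ((\<sigma>' j ^^ n) b)"
    have u: "?u \<in> Al (j - 1)" "?u \<in> Al j" using dc[OF b] sub by auto
    \<comment> \<open>The witness c_n d_n \<sigma>^-n(b) is the n-th coefficient before transport by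
      \<theta>. By iterativity d_k \<sigma>^-k sends it to a multiple of d_(n+k) \<sigma>^-(n+k)(b),
      which vanishes with the (n+k)-th coefficient.\<close>
    show "\<exists>u\<in>Al (j - 1). e_op j \<theta> 0 u = e_op j \<theta> n b \<and> (\<forall>k. e_op j \<theta> (n + k) b = \<zero> \<longrightarrow> e_op j \<theta> k u = \<zero>)"
    proof (intro bexI conjI allI impI)
      show cu: "coef j n \<otimes> ?u \<in> Al (j - 1)" using smult_Al[OF j coef_K(1) u(1)] .
      show "e_op j \<theta> 0 (coef j n \<otimes> ?u) = e_op j \<theta> n b"
        using d_0[OF j cu] tsm[OF coef_K(1) u(2)] cc tc[OF u(1)] unfolding e_op_def by (simp add: coef_0)
      fix k assume "e_op j \<theta> (n + k) b = \<zero>"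
      then have z: "d j (n + k) ((\<sigma>' j ^^ (n + k)) b) = \<zero>" using ez[OF b] by simp
      have "(\<sigma>' j ^^ k) (coef j n \<otimes> ?u) = coef j n \<otimes> (q j [^] (n * k) \<otimes> d j n ((\<sigma>' j ^^ k) ((\<sigma>' j ^^ n) b)))"
        using sigma'_smult[OF j coef_K(1) u(1)] d_sigma'_pow[OF j sigma'_pow_closed[OF j b]] by simp
      also have "(\<sigma>' j ^^ k) ((\<sigma>' j ^^ n) b) = (\<sigma>' j ^^ (n + k)) b" by (simp add: funpow_add add.commute)
      finally have 1: "(\<sigma>' j ^^ k) (coef j n \<otimes> ?u) = coef j n \<otimes> (q j [^] (n * k) \<otimes> d j n ((\<sigma>' j ^^ (n + k)) b))" .
      have "d j k (d j n ((\<sigma>' j ^^ (n + k)) b)) = \<zero>"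
        using d_iter[OF j sigma'_pow_closed[OF j b], of k n "n + k"] z q_K(1)[OF j] by (simp add: add.commute)
      then have "d j k ((\<sigma>' j ^^ k) (coef j n \<otimes> ?u)) = \<zero>"
        unfolding 1 using d_smult[OF j coef_K(1)] d_smult[OF j q_pow_K(1)[OF j]] smult_Al[OF j q_pow_K(1)[OF j] dc[OF b]] dc[OF b] cc q_K(1)[OF j]
        by simp
      then show "e_op j \<theta> k (coef j n \<otimes> ?u) = \<zero>" using ez[OF cu] by simp
    qed
    show "\<theta> (X j) \<otimes> e_op j \<theta> n b = inv (q j [^] n) \<otimes> (e_op j \<theta> n (\<sigma> j b) \<otimes> \<theta> (X j)) \<oplus>
       (\<one> \<ominus> inv (q j [^] Suc n)) \<otimes> e_op j \<theta> (Suc n) (\<sigma> j b)"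
    proof -
      let ?v = "d j n ((\<sigma>' j ^^ n) (\<sigma> j b))" and ?w = "d j (Suc n) ((\<sigma>' j ^^ Suc n) (\<sigma> j b))"
      have vw: "?v \<in> Al (j - 1)" "?w \<in> Al (j - 1)" by (rule dc[OF sigma_closed[OF j b]])+
      have iq: "inv (q j [^] n) \<in> K" using q_pow_K[OF j] by simp
      have "?v = q j [^] n \<otimes> \<sigma> j ?u"
        using d_sigma[OF j sigma'_pow_closed[OF j b], of n n] s's(2)[OF b, of n] by simp
      then have su: "\<sigma> j ?u = inv (q j [^] n) \<otimes> ?v"
        using q_pow_K[OF j] Al_carrier[OF j_le[OF j] sigma_closed[OF j u(1)]] by simp
      \<comment> \<open>Iterativity with d_1 = \<delta> replaces the derivation by the next higher
        one, with the q-integer [n+1] as factor.\<close>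
      have "\<delta> j ?u = d j 1 ?u" using d_one[OF j u(1)] by simp
      also have "\<dots> = qbinomial (q j) (Suc n) n \<otimes> d j (Suc n) ((\<sigma>' j ^^ n) b)"
        using d_iter[OF j sigma'_pow_closed[OF j b], of 1 n n] by (simp add: One_nat_def)
      finally have du: "\<delta> j ?u = qbinomial (q j) (Suc n) n \<otimes> ?w" unfolding s's(1)[OF b] .
      have "\<theta> (X j) \<otimes> e_op j \<theta> n b = coef j n \<otimes> \<theta> (X j \<otimes> ?u)"
        unfolding e_op_def using K_lcomm[OF coef_K(1) x tc[OF u(1)]] tD(2)[OF Xj u(2)] by simp
      also have "X j \<otimes> ?u = (inv (q j [^] n) \<otimes> ?v) \<otimes> X j \<oplus> qbinomial (q j) (Suc n) n \<otimes> ?w"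
        using X_rel[OF j u(1)] su du by simp
      also have "\<theta> \<dots> = inv (q j [^] n) \<otimes> \<theta> ?v \<otimes> \<theta> (X j) \<oplus> qbinomial (q j) (Suc n) n \<otimes> \<theta> ?w"
      proof -
        have m1: "inv (q j [^] n) \<otimes> ?v \<in> Al j" "qbinomial (q j) (Suc n) n \<otimes> ?w \<in> Al j"
          using sub[OF smult_Al[OF j iq vw(1)]] sub[OF smult_Al[OF j qb_K vw(2)]] by auto
        show ?thesis
          using tD(3)[OF subringE(6)[OF Sj m1(1) Xj] m1(2)] tD(2)[OF m1(1) Xj] tsm[OF iq sub[OF vw(1)]] tsm[OF qb_K sub[OF vw(2)], of "Suc n" n]
          by simp
      qed
      also have "coef j n \<otimes> (inv (q j [^] n) \<otimes> \<theta> ?v \<otimes> \<theta> (X j) \<oplus> qbinomial (q j) (Suc n) n \<otimes> \<theta> ?w)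
          = inv (q j [^] n) \<otimes> (coef j n \<otimes> \<theta> ?v \<otimes> \<theta> (X j)) \<oplus> (coef j n \<otimes> qbinomial (q j) (Suc n) n) \<otimes> \<theta> ?w"
        using cc K_carrier[OF iq] K_carrier[OF qb_K] tc[OF vw(1)] tc[OF vw(2)] x
          K_lcomm[OF iq cc[of n], of "\<theta> ?v \<otimes> \<theta> (X j)"]
        by (simp add: r_distr m_assoc del: qbinomial.simps)
      also have "\<dots> = inv (q j [^] n) \<otimes> (e_op j \<theta> n (\<sigma> j b) \<otimes> \<theta> (X j)) \<oplus> (\<one> \<ominus> inv (q j [^] Suc n)) \<otimes> e_op j \<theta> (Suc n) (\<sigma> j b)"
        unfolding coef_qb e_op_def using cc q_pow_K[OF j, of "Suc n"] tc[OF vw(2)] by (simp add: m_assoc minus_eq del: nat_pow_Suc funpow.simps)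
      finally show ?thesis .
    qed
    fix a assume a: "a \<in> Al (j - 1)"
    show "e_op j \<theta> n (b \<oplus> a) = e_op j \<theta> n b \<oplus> e_op j \<theta> n a"
      unfolding e_op_def sigma'_pow_add[OF j b a] d_add[OF j sigma'_pow_closed[OF j b] sigma'_pow_closed[OF j a]]
      using tD(3)[OF sub[OF dc[OF b]] sub[OF dc[OF a]]] cc tc[OF dc[OF a]] tc[OF dc[OF b]] by (simp add: r_distr)
    show "e_op j \<theta> n (b \<otimes> a) = (\<Oplus>i\<in>{..n}. e_op j \<theta> i b \<otimes> e_op j \<theta> (n - i) ((\<sigma>' j ^^ i) a))"
    proof -
      let ?f = "\<lambda>i. (\<sigma> j ^^ (n - i)) (d j i ((\<sigma>' j ^^ n) b)) \<otimes> d j (n - i) ((\<sigma>' j ^^ n) a)"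
      have sp: "(\<sigma> j ^^ m) c \<in> Al (j - 1)" if "c \<in> Al (j - 1)" for c m
        using that by (induct m) (auto simp: sigma_closed[OF j])
      have f: "?f i \<in> Al (j - 1)" for i using S(6) sp dc a b by blast
      have fs: "(\<Oplus>i\<in>A. ?f i) \<in> Al (j - 1) \<and> \<theta> (\<Oplus>i\<in>A. ?f i) = (\<Oplus>i\<in>A. \<theta> (?f i))" if "finite A" for A
        using that
      proof (induct A)
        case empty then show ?case using S(2) t0 by simp
      next
        case (insert i A)
        have "(\<Oplus>i\<in>insert i A. ?f i) = ?f i \<oplus> (\<Oplus>i\<in>A. ?f i)"
          using insert f Al_carrier[OF j_le[OF j]] by (intro finsum_insert) auto
        moreover have "(\<Oplus>i\<in>insert i A. \<theta> (?f i)) = \<theta> (?f i) \<oplus> (\<Oplus>i\<in>A. \<theta> (?f i))"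
          using insert tc[OF f] by (intro finsum_insert) auto
        ultimately show ?case using insert S(7)[OF f] tD(3)[OF sub[OF f] sub] by simp
      qed
      have "d j n ((\<sigma>' j ^^ n) (b \<otimes> a)) = (\<Oplus>i\<in>{..n}. ?f i)"
        unfolding sigma'_pow_mult[OF j b a] d_mult[OF j sigma'_pow_closed[OF j b] sigma'_pow_closed[OF j a]]
        by (simp add: atMost_atLeast0)
      then have "e_op j \<theta> n (b \<otimes> a) = (\<Oplus>i\<in>{..n}. coef j n \<otimes> \<theta> (?f i))"
        unfolding e_op_def using fs[of "{..n}"] tc[OF f] cc by (simp add: finsum_rdistr)
      also have "\<dots> = (\<Oplus>i\<in>{..n}. e_op j \<theta> i b \<otimes> e_op j \<theta> (n - i) ((\<sigma>' j ^^ i) a))"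
      proof (rule finsum_cong')
        fix i assume i: "i \<in> {..n}"
        let ?m = "n - i"
        let ?g = "(\<sigma> j ^^ ?m) (d j i ((\<sigma>' j ^^ n) b))" and ?h = "d j ?m ((\<sigma>' j ^^ n) a)" and ?b = "d j i ((\<sigma>' j ^^ i) b)"
        have n: "n = ?m + i" "n = i + ?m" using i by auto
        have g: "?g \<in> Al (j - 1)" "?h \<in> Al (j - 1)" "?b \<in> Al (j - 1)" using sp dc a b by auto
        have "(\<sigma>' j ^^ n) b = (\<sigma>' j ^^ ?m) ((\<sigma>' j ^^ i) b)" using n(1) funpow_add[of ?m i "\<sigma>' j"] by simp
        \<comment> \<open>Here the factor q^(i m) supplied by \<open>coef_add\<close> is used
          up.\<close>
        then have "q j [^] (i * ?m) \<otimes> ?g = ?b" using d_sigma_pow[OF j sigma'_pow_closed[OF j b], of i ?m i] by simp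
        then have e1: "q j [^] (i * ?m) \<otimes> \<theta> ?g = \<theta> ?b" using tsm[OF q_pow_K(1)[OF j] sub[OF g(1)]] by metis
        have e2: "(\<sigma>' j ^^ n) a = (\<sigma>' j ^^ ?m) ((\<sigma>' j ^^ i) a)" using n(1) funpow_add[of ?m i "\<sigma>' j"] by simp
        have c: "\<theta> ?g \<in> carrier F" "\<theta> ?h \<in> carrier F" "\<theta> ?b \<in> carrier F" "q j [^] (i * ?m) \<in> carrier F"
          using tc g q_K(1)[OF j] by auto
        have "coef j n \<otimes> \<theta> (?f i) = coef j i \<otimes> (coef j ?m \<otimes> q j [^] (i * ?m)) \<otimes> (\<theta> ?g \<otimes> \<theta> ?h)"
          using coef_add[of i ?m] n(2) tD(2)[OF sub[OF g(1)] sub[OF g(2)]] by simp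
        also have "\<dots> = coef j i \<otimes> (coef j ?m \<otimes> (\<theta> ?b \<otimes> \<theta> ?h))"
          unfolding e1[symmetric] using c cc by (simp add: m_assoc)
        also have "\<dots> = (coef j i \<otimes> \<theta> ?b) \<otimes> (coef j ?m \<otimes> \<theta> ?h)"
          using c cc K_lcomm[OF coef_K(1) c(3) c(2), of ?m] by (simp add: m_assoc)
        finally show "coef j n \<otimes> \<theta> (?f i) = e_op j \<theta> i b \<otimes> e_op j \<theta> ?m ((\<sigma>' j ^^ i) a)"
          unfolding e_op_def e2 .
      next
        have "e_op j \<theta> k c \<in> carrier F" if "c \<in> Al (j - 1)" for k c unfolding e_op_def using cc tc[OF dc[OF that]] by simp
        then show "(\<lambda>i. e_op j \<theta> i b \<otimes> e_op j \<theta> (n - i) ((\<sigma>' j ^^ i) a)) \<in> {..n} \<rightarrow> carrier F"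
          using b sigma'_pow_closed[OF j a] by auto
      qed simp
      finally show ?thesis .
    qed
  qed
qed

end

end


lemma ring_hom_image_subring:
  assumes "ring R" "ring Q" "subring B R" "h \<in> Ring.ring_hom (R\<lparr>carrier := B\<rparr>) Q"
  shows "subring (h ` B) Q"
proof -
  interpret Q: ring Q by fact
  note hD = ring_hom_subD[OF assms(4)] and S = subringE[OF assms(3)]
  show ?thesis
  proof (rule Q.subringI)
    show "h ` B \<subseteq> carrier Q" using hD(1) by auto
    show "\<one>\<^bsub>Q\<^esub> \<in> h ` B" using hD(4) S(3) by (metis imageI)
    fix a assume "a \<in> h ` B"
    then obtain b where b: "b \<in> B" "a = h b" by blast
    show "\<ominus>\<^bsub>Q\<^esub> a \<in> h ` B" using ring_hom_sub_neg[OF assms b(1)] S(5)[OF b(1)] b(2) by (metis imageI)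
    fix a' assume "a' \<in> h ` B"
    then obtain b' where b': "b' \<in> B" "a' = h b'" by blast
    show "a \<otimes>\<^bsub>Q\<^esub> a' \<in> h ` B" "a \<oplus>\<^bsub>Q\<^esub> a' \<in> h ` B"
      using hD(2,3)[OF b(1) b'(1)] S(6,7)[OF b(1) b'(1)] b(2) b'(2) by (metis imageI)+
  qed
qed

lemma ring_hom_on_subset:
  "h \<in> Ring.ring_hom (R\<lparr>carrier := B\<rparr>) Q \<Longrightarrow> C \<subseteq> B \<Longrightarrow> h \<in> Ring.ring_hom (R\<lparr>carrier := C\<rparr>) Q"
  by (intro ring_hom_memI) (auto dest: ring_hom_subD simp: subset_iff)

lemma (in central_subfield) subalg_image:
  assumes X: "\<And>i. i \<in> {1..n} \<Longrightarrow> X i \<in> carrier R" and h: "h \<in> Ring.ring_hom (R\<lparr>carrier := subalg K X n\<rparr>) R"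
    and hK: "\<And>k. k \<in> K \<Longrightarrow> h k = k" and hX: "\<And>i. i \<in> {1..n} \<Longrightarrow> h (X i) = y i"
  shows "h ` subalg K X n = subalg K y n"
proof
  have S: "subring (subalg K X n) R" by (rule subalg_subring) (rule X)
  have XR: "X ` {1..n} \<subseteq> carrier R" using X by auto
  note hD = ring_hom_subD[OF h]
  have y: "y i \<in> carrier R" if "i \<in> {1..n}" for i using hX[OF that] hD(1)[OF gen_subalg, of i] that by auto
  have Sy: "subring (subalg K y n) R" by (rule subalg_subring) (rule y)
  have "subring (h ` subalg K X n) R" by (rule ring_hom_image_subring[OF ring_axioms ring_axioms S h])
  moreover have "K \<subseteq> h ` subalg K X n" using hK K_subalg by (metis imageI subsetI)
  moreover have "y i \<in> h ` subalg K X n" if "i \<in> {1..n}" for i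
    using hX[OF that] gen_subalg[of i n X] that by (metis atLeastAtMost_iff imageI)
  ultimately show "subalg K y n \<subseteq> h ` subalg K X n" by (rule subalg_min)
  show "h ` subalg K X n \<subseteq> subalg K y n"
  proof (rule image_subsetI)
    fix a assume "a \<in> subalg K X n"
    from this XR show "h a \<in> subalg K y n"
    proof (induct rule: subalg_induct)
      case (K k) then show ?case using hK K_subalg by simp
    next
      case (gen i) then show ?case using hX gen_subalg by simp
    next
      case (neg a) then show ?case
        using ring_hom_sub_neg[OF ring_axioms ring_axioms S h neg(1)] subringE(5)[OF Sy] by simp
    next
      case (add a b) then show ?case using hD(3) subringE(7)[OF Sy] by simp
    next
      case (mult a b) then show ?case using hD(2) subringE(6)[OF Sy] by simp
    qed
  qed
qed

section \<open>The algebras A^(j) and the embedded copies of A_(j-1)\<close>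

context qna_root
begin

text \<open>
  \<open>Phi j\<close> is the embedding \<open>A\<^bsub>j-1\<^esub> \<rightarrow> F\<close> with \<open>X\<^sub>i \<mapsto> X\<^sub>i\<^bsup>(j)\<^esup>\<close>, that is, the inverse of
  \<open>dd_iso (j - 1)\<close>.
\<close>

primrec PhiR :: "nat \<Rightarrow> 'a \<Rightarrow> 'a" where
  "PhiR 0 = (\<lambda>b. b)"
| "PhiR (Suc k) = dd_phi.phi F (PhiR k (X (N - k))) (e_op (N - k) (PhiR k))"

definition Phi :: "nat \<Rightarrow> 'a \<Rightarrow> 'a" where "Phi j = PhiR (N + 1 - j)"

lemma Phi_top: "Phi (N + 1) = (\<lambda>b. b)"
  unfolding Phi_def by simp

lemma Phi_step:
  assumes "j \<in> {2..N}" shows "Phi j = dd_phi.phi F (Phi (j + 1) (X j)) (e_op j (Phi (j + 1)))"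
proof -
  have "N + 1 - j = Suc (N - j)" "N + 1 - (j + 1) = N - j" "N - (N - j) = j" using assms by auto
  then show ?thesis unfolding Phi_def by simp
qed

lemma dd_gen_top: "dd_gen (N + 1) = X"
  unfolding dd_gen_def by simp

lemma dd_gen_step:
  assumes "j \<in> {2..N}" shows "dd_gen j = dd_step j (dd_gen (j + 1))"
proof -
  have "N + 1 - j = Suc (N - j)" "N + 1 - (j + 1) = N - j" "N - (N - j) = j" using assms by auto
  then show ?thesis unfolding dd_gen_def by simp
qed

text \<open>Level j looks like an iterated Ore extension whose derivations are deleted from index j
  on: a copy of A_(j-1) through \<open>Phi j\<close>, and later generators that act on it by
  \<sigma>_i alone. Freeness is established separately, in \<open>dd_free\<close>.\<close>

definition dd_inv :: "nat \<Rightarrow> bool" where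
  "dd_inv j \<longleftrightarrow>
     Phi j \<in> Ring.ring_hom (F\<lparr>carrier := Al (j - 1)\<rparr>) F \<and> (\<forall>a\<in>Al (j - 1). Phi j a = \<zero> \<longrightarrow> a = \<zero>) \<and>
     (\<forall>k\<in>K. Phi j k = k) \<and> (\<forall>i\<in>{1..j-1}. dd_gen j i = Phi j (X i)) \<and>
     (\<forall>i\<in>{j..N}. dd_gen j i \<in> carrier F - {\<zero>}) \<and>
     (\<forall>i\<in>{j..N}. \<forall>b\<in>Al (j - 1). dd_gen j i \<otimes> Phi j b = Phi j (\<sigma> i b) \<otimes> dd_gen j i) \<and>
     (\<forall>i\<in>{j..N}. \<forall>m\<in>{j..<i}. dd_gen j i \<otimes> dd_gen j m = lam i m \<otimes> (dd_gen j m \<otimes> dd_gen j i))"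

lemma dd_invD:
  assumes "dd_inv j"
  shows "Phi j \<in> Ring.ring_hom (F\<lparr>carrier := Al (j - 1)\<rparr>) F"
    "\<And>a. a \<in> Al (j - 1) \<Longrightarrow> Phi j a = \<zero> \<Longrightarrow> a = \<zero>" "\<And>k. k \<in> K \<Longrightarrow> Phi j k = k"
    "\<And>i. i \<in> {1..j-1} \<Longrightarrow> dd_gen j i = Phi j (X i)"
    "\<And>i. i \<in> {j..N} \<Longrightarrow> dd_gen j i \<in> carrier F" "\<And>i. i \<in> {j..N} \<Longrightarrow> dd_gen j i \<noteq> \<zero>"
    "\<And>i b. i \<in> {j..N} \<Longrightarrow> b \<in> Al (j - 1) \<Longrightarrow> dd_gen j i \<otimes> Phi j b = Phi j (\<sigma> i b) \<otimes> dd_gen j i"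
    "\<And>i m. i \<in> {j..N} \<Longrightarrow> m \<in> {j..<i} \<Longrightarrow> dd_gen j i \<otimes> dd_gen j m = lam i m \<otimes> (dd_gen j m \<otimes> dd_gen j i)"
  using assms unfolding dd_inv_def by auto

lemma dd_inv_top: "dd_inv (N + 1)"
  unfolding dd_inv_def Phi_top dd_gen_top
  using Al_carrier[of N] by (auto intro!: ring_hom_memI)

lemma X_nonzero: assumes "j \<in> {1..N}" shows "X j \<noteq> \<zero>"
proof
  assume "X j = \<zero>"
  then have h: "horner (X j) [\<zero>, \<one>] = \<zero>" by simp
  have s: "set [\<zero>, \<one>] \<subseteq> Al n" for n using K_subalg by simp
  have "left_free (Al (j - 1)) (X j)"
    using X_free[of j] X_one_free assms subalg_0[of X] by (cases "j = 1") auto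
  then have "set [\<zero>, \<one>] \<subseteq> {\<zero>}" using h s unfolding left_free_def by blast
  then show False using one_not_zero by simp
qed

lemma dd_gen_carrier:
  assumes inv: "dd_inv j" and j: "2 \<le> j" "j \<le> N + 1" and i: "i \<in> {1..N}"
  shows "dd_gen j i \<in> carrier F" "dd_gen j i \<noteq> \<zero>"
proof -
  note D = dd_invD[OF inv]
  have "dd_gen j i \<in> carrier F \<and> dd_gen j i \<noteq> \<zero>"
  proof (cases "i < j")
    case True
    then have i': "i \<in> {1..j-1}" "X i \<in> Al (j - 1)" using i gen_subalg[of i "j - 1" X] by auto
    then show ?thesis using D(4)[OF i'(1)] ring_hom_subD(1)[OF D(1) i'(2)] D(2)[OF i'(2)] X_nonzero[OF i] by auto
  next
    case False then show ?thesis using D(5,6)[of i] i by auto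
  qed
  then show "dd_gen j i \<in> carrier F" "dd_gen j i \<noteq> \<zero>" by auto
qed

lemma dd_gen_rel:
  assumes inv: "dd_inv j" and j: "2 \<le> j" "j \<le> N + 1" and i: "i \<in> {j..N}" "m \<in> {1..<i}"
  shows "dd_gen j i \<otimes> dd_gen j m = lam i m \<otimes> (dd_gen j m \<otimes> dd_gen j i)"
proof (cases "m < j")
  case True
  note D = dd_invD[OF inv]
  have m: "m \<in> {1..j-1}" "m \<in> {1..N}" "X m \<in> Al (j - 1)" "i \<in> {2..N}" "i \<in> {1..N}" using True i j gen_subalg[of m "j - 1" X] by auto
  have lk: "lam i m \<in> K" using lam_K m by blast
  have "dd_gen j i \<otimes> Phi j (X m) = Phi j (lam i m \<otimes> X m) \<otimes> dd_gen j i"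
    using D(7)[OF i(1) m(3)] sigma_gen[OF m(4) i(2)] by simp
  also have "Phi j (lam i m \<otimes> X m) = lam i m \<otimes> Phi j (X m)"
    using ring_hom_subD(2)[OF D(1) K_subalg[OF lk] m(3)] D(3)[OF lk] by simp
  finally show ?thesis unfolding D(4)[OF m(1)]
    using lk ring_hom_subD(1)[OF D(1) m(3)] D(5)[OF i(1)] by (simp add: m_assoc)
qed (use dd_invD(8)[OF inv i(1)] i in auto)

lemma subalg_Phi:
  assumes inv: "dd_inv j" and j: "2 \<le> j" "j \<le> N + 1" and n: "n \<le> j - 1"
  shows "subalg K (dd_gen j) n = Phi j ` Al n"
proof (rule subalg_image[symmetric])
  note D = dd_invD[OF inv]
  have nN: "n \<le> N" "j - 1 \<le> N" using n j by auto
  show "X i \<in> carrier F" if "i \<in> {1..n}" for i using that nN X_carrier by auto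
  show "Phi j \<in> Ring.ring_hom (F\<lparr>carrier := Al n\<rparr>) F"
    using ring_hom_on_subset[OF D(1) Al_mono[OF n nN(2)]] .
  show "Phi j k = k" if "k \<in> K" for k using D(3)[OF that] .
  show "Phi j (X i) = dd_gen j i" if "i \<in> {1..n}" for i using D(4)[of i] that n by auto
qed

text \<open>\<open>dd_iso\<close> is a choice. The inverse of \<open>Phi (j + 1)\<close> on A_(j-1)
  shows that a candidate exists, and any candidate composed with \<open>Phi (j + 1)\<close> is the
  identity because it fixes \<open>K\<close> and the generators.\<close>

lemma dd_iso_Phi:
  assumes j: "j \<in> {2..N}" and inv: "dd_inv (j + 1)" and a: "a \<in> Al (j - 1)"
  shows "dd_iso j (dd_gen (j + 1)) (Phi (j + 1) a) = a"
    "inv_into (subalg K (dd_gen (j + 1)) (j - 1)) (dd_iso j (dd_gen (j + 1))) a = Phi (j + 1) a"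
proof -
  let ?x = "dd_gen (j + 1)" and ?P = "Phi (j + 1)"
  note D = dd_invD[OF inv, unfolded add_diff_cancel_right']
  have jN: "j - 1 \<le> N" "j \<le> N" "j - 1 \<le> j" using j by auto
  note S = Al_subring[OF jN(1)]
  have img: "subalg K ?x (j - 1) = ?P ` Al (j - 1)" using subalg_Phi[OF inv, of "j - 1"] j by auto
  have hom: "?P \<in> Ring.ring_hom (F\<lparr>carrier := Al (j - 1)\<rparr>) F" using ring_hom_on_subset[OF D(1) Al_mono[OF jN(3,2)]] .
  have inj: "inj_on ?P (Al (j - 1))"
  proof (rule inj_onI)
    fix b c assume b: "b \<in> Al (j - 1)" "c \<in> Al (j - 1)" "?P b = ?P c"
    have mc: "\<ominus> c \<in> Al (j - 1)" "b \<oplus> \<ominus> c \<in> Al (j - 1)" using subringE(5,7)[OF S] b by auto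
    have "?P (b \<oplus> \<ominus> c) = ?P b \<oplus> \<ominus> ?P c"
      using ring_hom_subD(3)[OF hom b(1) mc(1)] ring_hom_sub_neg[OF ring_axioms ring_axioms S hom b(2)] by simp
    then have "?P (b \<oplus> \<ominus> c) = \<zero>" using b(3) ring_hom_subD(1)[OF hom b(2)] by (simp add: r_neg)
    then have "b \<oplus> \<ominus> c = \<zero>" using D(2) mc(2) Al_mono[OF jN(3,2)] by blast
    then show "b = c" using Al_carrier[OF jN(1)] b(1,2) by (metis minus_eq r_right_minus_eq)
  qed
  have iso: "?P \<in> ring_iso (F\<lparr>carrier := Al (j - 1)\<rparr>) (F\<lparr>carrier := subalg K ?x (j - 1)\<rparr>)"
    using ring_hom_subD[OF hom] inj img by (intro ring_iso_memI) (auto simp: bij_betw_def)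
  let ?Q = "\<lambda>\<theta>. \<theta> \<in> ring_iso (F\<lparr>carrier := subalg K ?x (j-1)\<rparr>) (F\<lparr>carrier := Al (j-1)\<rparr>) \<and>
     (\<forall>k\<in>K. \<theta> k = k) \<and> (\<forall>i\<in>{1..j-1}. \<theta> (?x i) = X i)"
  have "?Q (inv_into (Al (j - 1)) ?P)"
  proof (intro conjI ballI)
    show "inv_into (Al (j - 1)) ?P \<in> ring_iso (F\<lparr>carrier := subalg K ?x (j-1)\<rparr>) (F\<lparr>carrier := Al (j-1)\<rparr>)"
      using ring_iso_set_sym[OF Al_ring[OF jN(1)] iso] by simp
    show "inv_into (Al (j - 1)) ?P k = k" if "k \<in> K" for k
      using inv_into_f_f[OF inj K_subalg[OF that]] D(3)[OF that] by simp
    show "inv_into (Al (j - 1)) ?P (?x i) = X i" if "i \<in> {1..j-1}" for i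
      using inv_into_f_f[OF inj gen_subalg, of i] D(4)[of i] that by auto
  qed
  from someI[of ?Q, OF this] have Q: "?Q (dd_iso j ?x)" unfolding dd_iso_def .
  let ?g = "dd_iso j ?x"
  have ghom: "?g \<in> Ring.ring_hom (F\<lparr>carrier := subalg K ?x (j-1)\<rparr>) (F\<lparr>carrier := Al (j-1)\<rparr>)"
    using Q unfolding ring_iso_def by blast
  have XR: "X ` {1..j-1} \<subseteq> carrier F" using X_carrier jN by auto
  have g: "?g (?P b) = b" if "b \<in> Al (j - 1)" for b
  proof (rule ring_hom_eq_on_generate[OF ring_axioms Al_ring[OF jN(1)]])
    show "b \<in> generate_ring F (K \<union> X ` {1..j-1})" using that unfolding subalg_def .
    show "K \<union> X ` {1..j-1} \<subseteq> carrier F" using XR by auto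
    show "subring (Al (j - 1)) F" by fact
    show "K \<union> X ` {1..j-1} \<subseteq> Al (j - 1)" using K_subalg gen_subalg[of _ "j - 1" X] by auto
    show "(\<lambda>b. b) \<in> Ring.ring_hom (F\<lparr>carrier := Al (j - 1)\<rparr>) (F\<lparr>carrier := Al (j - 1)\<rparr>)"
      by (rule ring_hom_memI) auto
    show "(\<lambda>b. ?g (?P b)) \<in> Ring.ring_hom (F\<lparr>carrier := Al (j - 1)\<rparr>) (F\<lparr>carrier := Al (j - 1)\<rparr>)"
    proof -
      have "?P \<in> Ring.ring_hom (F\<lparr>carrier := Al (j - 1)\<rparr>) (F\<lparr>carrier := subalg K ?x (j-1)\<rparr>)"
        using iso unfolding ring_iso_def by blast
      then have "?g \<circ> ?P \<in> Ring.ring_hom (F\<lparr>carrier := Al (j - 1)\<rparr>) (F\<lparr>carrier := Al (j - 1)\<rparr>)"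
        using ghom by (rule ring_hom_trans)
      then show ?thesis unfolding comp_def .
    qed
    show "?g (?P z) = z" if zK: "z \<in> K \<union> X ` {1..j-1}" for z
    proof (cases "z \<in> K")
      case True then show ?thesis using Q D(3) by auto
    next
      case False
      then obtain i where i: "i \<in> {1..j-1}" "z = X i" using zK by auto
      then have "?P z = ?x i" using D(4)[of i] by auto
      then show ?thesis using Q i by auto
    qed
  qed
  show "?g (?P a) = a" using g[OF a] .
  have "inj_on ?g (subalg K ?x (j - 1))" using Q unfolding ring_iso_def bij_betw_def by auto
  then show "inv_into (subalg K ?x (j - 1)) ?g a = ?P a"
    using inv_into_f_f[of ?g "subalg K ?x (j - 1)" "?P a"] g[OF a] img a by auto
qed

section \<open>One step of the algorithm\<close>

context
  fixes j assumes j: "j \<in> {2..N}" and inv: "dd_inv (j + 1)"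
begin

lemmas upper_invD = dd_invD[OF inv, unfolded add_diff_cancel_right']

lemma x_j: "dd_gen (j + 1) j = Phi (j + 1) (X j)"
  using upper_invD(4)[of j] j by auto

lemma dd_phi_j: "dd_phi F K (Al (j - 1)) (dd_gen (j + 1) j) (e_op j (Phi (j + 1))) (\<sigma> j) (\<sigma>' j) (q j)"
  unfolding x_j using e_op_dd_phi[OF j upper_invD(1,2,3)] .

lemma Phi_j: "Phi j = dd_phi.phi F (dd_gen (j + 1) j) (e_op j (Phi (j + 1)))"
  unfolding x_j using Phi_step[OF j] .

lemma dd_gen_ge: "j \<le> i \<Longrightarrow> dd_gen j i = dd_gen (j + 1) i"
  unfolding dd_gen_step[OF j] dd_step_def by simp

interpretation P: dd_phi F K "Al (j - 1)" "dd_gen (j + 1) j" "e_op j (Phi (j + 1))" "\<sigma> j" "\<sigma>' j" "q j"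
  by (rule dd_phi_j)

lemma coef_carrier: "coef j n \<in> carrier F"
  using coef_K[OF j] by simp

lemma d_sigma'_pow_closed: "b \<in> Al (j - 1) \<Longrightarrow> d j n ((\<sigma>' j ^^ m) b) \<in> Al (j - 1)"
  using d_closed[OF j sigma'_pow_closed[OF j]] .

lemma Al_sub: "b \<in> Al (j - 1) \<Longrightarrow> b \<in> Al j"
  using Al_mono[of "j - 1" j] j by auto

text \<open>Once \<open>dd_iso\<close> is known to undo \<open>Phi (j + 1)\<close>, the summands of
  \<open>dd_step\<close> are literally those of \<open>P.phi\<close>.\<close>

lemma dd_gen_less: assumes i: "i \<in> {1..j-1}" shows "dd_gen j i = Phi j (X i)"
proof -
  have Xi: "X i \<in> Al (j - 1)" using gen_subalg[of i "j - 1" X] i by auto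
  have xi: "dd_gen (j + 1) i = Phi (j + 1) (X i)" using upper_invD(4)[of i] i by auto
  have u: "d j n ((\<sigma>' j ^^ n) (X i)) \<in> Al (j - 1)" for n using d_sigma'_pow_closed[OF Xi] .
  have c: "Phi (j + 1) (d j n ((\<sigma>' j ^^ n) (X i))) \<in> carrier F" for n
    using ring_hom_subD(1)[OF upper_invD(1) Al_sub[OF u]] .
  have "dd_op j (dd_gen (j + 1)) n (dd_gen (j + 1) i) = Phi (j + 1) (d j n ((\<sigma>' j ^^ n) (X i)))" for n
    unfolding dd_op_def xi dd_iso_Phi(1)[OF j inv Xi] \<sigma>'_def[symmetric] using dd_iso_Phi(2)[OF j inv u] .
  then have ds: "dd_summand j (dd_gen (j + 1)) i = (\<lambda>n. e_op j (Phi (j + 1)) n (X i) \<otimes> P.xi n)"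
    unfolding dd_summand_def e_op_def coef_def P.xi_def by simp
  have "i < j" using i by auto
  then show ?thesis
    unfolding dd_gen_step[OF j] dd_step_def Phi_j P.phi_def ds by simp
qed

text \<open>By \<open>K\<close>-linearity e_n k = k e_n \<one>, which is zero for n > 0.\<close>

lemma Phi_j_K: assumes k: "k \<in> K" shows "Phi j k = k"
proof -
  have e: "e_op j (Phi (j + 1)) n k = k \<otimes> e_op j (Phi (j + 1)) n \<one>" for n
  proof -
    have o: "\<one> \<in> Al (j - 1)" "\<one> \<in> K" using K_subalg by auto
    have dm: "d j n \<one> \<in> Al (j - 1)" using d_closed[OF j o(1)] .
    have "d j n k = k \<otimes> d j n \<one>" using d_smult[OF j k o(1)] k by simp
    then have "Phi (j + 1) (d j n k) = k \<otimes> Phi (j + 1) (d j n \<one>)"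
      using ring_hom_subD(2)[OF upper_invD(1) K_subalg[OF k] Al_sub[OF dm]] upper_invD(3)[OF k] by simp
    then show ?thesis
      unfolding e_op_def sigma'_pow_K[OF j k] sigma'_pow_K[OF j o(2)]
      using K_lcomm[OF k coef_carrier ring_hom_subD(1)[OF upper_invD(1) Al_sub[OF dm]]] by simp
  qed
  have kB: "k \<in> Al (j - 1)" using K_subalg[OF k] .
  have "P.phi k = P.psum (Suc 0) k" using P.e_one e k by (intro P.phi_psum) (auto simp: kB)
  also have "\<dots> = k" using kB k e[of 0] by (simp add: P.psum_Suc P.xi_0 P.e_0_one)
  finally show ?thesis unfolding Phi_j .
qed

text \<open>Passing the i-th generator through the n-th summand produces \<lambda>_{i,j}^n from the
  coefficient, by \<open>sigma_d\<close>, and the inverse power from x_j^-n; they cancel term by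
  term.\<close>

lemma dd_gen_conj_gt:
  assumes i: "i \<in> {j+1..N}" and b: "b \<in> Al (j - 1)"
  shows "dd_gen j i \<otimes> Phi j b = Phi j (\<sigma> i b) \<otimes> dd_gen j i"
proof -
  let ?y = "dd_gen (j + 1) i" and ?x = "dd_gen (j + 1) j" and ?e = "e_op j (Phi (j + 1))"
  have i': "i \<in> {2..N}" "i \<in> {1..N}" "j \<in> {1..N}" "j - 1 < i" "j < i" using i j by auto
  have Xj: "X j \<in> Al j" using gen_subalg[of j j X] j by auto
  have y: "?y \<in> carrier F" "?y \<noteq> \<zero>" using upper_invD(5,6)[OF i] by auto
  have lk: "lam i j \<in> K" "lam i j \<noteq> \<zero>" using lam_K[OF i'(2,3)] by auto
  have yx: "?y \<otimes> ?x = lam i j \<otimes> (?x \<otimes> ?y)"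
    using dd_gen_rel[OF inv, of i j] i i' j by auto
  have xin: "lam i j [^] n \<otimes> (?y \<otimes> P.xi n) = P.xi n \<otimes> ?y" for n
    unfolding P.xi_def using commute_inv_pow[OF y(1) P.x K_carrier[OF lk(1)] lk(2) yx K_comm[OF lk(1)]] .
  have sb: "\<sigma> i c \<in> Al (j - 1)" if "c \<in> Al (j - 1)" for c using sigma_sub[OF i'(1,4) that] .
  have ss: "\<sigma> i ((\<sigma>' j ^^ n) b) = (\<sigma>' j ^^ n) (\<sigma> i b)" for n
  proof (induct n)
    case (Suc n)
    let ?b = "(\<sigma>' j ^^ n) b"
    have bm: "?b \<in> Al (j - 1)" "\<sigma>' j ?b \<in> Al (j - 1)" using sigma'_pow_closed[OF j b] sigma'_closed[OF j] by auto
    have "\<sigma> i (\<sigma>' j ?b) = \<sigma>' j (\<sigma> j (\<sigma> i (\<sigma>' j ?b)))" using sigma'_sigma[OF j sb[OF bm(2)]] by simp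
    also have "\<sigma> j (\<sigma> i (\<sigma>' j ?b)) = \<sigma> i ?b"
      using sigma_commute[OF i'(1) j i'(5) bm(2)] sigma_sigma'[OF j bm(1)] by simp
    finally show ?case using Suc by simp
  qed simp
  have ye: "?y \<otimes> ?e n b = lam i j [^] n \<otimes> (?e n (\<sigma> i b) \<otimes> ?y)" for n
  proof -
    let ?u = "d j n ((\<sigma>' j ^^ n) b)" and ?v = "d j n ((\<sigma>' j ^^ n) (\<sigma> i b))"
    have u: "?u \<in> Al (j - 1)" "?v \<in> Al (j - 1)" using d_sigma'_pow_closed b sb by auto
    have ln: "lam i j [^] n \<in> K" using lk by simp
    have c: "Phi (j + 1) ?u \<in> carrier F" "Phi (j + 1) ?v \<in> carrier F"
      using ring_hom_subD(1)[OF upper_invD(1) Al_sub] u by auto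
    have su: "\<sigma> i ?u = lam i j [^] n \<otimes> ?v"
      using sigma_d[OF j, of i "(\<sigma>' j ^^ n) b" n] i sigma'_pow_closed[OF j b] ss by auto
    have "?y \<otimes> ?e n b = coef j n \<otimes> (?y \<otimes> Phi (j + 1) ?u)"
      unfolding e_op_def using K_lcomm[OF coef_K(1)[OF j] y(1) c(1)] .
    also have "?y \<otimes> Phi (j + 1) ?u = Phi (j + 1) (lam i j [^] n \<otimes> ?v) \<otimes> ?y"
      using upper_invD(7)[OF i Al_sub[OF u(1)]] su by simp
    also have "Phi (j + 1) (lam i j [^] n \<otimes> ?v) = lam i j [^] n \<otimes> Phi (j + 1) ?v"
      using ring_hom_subD(2)[OF upper_invD(1) K_subalg[OF ln] Al_sub[OF u(2)]] upper_invD(3)[OF ln] by simp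
    also have "coef j n \<otimes> (lam i j [^] n \<otimes> Phi (j + 1) ?v \<otimes> ?y) = lam i j [^] n \<otimes> (coef j n \<otimes> Phi (j + 1) ?v \<otimes> ?y)"
      using K_lcomm[OF ln coef_carrier, of "Phi (j + 1) ?v \<otimes> ?y" n] c y ln coef_carrier by (simp add: m_assoc)
    finally show ?thesis unfolding e_op_def .
  qed
  have "?y \<otimes> P.psum m b = P.psum m (\<sigma> i b) \<otimes> ?y" for m
  proof (induct m)
    case (Suc m)
    have ec: "?e m b \<in> carrier F" "?e m (\<sigma> i b) \<in> carrier F" using b sb by auto
    have lm: "lam i j [^] m \<in> K" using lk by simp
    have "?y \<otimes> (?e m b \<otimes> P.xi m) = lam i j [^] m \<otimes> (?e m (\<sigma> i b) \<otimes> (?y \<otimes> P.xi m))"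
      using ye[of m] ec y K_carrier[OF lm] by (simp flip: m_assoc)
    also have "\<dots> = ?e m (\<sigma> i b) \<otimes> (lam i j [^] m \<otimes> (?y \<otimes> P.xi m))"
      using K_lcomm[OF lm ec(2), of "?y \<otimes> P.xi m"] y by simp
    finally have "?y \<otimes> (?e m b \<otimes> P.xi m) = ?e m (\<sigma> i b) \<otimes> P.xi m \<otimes> ?y"
      unfolding xin using ec y by (simp add: m_assoc)
    then show ?case using Suc b sb ec y by (simp add: P.psum_Suc r_distr l_distr)
  qed (use y in simp)
  moreover obtain m1 where "\<forall>M\<ge>m1. P.phi b = P.psum M b" using P.phi_psum_ex[OF b] by blast
  moreover obtain m2 where "\<forall>M\<ge>m2. P.phi (\<sigma> i b) = P.psum M (\<sigma> i b)" using P.phi_psum_ex[OF sb[OF b]] by blast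
  ultimately have "?y \<otimes> P.phi b = P.phi (\<sigma> i b) \<otimes> ?y" by (metis max.cobounded1 max.cobounded2)
  then show ?thesis unfolding Phi_j using dd_gen_ge[of i] i by simp
qed

lemma dd_inv_step: "dd_inv j"
  unfolding dd_inv_def
proof (intro conjI ballI impI)
  show "Phi j \<in> Ring.ring_hom (F\<lparr>carrier := Al (j - 1)\<rparr>) F" unfolding Phi_j by (rule P.phi_hom)
  show "a = \<zero>" if "a \<in> Al (j - 1)" "Phi j a = \<zero>" for a using P.phi_inj[OF that(1)] that(2) unfolding Phi_j by simp
  show "Phi j k = k" if "k \<in> K" for k using Phi_j_K[OF that] .
  show "dd_gen j i = Phi j (X i)" if "i \<in> {1..j-1}" for i using dd_gen_less[OF that] .
  fix i assume i: "i \<in> {j..N}"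
  show "dd_gen j i \<in> carrier F - {\<zero>}"
    using dd_gen_carrier[OF inv, of i] i j dd_gen_ge by auto
  \<comment> \<open>For i = j this is \<open>P.x_phi\<close>, the point where \<delta>_j is deleted;
    for i > j it is \<open>dd_gen_conj_gt\<close>.\<close>
  show "dd_gen j i \<otimes> Phi j b = Phi j (\<sigma> i b) \<otimes> dd_gen j i" if b: "b \<in> Al (j - 1)" for b
  proof (cases "i = j")
    case True then show ?thesis using P.x_phi[OF b] dd_gen_ge[of j] unfolding Phi_j by simp
  next
    case False then show ?thesis using dd_gen_conj_gt[of i b] i b by auto
  qed
  show "dd_gen j i \<otimes> dd_gen j m = lam i m \<otimes> (dd_gen j m \<otimes> dd_gen j i)" if m: "m \<in> {j..<i}" for m
    using dd_gen_rel[OF inv, of i m] i m j dd_gen_ge[of i] dd_gen_ge[of m] by auto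
qed

end

lemma dd_inv_all:
  assumes "2 \<le> j" "j \<le> N + 1" shows "dd_inv j"
  using assms(2,1)
proof (induct j rule: inc_induct)
  case base show ?case by (rule dd_inv_top)
next
  case (step n) then show ?case using dd_inv_step[of n, unfolded Suc_eq_plus1[symmetric]] by auto
qed

end

section \<open>Completely prime ideals and fractions\<close>


lemma (in ideal) rcos_eq_self_iff:
  assumes "a \<in> carrier R" shows "I +> a = I \<longleftrightarrow> a \<in> I"
  using a_rcos_const[of a] a_rcos_self[OF assms] by auto

lemma completely_prime_iff:
  assumes "ring R"
  shows "completely_prime P R \<longleftrightarrow> ideal P R \<and> \<one>\<^bsub>R\<^esub> \<notin> P \<and>
    (\<forall>a\<in>carrier R. \<forall>b\<in>carrier R. a \<otimes>\<^bsub>R\<^esub> b \<in> P \<longrightarrow> a \<in> P \<or> b \<in> P)"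
proof (cases "ideal P R")
  case True
  then interpret ideal P R .
  interpret Q: ring "R Quot P" by (rule quotient_is_ring)
  have zero: "\<zero>\<^bsub>R Quot P\<^esub> = P" and one: "\<one>\<^bsub>R Quot P\<^esub> = P +>\<^bsub>R\<^esub> \<one>\<^bsub>R\<^esub>"
    and carr: "carrier (R Quot P) = a_rcosets\<^bsub>R\<^esub> P" unfolding FactRing_def by auto
  have mult: "(P +>\<^bsub>R\<^esub> a) \<otimes>\<^bsub>R Quot P\<^esub> (P +>\<^bsub>R\<^esub> b) = P +>\<^bsub>R\<^esub> (a \<otimes>\<^bsub>R\<^esub> b)"
    if "a \<in> carrier R" "b \<in> carrier R" for a b
    using that rcoset_mult_add[of a b] unfolding FactRing_def by simp
  have mem: "P +>\<^bsub>R\<^esub> a = P \<longleftrightarrow> a \<in> P" if "a \<in> carrier R" for a using rcos_eq_self_iff[OF that] .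
  have cos: "x \<in> carrier (R Quot P) \<longleftrightarrow> (\<exists>a\<in>carrier R. x = P +>\<^bsub>R\<^esub> a)" for x
    unfolding carr A_RCOSETS_def' by auto
  have "nc_domain (R Quot P) \<longleftrightarrow> \<one>\<^bsub>R\<^esub> \<notin> P \<and>
    (\<forall>a\<in>carrier R. \<forall>b\<in>carrier R. a \<otimes>\<^bsub>R\<^esub> b \<in> P \<longrightarrow> a \<in> P \<or> b \<in> P)" (is "?L \<longleftrightarrow> ?R")
  proof
    assume ?L
    then interpret nc_domain "R Quot P" .
    have "\<one>\<^bsub>R\<^esub> \<notin> P" using one_not_zero mem unfolding one zero by auto
    moreover have "a \<in> P \<or> b \<in> P" if ab: "a \<in> carrier R" "b \<in> carrier R" "a \<otimes>\<^bsub>R\<^esub> b \<in> P" for a b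
    proof -
      have "P +>\<^bsub>R\<^esub> a \<in> carrier (R Quot P)" "P +>\<^bsub>R\<^esub> b \<in> carrier (R Quot P)" using ab cos by auto
      moreover have "(P +>\<^bsub>R\<^esub> a) \<otimes>\<^bsub>R Quot P\<^esub> (P +>\<^bsub>R\<^esub> b) = \<zero>\<^bsub>R Quot P\<^esub>"
        unfolding mult[OF ab(1,2)] zero using mem ab by auto
      ultimately have "P +>\<^bsub>R\<^esub> a = P \<or> P +>\<^bsub>R\<^esub> b = P" using integral zero by metis
      then show ?thesis using mem ab by auto
    qed
    ultimately show ?R by blast
  next
    assume R: ?R
    show ?L
    proof (intro nc_domain.intro Q.ring_axioms nc_domain_axioms.intro)
      show "\<one>\<^bsub>R Quot P\<^esub> \<noteq> \<zero>\<^bsub>R Quot P\<^esub>" using R mem unfolding one zero by auto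
      fix x y assume "x \<in> carrier (R Quot P)" "y \<in> carrier (R Quot P)" and xy: "x \<otimes>\<^bsub>R Quot P\<^esub> y = \<zero>\<^bsub>R Quot P\<^esub>"
      then obtain a b where ab: "a \<in> carrier R" "b \<in> carrier R" "x = P +>\<^bsub>R\<^esub> a" "y = P +>\<^bsub>R\<^esub> b" unfolding cos by blast
      have "a \<otimes>\<^bsub>R\<^esub> b \<in> P" using xy mult[OF ab(1,2)] mem[of "a \<otimes>\<^bsub>R\<^esub> b"] ab unfolding zero by auto
      then show "x = \<zero>\<^bsub>R Quot P\<^esub> \<or> y = \<zero>\<^bsub>R Quot P\<^esub>" using R mem ab unfolding zero by blast
    qed
  qed
  then show ?thesis using True unfolding completely_prime_def by blast
qed (simp add: completely_prime_def)

context skew_field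
begin

text \<open>
  \<open>\<iota>\<close> identifies \<open>D\<close> with \<open>Frac(C/P)\<close>.  Denominators are required to be central, which makes
  both Ore conditions trivial.
\<close>

definition frac_datum :: "'a set \<Rightarrow> 'a set \<Rightarrow> 'a set \<Rightarrow> bool" where
  "frac_datum C P D \<longleftrightarrow> (\<exists>\<iota>. \<iota> \<in> Ring.ring_hom (R\<lparr>carrier := C\<rparr>) R \<and> \<iota> ` C \<subseteq> D \<and>
     (\<forall>a\<in>C. \<iota> a = \<zero> \<longleftrightarrow> a \<in> P) \<and>
     (\<forall>y\<in>D. \<exists>a\<in>C. \<exists>s\<in>C. \<iota> s \<noteq> \<zero> \<and> (\<forall>u\<in>D. \<iota> s \<otimes> u = u \<otimes> \<iota> s) \<and> y = \<iota> a \<otimes> inv (\<iota> s)))"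

text \<open>Elementwise form of complete primeness for a subring, free of quotient rings; see
  \<open>CSpec_iff_cprime\<close>.\<close>

definition cprime :: "'a set \<Rightarrow> 'a set \<Rightarrow> bool" where
  "cprime P C \<longleftrightarrow> P \<subseteq> C \<and> \<zero> \<in> P \<and> (\<forall>a\<in>P. \<forall>b\<in>P. a \<oplus> b \<in> P) \<and> (\<forall>a\<in>P. \<ominus> a \<in> P) \<and>
     (\<forall>a\<in>P. \<forall>c\<in>C. a \<otimes> c \<in> P \<and> c \<otimes> a \<in> P) \<and> \<one> \<notin> P \<and> (\<forall>a\<in>C. \<forall>b\<in>C. a \<otimes> b \<in> P \<longrightarrow> a \<in> P \<or> b \<in> P)"

lemma cprimeD:
  assumes "cprime P C"
  shows "\<And>a. a \<in> P \<Longrightarrow> a \<in> C" "\<zero> \<in> P" "\<And>a b. a \<in> P \<Longrightarrow> b \<in> P \<Longrightarrow> a \<oplus> b \<in> P" "\<And>a. a \<in> P \<Longrightarrow> \<ominus> a \<in> P"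
    "\<And>a c. a \<in> P \<Longrightarrow> c \<in> C \<Longrightarrow> a \<otimes> c \<in> P" "\<And>a c. a \<in> P \<Longrightarrow> c \<in> C \<Longrightarrow> c \<otimes> a \<in> P" "\<one> \<notin> P"
    "\<And>a b. a \<in> C \<Longrightarrow> b \<in> C \<Longrightarrow> a \<otimes> b \<in> P \<Longrightarrow> a \<in> P \<or> b \<in> P"
  using assms unfolding cprime_def by blast+

lemma subring_ideal_iff:
  assumes C: "subring C R"
  shows "ideal P (R\<lparr>carrier := C\<rparr>) \<longleftrightarrow> P \<subseteq> C \<and> \<zero> \<in> P \<and> (\<forall>a\<in>P. \<forall>b\<in>P. a \<oplus> b \<in> P) \<and> (\<forall>a\<in>P. \<ominus> a \<in> P) \<and>
     (\<forall>a\<in>P. \<forall>c\<in>C. a \<otimes> c \<in> P \<and> c \<otimes> a \<in> P)" (is "?L \<longleftrightarrow> ?R")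
proof -
  interpret C: ring "R\<lparr>carrier := C\<rparr>" by (rule subring_is_ring[OF C])
  have neg: "\<ominus>\<^bsub>R\<lparr>carrier := C\<rparr>\<^esub> a = \<ominus> a" if "a \<in> C" for a
  proof (rule C.minus_equality)
    show "\<ominus> a \<oplus>\<^bsub>R\<lparr>carrier := C\<rparr>\<^esub> a = \<zero>\<^bsub>R\<lparr>carrier := C\<rparr>\<^esub>" using that subringE(1)[OF C] by (auto simp: l_neg)
  qed (use that subringE(5)[OF C] in auto)
  show ?thesis
  proof
    assume ?L
    then interpret ideal P "R\<lparr>carrier := C\<rparr>" .
    have sub: "P \<subseteq> C" using a_subset by simp
    moreover have "\<ominus> a \<in> P" if "a \<in> P" for a 
      using I_l_closed[OF that, of "\<ominus> \<one>"] that sub subringE(1,3,5)[OF C] by (auto simp: l_minus subset_iff)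
    ultimately show ?R using additive_subgroup.zero_closed[OF is_additive_subgroup] additive_subgroup.a_closed[OF is_additive_subgroup]
        I_l_closed I_r_closed by auto
  next
    assume R: ?R
    show ?L
    proof (rule idealI[OF C.ring_axioms])
      show "subgroup P (add_monoid (R\<lparr>carrier := C\<rparr>))"
      proof (rule group.subgroupI[OF C.add.is_group])
        show "inv\<^bsub>add_monoid (R\<lparr>carrier := C\<rparr>)\<^esub> a \<in> P" if "a \<in> P" for a
          using R neg[of a] that unfolding a_inv_def[symmetric] by auto
      qed (use R in auto)
    qed (use R in auto)
  qed
qed

lemma CSpec_iff_cprime:
  assumes C: "subring C R" shows "P \<in> CSpec (R\<lparr>carrier := C\<rparr>) \<longleftrightarrow> cprime P C"
  unfolding CSpec_def cprime_def mem_Collect_eq completely_prime_iff[OF subring_is_ring[OF C]] subring_ideal_iff[OF C]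
  by simp

text \<open>An element central in \<open>C\<close> commutes with the images of all numerators and
  denominators. It will be applied to powers of x_j^l.\<close>

lemma frac_datum_central:
  assumes "\<iota> \<in> Ring.ring_hom (R\<lparr>carrier := C\<rparr>) R" "\<iota> ` C \<subseteq> D" and D: "D \<subseteq> carrier R"
    and frac: "\<And>y. y \<in> D \<Longrightarrow> \<exists>a\<in>C. \<exists>s\<in>C. \<iota> s \<noteq> \<zero> \<and> (\<forall>u\<in>D. \<iota> s \<otimes> u = u \<otimes> \<iota> s) \<and> y = \<iota> a \<otimes> inv (\<iota> s)"
    and z: "z \<in> C" "\<And>a. a \<in> C \<Longrightarrow> z \<otimes> a = a \<otimes> z" and u: "u \<in> D"
  shows "\<iota> z \<otimes> u = u \<otimes> \<iota> z"
proof -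
  note iD = ring_hom_subD[OF assms(1)]
  obtain a s where as: "a \<in> C" "s \<in> C" "\<iota> s \<noteq> \<zero>" "u = \<iota> a \<otimes> inv (\<iota> s)" using frac[OF u] by blast
  have c: "\<iota> z \<in> carrier R" "\<iota> a \<in> carrier R" "\<iota> s \<in> carrier R" using iD(1) as z by auto
  have za: "\<iota> z \<otimes> \<iota> b = \<iota> b \<otimes> \<iota> z" if "b \<in> C" for b using iD(2) z that by metis
  have 1: "inv (\<iota> s) \<otimes> \<iota> z = \<iota> z \<otimes> inv (\<iota> s)" using za[OF as(2)] as(3) c by (intro commute_inv) auto
  have "\<iota> z \<otimes> (\<iota> a \<otimes> inv (\<iota> s)) = \<iota> a \<otimes> (\<iota> z \<otimes> inv (\<iota> s))"
    using za[OF as(1)] c as(3) by (simp flip: m_assoc)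
  also have "\<dots> = \<iota> a \<otimes> inv (\<iota> s) \<otimes> \<iota> z" unfolding 1[symmetric] using c as(3) by (simp add: m_assoc)
  finally show ?thesis unfolding as(4) .
qed

section \<open>Transfer along a common central localisation\<close>

context
  fixes C1 C2 :: "'a set" and z P1 P2
  assumes C1: "subring C1 R" and C2: "subring C2 R" and z: "z \<in> C1" "z \<in> C2" "z \<noteq> \<zero>"
    and zc1: "\<And>a. a \<in> C1 \<Longrightarrow> z \<otimes> a = a \<otimes> z" and zc2: "\<And>a. a \<in> C2 \<Longrightarrow> z \<otimes> a = a \<otimes> z"
    and C12: "\<And>a. a \<in> C1 \<Longrightarrow> \<exists>k::nat. a \<otimes> z [^] k \<in> C2" and C21: "\<And>a. a \<in> C2 \<Longrightarrow> \<exists>k::nat. a \<otimes> z [^] k \<in> C1"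
    and P2: "cprime P2 C2" and zP2: "z \<notin> P2" and P1: "P1 = {a \<in> C1. \<exists>k::nat. a \<otimes> z [^] k \<in> P2}"
begin

lemma loc_carrier: "a \<in> C1 \<Longrightarrow> a \<in> carrier R" "a \<in> C2 \<Longrightarrow> a \<in> carrier R"
  using subringE(1)[OF C1] subringE(1)[OF C2] by auto

lemma loc_z_carrier: "z \<in> carrier R" using loc_carrier z by auto

lemma loc_pow_mem: "z [^] (k::nat) \<in> C1" "z [^] (k::nat) \<in> C2"
  using z subringE(3,6)[OF C1] subringE(3,6)[OF C2] by (induct k) auto

lemma loc_pow_commute1: "a \<in> C1 \<Longrightarrow> z [^] (k::nat) \<otimes> a = a \<otimes> z [^] k"
  using group_commutes_pow[OF zc1] loc_z_carrier loc_carrier by simp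

lemma loc_pow_commute2: "a \<in> C2 \<Longrightarrow> z [^] (k::nat) \<otimes> a = a \<otimes> z [^] k"
  using group_commutes_pow[OF zc2] loc_z_carrier loc_carrier by simp

lemma loc_pow_add: "a \<in> carrier R \<Longrightarrow> a \<otimes> z [^] (k + m :: nat) = a \<otimes> z [^] k \<otimes> z [^] m"
  using loc_z_carrier by (simp add: m_assoc nat_pow_mult)

lemma loc_pow_notin: "z [^] (k::nat) \<notin> P2"
proof (induct k)
  case (Suc k) then show ?case using cprimeD(8)[OF P2 loc_pow_mem(2) z(2), of k] zP2 by auto
qed (use cprimeD(7)[OF P2] in simp)

lemma loc_P2_iff: "a \<in> C2 \<Longrightarrow> a \<otimes> z [^] (k::nat) \<in> P2 \<longleftrightarrow> a \<in> P2"
  using cprimeD(5)[OF P2] cprimeD(8)[OF P2] loc_pow_mem(2) loc_pow_notin by blast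

lemma loc_P1_iff:
  assumes "a \<in> C1" "a \<otimes> z [^] (k::nat) \<in> C2" shows "a \<in> P1 \<longleftrightarrow> a \<otimes> z [^] k \<in> P2"
proof
  assume "a \<in> P1"
  then obtain m :: nat where m: "a \<otimes> z [^] m \<in> P2" unfolding P1 by blast
  have "a \<otimes> z [^] (m + k) = a \<otimes> z [^] k \<otimes> z [^] m" using loc_pow_add[of a k m] loc_carrier assms by (simp add: add.commute)
  moreover have "a \<otimes> z [^] (m + k) \<in> P2" using loc_pow_add[of a m k] loc_carrier assms cprimeD(5)[OF P2 m loc_pow_mem(2)] by simp
  ultimately show "a \<otimes> z [^] k \<in> P2" using loc_P2_iff[OF assms(2), of m] by simp
qed (use assms P1 in auto)

lemma loc_common_denominator: "a \<in> C1 \<Longrightarrow> b \<in> C1 \<Longrightarrow> \<exists>k::nat. a \<otimes> z [^] k \<in> C2 \<and> b \<otimes> z [^] k \<in> C2"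
proof -
  assume a: "a \<in> C1" "b \<in> C1"
  obtain k m :: nat where k: "a \<otimes> z [^] k \<in> C2" "b \<otimes> z [^] m \<in> C2" using C12 a by blast
  have "a \<otimes> z [^] (k + m) \<in> C2" using loc_pow_add[of a k m] loc_carrier a subringE(6)[OF C2 k(1) loc_pow_mem(2)] by simp
  moreover have "b \<otimes> z [^] (m + k) \<in> C2" using loc_pow_add[of b m k] loc_carrier a subringE(6)[OF C2 k(2) loc_pow_mem(2)] by simp
  ultimately show ?thesis by (metis add.commute)
qed

lemma loc_mult_pow: "a \<in> C1 \<Longrightarrow> b \<in> C1 \<Longrightarrow> a \<otimes> z [^] (k::nat) \<otimes> (b \<otimes> z [^] (m::nat)) = a \<otimes> b \<otimes> z [^] (k + m)"
  using loc_pow_commute1[of b k] loc_carrier loc_z_carrier by (simp add: m_assoc nat_pow_mult[symmetric]) (simp flip: m_assoc)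

text \<open>In the application \<open>C1\<close> is A^(j), \<open>C2\<close> is A^(j+1) and z is
  x_j^l. A high power of z moves two given elements of \<open>C1\<close> into \<open>C2\<close>,
  where \<open>P2\<close> is prime and the powers of z lie outside it.\<close>

lemma loc_cprime: "cprime P1 C1"
  unfolding cprime_def
proof (intro conjI ballI impI)
  show "P1 \<subseteq> C1" unfolding P1 by auto
  show "\<zero> \<in> P1" unfolding P1 using subringE(2)[OF C1] cprimeD(2)[OF P2] loc_z_carrier by (auto intro: exI[of _ 0])
  show "\<one> \<notin> P1" unfolding P1 using loc_pow_notin loc_z_carrier by auto
  fix a assume a: "a \<in> P1"
  then have aC: "a \<in> C1" unfolding P1 by auto
  obtain m :: nat where m: "a \<otimes> z [^] m \<in> P2" using a unfolding P1 by blast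
  have "(\<ominus> a) \<otimes> z [^] m \<in> P2" using cprimeD(4)[OF P2 m] loc_carrier aC loc_z_carrier by (simp add: l_minus)
  then show "\<ominus> a \<in> P1" unfolding P1 using subringE(5)[OF C1 aC] by blast
  {
    fix b assume b: "b \<in> C1"
    obtain k :: nat where k: "a \<otimes> z [^] k \<in> C2" "b \<otimes> z [^] k \<in> C2" using loc_common_denominator aC b by blast
    have ak: "a \<otimes> z [^] k \<in> P2" using loc_P1_iff[OF aC k(1)] a by simp
    have ab: "a \<otimes> b \<in> C1" "b \<otimes> a \<in> C1" using subringE(6)[OF C1] aC b by auto
    have "a \<otimes> b \<otimes> z [^] (k + k) \<in> P2" using loc_mult_pow[OF aC b, of k k] cprimeD(5)[OF P2 ak k(2)] by simp
    then show "a \<otimes> b \<in> P1" unfolding P1 using ab by blast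
    have "b \<otimes> a \<otimes> z [^] (k + k) \<in> P2" using loc_mult_pow[OF b aC, of k k] cprimeD(6)[OF P2 ak k(2)] by simp
    then show "b \<otimes> a \<in> P1" unfolding P1 using ab by blast
  }
  fix b assume b: "b \<in> P1"
  then have bC: "b \<in> C1" unfolding P1 by auto
  obtain k :: nat where k: "a \<otimes> z [^] k \<in> C2" "b \<otimes> z [^] k \<in> C2" using loc_common_denominator aC bC by blast
  have "a \<otimes> z [^] k \<oplus> b \<otimes> z [^] k \<in> P2" using loc_P1_iff aC bC a b k cprimeD(3)[OF P2] by auto
  then have "(a \<oplus> b) \<otimes> z [^] k \<in> P2" using loc_carrier aC bC loc_z_carrier by (simp add: l_distr)
  then show "a \<oplus> b \<in> P1" unfolding P1 using subringE(7)[OF C1 aC bC] by blast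
next
  fix a b assume ab: "a \<in> C1" "b \<in> C1" "a \<otimes> b \<in> P1"
  obtain k :: nat where k: "a \<otimes> z [^] k \<in> C2" "b \<otimes> z [^] k \<in> C2" using loc_common_denominator ab by blast
  have e: "a \<otimes> z [^] k \<otimes> (b \<otimes> z [^] k) = a \<otimes> b \<otimes> z [^] (k + k)" using loc_mult_pow ab by blast
  have "a \<otimes> b \<otimes> z [^] (k + k) \<in> C2" using e subringE(6)[OF C2 k] by simp
  then have "a \<otimes> z [^] k \<otimes> (b \<otimes> z [^] k) \<in> P2"
    using loc_P1_iff[OF subringE(6)[OF C1 ab(1,2)]] ab(3) e by metis
  then show "a \<in> P1 \<or> b \<in> P1" using cprimeD(8)[OF P2 k] loc_P1_iff ab k by blast
qed

text \<open>The map on \<open>C2\<close> has to be r |-> \<iota>(r z^k) \<iota>(z)^-k for any k with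
  r z^k in \<open>C1\<close>. Its values stay in the same \<open>D\<close>, which contains the
  inverse of \<iota>(z).\<close>

lemma loc_frac_datum:
  assumes fd: "frac_datum C1 P1 D" and D: "D \<subseteq> carrier R" and Dsub: "subring D R" "\<And>y. y \<in> D \<Longrightarrow> y \<noteq> \<zero> \<Longrightarrow> inv y \<in> D"
  shows "frac_datum C2 P2 D"
proof -
  obtain \<iota> where i: "\<iota> \<in> Ring.ring_hom (R\<lparr>carrier := C1\<rparr>) R" "\<iota> ` C1 \<subseteq> D" "\<And>a. a \<in> C1 \<Longrightarrow> \<iota> a = \<zero> \<longleftrightarrow> a \<in> P1"
    and frac: "\<And>y. y \<in> D \<Longrightarrow> \<exists>a\<in>C1. \<exists>s\<in>C1. \<iota> s \<noteq> \<zero> \<and> (\<forall>u\<in>D. \<iota> s \<otimes> u = u \<otimes> \<iota> s) \<and> y = \<iota> a \<otimes> inv (\<iota> s)"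
    using fd unfolding frac_datum_def by blast
  note iD = ring_hom_subD[OF i(1)]
  define \<zeta> where "\<zeta> = \<iota> z"
  have zP1: "z [^] (k::nat) \<notin> P1" for k
    using loc_P1_iff[OF loc_pow_mem(1), of k 0] loc_pow_mem loc_pow_notin[of k] loc_z_carrier by auto
  have zk: "\<iota> (z [^] (k::nat)) = \<zeta> [^] k" for k
  proof (induct k)
    case 0 then show ?case using iD(4) by simp
  next
    case (Suc k) then show ?case using iD(2)[OF loc_pow_mem(1) z(1), of k] unfolding \<zeta>_def by simp
  qed
  have zeta: "\<zeta> \<in> D" "\<zeta> \<in> carrier R" "\<zeta> \<noteq> \<zero>"
    using i(2) iD(1)[OF z(1)] i(3)[OF z(1)] zP1[of "Suc 0"] loc_z_carrier z(1) unfolding \<zeta>_def by auto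
  have zcom: "\<zeta> [^] (k::nat) \<otimes> u = u \<otimes> \<zeta> [^] k" if "u \<in> D" for u k
    using frac_datum_central[OF i(1,2) D frac loc_pow_mem(1) loc_pow_commute1 that, of k] zk[of k] by simp
  define W where "W k = inv (\<zeta> [^] (k::nat))" for k
  have W: "W k \<in> carrier R" "W k \<noteq> \<zero>" "W k \<otimes> u = u \<otimes> W k" if "u \<in> D" for u k
    unfolding W_def using zeta commute_inv[OF _ _ _ zcom[OF that, of k]] D that by auto
  have Wadd: "W k \<otimes> W m = W (k + m)" for k m
    unfolding W_def using zeta by (simp add: inv_mult[symmetric] nat_pow_mult add.commute)
  have zW: "\<zeta> [^] (k::nat) \<otimes> W (k + m) = W m" for k m
  proof -
    have "\<zeta> [^] k \<otimes> (W k \<otimes> W m) = W m" unfolding W_def using zeta by simp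
    then show ?thesis unfolding Wadd .
  qed
  have WD: "W k \<in> D" for k
  proof -
    have "\<zeta> [^] k \<in> D" using zeta(1) subringE(3,6)[OF Dsub(1)] by (induct k) auto
    then show ?thesis unfolding W_def using Dsub(2) zeta by simp
  qed
  define G where "G = {(r, \<iota> (r \<otimes> z [^] k) \<otimes> W k) | r k. r \<in> C2 \<and> r \<otimes> z [^] k \<in> C1}"
  have GI: "(r, \<iota> (r \<otimes> z [^] k) \<otimes> W k) \<in> G" if "r \<in> C2" "r \<otimes> z [^] k \<in> C1" for r k
    unfolding G_def using that by blast
  \<comment> \<open>The value does not depend on k, so k may be raised; this provides a common
    exponent for two elements.\<close>
  have ext: "r \<otimes> z [^] (k + m) \<in> C1 \<and> \<iota> (r \<otimes> z [^] k) \<otimes> W k = \<iota> (r \<otimes> z [^] (k + m)) \<otimes> W (k + m)"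
    if "r \<in> C2" "r \<otimes> z [^] k \<in> C1" for r and k m :: nat
  proof -
    have e: "r \<otimes> z [^] (k + m) = r \<otimes> z [^] k \<otimes> z [^] m" using loc_pow_add loc_carrier that by blast
    have "\<iota> (r \<otimes> z [^] (k + m)) \<otimes> W (k + m) = \<iota> (r \<otimes> z [^] k) \<otimes> (\<zeta> [^] m \<otimes> W (m + k))"
      unfolding e iD(2)[OF that(2) loc_pow_mem(1)] zk using iD(1)[OF that(2)] zeta W(1)[OF WD] by (simp add: m_assoc add.commute)
    then show ?thesis unfolding zW using e subringE(6)[OF C1 that(2) loc_pow_mem(1)] by simp
  qed
  have GD: "w \<in> D" if "(r, w) \<in> G" for r w
    using that i(2) WD subringE(6)[OF Dsub(1)] unfolding G_def by auto
  have common2: "\<exists>k. a \<otimes> z [^] k \<in> C1 \<and> w = \<iota> (a \<otimes> z [^] k) \<otimes> W k \<and> b \<otimes> z [^] k \<in> C1 \<and> v = \<iota> (b \<otimes> z [^] k) \<otimes> W k \<and> a \<in> C2 \<and> b \<in> C2"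
    if ab: "(a, w) \<in> G" "(b, v) \<in> G" for a w b v
  proof -
    obtain k where k: "w = \<iota> (a \<otimes> z [^] k) \<otimes> W k" "a \<in> C2" "a \<otimes> z [^] k \<in> C1" using ab(1) unfolding G_def by blast
    obtain m where m: "v = \<iota> (b \<otimes> z [^] m) \<otimes> W m" "b \<in> C2" "b \<otimes> z [^] m \<in> C1" using ab(2) unfolding G_def by blast
    show ?thesis using ext[OF k(2,3), of m] ext[OF m(2,3), of k] k m by (intro exI[of _ "k + m"]) (simp add: add.commute)
  qed
  have "\<exists>h. h \<in> Ring.ring_hom (R\<lparr>carrier := fst ` G\<rparr>) R \<and> (\<forall>a w. (a, w) \<in> G \<longrightarrow> h a = w)"
  proof (rule graph_ring_hom[OF ring_axioms ring_axioms])
    show "G \<subseteq> carrier R \<times> carrier R" using GD D loc_carrier unfolding G_def by auto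
    show "(\<one>, \<one>) \<in> G" using GI[OF subringE(3)[OF C2], of 0] subringE(3)[OF C1] iD(4) by (simp add: W_def inv_one)
    show "w = \<zero>" if "(\<zero>, w) \<in> G" for w
      using that ring_hom_sub_zero[OF ring_axioms ring_axioms C1 i(1)] W(1)[OF WD] loc_z_carrier unfolding G_def by auto
    fix a w assume aw: "(a, w) \<in> G"
    then obtain k where k: "w = \<iota> (a \<otimes> z [^] k) \<otimes> W k" "a \<in> C2" "a \<otimes> z [^] k \<in> C1" unfolding G_def by blast
    have n: "(\<ominus> a) \<otimes> z [^] k = \<ominus> (a \<otimes> z [^] k)" using k loc_carrier loc_z_carrier by (simp add: l_minus)
    show "(\<ominus> a, \<ominus> w) \<in> G"
      using GI[OF subringE(5)[OF C2 k(2)], of k] subringE(5)[OF C1 k(3)] k W(1)[OF WD] iD(1)[OF k(3)]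
        ring_hom_sub_neg[OF ring_axioms ring_axioms C1 i(1) k(3)] unfolding n by (simp add: l_minus)
    fix b v assume bv: "(b, v) \<in> G"
    obtain m where m: "a \<otimes> z [^] m \<in> C1" "w = \<iota> (a \<otimes> z [^] m) \<otimes> W m" "b \<otimes> z [^] m \<in> C1" "v = \<iota> (b \<otimes> z [^] m) \<otimes> W m" "a \<in> C2" "b \<in> C2"
      using common2[OF aw bv] by blast
    have c: "\<iota> (a \<otimes> z [^] m) \<in> carrier R" "\<iota> (b \<otimes> z [^] m) \<in> carrier R" "a \<in> carrier R" "b \<in> carrier R" "W m \<in> carrier R"
      using iD(1) m loc_carrier W(1)[OF WD] by auto
    have s: "(a \<oplus> b) \<otimes> z [^] m = a \<otimes> z [^] m \<oplus> b \<otimes> z [^] m" using c loc_z_carrier by (simp add: l_distr)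
    show "(a \<oplus> b, w \<oplus> v) \<in> G"
      using GI[OF subringE(7)[OF C2 m(5,6)], of m] subringE(7)[OF C1 m(1,3)] m(2,4) iD(3)[OF m(1,3)] c
      unfolding s by (simp add: l_distr)
    have p: "(a \<otimes> b) \<otimes> z [^] (m + m) = (a \<otimes> z [^] m) \<otimes> (b \<otimes> z [^] m)"
      using loc_pow_commute2[OF m(6), of m] c loc_z_carrier by (simp add: m_assoc nat_pow_mult[symmetric]) (simp flip: m_assoc)
    have bD: "\<iota> (b \<otimes> z [^] m) \<in> D" using i(2) m(3) by blast
    have "w \<otimes> v = \<iota> (a \<otimes> z [^] m) \<otimes> (W m \<otimes> \<iota> (b \<otimes> z [^] m)) \<otimes> W m" unfolding m(2,4) using c by (simp add: m_assoc)
    also have "\<dots> = \<iota> (a \<otimes> z [^] m) \<otimes> \<iota> (b \<otimes> z [^] m) \<otimes> (W m \<otimes> W m)" unfolding W(3)[OF bD] using c by (simp add: m_assoc)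
    finally have "w \<otimes> v = \<iota> ((a \<otimes> b) \<otimes> z [^] (m + m)) \<otimes> W (m + m)" unfolding p iD(2)[OF m(1,3)] Wadd .
    then show "(a \<otimes> b, w \<otimes> v) \<in> G"
      using GI[OF subringE(6)[OF C2 m(5,6)], of "m + m"] subringE(6)[OF C1 m(1,3)] unfolding p by simp
  qed
  then obtain h where h: "h \<in> Ring.ring_hom (R\<lparr>carrier := fst ` G\<rparr>) R" "\<And>a w. (a, w) \<in> G \<Longrightarrow> h a = w" by blast
  have "fst ` G = C2" unfolding G_def using C21 by force
  then have hh: "h \<in> Ring.ring_hom (R\<lparr>carrier := C2\<rparr>) R" using h(1) by simp
  have hr: "\<exists>k. r \<otimes> z [^] k \<in> C1 \<and> h r = \<iota> (r \<otimes> z [^] k) \<otimes> W k \<and> (r, h r) \<in> G" if "r \<in> C2" for r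
    using C21[OF that] GI[OF that] h(2) by metis
  have hv: "h (a \<otimes> z [^] k) = \<iota> a \<otimes> \<zeta> [^] k" if "a \<in> C1" "a \<otimes> z [^] k \<in> C2" for a and k :: nat
  proof -
    have m: "a \<otimes> z [^] k \<in> C1" using subringE(6)[OF C1 that(1) loc_pow_mem(1)] .
    have e: "a \<otimes> z [^] k \<otimes> z [^] (0::nat) = a \<otimes> z [^] k" using loc_carrier(1)[OF m] by simp
    have "h (a \<otimes> z [^] k) = \<iota> (a \<otimes> z [^] k) \<otimes> W 0"
      using h(2)[OF GI[OF that(2), of 0]] m unfolding e by blast
    then show ?thesis using iD(1)[OF m] iD(2)[OF that(1) loc_pow_mem(1)] zk by (simp add: W_def inv_one)
  qed
  show ?thesis unfolding frac_datum_def
  proof (intro exI[of _ h] conjI ballI hh)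
    show "h ` C2 \<subseteq> D" using hr GD by blast
    fix r assume r: "r \<in> C2"
    obtain k where k: "r \<otimes> z [^] k \<in> C1" "h r = \<iota> (r \<otimes> z [^] k) \<otimes> W k" using hr[OF r] by blast
    have "h r = \<zero> \<longleftrightarrow> r \<otimes> z [^] k \<in> P1" using k(2) i(3)[OF k(1)] iD(1)[OF k(1)] W(1,2)[OF WD] by simp
    also have "\<dots> \<longleftrightarrow> r \<in> P2"
      using loc_P1_iff[OF k(1), of 0] loc_P2_iff[OF r, of k] subringE(6)[OF C2 r loc_pow_mem(2)] loc_carrier loc_z_carrier r by simp
    finally show "h r = \<zero> \<longleftrightarrow> r \<in> P2" .
  next
    fix y assume "y \<in> D"
    then obtain a s where as: "a \<in> C1" "s \<in> C1" "\<iota> s \<noteq> \<zero>" "\<forall>u\<in>D. \<iota> s \<otimes> u = u \<otimes> \<iota> s" "y = \<iota> a \<otimes> inv (\<iota> s)"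
      using frac by blast
    \<comment> \<open>Numerator and denominator are multiplied by the same power of z, whose image
      is central and cancels.\<close>
    obtain k :: nat where k: "a \<otimes> z [^] k \<in> C2" "s \<otimes> z [^] k \<in> C2" using loc_common_denominator as by blast
    have c: "\<iota> a \<in> carrier R" "\<iota> s \<in> carrier R" "\<iota> s \<in> D" using iD(1) as i(2) by auto
    have hs: "h (s \<otimes> z [^] k) = \<iota> s \<otimes> \<zeta> [^] k" using hv as k by blast
    show "\<exists>a\<in>C2. \<exists>s\<in>C2. h s \<noteq> \<zero> \<and> (\<forall>u\<in>D. h s \<otimes> u = u \<otimes> h s) \<and> y = h a \<otimes> inv (h s)"
    proof (rule bexI[OF _ k(1)], rule bexI[OF _ k(2)], intro conjI ballI)
      show "h (s \<otimes> z [^] k) \<noteq> \<zero>" unfolding hs using c as zeta by simp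
      show "h (s \<otimes> z [^] k) \<otimes> u = u \<otimes> h (s \<otimes> z [^] k)" if u: "u \<in> D" for u
      proof -
        have uc: "u \<in> carrier R" using u D by blast
        have "\<iota> s \<otimes> \<zeta> [^] k \<otimes> u = \<iota> s \<otimes> u \<otimes> \<zeta> [^] k" using zcom[OF u, of k] c uc zeta by (simp add: m_assoc)
        also have "\<dots> = u \<otimes> (\<iota> s \<otimes> \<zeta> [^] k)" using as(4) u c uc zeta by (simp add: m_assoc)
        finally show ?thesis unfolding hs .
      qed
      have "\<iota> a \<otimes> \<zeta> [^] k \<otimes> inv (\<iota> s \<otimes> \<zeta> [^] k) = \<iota> a \<otimes> inv (\<iota> s)"
        using zcom[OF c(3), of k] c as(3) zeta by (simp add: inv_mult m_assoc)
      then show "y = h (a \<otimes> z [^] k) \<otimes> inv (h (s \<otimes> z [^] k))" unfolding hs hv[OF as(1) k(1)] as(5) by simp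
    qed
  qed
qed

end

section \<open>Transfer along a common quotient\<close>

context
  fixes C1 C2 :: "'a set" and Q :: "('q, 'm) ring_scheme" and g \<pi> :: "'a \<Rightarrow> 'q" and P1 P2
  assumes C1: "subring C1 R" and C2: "subring C2 R" and Q: "ring Q"
    and g: "g \<in> Ring.ring_hom (R\<lparr>carrier := C1\<rparr>) Q" and pi: "\<pi> \<in> Ring.ring_hom (R\<lparr>carrier := C2\<rparr>) Q"
    and C12: "\<And>a. a \<in> C1 \<Longrightarrow> \<exists>r\<in>C2. g a = \<pi> r" and C21: "\<And>r. r \<in> C2 \<Longrightarrow> \<exists>a\<in>C1. g a = \<pi> r"
    and P2: "cprime P2 C2" and ker: "\<And>r. r \<in> C2 \<Longrightarrow> \<pi> r = \<zero>\<^bsub>Q\<^esub> \<Longrightarrow> r \<in> P2"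
    and P1: "P1 = {a \<in> C1. g a \<in> \<pi> ` P2}"
begin

lemma quot_carrier: "a \<in> C1 \<Longrightarrow> a \<in> carrier R" "a \<in> C2 \<Longrightarrow> a \<in> carrier R"
  using subringE(1)[OF C1] subringE(1)[OF C2] by auto

text \<open>As \<open>P2\<close> contains the kernel of \<pi>, membership in \<open>P2\<close> can
  be read off from the image in \<open>Q\<close>.\<close>

lemma quot_kernel: assumes r: "r \<in> C2" and p: "p \<in> P2" "\<pi> r = \<pi> p" shows "r \<in> P2"
proof -
  interpret Q: ring Q by (rule Q)
  have pC: "p \<in> C2" "\<ominus> p \<in> C2" using cprimeD(1)[OF P2 p(1)] subringE(5)[OF C2] by auto
  have m: "r \<oplus> \<ominus> p \<in> C2" using subringE(7)[OF C2 r pC(2)] .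
  have "\<pi> (r \<oplus> \<ominus> p) = \<pi> r \<oplus>\<^bsub>Q\<^esub> \<ominus>\<^bsub>Q\<^esub> \<pi> p"
    using ring_hom_subD(3)[OF pi r pC(2)] ring_hom_sub_neg[OF ring_axioms Q C2 pi pC(1)] by simp
  then have "\<pi> (r \<oplus> \<ominus> p) = \<zero>\<^bsub>Q\<^esub>" using p(2) ring_hom_subD(1)[OF pi pC(1)] by (simp add: Q.r_neg)
  then have "r \<oplus> \<ominus> p \<in> P2" using ker m by blast
  then have "r \<oplus> \<ominus> p \<oplus> p \<in> P2" using cprimeD(3)[OF P2] p(1) by blast
  then show ?thesis using quot_carrier r pC by (simp add: a_assoc l_neg)
qed

lemma quot_P1_iff: assumes "a \<in> C1" "r \<in> C2" "g a = \<pi> r" shows "a \<in> P1 \<longleftrightarrow> r \<in> P2"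
proof
  assume "a \<in> P1"
  then obtain p where "p \<in> P2" "g a = \<pi> p" unfolding P1 by blast
  then show "r \<in> P2" using quot_kernel[OF assms(2)] assms(3) by simp
next
  assume "r \<in> P2"
  then show "a \<in> P1" using assms unfolding P1 by blast
qed

lemma quot_cprime: "cprime P1 C1"
proof -
  note gD = ring_hom_subD[OF g] and pD = ring_hom_subD[OF pi]
  have neg: "g (\<ominus> a) = \<pi> (\<ominus> r)" if "a \<in> C1" "r \<in> C2" "g a = \<pi> r" for a r
    using that ring_hom_sub_neg[OF ring_axioms Q C1 g] ring_hom_sub_neg[OF ring_axioms Q C2 pi] by metis
  have add: "g (a \<oplus> b) = \<pi> (r \<oplus> s)" if "a \<in> C1" "r \<in> C2" "g a = \<pi> r" "b \<in> C1" "s \<in> C2" "g b = \<pi> s" for a r b s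
    using that gD(3) pD(3) by metis
  have mult: "g (a \<otimes> b) = \<pi> (r \<otimes> s)" if "a \<in> C1" "r \<in> C2" "g a = \<pi> r" "b \<in> C1" "s \<in> C2" "g b = \<pi> s" for a r b s
    using that gD(2) pD(2) by metis
  have g01: "g \<zero> = \<pi> \<zero>" "g \<one> = \<pi> \<one>"
    using ring_hom_sub_zero[OF ring_axioms Q C1 g] ring_hom_sub_zero[OF ring_axioms Q C2 pi] gD(4) pD(4) by auto
  note S1 = subringE[OF C1] and S2 = subringE[OF C2] and PD = cprimeD[OF P2]
  show ?thesis unfolding cprime_def
  proof (intro conjI ballI impI)
    show "P1 \<subseteq> C1" unfolding P1 by auto
    show "\<zero> \<in> P1" using quot_P1_iff[OF S1(2) S2(2) g01(1)] PD(2) by simp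
    show "\<one> \<notin> P1" using quot_P1_iff[OF S1(3) S2(3) g01(2)] PD(7) by simp
    fix a assume a: "a \<in> P1"
    then have aC: "a \<in> C1" unfolding P1 by auto
    obtain r where r: "r \<in> C2" "g a = \<pi> r" using C12[OF aC] by blast
    have rP: "r \<in> P2" using quot_P1_iff[OF aC r] a by simp
    show "\<ominus> a \<in> P1" using quot_P1_iff[OF S1(5)[OF aC] S2(5)[OF r(1)] neg[OF aC r]] PD(4)[OF rP] by simp
    {
      fix b assume b: "b \<in> C1"
      obtain s where s: "s \<in> C2" "g b = \<pi> s" using C12[OF b] by blast
      show "a \<otimes> b \<in> P1" using quot_P1_iff[OF S1(6)[OF aC b] S2(6)[OF r(1) s(1)] mult[OF aC r b s]] PD(5)[OF rP s(1)] by simp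
      show "b \<otimes> a \<in> P1" using quot_P1_iff[OF S1(6)[OF b aC] S2(6)[OF s(1) r(1)] mult[OF b s aC r]] PD(6)[OF rP s(1)] by simp
    }
    fix b assume b: "b \<in> P1"
    then have bC: "b \<in> C1" unfolding P1 by auto
    obtain s where s: "s \<in> C2" "g b = \<pi> s" using C12[OF bC] by blast
    have sP: "s \<in> P2" using quot_P1_iff[OF bC s] b by simp
    show "a \<oplus> b \<in> P1" using quot_P1_iff[OF S1(7)[OF aC bC] S2(7)[OF r(1) s(1)] add[OF aC r bC s]] PD(3)[OF rP sP] by simp
  next
    fix a b assume ab: "a \<in> C1" "b \<in> C1" "a \<otimes> b \<in> P1"
    obtain r s where r: "r \<in> C2" "g a = \<pi> r" and s: "s \<in> C2" "g b = \<pi> s" using C12 ab by blast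
    have "r \<otimes> s \<in> P2" using quot_P1_iff[OF S1(6)[OF ab(1,2)] S2(6)[OF r(1) s(1)] mult[OF ab(1) r ab(2) s]] ab(3) by simp
    then show "a \<in> P1 \<or> b \<in> P1" using PD(8)[OF r(1) s(1)] quot_P1_iff[OF ab(1) r] quot_P1_iff[OF ab(2) s] by blast
  qed
qed

text \<open>Both factor rings are quotients of the common image in \<open>Q\<close> by the same
  ideal, so \<iota> can be moved over: r goes to \<iota> a for any a with g a = \<pi> r.\<close>

lemma quot_frac_datum:
  assumes fd: "frac_datum C1 P1 D"
  shows "frac_datum C2 P2 D"
proof -
  obtain \<iota> where i: "\<iota> \<in> Ring.ring_hom (R\<lparr>carrier := C1\<rparr>) R" "\<iota> ` C1 \<subseteq> D" "\<And>a. a \<in> C1 \<Longrightarrow> \<iota> a = \<zero> \<longleftrightarrow> a \<in> P1"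
    and frac: "\<And>y. y \<in> D \<Longrightarrow> \<exists>a\<in>C1. \<exists>s\<in>C1. \<iota> s \<noteq> \<zero> \<and> (\<forall>u\<in>D. \<iota> s \<otimes> u = u \<otimes> \<iota> s) \<and> y = \<iota> a \<otimes> inv (\<iota> s)"
    using fd unfolding frac_datum_def by blast
  note iD = ring_hom_subD[OF i(1)] and gD = ring_hom_subD[OF g] and pD = ring_hom_subD[OF pi]
  note S1 = subringE[OF C1] and S2 = subringE[OF C2] and PD = cprimeD[OF P2]
  define G where "G = {(r, \<iota> a) | r a. r \<in> C2 \<and> a \<in> C1 \<and> g a = \<pi> r}"
  have GI: "(r, \<iota> a) \<in> G" if "r \<in> C2" "a \<in> C1" "g a = \<pi> r" for r a unfolding G_def using that by blast
  have "\<exists>h. h \<in> Ring.ring_hom (R\<lparr>carrier := fst ` G\<rparr>) R \<and> (\<forall>a w. (a, w) \<in> G \<longrightarrow> h a = w)"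
  proof (rule graph_ring_hom[OF ring_axioms ring_axioms])
    show "G \<subseteq> carrier R \<times> carrier R" using iD(1) quot_carrier unfolding G_def by auto
    show "(\<one>, \<one>) \<in> G" using GI[OF S2(3) S1(3)] gD(4) pD(4) iD(4) by simp
    show "w = \<zero>" if G0: "(\<zero>, w) \<in> G" for w
    proof -
      obtain a where a: "w = \<iota> a" "a \<in> C1" "g a = \<pi> \<zero>" using G0 unfolding G_def by auto
      then show ?thesis using quot_P1_iff[OF a(2) S2(2) a(3)] PD(2) i(3)[OF a(2)] by simp
    qed
    fix r w assume "(r, w) \<in> G"
    then obtain a where a: "w = \<iota> a" "a \<in> C1" "g a = \<pi> r" "r \<in> C2" unfolding G_def by blast
    show "(\<ominus> r, \<ominus> w) \<in> G"
      using GI[OF S2(5)[OF a(4)] S1(5)[OF a(2)]] a ring_hom_sub_neg[OF ring_axioms Q C1 g a(2)]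
        ring_hom_sub_neg[OF ring_axioms Q C2 pi a(4)] ring_hom_sub_neg[OF ring_axioms ring_axioms C1 i(1) a(2)] by simp
    fix s v assume "(s, v) \<in> G"
    then obtain b where b: "v = \<iota> b" "b \<in> C1" "g b = \<pi> s" "s \<in> C2" unfolding G_def by blast
    show "(r \<oplus> s, w \<oplus> v) \<in> G"
      using GI[OF S2(7)[OF a(4) b(4)] S1(7)[OF a(2) b(2)]] a b gD(3)[OF a(2) b(2)] pD(3)[OF a(4) b(4)] iD(3)[OF a(2) b(2)] by simp
    show "(r \<otimes> s, w \<otimes> v) \<in> G"
      using GI[OF S2(6)[OF a(4) b(4)] S1(6)[OF a(2) b(2)]] a b gD(2)[OF a(2) b(2)] pD(2)[OF a(4) b(4)] iD(2)[OF a(2) b(2)] by simp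
  qed
  then obtain h where h: "h \<in> Ring.ring_hom (R\<lparr>carrier := fst ` G\<rparr>) R" "\<And>a w. (a, w) \<in> G \<Longrightarrow> h a = w" by blast
  have "fst ` G = C2" unfolding G_def using C21 by force
  then have hh: "h \<in> Ring.ring_hom (R\<lparr>carrier := C2\<rparr>) R" using h(1) by simp
  have hr: "h r = \<iota> a" if "r \<in> C2" "a \<in> C1" "g a = \<pi> r" for r a using h(2)[OF GI[OF that]] .
  show ?thesis unfolding frac_datum_def
  proof (intro exI[of _ h] conjI ballI hh)
    show "h ` C2 \<subseteq> D" using hr C21 i(2) by (metis image_subset_iff)
    fix r assume r: "r \<in> C2"
    obtain a where a: "a \<in> C1" "g a = \<pi> r" using C21[OF r] by blast
    show "h r = \<zero> \<longleftrightarrow> r \<in> P2" using hr[OF r a] i(3)[OF a(1)] quot_P1_iff[OF a(1) r a(2)] by simp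
  next
    fix y assume "y \<in> D"
    then obtain a s where as: "a \<in> C1" "s \<in> C1" "\<iota> s \<noteq> \<zero>" "\<forall>u\<in>D. \<iota> s \<otimes> u = u \<otimes> \<iota> s" "y = \<iota> a \<otimes> inv (\<iota> s)"
      using frac by blast
    obtain a' s' where "a' \<in> C2" "g a = \<pi> a'" "s' \<in> C2" "g s = \<pi> s'" using C12 as by blast
    then show "\<exists>a\<in>C2. \<exists>s\<in>C2. h s \<noteq> \<zero> \<and> (\<forall>u\<in>D. h s \<otimes> u = u \<otimes> h s) \<and> y = h a \<otimes> inv (h s)"
      using hr as by metis
  qed
qed

end

end


section \<open>Central powers of q-commuting elements\<close>

context central_subfield
begin

lemma commute_subalg:
  assumes y: "\<And>i. i \<in> {1..n} \<Longrightarrow> y i \<in> carrier R" and x: "x \<in> carrier R"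
    and c: "\<And>i. i \<in> {1..n} \<Longrightarrow> x \<otimes> y i = y i \<otimes> x" and a: "a \<in> subalg K y n"
  shows "x \<otimes> a = a \<otimes> x"
proof -
  have yR: "y ` {1..n} \<subseteq> carrier R" using y by auto
  from a yR show ?thesis
  proof (induct rule: subalg_induct)
    case (K k) then show ?case using K_comm[OF K x] by simp
  next
    case (gen i) then show ?case using c by simp
  next
    case (neg a) then show ?case using x by (simp add: l_minus r_minus)
  next
    case (add a b) then show ?case using x by (simp add: l_distr r_distr)
  next
    case (mult a b)
    have "x \<otimes> (a \<otimes> b) = a \<otimes> (x \<otimes> b)" using mult x m_assoc[of x a b] by (simp add: m_assoc)
    also have "\<dots> = a \<otimes> b \<otimes> x" unfolding mult(6) using mult(3,4) x by (simp add: m_assoc)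
    finally show ?case .
  qed
qed

lemma root_commute:
  assumes "a \<in> carrier R" "b \<in> carrier R" "c \<in> K" "a \<otimes> b = c \<otimes> (b \<otimes> a)" "c [^] (l::nat) = \<one>"
  shows "a [^] l \<otimes> b = b \<otimes> a [^] l" "a \<otimes> b [^] l = b [^] l \<otimes> a"
proof -
  note cR = K_carrier[OF assms(3)]
  have "a [^] n \<otimes> b = c [^] n \<otimes> (b \<otimes> a [^] n)" for n :: nat
  proof (induct n)
    case (Suc n)
    have "a [^] Suc n \<otimes> b = a [^] n \<otimes> (a \<otimes> b)" using assms(1,2) by (simp add: m_assoc)
    also have "\<dots> = c \<otimes> (a [^] n \<otimes> (b \<otimes> a))" unfolding assms(4) using assms(1-3) by (intro K_lcomm) auto
    also have "a [^] n \<otimes> (b \<otimes> a) = c [^] n \<otimes> (b \<otimes> a [^] n) \<otimes> a" using Suc assms(1,2) by (simp add: m_assoc[symmetric])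
    also have "c \<otimes> (c [^] n \<otimes> (b \<otimes> a [^] n) \<otimes> a) = c [^] Suc n \<otimes> (b \<otimes> a [^] Suc n)"
      unfolding nat_pow_Suc2[OF cR] using assms(1,2) cR by (simp add: m_assoc)
    finally show ?case .
  qed (use assms in simp)
  then show "a [^] l \<otimes> b = b \<otimes> a [^] l" using assms by simp
  have "a \<otimes> b [^] n = c [^] n \<otimes> (b [^] n \<otimes> a)" for n :: nat
  proof (induct n)
    case (Suc n)
    have "a \<otimes> b [^] Suc n = (a \<otimes> b [^] n) \<otimes> b" using assms(1,2) by (simp add: m_assoc)
    also have "\<dots> = c [^] n \<otimes> (b [^] n \<otimes> (a \<otimes> b))" unfolding Suc using assms(1,2) cR by (simp add: m_assoc)
    also have "b [^] n \<otimes> (a \<otimes> b) = c \<otimes> (b [^] n \<otimes> (b \<otimes> a))" unfolding assms(4) using assms(1-3) by (intro K_lcomm) auto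
    also have "c [^] n \<otimes> (c \<otimes> (b [^] n \<otimes> (b \<otimes> a))) = c [^] Suc n \<otimes> (b [^] Suc n \<otimes> a)"
      using assms(1,2) cR by (simp add: m_assoc)
    finally show ?case .
  qed (use assms in simp)
  then show "a \<otimes> b [^] l = b [^] l \<otimes> a" using assms by simp
qed

lemma central_mult_powers:
  assumes B: "subring B R" and z: "z \<in> B" "z \<noteq> \<zero>" and c: "\<And>a. a \<in> B \<Longrightarrow> z \<otimes> a = a \<otimes> z"
  shows "central_mult B (range (\<lambda>n::nat. z [^] n))"
proof -
  have zR: "z \<in> carrier R" using z subringE(1)[OF B] by blast
  have 1: "z [^] (n::nat) \<in> B - {\<zero>}" for n
  proof -
    have "z [^] n \<in> B" using z subringE(3,6)[OF B] by (induct n) auto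
    then show ?thesis using z zR by simp
  qed
  have 2: "z [^] (n::nat) \<otimes> a = a \<otimes> z [^] n" if "a \<in> B" for n a
    using group_commutes_pow[OF c[OF that] zR] subringE(1)[OF B] that by blast
  have 3: "z [^] (n::nat) \<otimes> z [^] (m::nat) \<in> range (\<lambda>n::nat. z [^] n)" for n m
    unfolding nat_pow_mult[OF zR] by (rule rangeI)
  have 4: "\<one> \<in> range (\<lambda>n::nat. z [^] n)" by (rule range_eqI[of _ _ 0]) simp
  show ?thesis unfolding central_mult_def
  proof (intro conjI ballI B 4 image_subsetI 1)
    show "s \<otimes> t \<in> range (\<lambda>n::nat. z [^] n)" if "s \<in> range (\<lambda>n::nat. z [^] n)" "t \<in> range (\<lambda>n::nat. z [^] n)" for s t
      using that by (elim rangeE) (simp only: 3)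
    show "s \<otimes> a = a \<otimes> s" if "s \<in> range (\<lambda>n::nat. z [^] n)" "a \<in> B" for s a
      using that(1) by (elim rangeE) (simp only: 2[OF that(2)])
  qed
qed

lemma central_loc_powersD:
  assumes "a \<in> central_loc B (range (\<lambda>n::nat. z [^] n))" "B \<subseteq> carrier R" "z \<in> carrier R" "z \<noteq> \<zero>"
  shows "\<exists>k::nat. a \<otimes> z [^] k \<in> B"
proof -
  obtain b and k :: nat where b: "a = b \<otimes> inv (z [^] k)" "b \<in> B" using assms(1) unfolding central_loc_def by blast
  then have "a \<otimes> z [^] k = b" using assms by (auto simp: m_assoc)
  then show ?thesis using b by metis
qed

text \<open>Since x^-1 = x^(l-1) (x^l)^-1, inverting the power x^l already inverts x.\<close>

lemma inv_in_central_loc: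
  assumes "subring B R" "x \<in> B" "x \<noteq> \<zero>" "0 < (l::nat)"
  shows "inv x \<in> central_loc B (range (\<lambda>n::nat. (x [^] l) [^] n))"
proof -
  have xR: "x \<in> carrier R" using assms subringE(1) by blast
  obtain m where m: "l = Suc m" using assms(4) gr0_conv_Suc by blast
  have "x [^] (n::nat) \<in> B" for n using assms(2) subringE(3,6)[OF assms(1)] by (induct n) auto
  moreover have "inv x = x [^] m \<otimes> inv ((x [^] l) [^] Suc 0)"
  proof -
    have "(x [^] l) [^] Suc 0 = x \<otimes> x [^] m" using xR unfolding m by (simp add: nat_pow_Suc2[symmetric])
    then show ?thesis using xR assms(3) by (simp add: inv_mult)
  qed
  ultimately show ?thesis unfolding central_loc_def by blast
qed

end

section \<open>Consecutive algebras A^(j) and A^(j+1)\<close>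

context qna_root
begin

abbreviation Aj :: "nat \<Rightarrow> nat \<Rightarrow> 'a set" where "Aj j n \<equiv> subalg K (dd_gen j) n"

lemma Aj_subring:
  assumes "2 \<le> j" "j \<le> N + 1" "n \<le> N" shows "subring (Aj j n) F"
  using dd_gen_carrier(1)[OF dd_inv_all[OF assms(1,2)] assms(1,2)] assms(3) by (intro subalg_subring) auto

context
  fixes j assumes j: "j \<in> {2..N}"
begin

lemma level_bounds: "2 \<le> j" "j \<le> N + 1" "2 \<le> j + 1" "j + 1 \<le> N + 1" "j \<in> {1..N}" "j \<in> {j..N}" "j \<le> N"
  using j by auto

lemmas inv_j = dd_inv_all[OF level_bounds(1,2)] and inv_Sj = dd_inv_all[OF level_bounds(3,4)]

text \<open>As the \<open>\<lambda>\<^bsub>i,m\<^esub>\<close> are \<open>l\<close>-th roots of unity, \<open>x\<^sub>j\<^bsup>l\<^esup>\<close> is central in both \<open>A\<^bsup>(j)\<^esup>\<close> and \<open>A\<^bsup>(j+1)\<^esup>\<close>.\<close>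

definition zz :: 'a where "zz = dd_gen (j + 1) j [^] l"

lemma gens_j: "i \<in> {1..N} \<Longrightarrow> dd_gen j i \<in> carrier F" "i \<in> {1..N} \<Longrightarrow> dd_gen j i \<noteq> \<zero>"
    "i \<in> {1..N} \<Longrightarrow> dd_gen (j + 1) i \<in> carrier F" "i \<in> {1..N} \<Longrightarrow> dd_gen (j + 1) i \<noteq> \<zero>"
  using dd_gen_carrier[OF inv_j level_bounds(1,2)] dd_gen_carrier[OF inv_Sj level_bounds(3,4)] by auto

lemma gen_jj: "dd_gen j j = dd_gen (j + 1) j"
  using dd_gen_ge[OF j inv_Sj] by simp

lemma zz_gen: assumes i: "i \<in> {1..N}" shows "zz \<otimes> dd_gen j i = dd_gen j i \<otimes> zz"
proof -
  consider "i < j" | "i = j" | "j < i" by linarith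
  then show ?thesis
  proof cases
    case 1
    then have "dd_gen j j \<otimes> dd_gen j i = lam j i \<otimes> (dd_gen j i \<otimes> dd_gen j j)"
      using dd_gen_rel[OF inv_j level_bounds(1,2) level_bounds(6), of i] i by auto
    from root_commute(1)[OF gens_j(1)[OF level_bounds(5)] gens_j(1)[OF i] lam_K(1)[OF level_bounds(5) i] this lam_root[OF level_bounds(5) i]]
    show ?thesis unfolding zz_def gen_jj .
  next
    case 2
    then show ?thesis unfolding zz_def using gen_jj gens_j(3)[OF level_bounds(5)] nat_pow_Suc2[of "dd_gen (j + 1) j" l] by simp
  next
    case 3
    then have "dd_gen j i \<otimes> dd_gen j j = lam i j \<otimes> (dd_gen j j \<otimes> dd_gen j i)"
      using dd_gen_rel[OF inv_j level_bounds(1,2), of i j] i j by auto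
    from root_commute(2)[OF gens_j(1)[OF i] gens_j(1)[OF level_bounds(5)] lam_K(1)[OF i level_bounds(5)] this lam_root[OF i level_bounds(5)]]
    show ?thesis unfolding zz_def gen_jj by simp
  qed
qed

lemma zz_carrier: "zz \<in> carrier F" "zz \<noteq> \<zero>"
  unfolding zz_def using gens_j(3,4)[OF level_bounds(5)] by auto

lemma Aj_sub: "n \<le> N \<Longrightarrow> subring (Aj j n) F" "n \<le> N \<Longrightarrow> subring (Aj (j + 1) n) F"
  using Aj_subring level_bounds by auto

lemma Aj_mono: "n \<le> N \<Longrightarrow> Aj j n \<subseteq> Aj j N" "n \<le> N \<Longrightarrow> Aj (j + 1) n \<subseteq> Aj (j + 1) N"
  by (rule subalg_mono; use gens_j in simp)+

lemma zz_commute: "a \<in> Aj j N \<Longrightarrow> zz \<otimes> a = a \<otimes> zz"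
  by (rule commute_subalg[where n = N and y = "dd_gen j"]) (use gens_j(1) zz_carrier(1) zz_gen in auto)

lemma zz_mem: assumes "j \<le> n" "n \<le> N" shows "zz \<in> Aj j n" "zz \<in> Aj (j + 1) n"
proof -
  have pow: "x [^] (m::nat) \<in> B" if "subring B F" "x \<in> B" for x B m
    using that subringE(3,6)[OF that(1)] by (induct m) auto
  show "zz \<in> Aj j n" unfolding zz_def gen_jj[symmetric] using pow[OF Aj_sub(1)[OF assms(2)]] gen_subalg[of j n] assms j by auto
  show "zz \<in> Aj (j + 1) n" unfolding zz_def using pow[OF Aj_sub(2)[OF assms(2)]] gen_subalg[of j n] assms j by auto
qed

text \<open>Recovers the old generators from the new ones by \<open>e0_in_loc\<close>. All n from j
  to N are treated, since \<open>free_step\<close> compares the subalgebras on the first i - 1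
  generators.\<close>

lemma gens_in_loc:
  assumes n: "j \<le> n" "n \<le> N" shows "Aj (j + 1) n \<subseteq> central_loc (Aj j n) (range (\<lambda>k::nat. zz [^] k))" (is "_ \<subseteq> ?L")
proof -
  interpret P: dd_phi F K "Al (j - 1)" "dd_gen (j + 1) j" "e_op j (Phi (j + 1))" "\<sigma> j" "\<sigma>' j" "q j"
    using dd_phi_j[OF j inv_Sj] .
  have cm: "central_mult (Aj j n) (range (\<lambda>k::nat. zz [^] k))"
    using Aj_sub[OF n(2)] zz_mem[OF n] zz_carrier zz_commute Aj_mono[OF n(2)] by (intro central_mult_powers) auto
  note L = central_loc_subring[OF cm] and incl = central_loc_incl[OF cm]
  have ix: "inv (dd_gen (j + 1) j) \<in> ?L"
    unfolding zz_def gen_jj[symmetric]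
    using gens_j(2)[OF level_bounds(5)] gen_subalg[of j n] n level_bounds l_pos by (intro inv_in_central_loc Aj_sub) auto
  have "P.phi ` Al (j - 1) \<subseteq> Aj j n"
  proof -
    have "Phi j ` Al (j - 1) = Aj j (j - 1)" using subalg_Phi[OF inv_j level_bounds(1,2)] by auto
    moreover have "Aj j (j - 1) \<subseteq> Aj j n" using gens_j(1) n by (intro subalg_mono) auto
    ultimately show ?thesis unfolding Phi_j[OF j inv_Sj] by simp
  qed
  then have e0: "e_op j (Phi (j + 1)) 0 b \<in> ?L" if "b \<in> Al (j - 1)" for b
    using P.e0_in_loc[OF L _ ix that] incl by blast
  show ?thesis
  proof (rule subalg_min[OF L])
    show "K \<subseteq> ?L" using incl K_subalg by blast
    fix i assume i: "i \<in> {1..n}"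
    show "dd_gen (j + 1) i \<in> ?L"
    proof (cases "i < j")
      case True
      have Xi: "X i \<in> Al (j - 1)" using gen_subalg[of i "j - 1" X] i True by auto
      have "e_op j (Phi (j + 1)) 0 (X i) = Phi (j + 1) (X i)"
        unfolding e_op_def coef_0[OF j] using d_0[OF j Xi] ring_hom_subD(1)[OF dd_invD(1)[OF inv_Sj]] Al_sub[OF j inv_Sj Xi] by simp
      moreover have "dd_gen (j + 1) i = Phi (j + 1) (X i)" using dd_invD(4)[OF inv_Sj, of i] i True by auto
      ultimately show ?thesis using e0[OF Xi] by simp
    next
      case False
      then have "dd_gen (j + 1) i = dd_gen j i" using dd_gen_ge[OF j inv_Sj, of i] by simp
      then show ?thesis using incl gen_subalg[of i n "dd_gen j"] i by auto
    qed
  qed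
qed

text \<open>In A^(j+1) the relation of x_j with an earlier generator contains \<delta>_j, so
  centrality cannot be read off from the generators; it is inherited from the localisation of
  A^(j).\<close>

lemma zz_commute': assumes "a \<in> Aj (j + 1) N" shows "zz \<otimes> a = a \<otimes> zz"
proof -
  have cm: "central_mult (Aj j N) (range (\<lambda>k::nat. zz [^] k))"
    using Aj_sub zz_mem[OF level_bounds(7)] zz_carrier zz_commute by (intro central_mult_powers) auto
  show ?thesis
    using central_loc_commute[OF cm zz_carrier(1) zz_commute] gens_in_loc[OF level_bounds(7)] assms by blast
qed

lemma gens_in_loc':
  assumes n: "j \<le> n" "n \<le> N" shows "Aj j n \<subseteq> central_loc (Aj (j + 1) n) (range (\<lambda>k::nat. zz [^] k))" (is "_ \<subseteq> ?L")
proof -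
  interpret P: dd_phi F K "Al (j - 1)" "dd_gen (j + 1) j" "e_op j (Phi (j + 1))" "\<sigma> j" "\<sigma>' j" "q j"
    using dd_phi_j[OF j inv_Sj] .
  have cm: "central_mult (Aj (j + 1) n) (range (\<lambda>k::nat. zz [^] k))"
    using Aj_sub[OF n(2)] zz_mem[OF n] zz_carrier zz_commute' Aj_mono[OF n(2)] by (intro central_mult_powers) auto
  note L = central_loc_subring[OF cm] and incl = central_loc_incl[OF cm]
  have ix: "inv (dd_gen (j + 1) j) \<in> ?L"
    unfolding zz_def
    using gens_j(4)[OF level_bounds(5)] gen_subalg[of j n] n level_bounds l_pos by (intro inv_in_central_loc Aj_sub) auto
  have e0: "e_op j (Phi (j + 1)) 0 ` Al (j - 1) \<subseteq> ?L"
  proof -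
    have "e_op j (Phi (j + 1)) 0 b = Phi (j + 1) b" if "b \<in> Al (j - 1)" for b
      unfolding e_op_def coef_0[OF j] using d_0[OF j that] ring_hom_subD(1)[OF dd_invD(1)[OF inv_Sj]] Al_sub[OF j inv_Sj that] by simp
    moreover have "Phi (j + 1) ` Al (j - 1) = Aj (j + 1) (j - 1)" using subalg_Phi[OF inv_Sj level_bounds(3,4), of "j - 1"] by auto
    moreover have "Aj (j + 1) (j - 1) \<subseteq> Aj (j + 1) n" using gens_j(3) n by (intro subalg_mono) auto
    ultimately show ?thesis using incl by force
  qed
  show ?thesis
  proof (rule subalg_min[OF L])
    show "K \<subseteq> ?L" using incl K_subalg by blast
    fix i assume i: "i \<in> {1..n}"
    show "dd_gen j i \<in> ?L"
    proof (cases "i < j")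
      case True
      have Xi: "X i \<in> Al (j - 1)" using gen_subalg[of i "j - 1" X] i True by auto
      have "dd_gen j i = Phi j (X i)" using dd_invD(4)[OF inv_j, of i] i True by auto
      then show ?thesis using P.phi_in_loc[OF L e0 ix Xi] unfolding Phi_j[OF j inv_Sj] by simp
    next
      case False
      then have "dd_gen j i = dd_gen (j + 1) i" using dd_gen_ge[OF j inv_Sj, of i] by simp
      then show ?thesis using incl gen_subalg[of i n "dd_gen (j + 1)"] i by auto
    qed
  qed
qed

lemma to_lower: "j \<le> n \<Longrightarrow> n \<le> N \<Longrightarrow> a \<in> Aj (j + 1) n \<Longrightarrow> \<exists>k::nat. a \<otimes> zz [^] k \<in> Aj j n"
  using central_loc_powersD[OF _ subringE(1)[OF Aj_sub(1)] zz_carrier] gens_in_loc by blast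

lemma to_upper: "j \<le> n \<Longrightarrow> n \<le> N \<Longrightarrow> a \<in> Aj j n \<Longrightarrow> \<exists>k::nat. a \<otimes> zz [^] k \<in> Aj (j + 1) n"
  using central_loc_powersD[OF _ subringE(1)[OF Aj_sub(2)] zz_carrier] gens_in_loc' by blast

text \<open>For i = j this is freeness over the image of the series. For i > j a relation with
  coefficients in A^(j) is multiplied from the left by a power of x_j^l and becomes a relation with
  coefficients in A^(j+1).\<close>

lemma free_step:
  assumes free: "\<And>i. i \<in> {j + 1..N} \<Longrightarrow> left_free (Aj (j + 1) (i - 1)) (dd_gen (j + 1) i)" and i: "i \<in> {j..N}"
  shows "left_free (Aj j (i - 1)) (dd_gen j i)"
proof (cases "i = j")
  case True
  interpret P: dd_phi F K "Al (j - 1)" "dd_gen (j + 1) j" "e_op j (Phi (j + 1))" "\<sigma> j" "\<sigma>' j" "q j"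
    using dd_phi_j[OF j inv_Sj] .
  have "Aj j (j - 1) = P.phi ` Al (j - 1)" using subalg_Phi[OF inv_j level_bounds(1,2), of "j - 1"] Phi_j[OF j inv_Sj] by simp
  then show ?thesis using P.phi_left_free gen_jj True by simp
next
  case False
  then have i': "i \<in> {j + 1..N}" "j \<le> i - 1" "i - 1 \<le> N" "i \<in> {1..N}" using i by auto
  let ?y = "dd_gen (j + 1) i" and ?B = "Aj j (i - 1)" and ?C = "Aj (j + 1) (i - 1)"
  have eq: "dd_gen j i = ?y" using dd_gen_ge[OF j inv_Sj, of i] i by auto
  note y = gens_j(3)[OF i'(4)]
  note BR = subringE(1)[OF Aj_sub(1)[OF i'(3)]]
  show ?thesis unfolding eq left_free_def
  proof (intro allI impI)
    fix cs assume cs: "set cs \<subseteq> ?B" "horner ?y cs = \<zero>"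
    have zp: "zz [^] (k::nat) \<in> ?C" for k
      using zz_mem(2)[OF i'(2,3)] subringE(3,6)[OF Aj_sub(2)[OF i'(3)]] by (induct k) auto
    have "\<exists>k::nat. \<forall>c\<in>set cs. zz [^] k \<otimes> c \<in> ?C"
      using cs(1)
    proof (induct cs)
      case (Cons c cs)
      then obtain k :: nat where k: "\<forall>c\<in>set cs. zz [^] k \<otimes> c \<in> ?C" by auto
      have c: "c \<in> ?B" "c \<in> carrier F" using Cons BR by auto
      obtain m :: nat where m: "c \<otimes> zz [^] m \<in> ?C" using to_upper[OF i'(2,3) c(1)] by blast
      have cm: "zz [^] m \<otimes> c = c \<otimes> zz [^] m"
        using group_commutes_pow[OF zz_commute zz_carrier(1) c(2)] c(1) Aj_mono(1)[OF i'(3)] by blast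
      have 1: "zz [^] (k + m) \<otimes> c \<in> ?C"
        using subringE(6)[OF Aj_sub(2)[OF i'(3)] zp m[folded cm], of k] c zz_carrier(1) by (simp add: nat_pow_mult flip: m_assoc)
      have "zz [^] (k + m) \<otimes> d \<in> ?C" if "d \<in> set cs" for d
      proof -
        have d: "d \<in> carrier F" using that Cons(2) BR by auto
        have "zz [^] m \<otimes> (zz [^] k \<otimes> d) \<in> ?C" using subringE(6)[OF Aj_sub(2)[OF i'(3)] zp] k that by blast
        then show ?thesis using d zz_carrier(1) by (simp add: nat_pow_mult add.commute flip: m_assoc)
      qed
      then show ?case using 1 by (intro exI[of _ "k + m"]) auto
    qed simp
    then obtain k :: nat where k: "\<forall>c\<in>set cs. zz [^] k \<otimes> c \<in> ?C" by blast
    have zk: "zz [^] k \<in> carrier F" "zz [^] k \<noteq> \<zero>" using zz_carrier by auto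
    have "horner ?y (map ((\<otimes>) (zz [^] k)) ds) = zz [^] k \<otimes> horner ?y ds" if "set ds \<subseteq> carrier F" for ds
      using that
    proof (induct ds)
      case (Cons d ds)
      have "horner ?y ds \<in> carrier F" using Cons y by (intro horner_closed) auto
      then show ?case using Cons y zk by (simp add: r_distr m_assoc)
    qed (use zk in simp)
    then have "horner ?y (map ((\<otimes>) (zz [^] k)) cs) = \<zero>" using cs BR zk by auto
    moreover have "set (map ((\<otimes>) (zz [^] k)) cs) \<subseteq> ?C" using k by auto
    ultimately have "set (map ((\<otimes>) (zz [^] k)) cs) \<subseteq> {\<zero>}" using free[OF i'(1)] unfolding left_free_def by blast
    then have "zz [^] k \<otimes> c = \<zero>" if "c \<in> set cs" for c using that by auto
    then show "set cs \<subseteq> {\<zero>}" using zk cs(1) BR by (auto simp: subset_iff)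
  qed
qed

end

text \<open>Descends from level N + 1, where the index range is empty; the step to level j adds the
  index i = j.\<close>

lemma dd_free:
  assumes "2 \<le> j" "j \<le> N + 1" "i \<in> {j..N}" shows "left_free (Aj j (i - 1)) (dd_gen j i)"
  using assms(2,1,3)
proof (induct j arbitrary: i rule: inc_induct)
  case base then show ?case by simp
next
  case (step n)
  have n: "n \<in> {2..N}" using step by auto
  show ?case using free_step[OF n _ step(5)] step(3) n by (simp add: Suc_eq_plus1[symmetric])
qed

end


lemma (in ideal) quot_zero_iff: "a \<in> carrier R \<Longrightarrow> I +> a = \<zero>\<^bsub>R Quot I\<^esub> \<longleftrightarrow> a \<in> I"
  using rcos_eq_self_iff unfolding FactRing_def by simp

section \<open>The homomorphism g_j and one step of \<psi>\<close>

context qna_root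
begin

context
  fixes j assumes j: "j \<in> {2..N}"
begin

abbreviation upper where "upper \<equiv> dd_alg (j + 1)"

definition pr :: "'a \<Rightarrow> 'a set" where "pr r = dd_ideal j +>\<^bsub>upper\<^esub> r"

lemma upper_carrier: "carrier upper = Aj (j + 1) N" and lower_eq: "dd_alg j = F\<lparr>carrier := Aj j N\<rparr>"
    and upper_eq: "upper = F\<lparr>carrier := Aj (j + 1) N\<rparr>"
  unfolding dd_alg_def by auto

lemma upper_ring: "ring upper"
  unfolding upper_eq using subring_is_ring[OF Aj_sub(2)[OF j order_refl]] .

lemma xj_upper: "dd_gen (j + 1) j \<in> Aj (j + 1) N"
  using gen_subalg[of j N] j by auto

lemma dd_ideal_ideal: "ideal (dd_ideal j) upper" and xj_ideal: "dd_gen (j + 1) j \<in> dd_ideal j"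
  unfolding dd_ideal_def
  using ring.genideal_ideal[OF upper_ring, of "{dd_gen (j + 1) j}"] ring.genideal_self[OF upper_ring, of "{dd_gen (j + 1) j}"]
    xj_upper upper_carrier by auto

lemma dd_ideal_min: "ideal P upper \<Longrightarrow> dd_gen (j + 1) j \<in> P \<Longrightarrow> dd_ideal j \<subseteq> P"
  unfolding dd_ideal_def using ring.genideal_minimal[OF upper_ring] by simp

lemma pr_hom: "pr \<in> Ring.ring_hom (F\<lparr>carrier := Aj (j + 1) N\<rparr>) (upper Quot dd_ideal j)"
  using ideal.rcos_ring_hom[OF dd_ideal_ideal] unfolding pr_def[abs_def] upper_eq .

lemma pr_zero: "r \<in> Aj (j + 1) N \<Longrightarrow> pr r = \<zero>\<^bsub>upper Quot dd_ideal j\<^esub> \<longleftrightarrow> r \<in> dd_ideal j"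
  unfolding pr_def using ideal.quot_zero_iff[OF dd_ideal_ideal] upper_carrier by simp

lemma quot_ring: "ring (upper Quot dd_ideal j)"
  using ideal.quotient_is_ring[OF dd_ideal_ideal] .

text \<open>\<open>dd_quot_map\<close> is a choice, so a candidate has to be produced. On the first
  j - 1 generators it is \<open>pr\<close> after \<open>Phi (j + 1)\<close> after the inverse of
  \<open>Phi j\<close>; the remaining generators are adjoined by
  \<open>extend_subalg_hom\<close>.\<close>

lemma quot_map_exists:
  "\<exists>g. g \<in> Ring.ring_hom (dd_alg j) (upper Quot dd_ideal j) \<and> (\<forall>k\<in>K. g k = pr k) \<and>
     (\<forall>i\<in>{1..N}. g (dd_gen j i) = pr (dd_gen (j + 1) i))"
proof -
  let ?Q = "upper Quot dd_ideal j" and ?y = "dd_gen j" and ?x = "dd_gen (j + 1)" and ?B = "Al (j - 1)"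
  interpret Q: ring ?Q by (rule quot_ring)
  note level_bounds = level_bounds[OF j] and inv_j = inv_j[OF j] and inv_Sj = inv_Sj[OF j] and gens = gens_j[OF j]
  note D = dd_invD[OF inv_j] and D' = dd_invD[OF inv_Sj, unfolded add_diff_cancel_right']
  note prD = ring_hom_subD[OF pr_hom]
  have jN: "j - 1 \<le> N" "j - 1 \<le> j" "j \<le> N" using j by auto
  have BS: "subring ?B F" using Al_subring[OF jN(1)] .
  have xm: "?x i \<in> Aj (j + 1) N" if "i \<in> {1..N}" for i using gen_subalg that by auto
  have Bsub: "b \<in> Al j" if "b \<in> ?B" for b using Al_sub[OF j inv_Sj that] .
  have img: "Phi j ` ?B = Aj j (j - 1)" "Phi (j + 1) ` ?B = Aj (j + 1) (j - 1)"
    using subalg_Phi[OF inv_j level_bounds(1,2), of "j - 1"] subalg_Phi[OF inv_Sj level_bounds(3,4), of "j - 1"] by auto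
  have up: "Phi (j + 1) b \<in> Aj (j + 1) N" if "b \<in> ?B" for b
    using that img(2) Aj_mono(2)[OF j jN(1)] by blast
  define G where "G = {(Phi j b, pr (Phi (j + 1) b)) | b. b \<in> ?B}"
  have GI: "(Phi j b, pr (Phi (j + 1) b)) \<in> G" if "b \<in> ?B" for b using that unfolding G_def by blast
  note SB = subringE[OF BS] and pD = ring_hom_subD[OF D(1)]
  have PhD: "Phi (j + 1) (a \<otimes> b) = Phi (j + 1) a \<otimes> Phi (j + 1) b" "Phi (j + 1) (a \<oplus> b) = Phi (j + 1) a \<oplus> Phi (j + 1) b"
    if "a \<in> ?B" "b \<in> ?B" for a b
    using ring_hom_subD(2,3)[OF D'(1) Bsub Bsub] that by auto
  have "\<exists>h. h \<in> Ring.ring_hom (F\<lparr>carrier := fst ` G\<rparr>) ?Q \<and> (\<forall>a w. (a, w) \<in> G \<longrightarrow> h a = w)"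
  proof (rule graph_ring_hom[OF ring_axioms quot_ring])
    show "G \<subseteq> carrier F \<times> carrier ?Q" unfolding G_def using pD(1) prD(1) up by auto
    show "(\<one>, \<one>\<^bsub>?Q\<^esub>) \<in> G" using GI[OF SB(3)] D(3)[of \<one>] D'(3)[of \<one>] prD(4) by simp
    show "w = \<zero>\<^bsub>?Q\<^esub>" if G0: "(\<zero>, w) \<in> G" for w
    proof -
      have "\<exists>b. (\<zero>, w) = (Phi j b, pr (Phi (j + 1) b)) \<and> b \<in> ?B" using G0 unfolding G_def by (rule CollectD)
      then obtain b where b: "Phi j b = \<zero>" "w = pr (Phi (j + 1) b)" "b \<in> ?B" by auto
      then have "b = \<zero>" using D(2) by blast
      then show ?thesis using b(2) D'(3)[of \<zero>] ring_hom_sub_zero[OF ring_axioms quot_ring Aj_sub(2)[OF j order_refl] pr_hom] by simp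
    qed
    fix a w assume "(a, w) \<in> G"
    then obtain b where b: "a = Phi j b" "w = pr (Phi (j + 1) b)" "b \<in> ?B" unfolding G_def by blast
    show "(\<ominus> a, \<ominus>\<^bsub>?Q\<^esub> w) \<in> G"
      using GI[OF SB(5)[OF b(3)]] ring_hom_sub_neg[OF ring_axioms ring_axioms BS D(1) b(3)]
        ring_hom_sub_neg[OF ring_axioms ring_axioms Al_subring[OF jN(3)] D'(1) Bsub[OF b(3)]]
        ring_hom_sub_neg[OF ring_axioms quot_ring Aj_sub(2)[OF j order_refl] pr_hom up[OF b(3)]] b by simp
    fix a' w' assume "(a', w') \<in> G"
    then obtain b' where b': "a' = Phi j b'" "w' = pr (Phi (j + 1) b')" "b' \<in> ?B" unfolding G_def by blast
    show "(a \<oplus> a', w \<oplus>\<^bsub>?Q\<^esub> w') \<in> G"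
      using GI[OF SB(7)[OF b(3) b'(3)]] pD(3)[OF b(3) b'(3)] PhD(2)[OF b(3) b'(3)] prD(3)[OF up[OF b(3)] up[OF b'(3)]] b b' by simp
    show "(a \<otimes> a', w \<otimes>\<^bsub>?Q\<^esub> w') \<in> G"
      using GI[OF SB(6)[OF b(3) b'(3)]] pD(2)[OF b(3) b'(3)] PhD(1)[OF b(3) b'(3)] prD(2)[OF up[OF b(3)] up[OF b'(3)]] b b' by simp
  qed
  then obtain h where h: "h \<in> Ring.ring_hom (F\<lparr>carrier := fst ` G\<rparr>) ?Q" "\<And>a w. (a, w) \<in> G \<Longrightarrow> h a = w" by blast
  have "fst ` G = Phi j ` ?B" unfolding G_def by force
  then have hh: "h \<in> Ring.ring_hom (F\<lparr>carrier := Aj j (j - 1)\<rparr>) ?Q" using h(1) img(1) by simp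
  have hPhi: "h (Phi j b) = pr (Phi (j + 1) b)" if "b \<in> ?B" for b using h(2)[OF GI[OF that]] .
  have hK: "h k = pr k" if "k \<in> K" for k using hPhi[OF K_subalg[OF that]] D(3)[OF that] D'(3)[OF that] by simp
  have Kup: "k \<in> Aj (j + 1) N" if "k \<in> K" for k using K_subalg[OF that] .
  have "\<exists>h'. h' \<in> Ring.ring_hom (F\<lparr>carrier := Aj j N\<rparr>) ?Q \<and>
    (\<forall>b\<in>Aj j (j - 1). h' b = h b) \<and> (\<forall>i\<in>{1..N}. h' (?y i) = pr (?x i))"
  proof (rule extend_subalg_hom[where c = lam, OF gens(1) gens(2) _ _ quot_ring hh])
    show "h (?y i) = pr (?x i)" if i: "i \<in> {1..j - 1}" for i
    proof -
      have "X i \<in> ?B" using gen_subalg[of i "j - 1" X] i by auto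
      moreover have "dd_gen (j + 1) i = Phi (j + 1) (X i)" using D'(4)[of i] i by auto
      ultimately show ?thesis using hPhi D(4)[OF i] by simp
    qed
    fix i assume i: "i \<in> {j - 1<..N}"
    then have i': "i \<in> {j..N}" "i \<in> {1..N}" using j by auto
    show "i \<in> {1..N}" using i' by simp
    show "left_free (Aj j (i - 1)) (?y i)" using dd_free[OF level_bounds(1,2) i'(1)] .
    show "pr (?x i) \<in> carrier ?Q" using prD(1) xm i' by simp
    show "pr (?x i) \<otimes>\<^bsub>?Q\<^esub> h k = h k \<otimes>\<^bsub>?Q\<^esub> pr (?x i)" if k: "k \<in> K" for k
      unfolding hK[OF k] using prD(2)[OF xm[OF i'(2)] Kup[OF k]] prD(2)[OF Kup[OF k] xm[OF i'(2)]]
        K_comm[OF k gens(3)[OF i'(2)]] by simp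
    fix m assume m: "m \<in> {1..<i}"
    then have m': "m \<in> {1..N}" using i' by auto
    show "lam i m \<in> K \<and> ?y i \<otimes> ?y m = lam i m \<otimes> (?y m \<otimes> ?y i)"
      using lam_K(1)[OF i'(2) m'] dd_gen_rel[OF inv_j level_bounds(1,2) i'(1) m] by simp
    have lk: "lam i m \<in> K" using lam_K(1)[OF i'(2) m'] .
    show "pr (?x i) \<otimes>\<^bsub>?Q\<^esub> pr (?x m) = h (lam i m) \<otimes>\<^bsub>?Q\<^esub> (pr (?x m) \<otimes>\<^bsub>?Q\<^esub> pr (?x i))"
    \<comment> \<open>The generator of index j goes to zero, so its relations hold trivially,
      although x_j need not q-commute with earlier generators in A^(j+1).\<close>
    proof (cases "i = j")
      case True
      have "pr (?x i) = \<zero>\<^bsub>?Q\<^esub>" unfolding True using pr_zero[OF xj_upper] xj_ideal by simp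
      then show ?thesis using prD(1)[OF xm[OF m']] prD(1)[OF Kup[OF lk]] hK[OF lk] by simp
    next
      case False
      then have "?x i \<otimes> ?x m = lam i m \<otimes> (?x m \<otimes> ?x i)" using dd_gen_rel[OF inv_Sj level_bounds(3,4), of i m] i' m by auto
      moreover have "?x m \<otimes> ?x i \<in> Aj (j + 1) N" using subringE(6)[OF Aj_sub(2)[OF j order_refl]] xm m' i' by blast
      ultimately show ?thesis unfolding hK[OF lk]
        using prD(2)[OF xm[OF i'(2)] xm[OF m']] prD(2)[OF xm[OF m'] xm[OF i'(2)]] prD(2)[OF Kup[OF lk]] by metis
    qed
  qed (use j in auto)
  then obtain h' where h': "h' \<in> Ring.ring_hom (F\<lparr>carrier := Aj j N\<rparr>) ?Q"
    "\<forall>b\<in>Aj j (j - 1). h' b = h b" "\<forall>i\<in>{1..N}. h' (?y i) = pr (?x i)" by blast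
  then show ?thesis using hK K_subalg unfolding lower_eq by (intro exI[of _ h']) auto
qed

lemma quot_map:
  "dd_quot_map j \<in> Ring.ring_hom (F\<lparr>carrier := Aj j N\<rparr>) (upper Quot dd_ideal j)"
  "k \<in> K \<Longrightarrow> dd_quot_map j k = pr k" "i \<in> {1..N} \<Longrightarrow> dd_quot_map j (dd_gen j i) = pr (dd_gen (j + 1) i)"
proof -
  have "dd_quot_map j \<in> Ring.ring_hom (dd_alg j) (upper Quot dd_ideal j) \<and> (\<forall>k\<in>K. dd_quot_map j k = pr k) \<and>
     (\<forall>i\<in>{1..N}. dd_quot_map j (dd_gen j i) = pr (dd_gen (j + 1) i))"
    using someI_ex[OF quot_map_exists] unfolding dd_quot_map_def pr_def .
  then show "dd_quot_map j \<in> Ring.ring_hom (F\<lparr>carrier := Aj j N\<rparr>) (upper Quot dd_ideal j)"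
    "k \<in> K \<Longrightarrow> dd_quot_map j k = pr k" "i \<in> {1..N} \<Longrightarrow> dd_quot_map j (dd_gen j i) = pr (dd_gen (j + 1) i)"
    unfolding lower_eq by auto
qed

lemma quot_map_surj: assumes r: "r \<in> Aj (j + 1) N" shows "\<exists>a\<in>Aj j N. dd_quot_map j a = pr r"
proof -
  note S = Aj_sub[OF j order_refl]
  note gD = ring_hom_subD[OF quot_map(1)] and pD = ring_hom_subD[OF pr_hom]
  have xR: "dd_gen (j + 1) ` {1..N} \<subseteq> carrier F" using gens_j[OF j] by auto
  from r xR show ?thesis
  proof (induct rule: subalg_induct)
    case (K k) then show ?case using quot_map(2) K_subalg by blast
  next
    case (gen i) then show ?case using quot_map(3) gen_subalg by (intro bexI[of _ "dd_gen j i"]) auto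
  next
    case (neg r)
    then obtain a where a: "a \<in> Aj j N" "dd_quot_map j a = pr r" by blast
    then show ?case using subringE(5)[OF S(1) a(1)] neg(1)
        ring_hom_sub_neg[OF ring_axioms quot_ring S(1) quot_map(1) a(1)] ring_hom_sub_neg[OF ring_axioms quot_ring S(2) pr_hom neg(1)] by metis
  next
    case (add r s)
    then obtain a b where ab: "a \<in> Aj j N" "dd_quot_map j a = pr r" "b \<in> Aj j N" "dd_quot_map j b = pr s" by blast
    then show ?case using subringE(7)[OF S(1) ab(1,3)] gD(3)[OF ab(1,3)] pD(3)[OF add(1,2)] by metis
  next
    case (mult r s)
    then obtain a b where ab: "a \<in> Aj j N" "dd_quot_map j a = pr r" "b \<in> Aj j N" "dd_quot_map j b = pr s" by blast
    then show ?case using subringE(6)[OF S(1) ab(1,3)] gD(2)[OF ab(1,3)] pD(2)[OF mult(1,2)] by metis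
  qed
qed

lemma quot_map_lift: assumes a: "a \<in> Aj j N" shows "\<exists>r\<in>Aj (j + 1) N. dd_quot_map j a = pr r"
proof -
  have "dd_quot_map j a \<in> carrier (upper Quot dd_ideal j)" using ring_hom_subD(1)[OF quot_map(1) a] .
  then show ?thesis unfolding FactRing_def A_RCOSETS_def' pr_def upper_carrier by auto
qed

text \<open>Denominators that are powers of x_j are traded for powers of x_j^l, the central element
  of the transfer lemmas.\<close>

lemma psi_step_loc:
  assumes P: "cprime P (Aj (j + 1) N)" and x: "dd_gen (j + 1) j \<notin> P"
  shows "psi_step j P = {a \<in> Aj j N. \<exists>k::nat. a \<otimes> zz j [^] k \<in> P}"
proof -
  let ?x = "dd_gen (j + 1) j"
  note xR = gens_j(3,4)[OF j level_bounds(5)[OF j]]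
  note PR = cprimeD[OF P]
  have xpow: "?x [^] (n::nat) \<in> Aj (j + 1) N" for n
    using xj_upper subringE(3,6)[OF Aj_sub(2)[OF j order_refl]] by (induct n) auto
  have PF: "p \<in> carrier F" if "p \<in> P" for p using PR(1)[OF that] subringE(1)[OF Aj_sub(2)[OF j order_refl]] by blast
  have zk: "zz j [^] (k::nat) = ?x [^] (l * k)" for k unfolding zz_def[OF j] using xR by (simp add: nat_pow_pow)
  have "psi_step j P = {p \<otimes> inv (?x [^] n) | p (n :: nat). p \<in> P} \<inter> Aj j N"
    unfolding psi_step_def using x by (simp add: dd_alg_def)
  also have "\<dots> = {a \<in> Aj j N. \<exists>k::nat. a \<otimes> zz j [^] k \<in> P}"
  proof (rule equalityI; rule subsetI)
    fix a assume "a \<in> {p \<otimes> inv (?x [^] n) | p (n :: nat). p \<in> P} \<inter> Aj j N"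
    then obtain p and n :: nat where p: "a = p \<otimes> inv (?x [^] n)" "p \<in> P" "a \<in> Aj j N" by blast
    \<comment> \<open>As x_j^n divides x_j^(l n), the numerator p only picks up the factor x_j^(l n
      - n) and stays in the ideal.\<close>
    have "n \<le> l * n" using l_pos by simp
    then have "?x [^] (l * n) = ?x [^] n \<otimes> ?x [^] (l * n - n)" using xR by (simp add: nat_pow_mult)
    then have "a \<otimes> zz j [^] n = p \<otimes> ?x [^] (l * n - n)" unfolding zk p(1) using xR PF[OF p(2)] by (simp add: m_assoc)
    then have "a \<otimes> zz j [^] n \<in> P" using PR(5)[OF p(2) xpow] by simp
    then show "a \<in> {a \<in> Aj j N. \<exists>k::nat. a \<otimes> zz j [^] k \<in> P}" using p(3) by blast
  next
    fix a assume "a \<in> {a \<in> Aj j N. \<exists>k::nat. a \<otimes> zz j [^] k \<in> P}"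
    then obtain k :: nat where k: "a \<in> Aj j N" "a \<otimes> zz j [^] k \<in> P" by blast
    have "a \<in> carrier F" using k(1) subringE(1)[OF Aj_sub(1)[OF j order_refl]] by blast
    then have "a = (a \<otimes> zz j [^] k) \<otimes> inv (?x [^] (l * k))" unfolding zk using xR by (simp add: m_assoc)
    then show "a \<in> {p \<otimes> inv (?x [^] n) | p (n :: nat). p \<in> P} \<inter> Aj j N" using k by blast
  qed
  finally show ?thesis .
qed

lemma psi_step_quot:
  assumes x: "dd_gen (j + 1) j \<in> P"
  shows "psi_step j P = {a \<in> Aj j N. dd_quot_map j a \<in> pr ` P}"
  unfolding psi_step_def pr_def using x by (simp add: dd_alg_def)

lemma cprime_ideal: "cprime P (Aj (j + 1) N) \<Longrightarrow> ideal P upper"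
  unfolding upper_eq subring_ideal_iff[OF Aj_sub(2)[OF j order_refl]] cprime_def by blast

text \<open>Primeness is passed down to A^(j), whereas the realisation of the fractions is passed up
  to A^(j+1). The two branches of \<open>psi_step\<close> are served by the quotient and the
  localisation transfer.\<close>

lemma psi_step_transfer:
  assumes P: "cprime P (Aj (j + 1) N)"
  shows "cprime (psi_step j P) (Aj j N)"
    "\<lbrakk>frac_datum (Aj j N) (psi_step j P) D; subring D F; \<And>y. y \<in> D \<Longrightarrow> y \<noteq> \<zero> \<Longrightarrow> inv y \<in> D\<rbrakk>
      \<Longrightarrow> frac_datum (Aj (j + 1) N) P D"
proof -
  note S = Aj_sub[OF j order_refl] and jN = level_bounds(7)[OF j]
  have "cprime (psi_step j P) (Aj j N) \<and> (frac_datum (Aj j N) (psi_step j P) D \<longrightarrow> subring D F \<longrightarrow>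
      (\<forall>y\<in>D. y \<noteq> \<zero> \<longrightarrow> inv y \<in> D) \<longrightarrow> frac_datum (Aj (j + 1) N) P D)"
  proof (cases "dd_gen (j + 1) j \<in> P")
    case True
    have ker: "r \<in> P" if "r \<in> Aj (j + 1) N" "pr r = \<zero>\<^bsub>upper Quot dd_ideal j\<^esub>" for r
      using pr_zero[OF that(1)] that(2) dd_ideal_min[OF cprime_ideal[OF P] True] by blast
    note f = quot_cprime[OF S quot_ring quot_map(1) pr_hom quot_map_lift quot_map_surj P ker psi_step_quot[OF True]]
      quot_frac_datum[OF S quot_ring quot_map(1) pr_hom quot_map_lift quot_map_surj P ker psi_step_quot[OF True]]
    show ?thesis using f by blast
  next
    case False
    have xpow: "dd_gen (j + 1) j [^] (n::nat) \<in> Aj (j + 1) N" for n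
      using xj_upper subringE(3,6)[OF S(2)] by (induct n) auto
    have "dd_gen (j + 1) j [^] (n::nat) \<notin> P" for n
    proof (induct n)
      case 0 then show ?case using cprimeD(7)[OF P] by simp
    next
      case (Suc n) then show ?case using cprimeD(8)[OF P xpow xj_upper, of n] False by auto
    qed
    then have z: "zz j \<notin> P" unfolding zz_def[OF j] by blast
    note zm = zz_mem[OF j jN order_refl] and zc = zz_carrier(2)[OF j]
    have f1: "cprime (psi_step j P) (Aj j N)"
      using loc_cprime[OF S zm zc zz_commute[OF j] zz_commute'[OF j] to_upper[OF j jN order_refl] to_lower[OF j jN order_refl] P z psi_step_loc[OF P False]] .
    have f2: "frac_datum (Aj (j + 1) N) P D" if "frac_datum (Aj j N) (psi_step j P) D" "subring D F" "\<forall>y\<in>D. y \<noteq> \<zero> \<longrightarrow> inv y \<in> D"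
      using loc_frac_datum[OF S zm zc zz_commute[OF j] zz_commute'[OF j] to_upper[OF j jN order_refl] to_lower[OF j jN order_refl] P z
          psi_step_loc[OF P False] that(1) subringE(1)[OF that(2)] that(2)] that(3) by blast
    show ?thesis using f1 f2 by blast
  qed
  then show "cprime (psi_step j P) (Aj j N)"
    "\<lbrakk>frac_datum (Aj j N) (psi_step j P) D; subring D F; \<And>y. y \<in> D \<Longrightarrow> y \<noteq> \<zero> \<Longrightarrow> inv y \<in> D\<rbrakk>
      \<Longrightarrow> frac_datum (Aj (j + 1) N) P D" by blast+
qed

end

text \<open>Two inductions in opposite directions: primeness of all intermediate ideals descends
  from level N + 1, then the fraction datum climbs from level 2 with \<open>D\<close>
  unchanged.\<close>

lemma psi_transfer:
  assumes P: "cprime P (Aj (N + 1) N)" and D: "subring D F" "\<And>y. y \<in> D \<Longrightarrow> y \<noteq> \<zero> \<Longrightarrow> inv y \<in> D"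
    and fd: "frac_datum (Aj 2 N) (psi P) D"
  shows "frac_datum (Aj (N + 1) N) P D"
proof -
  \<comment> \<open>The image of P at level j: P itself at level N + 1 and \<open>psi P\<close> at
    level 2.\<close>
  define Pj where "Pj j = foldr psi_step [j..<N+1] P" for j
  have Pstep: "Pj j = psi_step j (Pj (j + 1))" if "j \<in> {2..N}" for j
    using that unfolding Pj_def by (cases "j = N") (auto simp: upt_conv_Cons Suc_eq_plus1[symmetric])
  have cp: "cprime (Pj j) (Aj j N)" if "j \<le> N + 1" "2 \<le> j" for j
    using that
  proof (induct j rule: inc_induct)
    case base show ?case using P unfolding Pj_def by simp
  next
    case (step n)
    then have n: "n \<in> {2..N}" by auto
    then show ?case using psi_step_transfer(1)[OF n, of "Pj (n + 1)"] step Pstep[OF n] by (simp add: Suc_eq_plus1[symmetric])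
  qed
  have "2 \<le> N + 1" using N_pos by simp
  moreover have "frac_datum (Aj j N) (Pj j) D" if "2 \<le> j" "j \<le> N + 1" for j
    using that
  proof (induct j rule: dec_induct)
    case base show ?case using fd unfolding Pj_def psi_def by simp
  next
    case (step n)
    then have n: "n \<in> {2..N}" by auto
    show ?case using psi_step_transfer(2)[OF n cp[of "n + 1"] _ D] step n Pstep[OF n] by (simp add: Suc_eq_plus1[symmetric])
  qed
  ultimately have "frac_datum (Aj (N + 1) N) (Pj (N + 1)) D" by blast
  then show ?thesis unfolding Pj_def by simp
qed

end

section \<open>Counting characters\<close>


text \<open>The image of S on vectors over Z/l, each class represented by its reduced integral
  vector.\<close>

definition image_mod :: "nat \<Rightarrow> int mat \<Rightarrow> int vec set" where
  "image_mod l S = (\<lambda>a. map_vec (\<lambda>x. x mod int l) (S *\<^sub>v a)) ` carrier_vec (dim_col S)"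

lemma finite_image_mod: assumes "0 < l" shows "finite (image_mod l S)"
proof (rule finite_subset)
  let ?L = "{xs. set xs \<subseteq> {0..<int l} \<and> length xs = dim_row S}"
  show "finite (vec_of_list ` ?L)" by (intro finite_imageI finite_lists_length_eq) simp
  show "image_mod l S \<subseteq> vec_of_list ` ?L"
  proof
    fix v assume "v \<in> image_mod l S"
    then obtain a where v: "v = map_vec (\<lambda>x. x mod int l) (S *\<^sub>v a)" unfolding image_mod_def by blast
    have "list_of_vec v \<in> ?L" using v assms by (auto simp: set_list_of_vec vec_set_def)
    then show "v \<in> vec_of_list ` ?L" by (intro image_eqI[where x = "list_of_vec v"]) (simp_all add: vec_list)
  qed
qed

lemma map_vec_mod_mult:
  assumes P: "P \<in> carrier_mat n k" and v: "v \<in> carrier_vec k"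
  shows "map_vec (\<lambda>x. x mod m) (P *\<^sub>v map_vec (\<lambda>x. x mod m) v) = map_vec (\<lambda>x. x mod m) (P *\<^sub>v (v :: int vec))"
proof (rule eq_vecI)
  fix i assume i: "i < dim_vec (map_vec (\<lambda>x. x mod m) (P *\<^sub>v v))"
  then have i': "i < n" using P by simp
  have "(\<Sum>j = 0..<k. P $$ (i, j) * (v $ j mod m)) mod m = (\<Sum>j = 0..<k. P $$ (i, j) * v $ j) mod m"
  proof -
    have "(\<Sum>j = 0..<k. P $$ (i, j) * (v $ j mod m)) mod m = (\<Sum>j = 0..<k. P $$ (i, j) * (v $ j mod m) mod m) mod m"
      by (rule mod_sum_eq[symmetric])
    also have "\<dots> = (\<Sum>j = 0..<k. P $$ (i, j) * v $ j mod m) mod m" by (simp add: mod_mult_right_eq)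
    also have "\<dots> = (\<Sum>j = 0..<k. P $$ (i, j) * v $ j) mod m" by (rule mod_sum_eq)
    finally show ?thesis .
  qed
  then show "map_vec (\<lambda>x. x mod m) (P *\<^sub>v map_vec (\<lambda>x. x mod m) v) $ i = map_vec (\<lambda>x. x mod m) (P *\<^sub>v v) $ i"
    using i' P v by (simp add: scalar_prod_def)
qed (use P in simp)

text \<open>Reduction is compatible with integral matrices, so the image of P S Q modulo l is
  contained in what P makes of the image of S.\<close>

lemma card_image_mod_mult_le:
  assumes l: "0 < l" and P: "P \<in> carrier_mat n n" and S: "S \<in> carrier_mat n n" and Q: "Q \<in> carrier_mat n n"
  shows "card (image_mod l (P * S * Q)) \<le> card (image_mod l S)"
proof -
  have "image_mod l (P * S * Q) \<subseteq> (\<lambda>v. map_vec (\<lambda>x. x mod int l) (P *\<^sub>v v)) ` image_mod l S"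
  proof
    fix v assume "v \<in> image_mod l (P * S * Q)"
    then obtain a where a: "a \<in> carrier_vec n" "v = map_vec (\<lambda>x. x mod int l) (P * S * Q *\<^sub>v a)"
      using Q unfolding image_mod_def by auto
    have Qa: "Q *\<^sub>v a \<in> carrier_vec n" using Q a by simp
    have "P * S * Q *\<^sub>v a = P *\<^sub>v (S *\<^sub>v (Q *\<^sub>v a))"
      using P S Q a Qa by (simp add: assoc_mult_mat_vec[of _ n n _ n])
    then have "v = map_vec (\<lambda>x. x mod int l) (P *\<^sub>v map_vec (\<lambda>x. x mod int l) (S *\<^sub>v (Q *\<^sub>v a)))"
      unfolding a(2) using map_vec_mod_mult[OF P, of "S *\<^sub>v (Q *\<^sub>v a)" "int l"] S Qa by simp
    moreover have "map_vec (\<lambda>x. x mod int l) (S *\<^sub>v (Q *\<^sub>v a)) \<in> image_mod l S"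
      unfolding image_mod_def using Qa S by auto
    ultimately show "v \<in> (\<lambda>v. map_vec (\<lambda>x. x mod int l) (P *\<^sub>v v)) ` image_mod l S" by blast
  qed
  then show ?thesis
    by (meson card_image_le card_mono finite_image_mod finite_imageI l le_trans)
qed

text \<open>The preceding bound is applied to E and to its integral inverse.\<close>

lemma card_image_mod_congruent:
  assumes l: "0 < l" and E: "E \<in> carrier_mat n n" "invertible_mat E" and S: "S \<in> carrier_mat n n"
  shows "card (image_mod l (E * S * E\<^sup>T)) = card (image_mod l S)"
proof (rule antisym)
  show "card (image_mod l (E * S * E\<^sup>T)) \<le> card (image_mod l S)"
    using card_image_mod_mult_le[OF l E(1) S, of "E\<^sup>T"] E by simp
  obtain E' where E': "inverts_mat E E'" "inverts_mat E' E" using E(2) unfolding invertible_mat_def by blast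
  have E'c: "E' \<in> carrier_mat n n"
    using E' E(1) unfolding inverts_mat_def by (metis carrier_matD carrier_matI index_mult_mat(2,3) index_one_mat(2,3))
  have e: "E' * E = 1\<^sub>m n" using E'(2) E'c unfolding inverts_mat_def by simp
  have e2: "E\<^sup>T * E'\<^sup>T = 1\<^sub>m n" using e E'c E(1) transpose_mult[of E' n n E n] by simp
  have c: "E\<^sup>T \<in> carrier_mat n n" "E'\<^sup>T \<in> carrier_mat n n" using E E'c by auto
  have "E' * (E * S * E\<^sup>T) * E'\<^sup>T = (E' * E) * S * (E\<^sup>T * E'\<^sup>T)"
  proof -
    have "E' * (E * S * E\<^sup>T) * E'\<^sup>T = E' * (E * S) * E\<^sup>T * E'\<^sup>T"
      using E'c E S c by (simp add: assoc_mult_mat[of E' n n "E * S" n "E\<^sup>T" n])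
    also have "E' * (E * S) = E' * E * S" using E'c E S by (simp add: assoc_mult_mat[of E' n n E n S n])
    also have "E' * E * S * E\<^sup>T * E'\<^sup>T = E' * E * S * (E\<^sup>T * E'\<^sup>T)"
      using E'c E S c by (simp add: assoc_mult_mat[of _ n n "E\<^sup>T" n "E'\<^sup>T" n])
    finally show ?thesis .
  qed
  then have "E' * (E * S * E\<^sup>T) * E'\<^sup>T = S" using S by (simp add: e e2)
  then show "card (image_mod l S) \<le> card (image_mod l (E * S * E\<^sup>T))"
    using card_image_mod_mult_le[OF l E'c, of "E * S * E\<^sup>T" "E'\<^sup>T"] E S c E'c by simp
qed

lemma map_vec_append: "map_vec f (v @\<^sub>v w) = map_vec f v @\<^sub>v map_vec f w"
  by (rule eq_vecI) (auto simp: append_vec_def Let_def)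

lemma card_image_mod_four_block:
  assumes l: "0 < l" and A: "A \<in> carrier_mat n n" and D: "D \<in> carrier_mat m m"
  shows "card (image_mod l (four_block_mat A (0\<^sub>m n m) (0\<^sub>m m n) D)) = card (image_mod l A) * card (image_mod l D)"
    (is "card (image_mod l ?B) = _")
proof -
  have B: "?B *\<^sub>v (a @\<^sub>v d) = (A *\<^sub>v a) @\<^sub>v (D *\<^sub>v d)" if "a \<in> carrier_vec n" "d \<in> carrier_vec m" for a d
  proof -
    have "0\<^sub>m n m *\<^sub>v d = 0\<^sub>v n" "0\<^sub>m m n *\<^sub>v a = 0\<^sub>v m" using that by (auto intro!: eq_vecI simp: scalar_prod_def)
    then show ?thesis
      using four_block_mat_mult_vec[OF A zero_carrier_mat zero_carrier_mat D that] that A D by simp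
  qed
  have "image_mod l ?B = (\<lambda>(v, w). v @\<^sub>v w) ` (image_mod l A \<times> image_mod l D)"
  proof (rule equalityI; rule subsetI)
    fix x assume "x \<in> image_mod l ?B"
    then obtain a where a: "a \<in> carrier_vec (n + m)" "x = map_vec (\<lambda>x. x mod int l) (?B *\<^sub>v a)"
      using A D unfolding image_mod_def by auto
    have s: "a = vec_first a n @\<^sub>v vec_last a m" using a(1) by simp
    have c: "vec_first a n \<in> carrier_vec n" "vec_last a m \<in> carrier_vec m" by auto
    have "x = map_vec (\<lambda>x. x mod int l) (A *\<^sub>v vec_first a n) @\<^sub>v map_vec (\<lambda>x. x mod int l) (D *\<^sub>v vec_last a m)"
      unfolding a(2) using B[OF c] s by (metis map_vec_append)
    then show "x \<in> (\<lambda>(v, w). v @\<^sub>v w) ` (image_mod l A \<times> image_mod l D)"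
      using c A D unfolding image_mod_def by auto
  next
    fix x assume "x \<in> (\<lambda>(v, w). v @\<^sub>v w) ` (image_mod l A \<times> image_mod l D)"
    then obtain a d where a: "a \<in> carrier_vec n" "d \<in> carrier_vec m"
      "x = map_vec (\<lambda>x. x mod int l) (A *\<^sub>v a) @\<^sub>v map_vec (\<lambda>x. x mod int l) (D *\<^sub>v d)"
      using A D unfolding image_mod_def by auto
    have "x = map_vec (\<lambda>x. x mod int l) (?B *\<^sub>v (a @\<^sub>v d))" unfolding B[OF a(1,2)] map_vec_append a(3) ..
    moreover have "a @\<^sub>v d \<in> carrier_vec (dim_col ?B)" using a A D by auto
    ultimately show "x \<in> image_mod l ?B" unfolding image_mod_def by blast
  qed
  moreover have "inj_on (\<lambda>(v, w). v @\<^sub>v w) (image_mod l A \<times> image_mod l D)"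
  proof (rule inj_onI, clarify)
    fix v w v' w' assume "v \<in> image_mod l A" "v' \<in> image_mod l A" and e: "v @\<^sub>v w = v' @\<^sub>v w'"
    then have "v \<in> carrier_vec n" "v' \<in> carrier_vec n" using A unfolding image_mod_def by auto
    then show "v = v' \<and> w = w'" using e append_vec_eq by blast
  qed
  ultimately show ?thesis by (simp add: card_image card_cartesian_product)
qed

text \<open>With g = gcd(h, l) and h = g h', the factor h' is prime to k = l / g; hence h b modulo l
  determines exactly the class of b modulo k.\<close>

lemma card_multiples_mod:
  assumes l: "0 < l" shows "card ((\<lambda>b. h * b mod int l) ` UNIV) = l div nat (gcd h (int l))"
proof -
  define g where "g = gcd h (int l)"
  have g: "g > 0" "g dvd h" "g dvd int l" using l unfolding g_def by auto
  define k where "k = int l div g"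
  have k: "k > 0" "int l = g * k" using g l unfolding k_def by (auto simp: pos_imp_zdiv_pos_iff zdvd_imp_le)
  obtain h' where h': "h = g * h'" using g(2) by blast
  have cop: "coprime h' k"
  proof -
    have "g * gcd h' k = g" using h' k(2) g(1) unfolding g_def[symmetric] by (metis abs_of_pos g_def gcd_mult_distrib_int)
    then show ?thesis using g(1) by (simp add: coprime_iff_gcd_eq_1)
  qed
  have eq: "h * b mod int l = h * c mod int l \<longleftrightarrow> b mod k = c mod k" for b c
  proof -
    have "h * b mod int l = h * c mod int l \<longleftrightarrow> int l dvd h * b - h * c" by (rule mod_eq_dvd_iff)
    also have "\<dots> \<longleftrightarrow> g * k dvd g * (h' * (b - c))" unfolding k(2) h' by (simp add: algebra_simps)
    also have "\<dots> \<longleftrightarrow> k dvd h' * (b - c)" using g(1) by simp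
    also have "\<dots> \<longleftrightarrow> k dvd b - c" using cop by (simp add: coprime_commute coprime_dvd_mult_right_iff)
    also have "\<dots> \<longleftrightarrow> b mod k = c mod k" by (rule mod_eq_dvd_iff[symmetric])
    finally show ?thesis .
  qed
  have "(\<lambda>b. h * b mod int l) ` UNIV = (\<lambda>b. h * b mod int l) ` {0..<k}"
  proof (rule equalityI; rule subsetI)
    fix x assume "x \<in> (\<lambda>b. h * b mod int l) ` UNIV"
    then obtain b where "x = h * b mod int l" by blast
    then have "x = h * (b mod k) mod int l" using eq[of b "b mod k"] by simp
    moreover have "b mod k \<in> {0..<k}" using k by simp
    ultimately show "x \<in> (\<lambda>b. h * b mod int l) ` {0..<k}" by blast
  qed auto
  moreover have "inj_on (\<lambda>b. h * b mod int l) {0..<k}"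
    by (rule inj_onI) (simp add: eq)
  ultimately have "card ((\<lambda>b. h * b mod int l) ` UNIV) = nat k" by (simp add: card_image)
  also have "nat k = l div nat g" using g(1) unfolding k_def by (simp add: nat_div_distrib)
  finally show ?thesis unfolding g_def .
qed

text \<open>The two coordinates run independently through the multiples of h. This is why the
  dimension comes out as a square.\<close>

lemma card_image_mod_skew_block:
  assumes l: "0 < l" shows "card (image_mod l (skew_block h)) = (l div nat (gcd h (int l)))\<^sup>2"
proof -
  let ?R = "(\<lambda>b. h * b mod int l) ` UNIV"
  have S: "skew_block h = mat 2 2 (\<lambda>(i, j). if i = 0 then (if j = 0 then 0 else h) else (if j = 0 then - h else 0))"
    unfolding skew_block_def by (rule eq_matI) (auto simp: mat_of_rows_list_def less_2_cases_iff)
  have mv: "map_vec (\<lambda>x. x mod int l) (skew_block h *\<^sub>v a) = vec_of_list [h * a $ 1 mod int l, h * (- a $ 0) mod int l]"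
    if "a \<in> carrier_vec 2" for a
  proof (rule eq_vecI)
    fix i assume "i < dim_vec (vec_of_list [h * a $ 1 mod int l, h * (- a $ 0) mod int l])"
    then have "i = 0 \<or> i = 1" by auto
    then show "map_vec (\<lambda>x. x mod int l) (skew_block h *\<^sub>v a) $ i = vec_of_list [h * a $ 1 mod int l, h * (- a $ 0) mod int l] $ i"
      using that unfolding S by (auto simp: scalar_prod_def numeral_2_eq_2)
  qed (simp add: S)
  have "image_mod l (skew_block h) = (\<lambda>(x, y). vec_of_list [x, y]) ` (?R \<times> ?R)"
  proof (rule equalityI; rule subsetI)
    fix x assume "x \<in> image_mod l (skew_block h)"
    then obtain a where "a \<in> carrier_vec 2" "x = map_vec (\<lambda>x. x mod int l) (skew_block h *\<^sub>v a)"
      unfolding image_mod_def S by auto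
    then have "x = (\<lambda>(x, y). vec_of_list [x, y]) (h * a $ 1 mod int l, h * (- a $ 0) mod int l)" using mv[of a] by simp
    then show "x \<in> (\<lambda>(x, y). vec_of_list [x, y]) ` (?R \<times> ?R)" by (rule image_eqI) blast
  next
    fix x assume "x \<in> (\<lambda>(x, y). vec_of_list [x, y]) ` (?R \<times> ?R)"
    then obtain b c where bc: "x = vec_of_list [h * b mod int l, h * c mod int l]" by auto
    \<comment> \<open>The block sends (a_0, a_1) to (h a_1, -h a_0), so this vector hits the
      prescribed pair.\<close>
    define a where "a = vec 2 (\<lambda>i. if i = 0 then - c else b)"
    have a: "a \<in> carrier_vec 2" "a $ 1 = b" "- a $ 0 = c" unfolding a_def by auto
    have "x = map_vec (\<lambda>x. x mod int l) (skew_block h *\<^sub>v a)" unfolding mv[OF a(1)] a(2,3) bc ..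
    moreover have "dim_col (skew_block h) = 2" unfolding S by simp
    ultimately show "x \<in> image_mod l (skew_block h)" using a(1) unfolding image_mod_def by auto
  qed
  moreover have "inj_on (\<lambda>(x, y). vec_of_list [x, y]) (?R \<times> ?R)"
    by (rule inj_onI) (auto dest!: arg_cong[of _ _ list_of_vec] simp: list_vec)
  ultimately have "card (image_mod l (skew_block h)) = card ?R * card ?R"
    by (simp add: card_image card_cartesian_product)
  then show ?thesis unfolding card_multiples_mod[OF l] by (simp add: power2_eq_square)
qed

lemma skew_block_carrier: "skew_block h \<in> carrier_mat 2 2"
  unfolding skew_block_def by (rule carrier_matI) (auto simp: mat_of_rows_list_def)

lemma card_image_mod_diag:
  assumes l: "0 < l"
  shows "\<exists>n. diag_block_mat (map skew_block hs @ [0\<^sub>m k k]) \<in> carrier_mat n n \<and> n = 2 * length hs + k \<and>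
    card (image_mod l (diag_block_mat (map skew_block hs @ [0\<^sub>m k k]))) = (\<Prod>h\<leftarrow>hs. (l div nat (gcd h (int l)))\<^sup>2)"
proof (induct hs)
  case Nil
  have "image_mod l (0\<^sub>m k k) = {0\<^sub>v k}"
  proof -
    have "map_vec (\<lambda>x. x mod int l) (0\<^sub>m k k *\<^sub>v a) = 0\<^sub>v k" if "a \<in> carrier_vec k" for a
      using that by (intro eq_vecI) auto
    then show ?thesis unfolding image_mod_def by (auto intro!: image_eqI[of _ _ "0\<^sub>v k"])
  qed
  moreover have "diag_block_mat [0\<^sub>m k k] = (0\<^sub>m k k :: int mat)"
    by (rule eq_matI) (auto simp: Let_def)
  ultimately show ?case by simp
next
  case (Cons h hs)
  let ?D = "diag_block_mat (map skew_block hs @ [0\<^sub>m k k])"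
  obtain n where n: "?D \<in> carrier_mat n n" "n = 2 * length hs + k"
    "card (image_mod l ?D) = (\<Prod>h\<leftarrow>hs. (l div nat (gcd h (int l)))\<^sup>2)" using Cons by blast
  have "diag_block_mat (map skew_block (h # hs) @ [0\<^sub>m k k])
      = four_block_mat (skew_block h) (0\<^sub>m 2 n) (0\<^sub>m n 2) ?D"
    using skew_block_carrier[of h] n(1) by (simp add: Let_def)
  then show ?case
    using card_image_mod_four_block[OF l skew_block_carrier n(1), of h] card_image_mod_skew_block[OF l, of h]
      n skew_block_carrier[of h] by auto
qed

text \<open>Comparing sizes in the normal form gives n = 2 s + dim ker, so the upper bound of the
  product is the number s of blocks; the list counts from 0.\<close>

lemma card_image_mod_invariant_factors:
  assumes l: "0 < l" and S: "S \<in> carrier_mat n n" and hs: "invariant_factors S hs"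
  shows "card (image_mod l S) = (\<Prod>i = 1..(n - int_kernel_dim S) div 2. l div nat (gcd (hs ! (i - 1)) (int l)))\<^sup>2"
proof -
  let ?k = "int_kernel_dim S"
  obtain E where E: "E \<in> carrier_mat n n" "invertible_mat E"
    "E * S * E\<^sup>T = diag_block_mat (map skew_block hs @ [0\<^sub>m ?k ?k])"
    using hs S unfolding invariant_factors_def by auto
  obtain m where m: "diag_block_mat (map skew_block hs @ [0\<^sub>m ?k ?k]) \<in> carrier_mat m m" "m = 2 * length hs + ?k"
    "card (image_mod l (diag_block_mat (map skew_block hs @ [0\<^sub>m ?k ?k]))) = (\<Prod>h\<leftarrow>hs. (l div nat (gcd h (int l)))\<^sup>2)"
    using card_image_mod_diag[OF l] by blast
  have "E * S * E\<^sup>T \<in> carrier_mat n n" using E(1) S by auto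
  then have "m = n" using m(1) E(3) by (metis carrier_matD(1))
  then have len: "(n - ?k) div 2 = length hs" using m(2) by simp
  have "card (image_mod l S) = (\<Prod>h\<leftarrow>hs. (l div nat (gcd h (int l)))\<^sup>2)"
    using card_image_mod_congruent[OF l E(1,2) S] m(3) unfolding E(3) by simp
  also have "\<dots> = (\<Prod>h\<leftarrow>hs. l div nat (gcd h (int l)))\<^sup>2" by (induct hs) (auto simp: power_mult_distrib)
  also have "(\<Prod>h\<leftarrow>hs. l div nat (gcd h (int l))) = (\<Prod>i = 0..<length hs. l div nat (gcd (hs ! i) (int l)))"
    by (simp add: prod.list_conv_set_nth)
  also have "\<dots> = (\<Prod>i = 1..length hs. l div nat (gcd (hs ! (i - 1)) (int l)))"
    by (rule prod.reindex_bij_witness[of _ "\<lambda>i. i - 1" Suc]) auto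
  finally show ?thesis unfolding len .
qed

section \<open>The PI degree\<close>


context skew_field
begin

text \<open>Carries the dimension to the copy of the division ring whose type
  \<open>has_PI_deg\<close> demands, by following the inductive definition of dimension.\<close>

lemma dimension_ring_hom:
  assumes S: "ring S" and D: "subring D R" and f: "f \<in> Ring.ring_hom (R\<lparr>carrier := D\<rparr>) S" "inj_on f D"
    and K: "subfield K R" "K \<subseteq> D" and dim: "dimension n K E" "E \<subseteq> D"
  shows "ring.dimension S n (f ` K) (f ` E)"
  using dim(1) K dim(2)
proof (induct n K E rule: dimension.induct)
  case (zero_dim K)
  have "f ` {\<zero>} = {\<zero>\<^bsub>S\<^esub>}" using ring_hom_sub_zero[OF ring_axioms S D f(1)] by simp
  then show ?case using ring.zero_dim[OF S] by metis
next
  case (Suc_dim v E n K)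
  interpret S: ring S by (rule S)
  note fD = ring_hom_subD[OF f(1)] and SD = subringE[OF D]
  note K01 = subringE(2,3)[OF subfieldE(1)[OF Suc_dim(5)]]
  have E: "E \<subseteq> carrier R" "\<zero> \<in> E" using space_subgroup_props(1,2)[OF Suc_dim(5,3)] by auto
  \<comment> \<open>The induction hypothesis asks for the smaller space inside \<open>D\<close>; its
    elements are the combinations with coefficient zero at v, and v itself has coefficient
    one.\<close>
  have "\<zero> \<otimes> v \<oplus> e = e" if "e \<in> E" for e using that E Suc_dim(1) by auto
  then have ED: "E \<subseteq> D" using Suc_dim(7) K01 unfolding subset_iff line_extension_mem_iff by metis
  have "v = \<one> \<otimes> v \<oplus> \<zero>" using Suc_dim(1) by simp
  then have vD: "v \<in> D" using Suc_dim(7) K01 E(2) unfolding subset_iff line_extension_mem_iff by blast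
  have IH: "ring.dimension S n (f ` K) (f ` E)" using Suc_dim(4)[OF Suc_dim(5,6) ED] .
  have im: "f (k \<otimes> v \<oplus> e) = f k \<otimes>\<^bsub>S\<^esub> f v \<oplus>\<^bsub>S\<^esub> f e" if "k \<in> K" "e \<in> E" for k e
    using that fD(2,3) vD Suc_dim(6) ED SD(6)[OF _ vD] by (metis subsetD)
  have "f ` line_extension K v E = S.line_extension (f ` K) (f v) (f ` E)"
  proof (rule equalityI; rule subsetI)
    fix y assume "y \<in> f ` line_extension K v E"
    then obtain k e where "k \<in> K" "e \<in> E" "y = f (k \<otimes> v \<oplus> e)" by (auto simp: line_extension_mem_iff)
    then show "y \<in> S.line_extension (f ` K) (f v) (f ` E)" unfolding S.line_extension_mem_iff using im by blast
  next
    fix y assume "y \<in> S.line_extension (f ` K) (f v) (f ` E)"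
    then obtain k e where ke: "k \<in> K" "e \<in> E" "y = f k \<otimes>\<^bsub>S\<^esub> f v \<oplus>\<^bsub>S\<^esub> f e" unfolding S.line_extension_mem_iff by blast
    then have "k \<otimes> v \<oplus> e \<in> line_extension K v E" unfolding line_extension_mem_iff by blast
    then show "y \<in> f ` line_extension K v E" using im ke by (metis imageI)
  qed
  moreover have "f v \<notin> f ` E" using f(2) vD ED Suc_dim(2) by (auto simp: inj_on_def)
  ultimately show ?case using S.Suc_dim[OF fD(1)[OF vD] _ IH] by metis
qed

text \<open>As \<iota> has kernel \<open>P\<close>, it embeds the factor ring into \<open>D\<close>,
  and the fractions required by \<open>is_Frac\<close> are those of the datum.\<close>

lemma frac_datum_has_PI_deg:
  assumes C: "subring C R" and P: "cprime P C" and fd: "frac_datum C P D"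
    and D: "subring D R" "\<And>y. y \<in> D \<Longrightarrow> y \<noteq> \<zero> \<Longrightarrow> inv y \<in> D"
    and Z: "subfield (ring_center (R\<lparr>carrier := D\<rparr>)) R"
    and dim: "dimension (n\<^sup>2) (ring_center (R\<lparr>carrier := D\<rparr>)) D"
  shows "has_PI_deg (R\<lparr>carrier := C\<rparr> Quot P) n"
proof -
  obtain \<iota> where i: "\<iota> \<in> Ring.ring_hom (R\<lparr>carrier := C\<rparr>) R" "\<iota> ` C \<subseteq> D" "\<And>a. a \<in> C \<Longrightarrow> \<iota> a = \<zero> \<longleftrightarrow> a \<in> P"
    and frac: "\<And>y. y \<in> D \<Longrightarrow> \<exists>a\<in>C. \<exists>s\<in>C. \<iota> s \<noteq> \<zero> \<and> (\<forall>u\<in>D. \<iota> s \<otimes> u = u \<otimes> \<iota> s) \<and> y = \<iota> a \<otimes> inv (\<iota> s)"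
    using fd unfolding frac_datum_def by blast
  note iD = ring_hom_subD[OF i(1)] and SD = subringE[OF D(1)]
  have DR: "y \<in> carrier R" if "y \<in> D" for y using that SD(1) by blast
  \<comment> \<open>\<open>has_PI_deg\<close> prescribes the type of \<open>D\<close>, so that \<open>D\<close> is copied along an injection\<close>
  define f :: "'a \<Rightarrow> ('a set \<times> 'a set) set" where "f x = {({x}, {x})}" for x
  have inj: "inj f" by (rule injI) (simp add: f_def)
  define g where "g = inv_into UNIV f"
  have gf [simp]: "g (f x) = x" for x unfolding g_def using inj by (rule inv_f_f)
  define D' :: "('a set \<times> 'a set) set ring" where
    "D' = \<lparr>carrier = f ` D, monoid.mult = (\<lambda>X Y. f (g X \<otimes> g Y)), one = f \<one>, zero = f \<zero>, add = (\<lambda>X Y. f (g X \<oplus> g Y))\<rparr>"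
  have D'_simps: "carrier D' = f ` D" "f x \<otimes>\<^bsub>D'\<^esub> f y = f (x \<otimes> y)" "f x \<oplus>\<^bsub>D'\<^esub> f y = f (x \<oplus> y)" "\<one>\<^bsub>D'\<^esub> = f \<one>" "\<zero>\<^bsub>D'\<^esub> = f \<zero>" for x y
    unfolding D'_def by simp_all
  interpret DD: ring "R\<lparr>carrier := D\<rparr>" by (rule subring_is_ring[OF D(1)])
  have fiso: "f \<in> ring_iso (R\<lparr>carrier := D\<rparr>) D'"
    by (intro ring_iso_memI) (auto simp: D'_simps bij_betw_def inj_on_subset[OF inj])
  have fhom: "f \<in> Ring.ring_hom (R\<lparr>carrier := D\<rparr>) D'" using fiso unfolding ring_iso_def by blast
  have finj: "inj_on f D" using inj by (rule inj_on_subset) simp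
  interpret D': ring D' using DD.ring_iso_imp_img_ring[OF fiso] by (simp add: D'_def)
  have f_eq: "f x = f y \<longleftrightarrow> x = y" for x y using inj by (auto dest: injD)
  have finv: "f y \<in> Units D' \<and> inv\<^bsub>D'\<^esub> f y = f (inv y)" if y: "y \<in> D" "y \<noteq> \<zero>" for y
  proof -
    have m: "inv y \<in> D" "y \<in> carrier R" using D(2)[OF y] DR y by auto
    have e: "f (inv y) \<otimes>\<^bsub>D'\<^esub> f y = \<one>\<^bsub>D'\<^esub>" "f y \<otimes>\<^bsub>D'\<^esub> f (inv y) = \<one>\<^bsub>D'\<^esub>" using m y by (auto simp: D'_simps)
    have c: "f y \<in> carrier D'" "f (inv y) \<in> carrier D'" using y m by (auto simp: D'_simps)
    show ?thesis using e c D'.inv_unique'[OF c] unfolding Units_def by auto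
  qed
  have D'_sf: "skew_field D'"
  proof (intro skew_field.intro D'.ring_axioms skew_field_axioms.intro)
    show one: "\<one>\<^bsub>D'\<^esub> \<noteq> \<zero>\<^bsub>D'\<^esub>" using one_not_zero f_eq by (simp add: D'_simps)
    have "y \<noteq> \<zero>\<^bsub>D'\<^esub>" if "y \<in> Units D'" for y
      using one D'.Units_r_inv[OF that] D'.l_null[OF D'.Units_inv_closed[OF that]] by metis
    then show "Units D' = carrier D' - {\<zero>\<^bsub>D'\<^esub>}" using finv f_eq D'.Units_closed by (auto simp: D'_simps)
  qed
  interpret CC: ring "R\<lparr>carrier := C\<rparr>" by (rule subring_is_ring[OF C])
  have PI: "ideal P (R\<lparr>carrier := C\<rparr>)" using P unfolding subring_ideal_iff[OF C] cprime_def by blast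
  define h where "h = (\<lambda>a. f (\<iota> a))"
  have hhom: "h \<in> Ring.ring_hom (R\<lparr>carrier := C\<rparr>) D'"
    unfolding h_def using i(2) iD by (intro ring_hom_memI) (auto simp: D'_simps)
  interpret h: ring_hom_ring "R\<lparr>carrier := C\<rparr>" D' h
    by (rule ring_hom_ringI2[OF CC.ring_axioms D'.ring_axioms hhom])
  have ker: "a_kernel (R\<lparr>carrier := C\<rparr>) D' h = P"
    unfolding a_kernel_def' using i(3) f_eq cprimeD(1)[OF P] by (auto simp: h_def D'_simps)
  let ?Q = "R\<lparr>carrier := C\<rparr> Quot P"
  define j where "j = (\<lambda>X. the_elem (h ` X))"
  have jhom: "j \<in> Ring.ring_hom ?Q D'" using h.the_elem_hom unfolding ker j_def .
  have jinj: "inj_on j (carrier ?Q)" using h.the_elem_inj unfolding ker j_def inj_on_def by blast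
  have jcos: "j (P +>\<^bsub>R\<lparr>carrier := C\<rparr>\<^esub> a) = h a" if a: "a \<in> C" for a
    using h.the_elem_simp[of a] a unfolding ker j_def by simp
  have cos: "P +>\<^bsub>R\<lparr>carrier := C\<rparr>\<^esub> a \<in> carrier ?Q" if "a \<in> C" for a
    using that unfolding FactRing_def A_RCOSETS_def' by auto
  have Qring: "ring ?Q" using ideal.quotient_is_ring[OF PI] .
  have fr: "is_Frac ?Q D' j"
    unfolding is_Frac_def
  proof (intro conjI ballI Qring D'_sf jhom jinj)
    fix x assume "x \<in> carrier D'"
    then obtain y where y: "y \<in> D" "x = f y" by (auto simp: D'_simps)
    obtain a s where as: "a \<in> C" "s \<in> C" "\<iota> s \<noteq> \<zero>" "\<forall>u\<in>D. \<iota> s \<otimes> u = u \<otimes> \<iota> s" "y = \<iota> a \<otimes> inv (\<iota> s)"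
      using frac[OF y(1)] by blast
    have m: "\<iota> a \<in> D" "\<iota> s \<in> D" "\<iota> a \<in> carrier R" "\<iota> s \<in> carrier R" using as i(2) iD(1) by auto
    let ?a = "P +>\<^bsub>R\<lparr>carrier := C\<rparr>\<^esub> a" and ?s = "P +>\<^bsub>R\<lparr>carrier := C\<rparr>\<^esub> s"
    have js: "j ?a = f (\<iota> a)" "j ?s = f (\<iota> s)" using jcos as by (auto simp: h_def)
    have "?s \<noteq> \<zero>\<^bsub>?Q\<^esub>"
    proof
      assume "?s = \<zero>\<^bsub>?Q\<^esub>"
      then have "f (\<iota> s) = \<zero>\<^bsub>D'\<^esub>" using js(2) ring_hom_zero[OF jhom Qring D'.ring_axioms] by simp
      then show False using as(3) f_eq by (simp add: D'_simps)
    qed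
    then have mem: "?a \<in> carrier ?Q" "?s \<in> carrier ?Q - {\<zero>\<^bsub>?Q\<^esub>}" using cos as by auto
    have jinv: "inv\<^bsub>D'\<^esub> (f (\<iota> s)) = f (inv (\<iota> s))" using finv[OF m(2) as(3)] by simp
    have "x = j ?a \<otimes>\<^bsub>D'\<^esub> inv\<^bsub>D'\<^esub> j ?s" unfolding js jinv y(2) as(5) by (simp add: D'_simps)
    then show "\<exists>a\<in>carrier ?Q. \<exists>s\<in>carrier ?Q - {\<zero>\<^bsub>?Q\<^esub>}. x = j a \<otimes>\<^bsub>D'\<^esub> inv\<^bsub>D'\<^esub> j s" using mem by blast
    \<comment> \<open>The denominator is central in \<open>D\<close>, so the right fraction is also
      a left fraction.\<close>
    have "\<iota> a \<otimes> inv (\<iota> s) = inv (\<iota> s) \<otimes> \<iota> a"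
      by (rule commute_inv[symmetric]) (use m as(3,4) in auto)
    then have "x = inv\<^bsub>D'\<^esub> j ?s \<otimes>\<^bsub>D'\<^esub> j ?a" unfolding js jinv y(2) as(5) by (simp add: D'_simps)
    then show "\<exists>a\<in>carrier ?Q. \<exists>s\<in>carrier ?Q - {\<zero>\<^bsub>?Q\<^esub>}. x = inv\<^bsub>D'\<^esub> j s \<otimes>\<^bsub>D'\<^esub> j a" using mem by blast
  qed
  let ?Z = "ring_center (R\<lparr>carrier := D\<rparr>)"
  have ZD: "?Z \<subseteq> D" unfolding ring_center_def by auto
  have "f ` ?Z = ring_center D'"
    unfolding ring_center_def using f_eq by (auto simp: D'_simps)
  moreover have "D'.dimension (n\<^sup>2) (f ` ?Z) (f ` D)"
    using dimension_ring_hom[OF D'.ring_axioms D(1) fhom finj Z ZD dim] by simp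
  ultimately have "D'.dimension (n\<^sup>2) (ring_center D') (carrier D')" by (simp add: D'_simps)
  then show ?thesis unfolding has_PI_deg_def using fr by blast
qed

end

section \<open>Integral powers of a root of unity\<close>

context ring
begin

lemma root_pow_mod:
  assumes "q \<in> carrier R" "q [^] (l::nat) = \<one>" shows "q [^] (n::nat) = q [^] (n mod l)"
proof -
  have "q [^] n = q [^] (l * (n div l)) \<otimes> q [^] (n mod l)" using assms(1) by (simp add: nat_pow_mult)
  also have "q [^] (l * (n div l)) = \<one>" using nat_pow_pow[OF assms(1), of l "n div l"] assms(2) by simp
  finally show ?thesis using assms(1) by simp
qed

text \<open>The integral power z reduced modulo \<open>l\<close>, so that only natural exponents
  occur; \<open>int_pow_rpow\<close> identifies it with the power in the theorem.\<close>

definition rpow :: "'a \<Rightarrow> nat \<Rightarrow> int \<Rightarrow> 'a" where "rpow q l z = q [^] nat (z mod int l)"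

context
  fixes q and l :: nat assumes q: "q \<in> carrier R" "q [^] l = \<one>" and l: "0 < l"
begin

lemma rpow_closed [simp]: "rpow q l z \<in> carrier R"
  unfolding rpow_def using q by simp

lemma rpow_add: "rpow q l (z + w) = rpow q l z \<otimes> rpow q l w"
proof -
  have "rpow q l z \<otimes> rpow q l w = q [^] (nat (z mod int l) + nat (w mod int l))"
    unfolding rpow_def using q by (simp add: nat_pow_mult)
  also have "\<dots> = q [^] ((nat (z mod int l) + nat (w mod int l)) mod l)" using root_pow_mod[OF q] .
  also have "(nat (z mod int l) + nat (w mod int l)) mod l = nat ((z + w) mod int l)"
    using l by (simp add: nat_mod_distrib[symmetric] nat_add_distrib[symmetric] mod_add_eq flip: nat_mod_as_int)
      (simp add: nat_mod_as_int mod_add_eq)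
  finally show ?thesis unfolding rpow_def by simp
qed

lemma rpow_zero [simp]: "rpow q l 0 = \<one>"
  unfolding rpow_def by simp

lemma rpow_mod: "rpow q l (z mod int l) = rpow q l z"
  unfolding rpow_def by simp

lemma rpow_nat: "rpow q l (int n) = q [^] n"
  unfolding rpow_def using root_pow_mod[OF q, of n] by (simp add: zmod_int[symmetric])

lemma rpow_mult: "rpow q l (z * int n) = rpow q l z [^] n"
proof (induct n)
  case (Suc n)
  have "z * int (Suc n) = z * int n + z" by (simp add: algebra_simps)
  then show ?case using Suc rpow_add[of "z * int n" z] by simp
qed simp

lemma int_pow_rpow: "q [^] (z::int) = rpow q l z"
proof (cases "z < 0")
  case True
  define u where "u = q [^] nat (- z)"
  have u: "u \<in> carrier R" "u = rpow q l (- z)"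
  proof -
    show "u \<in> carrier R" unfolding u_def using q(1) by (rule nat_pow_closed)
    have "int (nat (- z)) = - z" using True by simp
    then show "u = rpow q l (- z)" unfolding u_def using rpow_nat[of "nat (- z)"] by metis
  qed
  have "u \<otimes> rpow q l z = \<one>" "rpow q l z \<otimes> u = \<one>"
    unfolding u(2) by (simp_all flip: rpow_add)
  from inv_unique'[OF u(1) rpow_closed this] have "inv (q [^] nat (- z)) = rpow q l z" unfolding u_def by simp
  then show ?thesis unfolding int_pow_def2 using True by (simp only: if_True)
next
  case False
  then have "int (nat z) = z" by simp
  then have "q [^] nat z = rpow q l z" using rpow_nat[of "nat z"] by metis
  then show ?thesis unfolding int_pow_def2 using False by (simp only: if_False)
qed

end

text \<open>Two equal powers with distinct exponents below \<open>l\<close> would give a trivial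
  power with positive exponent below \<open>l\<close>, against primitivity.\<close>

lemma (in skew_field) rpow_inj:
  assumes q: "q \<in> carrier R" "primitive_root_of_unity R l q"
    and zw: "z \<in> {0..<int l}" "w \<in> {0..<int l}" "rpow q l z = rpow q l w"
  shows "z = w"
proof -
  have l: "0 < l" "q [^] l = \<one>" and prim: "\<And>k. 0 < k \<Longrightarrow> k < l \<Longrightarrow> q [^] k \<noteq> \<one>"
    using q(2) unfolding primitive_root_of_unity_def by auto
  have q0: "q \<noteq> \<zero>" using l one_not_zero by (metis gr0_conv_Suc nat_pow_Suc q(1) r_null nat_pow_closed)
  have key: "a = b" if "a \<le> b" "b < l" "q [^] a = q [^] b" for a b :: nat
  proof (rule ccontr)
    assume "a \<noteq> b"
    have "q [^] b = q [^] a \<otimes> q [^] (b - a)" using that(1) q(1) by (simp add: nat_pow_mult)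
    then have "q [^] a \<otimes> \<one> = q [^] a \<otimes> q [^] (b - a)" using that(3) q(1) by simp
    then have "q [^] (b - a) = \<one>" using q(1) q0 by (subst (asm) mult_cancel_left) auto
    then show False using prim[of "b - a"] that \<open>a \<noteq> b\<close> by auto
  qed
  have "q [^] nat z = q [^] nat w" using zw unfolding rpow_def by simp
  moreover have "nat z < l" "nat w < l" using zw by auto
  ultimately have "nat z = nat w" by (metis key nat_le_linear)
  then show ?thesis using zw by auto
qed

end

section \<open>Characters of a uniparameter torus\<close>

locale uniparameter_torus = quantum_torus R K "{..<m}" t lam l for R (structure) and K m t lam l +
  fixes q :: 'a and S :: "int mat"
  assumes q: "q \<in> K" "primitive_root_of_unity R l q" and S: "S \<in> carrier_mat m m"
    and lam_q: "\<And>i j. i < m \<Longrightarrow> j < m \<Longrightarrow> lam i j = rpow q l (S $$ (i, j))"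
begin

lemma q_root: "q \<in> carrier R" "q [^] l = \<one>"
  using q unfolding primitive_root_of_unity_def by auto

text \<open>The i-th entry of S a, cut off after n columns so that words can be built one generator
  at a time.\<close>

definition wt :: "nat \<Rightarrow> (nat \<Rightarrow> nat) \<Rightarrow> nat \<Rightarrow> int" where
  "wt n a i = (\<Sum>j<n. S $$ (i, j) * int (a j))"

lemma eig_cong: "eig u c \<Longrightarrow> (\<And>i. i < m \<Longrightarrow> c i = c' i) \<Longrightarrow> eig u c'"
  unfolding eig_def by auto

lemma words_wt: "u \<in> words \<Longrightarrow> \<exists>a. eig u (\<lambda>i. rpow q l (wt m a i))"
proof (induct rule: words.induct)
  case one
  have "eig \<one> (\<lambda>i. rpow q l (wt m (\<lambda>_. 0) i))"
    using eig_one by (simp add: wt_def rpow_zero[OF q_root l_pos])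
  then show ?case by blast
next
  case (step u k)
  then obtain a where a: "eig u (\<lambda>i. rpow q l (wt m a i))" and k: "k < m" by auto
  let ?b = "a(k := Suc (a k))"
  have "wt m ?b i = S $$ (i, k) + wt m a i" for i
  proof -
    have "wt m ?b i = (\<Sum>j<m. S $$ (i, j) * int (a j) + (if j = k then S $$ (i, j) else 0))"
      unfolding wt_def by (rule sum.cong) (auto simp: algebra_simps)
    then show ?thesis unfolding wt_def using k by (simp add: sum.distrib sum.delta)
  qed
  then have "eig (t k \<otimes> u) (\<lambda>i. rpow q l (wt m ?b i))"
    by (intro eig_cong[OF eig_mult[OF eig_t a]]) (simp_all add: k lam_q rpow_add[OF q_root l_pos])
  then show ?case by blast
qed

lemma wt_words: "n \<le> m \<Longrightarrow> \<exists>u\<in>words. eig u (\<lambda>i. rpow q l (wt n a i))"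
proof (induct n)
  case 0
  then show ?case using eig_one words.one by (auto simp: wt_def rpow_zero[OF q_root l_pos])
next
  case (Suc n)
  then obtain u where u: "u \<in> words" "eig u (\<lambda>i. rpow q l (wt n a i))" by auto
  have n: "n \<in> {..<m}" using Suc by auto
  have tn: "t n \<in> words" using words.step[OF words.one n] t n by simp
  have "eig (u \<otimes> t n [^] a n) (\<lambda>i. rpow q l (wt (Suc n) a i))"
  proof (rule eig_cong[OF eig_mult[OF u(2) eig_pow[OF eig_t[OF n]]]])
    fix i assume "i < m"
    then show "rpow q l (wt n a i) \<otimes> lam i n [^] a n = rpow q l (wt (Suc n) a i)"
      using n by (simp add: lam_q rpow_add[OF q_root l_pos] rpow_mult[OF q_root l_pos] wt_def)
  qed
  then show ?case using words_mult[OF u(1) words_pow[OF tn]] by blast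
qed

definition vchar :: "int vec \<Rightarrow> nat \<Rightarrow> 'a" where "vchar v = (\<lambda>i\<in>{..<m}. rpow q l (v $ i))"

text \<open>A word with exponent vector a has the eigenvalues q^((S a)_i), which depend on S a
  modulo \<open>l\<close> only.\<close>

lemma chi_words: "chi ` words = vchar ` image_mod l S"
proof (rule equalityI; rule subsetI)
  fix x assume "x \<in> chi ` words"
  then obtain u a where u: "x = chi u" "eig u (\<lambda>i. rpow q l (wt m a i))" using words_wt by blast
  let ?a = "vec m (\<lambda>i. int (a i))"
  have "x = vchar (map_vec (\<lambda>x. x mod int l) (S *\<^sub>v ?a))"
    unfolding u(1) eig_chi[OF u(2)] vchar_def
    using S by (intro restrict_ext) (auto simp: rpow_mod[OF q_root l_pos] wt_def scalar_prod_def lessThan_atLeast0)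
  then show "x \<in> vchar ` image_mod l S" unfolding image_mod_def using S by auto
next
  fix x assume "x \<in> vchar ` image_mod l S"
  then obtain b where b: "b \<in> carrier_vec m" "x = vchar (map_vec (\<lambda>x. x mod int l) (S *\<^sub>v b))"
    unfolding image_mod_def using S by auto
  \<comment> \<open>Words carry nonnegative exponents; an integral vector is replaced by its
    residues, which leaves S b unchanged modulo \<open>l\<close>.\<close>
  define a where "a j = nat (b $ j mod int l)" for j
  obtain u where u: "u \<in> words" "eig u (\<lambda>i. rpow q l (wt m a i))" using wt_words[of m a] by auto
  have "wt m a i mod int l = (S *\<^sub>v b) $ i mod int l" if "i < m" for i
  proof -
    have "wt m a i mod int l = (\<Sum>j<m. S $$ (i, j) * (b $ j mod int l) mod int l) mod int l"
      unfolding wt_def a_def using l_pos by (simp add: mod_sum_eq)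
    also have "\<dots> = (\<Sum>j<m. S $$ (i, j) * b $ j mod int l) mod int l" by (simp add: mod_mult_right_eq)
    also have "\<dots> = (\<Sum>j<m. S $$ (i, j) * b $ j) mod int l" by (rule mod_sum_eq)
    finally show ?thesis using S b that by (simp add: scalar_prod_def lessThan_atLeast0)
  qed
  then have "chi u = x"
    unfolding eig_chi[OF u(2)] b(2) vchar_def using S
    by (intro restrict_ext) (auto, metis rpow_mod[OF q_root l_pos])
  then show "x \<in> chi ` words" using u(1) by blast
qed

text \<open>The entries are reduced modulo \<open>l\<close>, so primitivity separates them.\<close>

lemma inj_vchar: "inj_on vchar (image_mod l S)"
proof (rule inj_onI)
  fix v w assume v: "v \<in> image_mod l S" and w: "w \<in> image_mod l S" and e: "vchar v = vchar w"
  have r: "v \<in> carrier_vec m" "\<And>i. i < m \<Longrightarrow> v $ i \<in> {0..<int l}" if "v \<in> image_mod l S" for v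
    using that S l_pos unfolding image_mod_def by auto
  show "v = w"
  proof (rule eq_vecI)
    show "dim_vec v = dim_vec w" using r(1)[OF v] r(1)[OF w] by simp
    fix i assume "i < dim_vec w"
    then have i: "i < m" using r(1)[OF w] by simp
    then have "rpow q l (v $ i) = rpow q l (w $ i)" using fun_cong[OF e, of i] unfolding vchar_def by simp
    then show "v $ i = w $ i" using rpow_inj[OF q_root(1) q(2) r(2)[OF v i] r(2)[OF w i]] by simp
  qed
qed

lemma finite_chi: "finite (chi ` words)"
  unfolding chi_words using finite_image_mod[OF l_pos] by simp

lemma card_chi: "card (chi ` words) = card (image_mod l S)"
  unfolding chi_words using card_image[OF inj_vchar] .

end


text \<open>\<open>pick\<close> is the enumeration behind \<open>submatrix\<close>, and the
  successor shifts matrix indices to generator numbers.\<close>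

lemma remaining_index:
  assumes w: "finite (w :: nat set)"
  defines "J \<equiv> {i. Suc i \<notin> w}"
  shows "(\<lambda>k. Suc (pick J k)) ` {..<card {i. i < N \<and> i \<in> J}} = {1..N} - w"
    and "w \<subseteq> {1..N} \<Longrightarrow> card {i. i < N \<and> i \<in> J} = N - card w"
proof -
  show "(\<lambda>k. Suc (pick J k)) ` {..<card {i. i < N \<and> i \<in> J}} = {1..N} - w"
  proof (rule equalityI; rule subsetI)
    \<comment> \<open>Finiteness of w makes \<open>J\<close> cofinite; the membership rule for
      \<open>pick\<close> on infinite sets then applies without a bound on the position.\<close>
    have "infinite J"
    proof
      assume "finite J"
      then have "finite (Suc ` J \<union> w \<union> {0})" using w by simp
      moreover have "Suc ` J \<union> w \<union> {0} = UNIV"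
      proof (rule equalityI; rule subsetI)
        fix x :: nat
        show "x \<in> Suc ` J \<union> w \<union> {0}" unfolding J_def by (cases x) auto
      qed simp
      ultimately have "finite (UNIV :: nat set)" by argo
      then show False by simp
    qed
    fix x assume "x \<in> (\<lambda>k. Suc (pick J k)) ` {..<card {i. i < N \<and> i \<in> J}}"
    then obtain k where k: "x = Suc (pick J k)" "k < card {i. i < N \<and> i \<in> J}" by auto
    have "pick J k < N" using pick_le k(2) by blast
    moreover have "pick J k \<in> J" using pick_in_set_inf[OF \<open>infinite J\<close>] .
    ultimately show "x \<in> {1..N} - w" unfolding k(1) J_def by auto
  next
    fix x assume x: "x \<in> {1..N} - w"
    then obtain i where i: "x = Suc i" by (metis DiffD1 One_nat_def Suc_le_D atLeastAtMost_iff)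
    have iJ: "i \<in> J" "i < N" using x i unfolding J_def by auto
    let ?k = "card {a \<in> J. a < i}"
    have "{a \<in> J. a < i} \<subset> {a. a < N \<and> a \<in> J}" using iJ by auto
    then have "?k < card {i. i < N \<and> i \<in> J}" by (intro psubset_card_mono) auto
    moreover have "pick J ?k = i" using pick_card_in_set[OF iJ(1)] .
    ultimately show "x \<in> (\<lambda>k. Suc (pick J k)) ` {..<card {i. i < N \<and> i \<in> J}}" unfolding i by force
  qed
  assume wN: "w \<subseteq> {1..N}"
  have "Suc ` {i. i < N \<and> i \<in> J} = {1..N} - w"
    unfolding J_def by (auto simp: image_iff) (metis Suc_le_D Suc_le_eq)
  then have "card {i. i < N \<and> i \<in> J} = card ({1..N} - w)" by (metis card_image inj_Suc)
  then show "card {i. i < N \<and> i \<in> J} = N - card w" using wN w by (simp add: card_Diff_subset)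
qed

section \<open>The factor ring of A' by J_w, and the conclusion\<close>

context qna_root
begin

lemma T_inv: "dd_inv 2" and two_le: "2 \<le> N + 1"
  using dd_inv_all[of 2] N_pos by auto

lemmas T_carrier = dd_gen_carrier[OF T_inv order_refl two_le]

lemma T_rel:
  assumes i: "i \<in> {1..N}" "m \<in> {1..N}" shows "T i \<otimes> T m = lam i m \<otimes> (T m \<otimes> T i)"
proof -
  note c = T_carrier(1)[OF i(1)] T_carrier(1)[OF i(2)] lam_K(1)[OF i, THEN K_carrier] lam_K(1)[OF i(2,1), THEN K_carrier]
  consider "m < i" | "i = m" | "i < m" by linarith
  then show ?thesis
  proof cases
    case 1
    then show ?thesis using dd_gen_rel[OF T_inv order_refl two_le, of i m] i by auto
  next
    case 2 then show ?thesis using lam_diag[OF i(1)] c by simp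
  next
    case 3
    then have "T m \<otimes> T i = lam m i \<otimes> (T i \<otimes> T m)" using dd_gen_rel[OF T_inv order_refl two_le, of m i] i by auto
    then have "lam i m \<otimes> (T m \<otimes> T i) = lam i m \<otimes> lam m i \<otimes> (T i \<otimes> T m)" using c by (simp add: m_assoc)
    then show ?thesis using lam_swap[OF i] c by simp
  qed
qed

text \<open>At level 2 \<open>dd_free\<close> starts with index 2. For index 1 the map
  \<open>Phi 2\<close> carries the freeness of X_1 over \<open>K\<close> to T_1.\<close>

lemma T_free: assumes i: "i \<in> {1..N}" shows "left_free (Aj 2 (i - 1)) (T i)"
proof (cases "i = 1")
  case False then show ?thesis using dd_free[OF order_refl two_le, of i] i by auto
next
  case True
  note D = dd_invD[OF T_inv]
  have X1: "X 1 \<in> Al (2 - 1)" using gen_subalg[of 1 "2 - 1" X] by simp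
  have T1: "T 1 = Phi 2 (X 1)" using D(4)[of 1] by simp
  have oN: "2 - 1 \<le> N" using N_pos by simp
  note S = Al_subring[OF oN]
  have "horner (X 1) cs \<in> Al (2 - 1) \<and> Phi 2 (horner (X 1) cs) = horner (T 1) cs" if "set cs \<subseteq> K" for cs
    using that
  proof (induct cs)
    case Nil then show ?case using D(3)[of \<zero>] K_subalg by simp
  next
    case (Cons c cs)
    have c: "c \<in> K" "c \<in> Al (2 - 1)" using Cons K_subalg by auto
    have h: "horner (X 1) cs \<in> Al (2 - 1)" "horner (X 1) cs \<otimes> X 1 \<in> Al (2 - 1)"
      using Cons subringE(6)[OF S _ X1] by auto
    show ?case
      using Cons subringE(7)[OF S c(2) h(2)] ring_hom_subD(3)[OF D(1) c(2) h(2)] ring_hom_subD(2)[OF D(1) h(1) X1] D(3)[OF c(1)] T1 by simp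
  qed
  then have "left_free K (T 1)"
    using X_one_free D(2) unfolding left_free_def by metis
  then show ?thesis using True subalg_0 by simp
qed

text \<open>The quotient of \<open>A'\<close> by \<open>J_ideal w\<close> is the quantum affine space in the remaining generators,
  which embeds into \<open>A'\<close>.\<close>

lemma retraction_exists:
  "\<exists>\<rho>. \<rho> \<in> Ring.ring_hom (F\<lparr>carrier := Aj 2 N\<rparr>) F \<and> (\<forall>k\<in>K. \<rho> k = k) \<and>
     (\<forall>i\<in>{1..N}. \<rho> (T i) = (if i \<in> w then \<zero> else T i))"
proof -
  have idh: "(\<lambda>k. k) \<in> Ring.ring_hom (F\<lparr>carrier := Aj 2 0\<rparr>) F"
    unfolding subalg_0 by (rule ring_hom_memI) auto
  have "\<exists>h'. h' \<in> Ring.ring_hom (F\<lparr>carrier := Aj 2 N\<rparr>) F \<and> (\<forall>b\<in>Aj 2 0. h' b = b) \<and>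
      (\<forall>i\<in>{1..N}. h' (T i) = (if i \<in> w then \<zero> else T i))"
  proof (rule extend_subalg_hom[where c = lam and s = 0 and y = T, OF T_carrier(1) _ _ _ ring_axioms idh])
    fix i assume i: "i \<in> {0<..N}"
    then have i': "i \<in> {1..N}" by auto
    show "T i \<noteq> \<zero>" using T_carrier(2)[OF i'] .
    show "left_free (Aj 2 (i - 1)) (T i)" using T_free[OF i'] .
    show "(if i \<in> w then \<zero> else T i) \<in> carrier F" using T_carrier(1)[OF i'] by simp
    show "(if i \<in> w then \<zero> else T i) \<otimes> k = k \<otimes> (if i \<in> w then \<zero> else T i)" if "k \<in> K" for k
      using K_comm[OF that T_carrier(1)[OF i']] that by simp
    fix m assume m: "m \<in> {1..<i}"
    then have m': "m \<in> {1..N}" using i' by auto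
    show "lam i m \<in> K \<and> T i \<otimes> T m = lam i m \<otimes> (T m \<otimes> T i)" using lam_K(1)[OF i' m'] T_rel[OF i' m'] by simp
    \<comment> \<open>If i or m lies in w, both sides vanish; otherwise this is the relation between
      T_i and T_m.\<close>
    show "(if i \<in> w then \<zero> else T i) \<otimes> (if m \<in> w then \<zero> else T m)
      = lam i m \<otimes> ((if m \<in> w then \<zero> else T m) \<otimes> (if i \<in> w then \<zero> else T i))"
      using T_rel[OF i' m'] T_carrier(1)[OF i'] T_carrier(1)[OF m'] lam_K(1)[OF i' m'] by simp
  qed auto
  then show ?thesis unfolding subalg_0 by blast
qed

text \<open>Each a is congruent to \<rho> a modulo \<open>J_ideal w\<close>, by induction from the
  generators, so the kernel lies in the ideal. The other inclusion is minimality of the generated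
  ideal.\<close>

lemma J_ideal_kernel:
  assumes w: "w \<subseteq> {1..N}" and rho: "\<rho> \<in> Ring.ring_hom (F\<lparr>carrier := Aj 2 N\<rparr>) F" "\<And>k. k \<in> K \<Longrightarrow> \<rho> k = k"
    "\<And>i. i \<in> {1..N} \<Longrightarrow> \<rho> (T i) = (if i \<in> w then \<zero> else T i)" and a: "a \<in> Aj 2 N"
  shows "\<rho> a = \<zero> \<longleftrightarrow> a \<in> J_ideal w" and "\<rho> a \<in> Aj 2 N"
proof -
  note rD = ring_hom_subD[OF rho(1)]
  have S: "subring (Aj 2 N) F" using Aj_subring[OF order_refl two_le order_refl] .
  note SD = subringE[OF S]
  interpret A2: ring "A'" unfolding dd_alg_def by (rule subring_is_ring[OF S])
  have Tm: "T i \<in> Aj 2 N" if "i \<in> {1..N}" for i using gen_subalg that by auto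
  have TW: "T ` w \<subseteq> carrier A'" unfolding dd_alg_def using Tm w by auto
  have J: "ideal (J_ideal w) (F\<lparr>carrier := Aj 2 N\<rparr>)" "T ` w \<subseteq> J_ideal w"
    using A2.genideal_ideal[OF TW] A2.genideal_self[OF TW] unfolding J_ideal_def dd_alg_def by auto
  have Jp: "\<zero> \<in> J_ideal w" "\<And>a b. a \<in> J_ideal w \<Longrightarrow> b \<in> J_ideal w \<Longrightarrow> a \<oplus> b \<in> J_ideal w" "\<And>a. a \<in> J_ideal w \<Longrightarrow> \<ominus> a \<in> J_ideal w"
    "\<And>a c. a \<in> J_ideal w \<Longrightarrow> c \<in> Aj 2 N \<Longrightarrow> a \<otimes> c \<in> J_ideal w" "\<And>a c. a \<in> J_ideal w \<Longrightarrow> c \<in> Aj 2 N \<Longrightarrow> c \<otimes> a \<in> J_ideal w"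
    "J_ideal w \<subseteq> Aj 2 N"
    using J(1) unfolding subring_ideal_iff[OF S] by blast+
  let ?I = "{a \<in> Aj 2 N. \<rho> a = \<zero>}"
  have "ideal ?I (F\<lparr>carrier := Aj 2 N\<rparr>)"
    unfolding subring_ideal_iff[OF S]
    using SD ring_hom_sub_zero[OF ring_axioms ring_axioms S rho(1)] ring_hom_sub_neg[OF ring_axioms ring_axioms S rho(1)] rD by auto
  moreover have "T ` w \<subseteq> ?I" using w Tm rho(3) by auto
  ultimately have sub: "J_ideal w \<subseteq> ?I" using A2.genideal_minimal unfolding J_ideal_def dd_alg_def by simp
  have TR: "T ` {1..N} \<subseteq> carrier F" using T_carrier by auto
  from a TR have "\<rho> a \<in> Aj 2 N \<and> a \<ominus> \<rho> a \<in> J_ideal w"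
  proof (induct rule: subalg_induct)
    case (K k) then show ?case using rho(2) K_subalg Jp(1) by (simp add: r_neg minus_eq)
  next
    case (gen i)
    then have i: "i \<in> {1..N}" by auto
    show ?case
      using rho(3)[OF i] Tm[OF i] SD(2) J(2) Jp(1) T_carrier(1)[OF i] by (auto simp: r_neg minus_eq)
  next
    case (neg a)
    have c: "\<rho> a \<in> carrier F" using rD(1)[OF neg(1)] .
    have "\<ominus> a \<ominus> \<ominus> \<rho> a = \<ominus> (a \<ominus> \<rho> a)" using neg(2) c by (simp add: minus_eq minus_add)
    then show ?case using neg SD(5) Jp(3) ring_hom_sub_neg[OF ring_axioms ring_axioms S rho(1) neg(1)] by simp
  next
    case (add a b)
    have c: "\<rho> a \<in> carrier F" "\<rho> b \<in> carrier F" using rD(1) add(1,2) by auto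
    have "(a \<oplus> b) \<ominus> (\<rho> a \<oplus> \<rho> b) = (a \<ominus> \<rho> a) \<oplus> (b \<ominus> \<rho> b)" using add(3,4) c by (simp add: minus_eq minus_add a_ac)
    then show ?case using add SD(7) Jp(2) rD(3)[OF add(1,2)] by simp
  next
    case (mult a b)
    have c: "\<rho> a \<in> carrier F" "\<rho> b \<in> carrier F" using rD(1) mult(1,2) by auto
    \<comment> \<open>Inserting \<rho> a b splits the difference along the two congruences.\<close>
    have "a \<otimes> b \<ominus> \<rho> a \<otimes> \<rho> b = (a \<ominus> \<rho> a) \<otimes> b \<oplus> \<rho> a \<otimes> (b \<ominus> \<rho> b)"
    proof -
      have "(a \<ominus> \<rho> a) \<otimes> b \<oplus> \<rho> a \<otimes> (b \<ominus> \<rho> b) = a \<otimes> b \<oplus> (\<ominus> (\<rho> a \<otimes> b) \<oplus> (\<rho> a \<otimes> b \<oplus> \<ominus> (\<rho> a \<otimes> \<rho> b)))"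
        using mult(3,4) c by (simp add: minus_eq l_distr r_distr l_minus r_minus a_assoc)
      then show ?thesis using mult(3,4) c by (simp add: minus_eq r_neg1)
    qed
    then show ?case using mult SD(6) Jp(2) Jp(4)[of "a \<ominus> \<rho> a" b] Jp(5)[of "b \<ominus> \<rho> b" "\<rho> a"] rD(2)[OF mult(1,2)] by simp
  qed
  then show "\<rho> a \<in> Aj 2 N" and "\<rho> a = \<zero> \<longleftrightarrow> a \<in> J_ideal w"
  proof -
    assume r: "\<rho> a \<in> Aj 2 N \<and> a \<ominus> \<rho> a \<in> J_ideal w"
    show "\<rho> a \<in> Aj 2 N" using r by simp
    have "a \<in> J_ideal w" if "\<rho> a = \<zero>" using r that a SD(1) by (auto simp: minus_eq)
    then show "\<rho> a = \<zero> \<longleftrightarrow> a \<in> J_ideal w" using sub by blast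
  qed
qed

text \<open>\<rho> has kernel J_w and image \<open>tor.C\<close>, so \<open>tor.D\<close> realises
  the fractions of A'/J_w. By \<open>psi_transfer\<close> it also realises those of A/P, and its
  dimension over its centre is the number of characters.\<close>

lemma Cauchon_quotient_PI_deg:
  assumes p: "p \<in> K - {\<zero>}" "primitive_root_of_unity F l p" and M: "M \<in> carrier_mat N N"
    and lamp: "\<And>i j. i \<in> {1..N} \<Longrightarrow> j \<in> {1..N} \<Longrightarrow> lam i j = p [^] (M $$ (i - 1, j - 1))"
    and w: "w \<subseteq> {1..N}" and P: "P \<in> CSpec A" "psi P = J_ideal w"
    and h: "invariant_factors (remove_rows_cols M w) h"
  shows "has_PI_deg (A Quot P)
    (\<Prod>i = 1..(N - card w - int_kernel_dim (remove_rows_cols M w)) div 2. l div nat (gcd (h ! (i - 1)) (int l)))"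
    (is "has_PI_deg _ ?n")
proof -
  define J where "J = {i. Suc i \<notin> w}"
  define m where "m = card {i. i < N \<and> i \<in> J}"
  let ?S = "remove_rows_cols M w"
  have fw: "finite w" using w finite_subset by blast
  note ri = remaining_index[OF fw, of N, folded J_def]
  have m: "m = N - card w" using ri(2)[OF w] unfolding m_def .
  have dimM: "dim_row M = N" "dim_col M = N" using M by auto
  have S: "?S \<in> carrier_mat m m"
    unfolding remove_rows_cols_def J_def[symmetric] m_def by (rule carrier_matI) (simp_all add: dim_submatrix dimM)
  \<comment> \<open>The generators outside w, numbered like the rows of
    \<open>remove_rows_cols M w\<close>.\<close>
  define t where "t k = T (Suc (pick J k))" for k
  have idx: "Suc (pick J k) \<in> {1..N}" "Suc (pick J k) \<notin> w" if "k < m" for k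
    using ri(1) that unfolding m_def by blast+
  have timg: "t ` {..<m} = T ` ({1..N} - w)"
    unfolding ri(1)[symmetric] t_def m_def by (simp add: image_image)
  have pr: "p \<in> carrier F" "p [^] l = \<one>" using p unfolding primitive_root_of_unity_def by auto
  have lamt: "lam (Suc (pick J k)) (Suc (pick J k')) = rpow p l (?S $$ (k, k'))" if "k < m" "k' < m" for k k'
  proof -
    have "?S $$ (k, k') = M $$ (pick J k, pick J k')"
      unfolding remove_rows_cols_def J_def[symmetric]
      using that unfolding m_def by (intro submatrix_index) (simp_all add: dimM)
    then show ?thesis using lamp[OF idx(1)[OF that(1)] idx(1)[OF that(2)]] int_pow_rpow[OF pr l_pos] by simp
  qed
  interpret tor: uniparameter_torus F K m t "\<lambda>k k'. lam (Suc (pick J k)) (Suc (pick J k'))" l p ?S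
  proof (intro uniparameter_torus.intro quantum_torus.intro quantum_torus_axioms.intro uniparameter_torus_axioms.intro central_subfield_axioms)
    show "t k \<in> carrier F - {\<zero>}" if "k \<in> {..<m}" for k
      unfolding t_def using T_carrier idx that by auto
    show "t k \<otimes> t k' = lam (Suc (pick J k)) (Suc (pick J k')) \<otimes> (t k' \<otimes> t k)" if "k \<in> {..<m}" "k' \<in> {..<m}" for k k'
      unfolding t_def by (rule T_rel) (use idx that in auto)
    show "lam (Suc (pick J k)) (Suc (pick J k')) \<in> K \<and> lam (Suc (pick J k)) (Suc (pick J k')) [^] l = \<one>"
      if "k \<in> {..<m}" "k' \<in> {..<m}" for k k'
      using lam_K(1) lam_root idx that by auto
  qed (use l_pos p S lamt in auto)
  note fin = tor.finite_chi
  obtain \<rho> where rho: "\<rho> \<in> Ring.ring_hom (F\<lparr>carrier := Aj 2 N\<rparr>) F" "\<And>k. k \<in> K \<Longrightarrow> \<rho> k = k"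
    "\<And>i. i \<in> {1..N} \<Longrightarrow> \<rho> (T i) = (if i \<in> w then \<zero> else T i)"
    using retraction_exists[of w] by blast
  have SA: "subring (Aj 2 N) F" using Aj_subring[OF order_refl two_le order_refl] .
  have tA: "t k \<in> Aj 2 N" if "k < m" for k unfolding t_def using gen_subalg[of "Suc (pick J k)" N T] idx[OF that] by auto
  have CA: "tor.C \<subseteq> Aj 2 N"
    unfolding tor.C_def using tA K_subalg by (intro generate_ring_min_subring1[OF _ SA]) (auto simp: subalg_carrier)
  \<comment> \<open>As \<rho> is the identity on \<open>tor.C\<close>, each fraction in
    \<open>tor.D\<close> is already a fraction of values of \<rho>.\<close>
  have rhoC: "\<rho> c = c" if "c \<in> tor.C" for c
  proof (rule ring_hom_eq_on_generate[OF ring_axioms ring_axioms _ rho(1) _ SA])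
    show "c \<in> generate_ring F (K \<union> t ` {..<m})" using that unfolding tor.C_def .
    show "K \<union> t ` {..<m} \<subseteq> carrier F" by auto
    show "(\<lambda>c. c) \<in> Ring.ring_hom (F\<lparr>carrier := Aj 2 N\<rparr>) F"
      using subringE(1)[OF SA] by (intro ring_hom_memI) auto
    show "K \<union> t ` {..<m} \<subseteq> Aj 2 N" using tA K_subalg by auto
    show "\<rho> x = x" if "x \<in> K \<union> t ` {..<m}" for x
      using that rho(2,3) idx unfolding t_def by auto
  qed
  have rhoA: "\<rho> a \<in> tor.C" if a: "a \<in> Aj 2 N" for a
  proof -
    have TR: "T ` {1..N} \<subseteq> carrier F" using T_carrier by auto
    note rD = ring_hom_subD[OF rho(1)]
    from a TR show ?thesis
    proof (induct rule: subalg_induct)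
      case (K k) then show ?case using rho(2) by simp
    next
      case (gen i)
      then have i: "i \<in> {1..N}" by auto
      have "T i \<in> tor.C" if "i \<notin> w"
      proof -
        have "T i \<in> t ` {..<m}" unfolding timg using i that by blast
        then show ?thesis using tor.t_in_C by auto
      qed
      then show ?case using rho(3)[OF i] by simp
    next
      case (neg a) then show ?case using ring_hom_sub_neg[OF ring_axioms ring_axioms SA rho(1)] by simp
    next
      case (add a b) then show ?case using rD(3) by simp
    next
      case (mult a b) then show ?case using rD(2) by simp
    qed
  qed
  have "frac_datum (Aj 2 N) (psi P) tor.D"
    unfolding frac_datum_def P(2)
  proof (intro exI[of _ \<rho>] conjI ballI rho(1))
    show "\<rho> ` Aj 2 N \<subseteq> tor.D" using rhoA tor.C_D by blast
    show "\<rho> a = \<zero> \<longleftrightarrow> a \<in> J_ideal w" if "a \<in> Aj 2 N" for a using J_ideal_kernel(1)[OF w rho that] .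
    fix y assume "y \<in> tor.D"
    then obtain a s where as: "y = a \<otimes> inv s" "a \<in> tor.C" "s \<in> tor.ZC" "s \<noteq> \<zero>"
      unfolding tor.D_def central_loc_def by blast
    have sC: "s \<in> tor.C" using as(3) tor.ZC_C by blast
    have "\<rho> s \<noteq> \<zero> \<and> (\<forall>u\<in>tor.D. \<rho> s \<otimes> u = u \<otimes> \<rho> s) \<and> y = \<rho> a \<otimes> inv (\<rho> s)"
      unfolding rhoC[OF sC] rhoC[OF as(2)] using as tor.ZC_D_commute[OF as(3)] by blast
    then show "\<exists>a\<in>Aj 2 N. \<exists>s\<in>Aj 2 N. \<rho> s \<noteq> \<zero> \<and> (\<forall>u\<in>tor.D. \<rho> s \<otimes> u = u \<otimes> \<rho> s) \<and> y = \<rho> a \<otimes> inv (\<rho> s)"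
      using CA sC as(2) by blast
  qed
  moreover have SN: "subring (Aj (N + 1) N) F" using Aj_subring[of "N + 1" N] two_le by simp
  moreover have cP: "cprime P (Aj (N + 1) N)" using P(1) unfolding CSpec_iff_cprime[OF SN, symmetric] dd_alg_def .
  ultimately have fd: "frac_datum (Aj (N + 1) N) P tor.D"
    using psi_transfer[OF cP tor.D_subring tor.D_inv[OF fin]] by blast
  have "card (tor.chi ` tor.words) = ?n\<^sup>2"
    unfolding tor.card_chi using card_image_mod_invariant_factors[OF l_pos S h] unfolding m .
  then have "dimension (?n\<^sup>2) tor.Z tor.D" using tor.D_dimension[OF fin] by simp
  then show ?thesis
    using frac_datum_has_PI_deg[OF SN cP fd tor.D_subring tor.D_inv[OF fin], unfolded tor.D_center, OF _ _ tor.Z_subfield]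
    unfolding dd_alg_def by blast
qed

end

theorem theorem4p3:
  fixes F :: "('a, 'b) ring_scheme" (structure)
    and K :: "'a set" and N :: nat and X :: "nat \<Rightarrow> 'a" and lam :: "nat \<Rightarrow> nat \<Rightarrow> 'a"
    and \<sigma> \<delta> :: "nat \<Rightarrow> 'a \<Rightarrow> 'a" and d :: "nat \<Rightarrow> nat \<Rightarrow> 'a \<Rightarrow> 'a" and qs :: "nat \<Rightarrow> 'a"
    and q :: 'a and l :: nat and M :: "int mat"
    and w :: "nat set" and P :: "'a set" and h :: "int list"
  assumes "quantum_nilpotent_algebra F K N X lam \<sigma> \<delta> d qs"
    and "q \<in> K - {\<zero>}" and "primitive_root_of_unity F l q"
    and "M \<in> carrier_mat N N" and "M\<^sup>T = - M"
    and "\<And>i j. \<lbrakk>i \<in> {1..N}; j \<in> {1..N}\<rbrakk> \<Longrightarrow> lam i j = q [^] (M $$ (i - 1, j - 1))"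
    and "w \<in> quantum_nilpotent_algebra.Cauchon_diagrams F K N X \<sigma> d qs"
    and "quantum_nilpotent_algebra.Cauchon_ideal F K N X \<sigma> d qs w P"
    and "invariant_factors (remove_rows_cols M w) h"
  shows "has_PI_deg (quantum_nilpotent_algebra.A F K N X \<sigma> d qs Quot P)
    (\<Prod>i = 1..(N - card w - int_kernel_dim (remove_rows_cols M w)) div 2.
       l div nat (gcd (h ! (i - 1)) (int l)))"
proof -
  interpret quantum_nilpotent_algebra F K N X lam \<sigma> \<delta> d qs by fact
  have l: "0 < l" "q [^] l = \<one>" using assms(3) unfolding primitive_root_of_unity_def by auto
  have qc: "q \<in> carrier F" using assms(2) subfieldE(3)[OF K_subfield] by blast
  \<comment> \<open>Reducing exponents modulo \<open>l\<close> makes each \<lambda>_{i,j} a natural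
    power of q, so its \<open>l\<close>-th power is \<one>.\<close>
  have root: "lam i j [^] l = \<one>" if ij: "i \<in> {1..N}" "j \<in> {1..N}" for i j
  proof -
    obtain n :: nat where "lam i j = q [^] n"
      using assms(6)[OF ij] int_pow_rpow[OF qc l(2,1)] unfolding rpow_def by metis
    then show ?thesis using qc l(2) by (simp add: nat_pow_pow mult.commute) (simp flip: nat_pow_pow)
  qed
  interpret qna_root F K N X lam \<sigma> \<delta> d qs l by unfold_locales (use l root in auto)
  have w: "w \<subseteq> {1..N}" using assms(7) unfolding Cauchon_diagrams_def by blast
  have P: "P \<in> CSpec A" "psi P = J_ideal w" using assms(8) unfolding Cauchon_ideal_def CSpec_A_at_def by auto
  show ?thesis by (rule Cauchon_quotient_PI_deg[OF assms(2,3,4,6) w P assms(9)])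
qed

end
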